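(* The following are equivalent: (1) There exists a strong cardinal. (2) $\Sigma_2$-$\mathrm{PRP}$. (3) $\Pi_1$-$\mathrm{PRP}$. (4) $\Sigma_2$-$\mathrm{SWVP}$. (5) $\Pi_1$-$\mathrm{SWVP}$. (6) $\Sigma_2$-$\mathrm{WVP}$. (7) $\Pi_1$-$\mathrm{WVP}$.
   Context: We work in ZFC; $\Sigma_n,\Pi_n$ refer to the Levy hierarchy, and "class" means definable class. Graphs. A graph is a structure $\langle G,E_G\rangle$ with $G$ a non-empty set and $E_G$ a binary relation on $G$. A homomorphism $h:G\to H$ is a map such that $xE_Gy$ implies $h(x)E_Hh(y)$. For a set $S$ of graphs, $\prod S$ is the structure whose universe is the set of all functions $f$ with domain $S$ such that $f(\mathcal{A})$ belongs to the universe of $\mathcal{A}$ for every $\mathcal{A}\in S$, with the relation defined pointwise. Principles. Let $\Gamma$ be one of $\Sigma_m,\Pi_m$, $m>0$. All definitions below are without parameters. - $\Gamma$-$\mathrm{PRP}$ (Product Reflection Principle): for every $\Gamma$-definable proper class $\mathcal{C}$ of graphs there is a subset $S$ of $\mathcal{C}$ such that for every $G$ in $\mathcal{C}$ there is a homomorphism $\prod S\to G$. - $\Gamma$-$\mathrm{WVP}$ (Weak Vopěnka Principle): there is no $\Gamma$-definable sequence $\langle G_\alpha:\alpha\in\mathrm{OR}\rangle$ of graphs such that for every $\alpha\leq\beta$ there exists exactly one homomorphism $G_\beta\to G_\alpha$, and there is no homomorphism $G_\alpha\to G_\beta$ whenever $\alpha<\beta$. - $\Gamma$-$\mathrm{SWVP}$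 (Semi-Weak Vopěnka Principle): the same as $\Gamma$-$\mathrm{WVP}$, with "exactly one homomorphism $G_\beta\to G_\alpha$" replaced by "at least one homomorphism $G_\beta\to G_\alpha$". A cardinal $\kappa$ is $\lambda$-strong, where $\lambda>\kappa$ is a cardinal, if there is an elementary embedding $j:V\to M$ with $M$ transitive, critical point $\kappa$, and $V_\lambda\subseteq M$; $\kappa$ is strong if it is $\lambda$-strong for every cardinal $\lambda>\kappa$. *)

theory Defs
  imports Main
begin

text \<open>
  Working in ZFC is rendered semantically: everything is evaluated in an arbitrary first-order
  model of ZFC, that is, a type \<^typ>\<open>'v\<close> with a binary relation satisfying the axioms of ZFC,
  where Separation and Replacement range over (deeply embedded) first-order formulas only.
  Classes of the model are the definable subsets of \<^typ>\<open>'v\<close>; sets are the elements of \<^typ>\<open>'v\<close>.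
\<close>

section \<open>The language of set theory and the Levy hierarchy\<close>

datatype fm =
    Member nat nat
  | Equal nat nat
  | Neg fm
  | And fm fm
  | Exists nat fm

abbreviation Forall :: "nat \<Rightarrow> fm \<Rightarrow> fm" where
  "Forall n \<phi> \<equiv> Neg (Exists n (Neg \<phi>))"

primrec fv :: "fm \<Rightarrow> nat set" where
  "fv (Member m n) = {m, n}"
| "fv (Equal m n) = {m, n}"
| "fv (Neg \<phi>) = fv \<phi>"
| "fv (And \<phi> \<psi>) = fv \<phi> \<union> fv \<psi>"
| "fv (Exists n \<phi>) = fv \<phi> - {n}"

text \<open>Satisfaction in the substructure with universe \<open>M\<close>: quantifiers range over \<open>M\<close>.\<close>

primrec sat :: "('v \<Rightarrow> 'v \<Rightarrow> bool) \<Rightarrow> 'v set \<Rightarrow> fm \<Rightarrow> (nat \<Rightarrow> 'v) \<Rightarrow> bool" where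
  "sat E M (Member m n) s \<longleftrightarrow> E (s m) (s n)"
| "sat E M (Equal m n) s \<longleftrightarrow> s m = s n"
| "sat E M (Neg \<phi>) s \<longleftrightarrow> \<not> sat E M \<phi> s"
| "sat E M (And \<phi> \<psi>) s \<longleftrightarrow> sat E M \<phi> s \<and> sat E M \<psi> s"
| "sat E M (Exists n \<phi>) s \<longleftrightarrow> (\<exists>x\<in>M. sat E M \<phi> (s(n := x)))"

text \<open>
  Bounded universal quantifiers are covered too, being
  \<^term>\<open>Neg (Exists m (And (Member m n) (Neg \<phi>)))\<close>.
\<close>

inductive Delta0 :: "fm \<Rightarrow> bool" where
  "Delta0 (Member m n)"
| "Delta0 (Equal m n)"
| "Delta0 \<phi> \<Longrightarrow> Delta0 (Neg \<phi>)"
| "Delta0 \<phi> \<Longrightarrow> Delta0 \<psi> \<Longrightarrow> Delta0 (And \<phi> \<psi>)"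
| "Delta0 \<phi> \<Longrightarrow> m \<noteq> n \<Longrightarrow> Delta0 (Exists m (And (Member m n) \<phi>))"

text \<open>Prenex form with blocks (possibly empty) of like quantifiers in front of a bounded formula.\<close>

inductive levy_Sigma :: "nat \<Rightarrow> fm \<Rightarrow> bool" and levy_Pi :: "nat \<Rightarrow> fm \<Rightarrow> bool" where
  "Delta0 \<phi> \<Longrightarrow> levy_Sigma 0 \<phi>"
| "Delta0 \<phi> \<Longrightarrow> levy_Pi 0 \<phi>"
| "levy_Pi n \<phi> \<Longrightarrow> levy_Sigma (Suc n) \<phi>"
| "levy_Sigma (Suc n) \<phi> \<Longrightarrow> levy_Sigma (Suc n) (Exists m \<phi>)"
| "levy_Sigma n \<phi> \<Longrightarrow> levy_Pi (Suc n) \<phi>"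
| "levy_Pi (Suc n) \<phi> \<Longrightarrow> levy_Pi (Suc n) (Forall m \<phi>)"

section \<open>Set-theoretic notions of a structure\<close>

locale membership =
  fixes mem :: "'v \<Rightarrow> 'v \<Rightarrow> bool" (infix "\<epsilon>" 50)
begin

text \<open>Classes are definable with parameters (the values of \<open>s\<close> on the other variables).\<close>

definition definable_class :: "'v set \<Rightarrow> bool" where
  "definable_class C \<longleftrightarrow> (\<exists>\<phi> s. C = {x. sat (\<epsilon>) UNIV \<phi> (s(0 := x))})"

text \<open>Lightface definability: \<open>\<phi>\<close> has at most the variable 0 free, so no parameters occur.\<close>

definition definable_by :: "(fm \<Rightarrow> bool) \<Rightarrow> 'v set \<Rightarrow> bool" where
  "definable_by \<Gamma> C \<longleftrightarrow> (\<exists>\<phi>. \<Gamma> \<phi> \<and> fv \<phi> \<subseteq> {0} \<and> C = {x. sat (\<epsilon>) UNIV \<phi> (\<lambda>_. x)})"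

definition proper_class :: "'v set \<Rightarrow> bool" where
  "proper_class C \<longleftrightarrow> \<not> (\<exists>a. \<forall>x. x \<epsilon> a \<longleftrightarrow> x \<in> C)"

definition empty_set :: "'v \<Rightarrow> bool" where
  "empty_set a \<longleftrightarrow> (\<forall>x. \<not> x \<epsilon> a)"

definition subset_of :: "'v \<Rightarrow> 'v \<Rightarrow> bool" where
  "subset_of a b \<longleftrightarrow> (\<forall>x. x \<epsilon> a \<longrightarrow> x \<epsilon> b)"

text \<open>The last argument of \<open>upair\<close>, \<open>opair\<close>, \<open>succ\<close>, \<open>powerset\<close> is the value:
  \<open>{x, y}\<close>, the Kuratowski pair \<open>(x, y)\<close>, \<open>x \<union> {x}\<close>, and the power set of \<open>a\<close>.\<close>

definition upair :: "'v \<Rightarrow> 'v \<Rightarrow> 'v \<Rightarrow> bool" where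
  "upair x y p \<longleftrightarrow> (\<forall>z. z \<epsilon> p \<longleftrightarrow> z = x \<or> z = y)"

definition opair :: "'v \<Rightarrow> 'v \<Rightarrow> 'v \<Rightarrow> bool" where
  "opair x y p \<longleftrightarrow> (\<exists>a b. upair x x a \<and> upair x y b \<and> upair a b p)"

definition succ :: "'v \<Rightarrow> 'v \<Rightarrow> bool" where
  "succ x y \<longleftrightarrow> (\<forall>z. z \<epsilon> y \<longleftrightarrow> z \<epsilon> x \<or> z = x)"

definition powerset :: "'v \<Rightarrow> 'v \<Rightarrow> bool" where
  "powerset a b \<longleftrightarrow> (\<forall>x. x \<epsilon> b \<longleftrightarrow> subset_of x a)"

text \<open>\<open>related r x y\<close>: the ordered pair of \<open>x\<close> and \<open>y\<close> belongs to the set \<open>r\<close>;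
  for a function \<open>r\<close> this says that \<open>y\<close> is its value at \<open>x\<close>.\<close>

definition related :: "'v \<Rightarrow> 'v \<Rightarrow> 'v \<Rightarrow> bool" where
  "related r x y \<longleftrightarrow> (\<exists>p. opair x y p \<and> p \<epsilon> r)"

definition function_on :: "'v \<Rightarrow> 'v \<Rightarrow> bool" where
  "function_on f a \<longleftrightarrow>
     (\<forall>p. p \<epsilon> f \<longrightarrow> (\<exists>x y. x \<epsilon> a \<and> opair x y p)) \<and>
     (\<forall>x. x \<epsilon> a \<longrightarrow> (\<exists>!y. related f x y))"

definition maps :: "'v \<Rightarrow> 'v \<Rightarrow> 'v \<Rightarrow> bool" where
  "maps f a b \<longleftrightarrow> function_on f a \<and> (\<forall>x y. related f x y \<longrightarrow> y \<epsilon> b)"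

definition bijection :: "'v \<Rightarrow> 'v \<Rightarrow> 'v \<Rightarrow> bool" where
  "bijection f a b \<longleftrightarrow>
     maps f a b \<and>
     (\<forall>x x' y. related f x y \<and> related f x' y \<longrightarrow> x = x') \<and>
     (\<forall>y. y \<epsilon> b \<longrightarrow> (\<exists>x. related f x y))"

text \<open>Transitive sets well-ordered by membership.\<close>

definition ordinal :: "'v \<Rightarrow> bool" where
  "ordinal \<alpha> \<longleftrightarrow>
     (\<forall>x y. y \<epsilon> x \<and> x \<epsilon> \<alpha> \<longrightarrow> y \<epsilon> \<alpha>) \<and>
     (\<forall>x. x \<epsilon> \<alpha> \<longrightarrow> \<not> x \<epsilon> x) \<and>
     (\<forall>x y z. x \<epsilon> \<alpha> \<and> y \<epsilon> \<alpha> \<and> z \<epsilon> \<alpha> \<and> x \<epsilon> y \<and> y \<epsilon> z \<longrightarrow> x \<epsilon> z) \<and>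
     (\<forall>x y. x \<epsilon> \<alpha> \<and> y \<epsilon> \<alpha> \<longrightarrow> x \<epsilon> y \<or> x = y \<or> y \<epsilon> x) \<and>
     (\<forall>b. subset_of b \<alpha> \<and> \<not> empty_set b \<longrightarrow>
        (\<exists>x. x \<epsilon> b \<and> (\<forall>y. y \<epsilon> b \<longrightarrow> x = y \<or> x \<epsilon> y)))"

definition cardinal :: "'v \<Rightarrow> bool" where
  "cardinal \<kappa> \<longleftrightarrow> ordinal \<kappa> \<and> \<not> (\<exists>\<beta> f. \<beta> \<epsilon> \<kappa> \<and> bijection f \<beta> \<kappa>)"

text \<open>\<open>f\<close> is the sequence of the \<open>V\<^sub>\<beta>\<close> for \<open>\<beta> \<epsilon> \<delta>\<close>; the three clauses concern zero, successor
  and limit \<open>\<beta>\<close>.\<close>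

definition cumulative_hierarchy :: "'v \<Rightarrow> 'v \<Rightarrow> bool" where
  "cumulative_hierarchy \<delta> f \<longleftrightarrow>
     function_on f \<delta> \<and>
     (\<forall>\<beta> v. related f \<beta> v \<longrightarrow>
        (empty_set \<beta> \<longrightarrow> empty_set v) \<and>
        (\<forall>\<gamma> w. succ \<gamma> \<beta> \<and> related f \<gamma> w \<longrightarrow> powerset w v) \<and>
        (\<not> empty_set \<beta> \<and> \<not> (\<exists>\<gamma>. succ \<gamma> \<beta>) \<longrightarrow>
           (\<forall>x. x \<epsilon> v \<longleftrightarrow> (\<exists>\<gamma> w. \<gamma> \<epsilon> \<beta> \<and> related f \<gamma> w \<and> x \<epsilon> w))))"

definition V_level :: "'v \<Rightarrow> 'v \<Rightarrow> bool" where
  "V_level \<alpha> v \<longleftrightarrow> (\<exists>\<delta> f. succ \<alpha> \<delta> \<and> cumulative_hierarchy \<delta> f \<and> related f \<alpha> v)"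

section \<open>Graphs and products\<close>

definition graph :: "'v \<Rightarrow> bool" where
  "graph A \<longleftrightarrow>
     (\<exists>G R. opair G R A \<and> \<not> empty_set G \<and>
        (\<forall>p. p \<epsilon> R \<longrightarrow> (\<exists>x y. x \<epsilon> G \<and> y \<epsilon> G \<and> opair x y p)))"

definition vertex :: "'v \<Rightarrow> 'v \<Rightarrow> bool" where
  "vertex A x \<longleftrightarrow> (\<exists>G R. opair G R A \<and> x \<epsilon> G)"

definition edge :: "'v \<Rightarrow> 'v \<Rightarrow> 'v \<Rightarrow> bool" where
  "edge A x y \<longleftrightarrow> (\<exists>G R. opair G R A \<and> related R x y)"

definition homomorphism :: "'v \<Rightarrow> 'v \<Rightarrow> 'v \<Rightarrow> bool" where
  "homomorphism h A B \<longleftrightarrow>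
     (\<exists>G R H T. opair G R A \<and> opair H T B \<and> maps h G H \<and>
        (\<forall>x y u v. related R x y \<and> related h x u \<and> related h y v \<longrightarrow> related T u v))"

definition product :: "'v \<Rightarrow> 'v \<Rightarrow> bool" where
  "product S P \<longleftrightarrow>
     (\<exists>U R. opair U R P \<and>
        (\<forall>f. f \<epsilon> U \<longleftrightarrow> function_on f S \<and> (\<forall>A x. related f A x \<longrightarrow> vertex A x)) \<and>
        (\<forall>p. p \<epsilon> R \<longleftrightarrow>
           (\<exists>f g. f \<epsilon> U \<and> g \<epsilon> U \<and> opair f g p \<and>
              (\<forall>A x y. A \<epsilon> S \<and> related f A x \<and> related g A y \<longrightarrow> edge A x y))))"

section \<open>The reflection principles\<close>

definition PRP :: "(fm \<Rightarrow> bool) \<Rightarrow> bool" where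
  "PRP \<Gamma> \<longleftrightarrow>
     (\<forall>C. definable_by \<Gamma> C \<and> proper_class C \<and> (\<forall>G\<in>C. graph G) \<longrightarrow>
        (\<exists>S. (\<forall>A. A \<epsilon> S \<longrightarrow> A \<in> C) \<and>
           (\<forall>G\<in>C. \<exists>P h. product S P \<and> homomorphism h P G)))"

definition value_at :: "'v set \<Rightarrow> 'v \<Rightarrow> 'v \<Rightarrow> bool" where
  "value_at F x y \<longleftrightarrow> (\<exists>p\<in>F. opair x y p)"

text \<open>\<open>F\<close> is a class function, as a class of ordered pairs, from the ordinals to graphs.\<close>

definition graph_sequence :: "'v set \<Rightarrow> bool" where
  "graph_sequence F \<longleftrightarrow>
     (\<forall>p\<in>F. \<exists>\<alpha> G. opair \<alpha> G p \<and> ordinal \<alpha> \<and> graph G) \<and>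
     (\<forall>\<alpha>. ordinal \<alpha> \<longrightarrow> (\<exists>!G. value_at F \<alpha> G))"

definition WVP :: "(fm \<Rightarrow> bool) \<Rightarrow> bool" where
  "WVP \<Gamma> \<longleftrightarrow>
     \<not> (\<exists>F. definable_by \<Gamma> F \<and> graph_sequence F \<and>
          (\<forall>\<alpha> \<beta> A B. ordinal \<alpha> \<and> ordinal \<beta> \<and> value_at F \<alpha> A \<and> value_at F \<beta> B \<longrightarrow>
             (\<alpha> \<epsilon> \<beta> \<or> \<alpha> = \<beta> \<longrightarrow> (\<exists>!h. homomorphism h B A)) \<and>
             (\<alpha> \<epsilon> \<beta> \<longrightarrow> \<not> (\<exists>h. homomorphism h A B))))"

definition SWVP :: "(fm \<Rightarrow> bool) \<Rightarrow> bool" where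
  "SWVP \<Gamma> \<longleftrightarrow>
     \<not> (\<exists>F. definable_by \<Gamma> F \<and> graph_sequence F \<and>
          (\<forall>\<alpha> \<beta> A B. ordinal \<alpha> \<and> ordinal \<beta> \<and> value_at F \<alpha> A \<and> value_at F \<beta> B \<longrightarrow>
             (\<alpha> \<epsilon> \<beta> \<or> \<alpha> = \<beta> \<longrightarrow> (\<exists>h. homomorphism h B A)) \<and>
             (\<alpha> \<epsilon> \<beta> \<longrightarrow> \<not> (\<exists>h. homomorphism h A B))))"

section \<open>Strong cardinals\<close>

text \<open>Both \<open>j\<close> and its target \<open>M\<close> are classes of the structure; elementarity is the usual schema
  over all first-order formulas.\<close>

definition elementary_embedding :: "('v \<Rightarrow> 'v) \<Rightarrow> 'v set \<Rightarrow> bool" where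
  "elementary_embedding j M \<longleftrightarrow>
     definable_class {p. \<exists>x. opair x (j x) p} \<and> definable_class M \<and>
     (\<forall>x. j x \<in> M) \<and>
     (\<forall>\<phi> s. sat (\<epsilon>) UNIV \<phi> s \<longleftrightarrow> sat (\<epsilon>) M \<phi> (j \<circ> s))"

definition transitive_class :: "'v set \<Rightarrow> bool" where
  "transitive_class M \<longleftrightarrow> (\<forall>x y. x \<in> M \<and> y \<epsilon> x \<longrightarrow> y \<in> M)"

definition critical_point :: "('v \<Rightarrow> 'v) \<Rightarrow> 'v \<Rightarrow> bool" where
  "critical_point j \<kappa> \<longleftrightarrow> ordinal \<kappa> \<and> j \<kappa> \<noteq> \<kappa> \<and> (\<forall>\<alpha>. \<alpha> \<epsilon> \<kappa> \<longrightarrow> j \<alpha> = \<alpha>)"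

definition strong_upto :: "'v \<Rightarrow> 'v \<Rightarrow> bool" where
  "strong_upto \<kappa> \<mu> \<longleftrightarrow>
     (\<exists>j M. elementary_embedding j M \<and> transitive_class M \<and> critical_point j \<kappa> \<and>
        (\<forall>v. V_level \<mu> v \<longrightarrow> (\<forall>x. x \<epsilon> v \<longrightarrow> x \<in> M)))"

definition strong_cardinal :: "'v \<Rightarrow> bool" where
  "strong_cardinal \<kappa> \<longleftrightarrow>
     cardinal \<kappa> \<and> (\<forall>\<mu>. cardinal \<mu> \<and> \<kappa> \<epsilon> \<mu> \<longrightarrow> strong_upto \<kappa> \<mu>)"

end

section \<open>Models of ZFC\<close>

locale ZFC = membership +
  assumes extensionality: "(\<forall>z. z \<epsilon> x \<longleftrightarrow> z \<epsilon> y) \<longrightarrow> x = y"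
    and foundation: "\<not> empty_set a \<longrightarrow> (\<exists>x. x \<epsilon> a \<and> \<not> (\<exists>y. y \<epsilon> x \<and> y \<epsilon> a))"
    and pairing: "\<exists>p. upair x y p"
    and union: "\<exists>u. \<forall>x. x \<epsilon> u \<longleftrightarrow> (\<exists>y. y \<epsilon> a \<and> x \<epsilon> y)"
    and power: "\<exists>b. powerset a b"
    and infinity: "\<exists>a. (\<exists>x. empty_set x \<and> x \<epsilon> a) \<and> (\<forall>x y. x \<epsilon> a \<and> succ x y \<longrightarrow> y \<epsilon> a)"
    and separation: "\<exists>b. \<forall>x. x \<epsilon> b \<longleftrightarrow> x \<epsilon> a \<and> sat (\<epsilon>) UNIV \<phi> (s(0 := x))"
    and replacement:
      "(\<forall>x. x \<epsilon> a \<longrightarrow> (\<exists>!y. sat (\<epsilon>) UNIV \<phi> (s(0 := x, 1 := y)))) \<longrightarrow>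
       (\<exists>b. \<forall>y. y \<epsilon> b \<longleftrightarrow> (\<exists>x. x \<epsilon> a \<and> sat (\<epsilon>) UNIV \<phi> (s(0 := x, 1 := y))))"
    and choice:
      "(\<forall>x. x \<epsilon> a \<longrightarrow> \<not> empty_set x) \<longrightarrow>
       (\<exists>f. function_on f a \<and> (\<forall>x y. related f x y \<longrightarrow> y \<epsilon> x))"

end

theory Submission
  imports Defs
begin

text \<open>
  Let \<open>\<kappa>\<close> be strong, \<open>\<C>\<close> a \<open>\<Sigma>\<^sub>2\<close> class of graphs and \<open>S = \<C> \<inter> V\<^sub>\<kappa>\<close>. A graph \<open>G \<in> \<C>\<close> of rank \<open>\<rho> \<ge> \<kappa>\<close>
  satisfies the definition of \<open>\<C>\<close> in \<open>M\<close> as well, for a sufficiently strong embedding \<open>j : V \<rightarrow> M\<close>.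
  If \<open>\<rho> < j(\<eta>)\<close> for some \<open>\<eta> \<le> \<rho>\<close>, then \<open>G \<in> j(\<C> \<inter> V\<^sub>\<eta>)\<close>, and \<open>f \<mapsto> j(f)(G)\<close> is a homomorphism to \<open>G\<close>
  from the product of \<open>\<C> \<inter> V\<^sub>\<eta>\<close>; the product of \<open>S\<close> maps to the latter by induction on the rank.
  Otherwise \<open>j(\<rho>) = \<rho>\<close>, which Kunen's inconsistency argument at \<open>\<rho> + \<omega>\<close> refutes.

  A sequence violating the semi-weak Vopenka principle has a range that violates product reflection.

  For the converse, consider the structure on \<open>P(V\<^sub>\<lambda>)\<close>, \<open>\<lambda>\<close> a limit, with finitely many operations that express
  Boolean combinations, permutations and projections of relations, and with a predicate for
  well-foundedness. An endomorphism \<open>H\<close> other than the identity yields an embedding \<open>j : V \<rightarrow> M\<close> with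
  \<open>V\<^sub>\<lambda> \<subseteq> M\<close> and \<open>H(X) = j(X) \<inter> V\<^sub>\<lambda>\<close>, by the ultrapower with respect to the ultrafilters
  \<open>{X. a \<in> H(X)}\<close>, \<open>a \<in> V\<^sub>\<lambda>\<close>. So if there is no strong cardinal, then \<open>P(V\<^sub>\<lambda>)\<close> is rigid for arbitrarily large \<open>\<lambda>\<close>.
  Let \<open>G\<^sub>\<alpha>\<close> be a graph coding the structure for the least such \<open>\<lambda> > \<alpha>\<close> together with the family of
  the \<open>X \<supseteq> \<alpha>\<close>. By rigidity \<open>X \<mapsto> X \<inter> V\<^sub>\<lambda>\<close> induces the only homomorphism downwards and there is none upwards,
  and the sequence of these graphs is \<open>\<Pi>\<^sub>1\<close>.
\<close>

text \<open>Strength quantifies over class embeddings, so it cannot be fed to Separation or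
  Replacement. This is why the converse works with endomorphisms of a power set: such a map is a
  set, it plays the role of an extender, and "some endomorphism at the level \<open>l\<close> moves
  \<kappa> first" (\<open>crit_at\<close>) is first order. Only thanks to this can a level closed
  under the bounds for all smaller \<kappa> be reached (\<open>rigid_unbounded\<close>). The
  definition of strength does not require the image of \<kappa> to exceed the given \<lambda>. Hence
  no single embedding is assumed that sends \<kappa> above the rank of \<open>G\<close>; the forward
  direction inducts on the rank instead and has to exclude a fixed point. Product reflection for
  \<open>\<Pi>\<^sub>1\<close> needs more than a \<open>\<Pi>\<^sub>1\<close> sequence: the range is
  obtained by an existential quantifier over the index, which in general leaves
  \<open>\<Pi>\<^sub>1\<close>. The index is therefore bounded by an ordinal that can be read off
  from the graph. As only definable predicates may be separated or replaced, almost every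
  construction carries a definability side condition (\<open>defp\<close>,
  \<open>deft\<close>).\<close>

section \<open>Substitution of variables\<close>

lemma finite_fv: "finite (fv \<phi>)"
  by (induction \<phi>) auto

lemma sat_cong: "(\<And>i. i \<in> fv \<phi> \<Longrightarrow> s i = t i) \<Longrightarrow> sat E M \<phi> s = sat E M \<phi> t"
proof (induction \<phi> arbitrary: s t)
  case (Exists n \<phi>)
  have "sat E M \<phi> (s(n := x)) = sat E M \<phi> (t(n := x))" for x
    using Exists.prems by (intro Exists.IH) auto
  then show ?case by simp
next
  case (And \<phi> \<psi>)
  have "sat E M \<phi> s = sat E M \<phi> t" using And.prems by (intro And.IH(1)) simp
  moreover have "sat E M \<psi> s = sat E M \<psi> t" using And.prems by (intro And.IH(2)) simp
  ultimately show ?case by simp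
next
  case (Neg \<phi>)
  have "sat E M \<phi> s = sat E M \<phi> t" using Neg.prems by (intro Neg.IH) simp
  then show ?case by simp
qed auto

text \<open>Capture is avoided by renaming every bound variable to a number above the images of all
  free variables. This works also for maps \<open>r\<close> that are not injective.\<close>

primrec sub :: "fm \<Rightarrow> (nat \<Rightarrow> nat) \<Rightarrow> fm" where
  "sub (Member m n) r = Member (r m) (r n)"
| "sub (Equal m n) r = Equal (r m) (r n)"
| "sub (Neg \<phi>) r = Neg (sub \<phi> r)"
| "sub (And \<phi> \<psi>) r = And (sub \<phi> r) (sub \<psi> r)"
| "sub (Exists m \<phi>) r =
     (let m' = Suc (Max (insert 0 (r ` fv \<phi>))) in Exists m' (sub \<phi> (r(m := m'))))"

lemma fresh_greater: "i \<in> fv \<phi> \<Longrightarrow> r i < Suc (Max (insert 0 (r ` fv \<phi>)))"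
  by (simp add: finite_fv le_imp_less_Suc)

lemma sat_sub: "sat E M (sub \<phi> r) s = sat E M \<phi> (\<lambda>i. s (r i))"
proof (induction \<phi> arbitrary: r s)
  case (Exists m \<phi>)
  define m' where "m' = Suc (Max (insert 0 (r ` fv \<phi>)))"
  have *: "sat E M (sub \<phi> (r(m := m'))) (s(m' := x)) = sat E M \<phi> ((\<lambda>i. s (r i))(m := x))" for x
    unfolding Exists.IH
  proof (rule sat_cong)
    fix i assume "i \<in> fv \<phi>"
    then have "r i < m'" unfolding m'_def by (rule fresh_greater)
    then show "(s(m' := x)) ((r(m := m')) i) = ((\<lambda>i. s (r i))(m := x)) i" by simp
  qed
  show ?case by (simp only: sub.simps Let_def m'_def[symmetric] sat.simps *)
qed auto

lemma Delta0_sub: "Delta0 \<phi> \<Longrightarrow> Delta0 (sub \<phi> r)"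
proof (induction arbitrary: r rule: Delta0.induct)
  case (5 \<phi> m n)
  define m' where "m' = Suc (Max (insert 0 (r ` fv (And (Member m n) \<phi>))))"
  have "r n < m'" unfolding m'_def by (rule fresh_greater) simp
  then show ?case
    using 5 by (simp only: sub.simps Let_def m'_def[symmetric] fun_upd_same)
      (auto intro!: Delta0.intros)
qed (auto intro: Delta0.intros)

lemma levy_sub:
  shows levy_Sigma_sub: "levy_Sigma n \<phi> \<Longrightarrow> levy_Sigma n (sub \<phi> r)"
    and levy_Pi_sub: "levy_Pi n \<phi> \<Longrightarrow> levy_Pi n (sub \<phi> r)"
proof (induction arbitrary: r and r rule: levy_Sigma_levy_Pi.inducts)
  case (4 n \<phi> m)
  then show ?case by (simp only: sub.simps Let_def levy_Sigma_levy_Pi.intros(4))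
next
  case (6 n \<phi> m)
  then show ?case by (simp only: sub.simps Let_def levy_Sigma_levy_Pi.intros(6))
qed (blast intro: levy_Sigma_levy_Pi.intros Delta0_sub)+

definition mrg :: "(nat \<Rightarrow> 'v) \<Rightarrow> (nat \<Rightarrow> 'v) \<Rightarrow> nat \<Rightarrow> 'v" where
  "mrg s p i = (if even i then s (i div 2) else p (i div 2))"

lemma mrg_simps [simp]: "mrg s p (2 * k) = s k" "mrg s p (Suc (2 * k)) = p k"
  by (auto simp: mrg_def)

named_theorems defs_intro

context membership
begin

section \<open>Definable predicates and terms\<close>

text \<open>
  A predicate of an environment \<open>s\<close> is definable if a formula expresses it, where the parameters
  \<open>p\<close> occupy the odd variables and \<open>s\<close> the even ones.
  Environments follow the de Bruijn convention: a quantifier pushes a new entry in front.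
\<close>

definition defp :: "((nat \<Rightarrow> 'v) \<Rightarrow> bool) \<Rightarrow> bool" where
  "defp P \<longleftrightarrow> (\<exists>\<phi> p. \<forall>s. P s \<longleftrightarrow> sat (\<epsilon>) UNIV \<phi> (mrg s p))"

text \<open>The value sits in variable 0, so that a phrase
  \<open>\<exists>x. x = t s \<and> ...\<close> falls under \<open>defp_ex\<close>; terms are
  substituted into predicates in this way.\<close>

definition deft :: "((nat \<Rightarrow> 'v) \<Rightarrow> 'v) \<Rightarrow> bool" where
  "deft t \<longleftrightarrow> defp (\<lambda>s. s 0 = t (\<lambda>i. s (Suc i)))"

lemma defpI: "(\<And>s. P s \<longleftrightarrow> sat (\<epsilon>) UNIV \<phi> (mrg s p)) \<Longrightarrow> defp P"
  unfolding defp_def by blast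

text \<open>Variables may be frozen to constants: these join the old parameters in one sequence
  \<open>q\<close>, in which \<open>c\<close> takes the even and \<open>p\<close> the odd
  places.\<close>

lemma defp_env:
  assumes "defp P"
  shows "defp (\<lambda>s. P (\<lambda>i. if b i then c i else s (r i)))"
proof -
  from assms obtain \<phi> p where *: "\<And>s. P s \<longleftrightarrow> sat (\<epsilon>) UNIV \<phi> (mrg s p)"
    unfolding defp_def by blast
  define q where "q = mrg c p"
  define f where "f = (\<lambda>i. if even i then (if b (i div 2) then Suc (2 * (2 * (i div 2))) else 2 * r (i div 2))
    else Suc (2 * (Suc (2 * (i div 2)))))"
  have q: "mrg s q (Suc (2 * (2 * k))) = c k" "mrg s q (Suc (2 * Suc (2 * k))) = p k" for s k
    by (simp_all only: q_def mrg_simps)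
  have "mrg (\<lambda>i. if b i then c i else s (r i)) p = (\<lambda>i. mrg s q (f i))" for s
  proof
    fix i show "mrg (\<lambda>i. if b i then c i else s (r i)) p i = mrg s q (f i)"
    proof (cases "even i")
      case True
      then obtain k where "i = 2 * k" by blast
      then have "f i = (if b k then Suc (2 * (2 * k)) else 2 * r k)" by (simp add: f_def)
      then show ?thesis using q \<open>i = 2 * k\<close> by (simp only: mrg_simps split: if_split) simp
    next
      case False
      then obtain k where k: "i = Suc (2 * k)" by (metis oddE Suc_eq_plus1)
      then have "f i = Suc (2 * Suc (2 * k))" by (simp add: f_def)
      then show ?thesis using q k by (simp only: mrg_simps)
    qed
  qed
  then have "P (\<lambda>i. if b i then c i else s (r i)) \<longleftrightarrow> sat (\<epsilon>) UNIV (sub \<phi> f) (mrg s q)" for s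
    by (simp add: * sat_sub)
  then show ?thesis by (rule defpI)
qed

lemma defp_subst: "defp P \<Longrightarrow> defp (\<lambda>s. P (\<lambda>i. s (r i)))"
  using defp_env[of P "\<lambda>_. False"] by simp

lemma defp_const [defs_intro]: "defp (\<lambda>s. c)"
  unfolding defp_def
  by (rule exI[of _ "if c then Equal 0 0 else Neg (Equal 0 0)"]) auto

lemma defp_neg [defs_intro]: "defp P \<Longrightarrow> defp (\<lambda>s. \<not> P s)"
  unfolding defp_def by (metis sat.simps(3))

lemma defp_conj [defs_intro]: assumes "defp P" "defp Q" shows "defp (\<lambda>s. P s \<and> Q s)"
proof -
  from assms obtain \<phi> p \<psi> q where
    P: "\<And>s. P s \<longleftrightarrow> sat (\<epsilon>) UNIV \<phi> (mrg s p)" and Q: "\<And>s. Q s \<longleftrightarrow> sat (\<epsilon>) UNIV \<psi> (mrg s q)"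
    unfolding defp_def by blast
  define f where "f = (\<lambda>i::nat. if even i then i else Suc (2 * (2 * (i div 2))))"
  define g where "g = (\<lambda>i::nat. if even i then i else Suc (2 * (Suc (2 * (i div 2)))))"
  have *: "mrg s (mrg p q) (Suc (2 * (2 * k))) = p k" "mrg s (mrg p q) (Suc (2 * Suc (2 * k))) = q k" for s k
    by (simp_all only: mrg_simps)
  have f: "mrg s p i = mrg s (mrg p q) (f i)" and g: "mrg s q i = mrg s (mrg p q) (g i)" for s i
    unfolding f_def g_def by (simp_all only: * mrg_def[of s p] mrg_def[of s q] split: if_split)
      (simp_all add: mrg_def)
  have "P s \<and> Q s \<longleftrightarrow> sat (\<epsilon>) UNIV (And (sub \<phi> f) (sub \<psi> g)) (mrg s (mrg p q))" for s
    by (simp add: P Q sat_sub f[symmetric] g[symmetric])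
  then show ?thesis by (rule defpI)
qed

lemma defp_disj [defs_intro]: assumes "defp P" "defp Q" shows "defp (\<lambda>s. P s \<or> Q s)"
proof -
  have "defp (\<lambda>s. \<not> (\<not> P s \<and> \<not> Q s))" by (intro defp_neg defp_conj assms)
  then show ?thesis by simp
qed

lemma defp_imp [defs_intro]: assumes "defp P" "defp Q" shows "defp (\<lambda>s. P s \<longrightarrow> Q s)"
proof -
  have "defp (\<lambda>s. \<not> (P s \<and> \<not> Q s))" by (intro defp_neg defp_conj assms)
  then show ?thesis by simp
qed

lemma defp_iff [defs_intro]: assumes "defp P" "defp Q" shows "defp (\<lambda>s. P s \<longleftrightarrow> Q s)"
proof -
  have "defp (\<lambda>s. (P s \<longrightarrow> Q s) \<and> (Q s \<longrightarrow> P s))" by (intro defp_imp defp_conj assms)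
  then show ?thesis by (simp add: iff_conv_conj_imp)
qed

lemma defp_ex [defs_intro]:
  assumes "defp (\<lambda>s. Q (\<lambda>i. s (Suc i)) (s 0))"
  shows "defp (\<lambda>s. \<exists>x. Q s x)"
proof -
  from assms obtain \<phi> p where
    *: "\<And>s. Q (\<lambda>i. s (Suc i)) (s 0) \<longleftrightarrow> sat (\<epsilon>) UNIV \<phi> (mrg s p)"
    unfolding defp_def by blast
  \<comment> \<open>Variable 1, the place of parameter 0, becomes the bound variable; so the
    parameters move up by one place, and entry 0 of \<open>p'\<close> is a dummy.\<close>
  define p' where "p' = case_nat (p 0) p"
  define f where "f = (\<lambda>i. if even i then (case i div 2 of 0 \<Rightarrow> Suc 0 | Suc k \<Rightarrow> 2 * k) else Suc (2 * Suc (i div 2)))"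
  have "((mrg s p')(Suc 0 := x)) (f i) = mrg (case_nat x s) p i" for s x i
    by (auto simp: f_def p'_def mrg_def[of "case_nat x s"] simp del: mult_Suc_right split: nat.split)
  then have "Q s x \<longleftrightarrow> sat (\<epsilon>) UNIV (sub \<phi> f) ((mrg s p')(Suc 0 := x))" for s x
    using *[of "case_nat x s"] by (simp add: sat_sub)
  then have "(\<exists>x. Q s x) \<longleftrightarrow> sat (\<epsilon>) UNIV (Exists (Suc 0) (sub \<phi> f)) (mrg s p')" for s
    by simp
  then show ?thesis by (rule defpI)
qed

lemma defp_all [defs_intro]:
  assumes "defp (\<lambda>s. Q (\<lambda>i. s (Suc i)) (s 0))"
  shows "defp (\<lambda>s. \<forall>x. Q s x)"
proof -
  have "defp (\<lambda>s. \<not> (\<exists>x. \<not> Q s x))" by (intro defp_neg defp_ex assms)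
  then show ?thesis by simp
qed

lemma deft_var [defs_intro]: "deft (\<lambda>s. s k)"
proof -
  have "s 0 = s (Suc k) \<longleftrightarrow> sat (\<epsilon>) UNIV (Equal (2 * 0) (2 * Suc k)) (mrg s p)" for s p
    by (simp only: sat.simps mrg_simps)
  then show ?thesis unfolding deft_def by (rule defpI)
qed

lemma deft_const [defs_intro]: "deft (\<lambda>_. c)"
proof -
  have "s 0 = c \<longleftrightarrow> sat (\<epsilon>) UNIV (Equal (2 * 0) (Suc (2 * 0))) (mrg s (\<lambda>_. c))" for s
    by (simp only: sat.simps mrg_simps)
  then show ?thesis unfolding deft_def by (rule defpI)
qed

lemma deft_shift: "deft t \<Longrightarrow> deft (\<lambda>s. t (\<lambda>i. s (Suc i)))"
  unfolding deft_def
  by (drule defp_subst[where r = "\<lambda>i. case i of 0 \<Rightarrow> 0 | Suc k \<Rightarrow> Suc (Suc k)"]) simp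

lemma defp_app1:
  assumes "defp (\<lambda>s. P (s 0))" "deft t"
  shows "defp (\<lambda>s. P (t s))"
proof -
  have "defp (\<lambda>s. \<exists>x. x = t s \<and> P x)"
    using assms unfolding deft_def by (intro defp_ex defp_conj)
  then show ?thesis by simp
qed

lemma defp_app2:
  assumes "defp (\<lambda>s. P (s 0) (s 1))" "deft t" "deft u"
  shows "defp (\<lambda>s. P (t s) (u s))"
proof -
  \<comment> \<open>The last argument comes first: the innermost quantifier owns variable 0, which
    has to be the first argument of \<open>P\<close>.\<close>
  have "defp (\<lambda>s. \<exists>x. x = u s \<and> (\<exists>y. y = t s \<and> P y x))"
    using assms deft_shift[OF assms(2)] unfolding deft_def by (intro defp_ex defp_conj) simp_all
  then show ?thesis by simp
qed

lemma defp_app3: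
  assumes "defp (\<lambda>s. P (s 0) (s 1) (s 2))" "deft t" "deft u" "deft v"
  shows "defp (\<lambda>s. P (t s) (u s) (v s))"
proof -
  have "defp (\<lambda>s. \<exists>z. z = v s \<and> (\<exists>x. x = u s \<and> (\<exists>y. y = t s \<and> P y x z)))"
    using assms deft_shift[OF deft_shift[OF assms(2)]] deft_shift[OF assms(3)]
    unfolding deft_def by (intro defp_ex defp_conj) (simp_all add: numeral_2_eq_2)
  then show ?thesis by simp
qed

lemma defp_app4:
  assumes "defp (\<lambda>s. P (s 0) (s 1) (s 2) (s 3))" "deft t" "deft u" "deft v" "deft w"
  shows "defp (\<lambda>s. P (t s) (u s) (v s) (w s))"
proof -
  have "defp (\<lambda>s. \<exists>b. b = w s \<and> (\<exists>z. z = v s \<and> (\<exists>x. x = u s \<and> (\<exists>y. y = t s \<and> P y x z b))))"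
    using assms deft_shift[OF deft_shift[OF deft_shift[OF assms(2)]]] deft_shift[OF deft_shift[OF assms(3)]]
      deft_shift[OF assms(4)]
    unfolding deft_def by (intro defp_ex defp_conj) (simp_all add: numeral_2_eq_2 numeral_3_eq_3)
  then show ?thesis by simp
qed

lemma defp_mem [defs_intro]: "deft t \<Longrightarrow> deft u \<Longrightarrow> defp (\<lambda>s. t s \<epsilon> u s)"
proof (rule defp_app2)
  have "s 0 \<epsilon> s 1 \<longleftrightarrow> sat (\<epsilon>) UNIV (Member (2 * 0) (2 * 1)) (mrg s p)" for s p
    by (simp only: sat.simps mrg_simps)
  then show "defp (\<lambda>s. s 0 \<epsilon> s 1)" by (rule defpI)
qed

lemma defp_eq [defs_intro]: "deft t \<Longrightarrow> deft u \<Longrightarrow> defp (\<lambda>s. t s = u s)"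
proof (rule defp_app2)
  have "s 0 = s 1 \<longleftrightarrow> sat (\<epsilon>) UNIV (Equal (2 * 0) (2 * 1)) (mrg s p)" for s p
    by (simp only: sat.simps mrg_simps)
  then show "defp (\<lambda>s. s 0 = s 1)" by (rule defpI)
qed

lemma defp_ex1 [defs_intro]:
  assumes "defp (\<lambda>s. Q (\<lambda>i. s (Suc i)) (s 0))"
  shows "defp (\<lambda>s. \<exists>!x. Q s x)"
proof -
  have 1: "defp (\<lambda>s. Q (\<lambda>i. s (Suc (Suc i))) (s 0))"
    using defp_subst[OF assms, where r = "\<lambda>i. case i of 0 \<Rightarrow> 0 | Suc k \<Rightarrow> Suc (Suc k)"] by simp
  show ?thesis unfolding Ex1_def by (intro defs_intro assms 1)
qed

text \<open>Outside unique existence \<open>THE\<close> is unspecified and might vary undefinably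
  with \<open>P\<close>. One fixed default, usable as a parameter, keeps every description
  definable.\<close>

definition the1 :: "('v \<Rightarrow> bool) \<Rightarrow> 'v" where
  "the1 P = (if \<exists>!y. P y then THE y. P y else (THE y. empty_set y))"

lemma the1_equality: "P y \<Longrightarrow> (\<And>z. P z \<Longrightarrow> z = y) \<Longrightarrow> the1 P = y"
  unfolding the1_def by (metis (mono_tags, lifting) the_equality)

lemma the1I: "\<exists>!y. P y \<Longrightarrow> P (the1 P)"
  unfolding the1_def by (simp add: theI')

lemma deft_the1 [defs_intro]:
  assumes "defp (\<lambda>s. P (\<lambda>i. s (Suc i)) (s 0))"
  shows "deft (\<lambda>s. the1 (P s))"
proof -
  have 1: "defp (\<lambda>s. P (\<lambda>i. s (Suc (Suc i))) (s 0))"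
    using defp_subst[OF assms, where r = "\<lambda>i. case i of 0 \<Rightarrow> 0 | Suc k \<Rightarrow> Suc (Suc k)"] by simp
  have "y = the1 (P s) \<longleftrightarrow> ((\<exists>!x. P s x) \<and> P s y) \<or> (\<not> (\<exists>!x. P s x) \<and> y = (THE y. empty_set y))" for s y
  proof (cases "\<exists>!x. P s x")
    case True
    then show ?thesis by (metis the1I)
  qed (simp add: the1_def)
  then show ?thesis
    unfolding deft_def by (simp only:) (intro defs_intro assms 1)
qed

lemma deft_the1_app1:
  assumes "defp (\<lambda>s. P (s 1) (s 0))" "deft t"
  shows "deft (\<lambda>s. the1 (P (t s)))"
proof (rule deft_the1)
  show "defp (\<lambda>s. P (t (\<lambda>i. s (Suc i))) (s 0))"
    by (rule defp_app2[where P = "\<lambda>x y. P y x", OF assms(1) deft_var deft_shift[OF assms(2)]])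
qed

lemma deft_the1_app2:
  assumes "defp (\<lambda>s. P (s 1) (s 2) (s 0))" "deft t" "deft u"
  shows "deft (\<lambda>s. the1 (P (t s) (u s)))"
proof (rule deft_the1)
  show "defp (\<lambda>s. P (t (\<lambda>i. s (Suc i))) (u (\<lambda>i. s (Suc i))) (s 0))"
    by (rule defp_app3[where P = "\<lambda>x y z. P y z x",
          OF assms(1) deft_var deft_shift[OF assms(2)] deft_shift[OF assms(3)]])
qed

lemma deft_app1:
  assumes "deft (\<lambda>s. f (s 0))" "deft t"
  shows "deft (\<lambda>s. f (t s))"
proof -
  have "defp (\<lambda>s. s 0 = f (t (\<lambda>i. s (Suc i))))"
    by (rule defp_app2[where P = "\<lambda>x y. x = f y", OF _ deft_var deft_shift[OF assms(2)]])
      (use assms(1) in \<open>simp add: deft_def\<close>)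
  then show ?thesis unfolding deft_def .
qed

lemma deft_app2:
  assumes "deft (\<lambda>s. f (s 0) (s 1))" "deft t" "deft u"
  shows "deft (\<lambda>s. f (t s) (u s))"
proof -
  have "defp (\<lambda>s. s 0 = f (t (\<lambda>i. s (Suc i))) (u (\<lambda>i. s (Suc i))))"
    by (rule defp_app3[where P = "\<lambda>x y z. x = f y z",
          OF _ deft_var deft_shift[OF assms(2)] deft_shift[OF assms(3)]])
      (use assms(1) in \<open>simp add: deft_def numeral_2_eq_2\<close>)
  then show ?thesis unfolding deft_def .
qed

lemma deft_if [defs_intro]:
  assumes "defp P" "deft t" "deft u"
  shows "deft (\<lambda>s. if P s then t s else u s)"
proof -
  have "y = (if P s then t s else u s) \<longleftrightarrow> (P s \<and> y = t s) \<or> (\<not> P s \<and> y = u s)" for s y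
    by simp
  then show ?thesis
    unfolding deft_def
    by (simp only:) (intro defs_intro deft_shift[OF assms(2)] deft_shift[OF assms(3)]
        defp_subst[OF assms(1), where r = Suc])
qed

lemma deft_inst:
  assumes "deft t"
  shows "deft (\<lambda>s. t (\<lambda>i. if b i then c i else s (r i)))"
  using defp_env[OF assms[unfolded deft_def], of "case_nat False b" "case_nat undefined c" "case_nat 0 (\<lambda>i. Suc (r i))"]
  unfolding deft_def by (simp cong: if_cong)

lemma definable_class_iff: "definable_class C \<longleftrightarrow> defp (\<lambda>s. s 0 \<in> C)"
proof
  assume "definable_class C"
  then obtain \<phi> p where C: "C = {x. sat (\<epsilon>) UNIV \<phi> (p(0 := x))}"
    unfolding definable_class_def by blast
  define f where "f = (\<lambda>i::nat. if i = 0 then 0 else Suc (2 * i))"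
  have "mrg s p (f i) = (p(0 := s 0)) i" for s i
    by (cases "i = 0") (auto simp: f_def mrg_def)
  then have "s 0 \<in> C \<longleftrightarrow> sat (\<epsilon>) UNIV (sub \<phi> f) (mrg s p)" for s
    unfolding C by (simp only: sat_sub mem_Collect_eq)
  then show "defp (\<lambda>s. s 0 \<in> C)" by (rule defpI)
next
  assume "defp (\<lambda>s. s 0 \<in> C)"
  then obtain \<phi> p where *: "\<And>s. s 0 \<in> C \<longleftrightarrow> sat (\<epsilon>) UNIV \<phi> (mrg s p)"
    unfolding defp_def by blast
  have "(mrg (\<lambda>_. y) p)(0 := x) = mrg (\<lambda>i. if i = 0 then x else y) p" for x y
    by (rule ext) (auto simp: mrg_def)
  then have "C = {x. sat (\<epsilon>) UNIV \<phi> ((mrg (\<lambda>_. undefined) p)(0 := x))}"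
    using *[of "\<lambda>i. if i = 0 then _ else undefined"] by auto
  then show "definable_class C" unfolding definable_class_def by blast
qed

lemma defp_class: "definable_class C \<Longrightarrow> deft t \<Longrightarrow> defp (\<lambda>s. t s \<in> C)"
  by (rule defp_app1) (simp_all add: definable_class_iff)

lemma definable_by_imp_definable_class:
  assumes "definable_by \<Gamma> C"
  shows "definable_class C"
proof -
  from assms obtain \<phi> where \<phi>: "fv \<phi> \<subseteq> {0}" "C = {x. sat (\<epsilon>) UNIV \<phi> (\<lambda>_. x)}"
    unfolding definable_by_def by blast
  have "sat (\<epsilon>) UNIV \<phi> (\<lambda>_. x) = sat (\<epsilon>) UNIV \<phi> (s(0 := x))" for s x
    by (rule sat_cong) (use \<phi>(1) in auto)
  then show ?thesis unfolding definable_class_def \<phi>(2) by blast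
qed

text \<open>Relativization, by recursion on the formula. There is no conflict with the
  undefinability of truth: the formula and the recursion live outside of the model.\<close>

lemma defp_sat:
  assumes "\<And>i. deft (t i)" "definable_class M"
  shows "defp (\<lambda>s. sat (\<epsilon>) M \<phi> (\<lambda>i. t i s))"
  using assms(1)
proof (induction \<phi> arbitrary: t)
  case (Exists n \<phi>)
  have "defp (\<lambda>s. sat (\<epsilon>) M \<phi> (\<lambda>i. (if i = n then (\<lambda>s. s 0) else (\<lambda>s. t i (\<lambda>i. s (Suc i)))) s))"
    by (rule Exists.IH) (auto intro: deft_var deft_shift Exists.prems)
  moreover have "(\<lambda>i. (if i = n then (\<lambda>s. s 0) else (\<lambda>s. t i (\<lambda>i. s (Suc i)))) s) =
      (\<lambda>i. t i (\<lambda>i. s (Suc i)))(n := s 0)" for s by auto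
  ultimately have "defp (\<lambda>s. sat (\<epsilon>) M \<phi> ((\<lambda>i. t i (\<lambda>i. s (Suc i)))(n := s 0)))"
    by (simp only:)
  then show ?case
    unfolding sat.simps Bex_def
    by (intro defp_ex defp_conj defp_class[OF assms(2)] deft_var)
next
  case (Neg \<phi>)
  show ?case unfolding sat.simps by (intro defp_neg Neg.IH Neg.prems)
next
  case (And \<phi> \<psi>)
  show ?case unfolding sat.simps by (intro defp_conj And.IH And.prems)
next
  case (Member m n)
  then show ?case unfolding sat.simps by (intro defp_mem)
next
  case (Equal m n)
  then show ?case unfolding sat.simps by (intro defp_eq)
qed

section \<open>Basic set theory inside the model\<close>

definition emp where "emp = the1 empty_set"
definition up where "up x y = the1 (upair x y)"
definition sg where "sg x = up x x"
definition pr where "pr x y = up (sg x) (up x y)"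
definition Uni where "Uni a = the1 (\<lambda>u. \<forall>x. x \<epsilon> u \<longleftrightarrow> (\<exists>y. y \<epsilon> a \<and> x \<epsilon> y))"
definition un where "un x y = Uni (up x y)"
definition Pow where "Pow a = the1 (powerset a)"
text \<open>\<open>Sep\<close> and \<open>Repl\<close> accept every HOL predicate or function, but
  the expected membership laws are available for definable ones only. Hence the premises of
  \<open>mem_Sep\<close> and \<open>mem_Repl\<close>, which the rules \<open>defs_intro\<close>
  discharge.\<close>

definition Sep where "Sep a P = the1 (\<lambda>b. \<forall>x. x \<epsilon> b \<longleftrightarrow> x \<epsilon> a \<and> P x)"
definition Repl where "Repl a f = the1 (\<lambda>b. \<forall>y. y \<epsilon> b \<longleftrightarrow> (\<exists>x. x \<epsilon> a \<and> y = f x))"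
definition sc where "sc x = un x (sg x)"
definition lam where "lam a f = Repl a (\<lambda>x. pr x (f x))"
definition app where "app f x = the1 (\<lambda>y. pr x y \<epsilon> f)"
definition p1 where "p1 z = the1 (\<lambda>x. \<exists>y. z = pr x y)"
definition p2 where "p2 z = the1 (\<lambda>y. \<exists>x. z = pr x y)"
definition cross where "cross a b = Uni (Repl a (\<lambda>x. Repl b (\<lambda>y. pr x y)))"
definition tr where "tr a \<longleftrightarrow> (\<forall>x y. y \<epsilon> x \<and> x \<epsilon> a \<longrightarrow> y \<epsilon> a)"

lemma defp_empty_set [defs_intro]: "deft t \<Longrightarrow> defp (\<lambda>s. empty_set (t s))"
  by (rule defp_app1[where P = empty_set]) (unfold empty_set_def, intro defs_intro)

lemma defp_subset_of [defs_intro]: "deft t \<Longrightarrow> deft u \<Longrightarrow> defp (\<lambda>s. subset_of (t s) (u s))"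
  by (rule defp_app2[where P = subset_of]) (unfold subset_of_def, intro defs_intro)

lemma defp_upair [defs_intro]: "deft t \<Longrightarrow> deft u \<Longrightarrow> deft v \<Longrightarrow> defp (\<lambda>s. upair (t s) (u s) (v s))"
  by (rule defp_app3[where P = upair]) (unfold upair_def, intro defs_intro)

lemma defp_powerset [defs_intro]: "deft t \<Longrightarrow> deft u \<Longrightarrow> defp (\<lambda>s. powerset (t s) (u s))"
  by (rule defp_app2[where P = powerset]) (unfold powerset_def, intro defs_intro)

lemma deft_emp [defs_intro]: "deft (\<lambda>s. emp)"
  by (rule deft_const)

lemma deft_up [defs_intro]: "deft t \<Longrightarrow> deft u \<Longrightarrow> deft (\<lambda>s. up (t s) (u s))"
  unfolding up_def by (rule deft_the1_app2[where P = upair]) (intro defs_intro)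

lemma deft_sg [defs_intro]: "deft t \<Longrightarrow> deft (\<lambda>s. sg (t s))"
  unfolding sg_def by (intro defs_intro)

lemma deft_pr [defs_intro]: "deft t \<Longrightarrow> deft u \<Longrightarrow> deft (\<lambda>s. pr (t s) (u s))"
  unfolding pr_def by (intro defs_intro)

lemma deft_Uni [defs_intro]: "deft t \<Longrightarrow> deft (\<lambda>s. Uni (t s))"
  unfolding Uni_def
  by (rule deft_the1_app1[where P = "\<lambda>a u. \<forall>x. x \<epsilon> u \<longleftrightarrow> (\<exists>y. y \<epsilon> a \<and> x \<epsilon> y)"]) (intro defs_intro)

lemma deft_un [defs_intro]: "deft t \<Longrightarrow> deft u \<Longrightarrow> deft (\<lambda>s. un (t s) (u s))"
  unfolding un_def by (intro defs_intro)

lemma deft_Pow [defs_intro]: "deft t \<Longrightarrow> deft (\<lambda>s. Pow (t s))"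
  unfolding Pow_def by (rule deft_the1_app1[where P = powerset]) (intro defs_intro)

lemma defp_shift0:
  assumes "defp (\<lambda>s. P (\<lambda>i. s (Suc i)) (s 0))"
  shows "defp (\<lambda>s. P (\<lambda>i. s (Suc (Suc i))) (s 0))"
  using defp_subst[OF assms, where r = "\<lambda>i. case i of 0 \<Rightarrow> 0 | Suc k \<Rightarrow> Suc (Suc k)"] by simp

lemma deft_Sep [defs_intro]:
  assumes "deft t" "defp (\<lambda>s. P (\<lambda>i. s (Suc i)) (s 0))"
  shows "deft (\<lambda>s. Sep (t s) (P s))"
  unfolding Sep_def
  by (intro deft_the1 defp_all defp_iff defp_conj defp_mem deft_var
      deft_shift[OF deft_shift[OF assms(1)]] defp_shift0[where P = "\<lambda>s. P (\<lambda>i. s (Suc i))"])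
    (rule defp_shift0[OF assms(2)])

lemma deft_under2:
  assumes "deft (\<lambda>s. f (\<lambda>i. s (Suc i)) (s 0))"
  shows "deft (\<lambda>s. f (\<lambda>i. s (Suc (Suc (Suc i)))) (s 0))"
  using deft_inst[OF assms, where b = "\<lambda>_. False" and r = "\<lambda>i. case i of 0 \<Rightarrow> 0 | Suc k \<Rightarrow> Suc (Suc (Suc k))"]
  by simp

lemma deft_Repl [defs_intro]:
  assumes "deft t" "deft (\<lambda>s. f (\<lambda>i. s (Suc i)) (s 0))"
  shows "deft (\<lambda>s. Repl (t s) (f s))"
  unfolding Repl_def
  by (intro deft_the1 defp_all defp_ex defp_iff defp_conj defp_mem defp_eq deft_var
      deft_shift[OF deft_shift[OF deft_shift[OF assms(1)]]] deft_under2[OF assms(2)])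

lemma deft_sc [defs_intro]: "deft t \<Longrightarrow> deft (\<lambda>s. sc (t s))"
  unfolding sc_def by (intro defs_intro)

lemma deft_lam [defs_intro]:
  "deft t \<Longrightarrow> deft (\<lambda>s. f (\<lambda>i. s (Suc i)) (s 0)) \<Longrightarrow> deft (\<lambda>s. lam (t s) (f s))"
  unfolding lam_def by (intro deft_Repl deft_pr deft_var)

lemma deft_app [defs_intro]: "deft t \<Longrightarrow> deft u \<Longrightarrow> deft (\<lambda>s. app (t s) (u s))"
  unfolding app_def by (rule deft_the1_app2[where P = "\<lambda>f x y. pr x y \<epsilon> f"]) (intro defs_intro)

lemma deft_p1 [defs_intro]: "deft t \<Longrightarrow> deft (\<lambda>s. p1 (t s))"
  unfolding p1_def by (rule deft_the1_app1[where P = "\<lambda>z x. \<exists>y. z = pr x y"]) (intro defs_intro)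

lemma deft_p2 [defs_intro]: "deft t \<Longrightarrow> deft (\<lambda>s. p2 (t s))"
  unfolding p2_def by (rule deft_the1_app1[where P = "\<lambda>z y. \<exists>x. z = pr x y"]) (intro defs_intro)

lemma deft_cross [defs_intro]: "deft t \<Longrightarrow> deft u \<Longrightarrow> deft (\<lambda>s. cross (t s) (u s))"
proof -
  assume *: "deft t" "deft u"
  show ?thesis unfolding cross_def
    by (intro deft_Uni deft_Repl * deft_shift[OF *(2)] deft_pr deft_var)
qed

lemma defp_tr [defs_intro]: "deft t \<Longrightarrow> defp (\<lambda>s. tr (t s))"
  by (rule defp_app1[where P = tr]) (unfold tr_def, intro defs_intro)

lemma defp_opair [defs_intro]: "deft t \<Longrightarrow> deft u \<Longrightarrow> deft v \<Longrightarrow> defp (\<lambda>s. opair (t s) (u s) (v s))"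
  by (rule defp_app3[where P = opair]) (unfold opair_def, intro defs_intro)

lemma defp_related [defs_intro]: "deft t \<Longrightarrow> deft u \<Longrightarrow> deft v \<Longrightarrow> defp (\<lambda>s. related (t s) (u s) (v s))"
  by (rule defp_app3[where P = related]) (unfold related_def, intro defs_intro)

lemma defp_function_on [defs_intro]: "deft t \<Longrightarrow> deft u \<Longrightarrow> defp (\<lambda>s. function_on (t s) (u s))"
  by (rule defp_app2[where P = function_on]) (unfold function_on_def, intro defs_intro)

lemma defp_maps [defs_intro]: "deft t \<Longrightarrow> deft u \<Longrightarrow> deft v \<Longrightarrow> defp (\<lambda>s. maps (t s) (u s) (v s))"
  by (rule defp_app3[where P = maps]) (unfold maps_def, intro defs_intro)

end

context ZFC
begin

lemma set_ext: "(\<And>z. z \<epsilon> x \<longleftrightarrow> z \<epsilon> y) \<Longrightarrow> x = y"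
  using extensionality by blast

lemma the1_ext: "(\<And>x. x \<epsilon> b \<longleftrightarrow> P x) \<Longrightarrow> the1 (\<lambda>b. \<forall>x. x \<epsilon> b \<longleftrightarrow> P x) = b"
  by (rule the1_equality) (auto intro: set_ext)

lemma mem_the1: "\<exists>b. \<forall>x. x \<epsilon> b \<longleftrightarrow> P x \<Longrightarrow> y \<epsilon> the1 (\<lambda>b. \<forall>x. x \<epsilon> b \<longleftrightarrow> P x) \<longleftrightarrow> P y"
  using the1_ext by blast

lemma defp_fix:
  assumes "defp (\<lambda>s. P (s 0))"
  shows "\<exists>\<phi> s. \<forall>x. P x \<longleftrightarrow> sat (\<epsilon>) UNIV \<phi> (s(0 := x))"
proof -
  have "definable_class {x. P x}" using assms by (simp add: definable_class_iff)
  then show ?thesis unfolding definable_class_def by auto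
qed

lemma mem_Sep: "defp (\<lambda>s. P (s 0)) \<Longrightarrow> x \<epsilon> Sep a P \<longleftrightarrow> x \<epsilon> a \<and> P x"
proof -
  assume "defp (\<lambda>s. P (s 0))"
  from defp_fix[OF this] have "\<exists>b. \<forall>x. x \<epsilon> b \<longleftrightarrow> x \<epsilon> a \<and> P x"
    using separation[of a] by metis
  then show ?thesis unfolding Sep_def by (rule mem_the1)
qed

lemma mem_emp [simp]: "\<not> x \<epsilon> emp"
proof -
  have "\<exists>b. \<forall>x. x \<epsilon> b \<longleftrightarrow> False"
  proof -
    obtain b where "\<forall>x. x \<epsilon> b \<longleftrightarrow> x \<epsilon> undefined \<and> sat (\<epsilon>) UNIV (Neg (Equal 0 0)) ((\<lambda>_. undefined)(0 := x))"
      using separation by blast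
    then show ?thesis by auto
  qed
  from mem_the1[OF this] show ?thesis unfolding emp_def empty_set_def by simp
qed

lemma empty_set_iff [simp]: "empty_set x \<longleftrightarrow> x = emp"
  unfolding empty_set_def using set_ext[of x emp] by auto

lemma nonempty_iff: "x \<noteq> emp \<longleftrightarrow> (\<exists>y. y \<epsilon> x)"
  using empty_set_iff[of x] unfolding empty_set_def by blast

lemma mem_up [simp]: "z \<epsilon> up x y \<longleftrightarrow> z = x \<or> z = y"
  unfolding up_def upair_def using pairing[of x y, unfolded upair_def] by (rule mem_the1)

lemma mem_sg [simp]: "z \<epsilon> sg x \<longleftrightarrow> z = x"
  unfolding sg_def by simp

lemma mem_Uni [simp]: "x \<epsilon> Uni a \<longleftrightarrow> (\<exists>y. y \<epsilon> a \<and> x \<epsilon> y)"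
  unfolding Uni_def using union[of a] by (rule mem_the1)

lemma mem_un [simp]: "z \<epsilon> un x y \<longleftrightarrow> z \<epsilon> x \<or> z \<epsilon> y"
  unfolding un_def by auto

lemma mem_Pow [simp]: "x \<epsilon> Pow a \<longleftrightarrow> subset_of x a"
  unfolding Pow_def powerset_def using power[of a, unfolded powerset_def] by (rule mem_the1)

lemma mem_sc [simp]: "x \<epsilon> sc a \<longleftrightarrow> x \<epsilon> a \<or> x = a"
  unfolding sc_def by auto

lemma upair_iff [simp]: "upair x y p \<longleftrightarrow> p = up x y"
  unfolding upair_def by (auto intro: set_ext)

lemma succ_iff [simp]: "succ x y \<longleftrightarrow> y = sc x"
  unfolding succ_def by (auto intro: set_ext)

lemma powerset_iff [simp]: "powerset a b \<longleftrightarrow> b = Pow a"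
  unfolding powerset_def by (auto intro: set_ext)

lemma up_inject: "up a b = up c d \<longleftrightarrow> (a = c \<and> b = d) \<or> (a = d \<and> b = c)"
proof
  assume "up a b = up c d"
  then have "\<And>z. z = a \<or> z = b \<longleftrightarrow> z = c \<or> z = d" by (metis mem_up)
  then show "(a = c \<and> b = d) \<or> (a = d \<and> b = c)" by metis
qed (auto intro: set_ext)

lemma sg_inject [simp]: "sg x = sg y \<longleftrightarrow> x = y"
  by (metis mem_sg)

lemma pr_inject [simp]: "pr a b = pr c d \<longleftrightarrow> a = c \<and> b = d"
  unfolding pr_def sg_def by (auto simp: up_inject)

lemma opair_iff [simp]: "opair x y p \<longleftrightarrow> p = pr x y"
  unfolding opair_def pr_def sg_def by simp

lemma related_iff [simp]: "related r x y \<longleftrightarrow> pr x y \<epsilon> r"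
  unfolding related_def by simp

lemma p1_pr [simp]: "p1 (pr x y) = x"
  unfolding p1_def by (rule the1_equality) auto

lemma p2_pr [simp]: "p2 (pr x y) = y"
  unfolding p2_def by (rule the1_equality) auto

lemma mem_Repl:
  assumes "deft (\<lambda>s. f (s 0))"
  shows "y \<epsilon> Repl a f \<longleftrightarrow> (\<exists>x. x \<epsilon> a \<and> y = f x)"
proof -
  have 1: "defp (\<lambda>s. \<exists>x y. s 0 = pr x y \<and> y = f x)"
    by (intro defs_intro deft_app1[OF assms])
  have *: "\<exists>\<phi> s. \<forall>x y. y = f x \<longleftrightarrow> sat (\<epsilon>) UNIV \<phi> (s(0 := x, 1 := y))"
  proof -
    have "defp (\<lambda>s. s 0 = f (s 1))" by (intro defs_intro deft_app1[OF assms])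
    then obtain \<phi> p where \<phi>: "\<And>s. s 0 = f (s 1) \<longleftrightarrow> sat (\<epsilon>) UNIV \<phi> (mrg s p)"
      unfolding defp_def by blast
    \<comment> \<open>Replacement expects the argument in variable 0 and the value in variable 1,
      while \<open>\<phi>\<close> has them in variables 2 and 0; everything else moves up by
      two.\<close>
    define g where "g = (\<lambda>i::nat. if i = 0 then 1 else if i = 2 then 0 else i + 2)"
    define s where "s = (\<lambda>i::nat. mrg (\<lambda>_. emp) p (i - 2))"
    define t where "t = (\<lambda>x y. case_nat y (case_nat x (\<lambda>_. emp)))"
    have "(s(0 := x, 1 := y)) (g i) = mrg (t x y) p i" for x y i
      by (auto simp: g_def s_def t_def mrg_def split: nat.split)
    then have "y = f x \<longleftrightarrow> sat (\<epsilon>) UNIV (sub \<phi> g) (s(0 := x, 1 := y))" for x y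
      using \<phi>[of "t x y"] by (simp add: sat_sub t_def)
    then show ?thesis by blast
  qed
  have "\<exists>b. \<forall>y. y \<epsilon> b \<longleftrightarrow> (\<exists>x. x \<epsilon> a \<and> y = f x)"
  proof -
    from * obtain \<phi> s where \<phi>: "\<And>x y. y = f x \<longleftrightarrow> sat (\<epsilon>) UNIV \<phi> (s(0 := x, 1 := y))" by blast
    show ?thesis using replacement[of a \<phi> s] unfolding \<phi>[symmetric] by blast
  qed
  then show ?thesis unfolding Repl_def by (rule mem_the1)
qed

lemma mem_cross [simp]: "p \<epsilon> cross a b \<longleftrightarrow> (\<exists>x y. x \<epsilon> a \<and> y \<epsilon> b \<and> p = pr x y)"
proof -
  have "q \<epsilon> Repl b (\<lambda>y. pr x y) \<longleftrightarrow> (\<exists>y. y \<epsilon> b \<and> q = pr x y)" for q x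
    by (rule mem_Repl) (intro defs_intro)
  moreover have "q \<epsilon> Repl a (\<lambda>x. Repl b (\<lambda>y. pr x y)) \<longleftrightarrow> (\<exists>x. x \<epsilon> a \<and> q = Repl b (\<lambda>y. pr x y))" for q
    by (rule mem_Repl) (intro defs_intro)
  ultimately show ?thesis unfolding cross_def by auto
qed

lemma mem_lam:
  assumes "deft (\<lambda>s. f (s 0))"
  shows "p \<epsilon> lam a f \<longleftrightarrow> (\<exists>x. x \<epsilon> a \<and> p = pr x (f x))"
  unfolding lam_def by (rule mem_Repl) (intro defs_intro assms)

lemma function_on_iff: "function_on f a \<longleftrightarrow>
    (\<forall>p. p \<epsilon> f \<longrightarrow> (\<exists>x y. x \<epsilon> a \<and> p = pr x y)) \<and> (\<forall>x. x \<epsilon> a \<longrightarrow> (\<exists>!y. pr x y \<epsilon> f))"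
proof -
  have "related f x = (\<lambda>y. pr x y \<epsilon> f)" for x by (rule HOL.ext) simp
  then show ?thesis unfolding function_on_def by simp
qed

lemma function_on_lam: "deft (\<lambda>s. f (s 0)) \<Longrightarrow> function_on (lam a f) a"
  unfolding function_on_iff by (auto simp: mem_lam)

lemma app_lam: "deft (\<lambda>s. f (s 0)) \<Longrightarrow> x \<epsilon> a \<Longrightarrow> app (lam a f) x = f x"
  unfolding app_def by (rule the1_equality) (auto simp: mem_lam)

lemma app_eq: "function_on f a \<Longrightarrow> x \<epsilon> a \<Longrightarrow> app f x = y \<longleftrightarrow> pr x y \<epsilon> f"
  unfolding function_on_iff app_def using the1I[of "\<lambda>y. pr x y \<epsilon> f"] by blast

lemma pr_app: "function_on f a \<Longrightarrow> x \<epsilon> a \<Longrightarrow> pr x (app f x) \<epsilon> f"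
  using app_eq[of f a x "app f x"] by simp

lemma function_on_mem: "function_on f a \<Longrightarrow> p \<epsilon> f \<longleftrightarrow> (\<exists>x. x \<epsilon> a \<and> p = pr x (app f x))"
proof
  assume f: "function_on f a" and "p \<epsilon> f"
  then obtain x y where xy: "x \<epsilon> a" "p = pr x y" unfolding function_on_iff by blast
  then have "app f x = y" using app_eq[OF f xy(1)] \<open>p \<epsilon> f\<close> by blast
  then show "\<exists>x. x \<epsilon> a \<and> p = pr x (app f x)" using xy by blast
qed (auto intro: pr_app)

lemma function_on_pr: "function_on f a \<Longrightarrow> pr x y \<epsilon> f \<longleftrightarrow> x \<epsilon> a \<and> y = app f x"
  using function_on_mem by auto

lemma function_ext:
  assumes "function_on f a" "function_on g a" "\<And>x. x \<epsilon> a \<Longrightarrow> app f x = app g x"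
  shows "f = g"
  by (rule set_ext) (use assms in \<open>auto simp: function_on_mem\<close>)

lemma maps_iff: "maps f a b \<longleftrightarrow> function_on f a \<and> (\<forall>x. x \<epsilon> a \<longrightarrow> app f x \<epsilon> b)"
  unfolding maps_def by (auto simp: function_on_pr)

lemma maps_lam: "deft (\<lambda>s. f (s 0)) \<Longrightarrow> (\<And>x. x \<epsilon> a \<Longrightarrow> f x \<epsilon> b) \<Longrightarrow> maps (lam a f) a b"
  by (simp add: maps_iff function_on_lam app_lam)

lemma maps_set: "\<exists>z. \<forall>f. f \<epsilon> z \<longleftrightarrow> maps f a b"
proof -
  have "f \<epsilon> Sep (Pow (cross a b)) (\<lambda>f. maps f a b) \<longleftrightarrow> f \<epsilon> Pow (cross a b) \<and> maps f a b" for f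
    by (rule mem_Sep) (intro defs_intro)
  moreover have "maps f a b \<Longrightarrow> f \<epsilon> Pow (cross a b)" for f
    by (auto simp: maps_iff subset_of_def function_on_mem)
  ultimately show ?thesis by blast
qed

definition Fun where "Fun a b = the1 (\<lambda>z. \<forall>f. f \<epsilon> z \<longleftrightarrow> maps f a b)"

lemma mem_Fun [simp]: "f \<epsilon> Fun a b \<longleftrightarrow> maps f a b"
  unfolding Fun_def using maps_set by (rule mem_the1)

lemma deft_Fun [defs_intro]: "deft t \<Longrightarrow> deft u \<Longrightarrow> deft (\<lambda>s. Fun (t s) (u s))"
  unfolding Fun_def by (rule deft_the1_app2[where P = "\<lambda>a b z. \<forall>f. f \<epsilon> z \<longleftrightarrow> maps f a b"]) (intro defs_intro)

section \<open>Foundation and ordinals\<close>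

lemma set_minimal: "y \<epsilon> a \<Longrightarrow> \<exists>x. x \<epsilon> a \<and> (\<forall>z. z \<epsilon> x \<longrightarrow> \<not> z \<epsilon> a)"
  using foundation[of a] by (auto simp: nonempty_iff)

lemma mem_irrefl: "\<not> x \<epsilon> x"
  using set_minimal[of x "sg x"] by auto

lemma mem_asym: "x \<epsilon> y \<Longrightarrow> \<not> y \<epsilon> x"
  using set_minimal[of x "up x y"] by auto

lemma sc_inject [simp]: "sc x = sc y \<longleftrightarrow> x = y"
  by (metis mem_sc mem_asym)

lemma sc_not_emp [simp]: "sc x \<noteq> emp" "emp \<noteq> sc x"
  by (metis mem_sc mem_emp)+

lemma tr_minimal:
  assumes "defp (\<lambda>s. P (s 0))" "tr T" "x \<epsilon> T" "P x"
  shows "\<exists>x. x \<epsilon> T \<and> P x \<and> (\<forall>y. y \<epsilon> x \<longrightarrow> \<not> P y)"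
proof -
  have "x \<epsilon> Sep T P" using assms by (simp add: mem_Sep)
  from set_minimal[OF this] show ?thesis using assms by (auto simp: mem_Sep tr_def)
qed

text \<open>Equivalent to \<open>ordinal\<close> by Foundation, but bounded, whereas
  \<open>ordinal\<close> quantifies over all subsets. This makes ordinals absolute for transitive
  classes.\<close>

definition Ord where "Ord x \<longleftrightarrow> tr x \<and> (\<forall>y. y \<epsilon> x \<longrightarrow> tr y)"

lemma defp_Ord [defs_intro]: "deft t \<Longrightarrow> defp (\<lambda>s. Ord (t s))"
  by (rule defp_app1[where P = Ord]) (unfold Ord_def, intro defs_intro)

lemma Ord_mem: "Ord a \<Longrightarrow> x \<epsilon> a \<Longrightarrow> Ord x"
  unfolding Ord_def tr_def by blast

lemma Ord_trans: "Ord c \<Longrightarrow> a \<epsilon> b \<Longrightarrow> b \<epsilon> c \<Longrightarrow> a \<epsilon> c"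
  unfolding Ord_def tr_def by blast

lemma Ord_tr: "Ord a \<Longrightarrow> tr a"
  unfolding Ord_def by blast

lemma Ord_emp [simp]: "Ord emp"
  unfolding Ord_def tr_def by simp

lemma Ord_sc: "Ord a \<Longrightarrow> Ord (sc a)"
  unfolding Ord_def tr_def mem_sc by blast

lemma Ord_Uni: "(\<And>x. x \<epsilon> a \<Longrightarrow> Ord x) \<Longrightarrow> Ord (Uni a)"
  unfolding Ord_def tr_def mem_Uni by blast

lemma Ord_least:
  assumes "defp (\<lambda>s. P (s 0))" "Ord a" "P a"
  shows "\<exists>b. Ord b \<and> P b \<and> (\<forall>c. c \<epsilon> b \<longrightarrow> \<not> P c)"
proof -
  have "tr (sc a)" using Ord_sc[OF assms(2)] by (rule Ord_tr)
  from tr_minimal[OF assms(1) this _ assms(3)] obtain b where "b \<epsilon> sc a" "P b" "\<forall>c. c \<epsilon> b \<longrightarrow> \<not> P c"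
    by auto
  then show ?thesis using Ord_mem[OF Ord_sc[OF assms(2)]] by blast
qed

lemma Ord_induct:
  assumes "defp (\<lambda>s. P (s 0))" "Ord a" "\<And>a. Ord a \<Longrightarrow> (\<forall>b. b \<epsilon> a \<longrightarrow> P b) \<Longrightarrow> P a"
  shows "P a"
proof (rule ccontr)
  assume "\<not> P a"
  from Ord_least[OF defp_neg[OF assms(1)] assms(2) this] show False using assms(3) by blast
qed

text \<open>Take \<open>x\<close> minimal among the ordinals that are incomparable to some ordinal,
  and \<open>y\<close> minimal among those incomparable to \<open>x\<close>. Then \<open>x\<close>
  and \<open>y\<close> have the same elements.\<close>

lemma Ord_linear: "Ord a \<Longrightarrow> Ord b \<Longrightarrow> a \<epsilon> b \<or> a = b \<or> b \<epsilon> a"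
proof (rule ccontr)
  assume a: "Ord a" and b: "Ord b" and "\<not> (a \<epsilon> b \<or> a = b \<or> b \<epsilon> a)"
  then have P: "\<exists>b. Ord b \<and> \<not> (a \<epsilon> b \<or> a = b \<or> b \<epsilon> a)" by blast
  have "defp (\<lambda>s. \<exists>b. Ord b \<and> \<not> (s 0 \<epsilon> b \<or> s 0 = b \<or> b \<epsilon> s 0))" by (intro defs_intro)
  from Ord_least[OF this a P] obtain x where x: "Ord x"
    "\<exists>b. Ord b \<and> \<not> (x \<epsilon> b \<or> x = b \<or> b \<epsilon> x)"
    "\<And>c b. c \<epsilon> x \<Longrightarrow> Ord b \<Longrightarrow> c \<epsilon> b \<or> c = b \<or> b \<epsilon> c" by blast
  from x(2) obtain b where b: "Ord b" "\<not> (x \<epsilon> b \<or> x = b \<or> b \<epsilon> x)" by blast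
  have "defp (\<lambda>s. \<not> (x \<epsilon> s 0 \<or> x = s 0 \<or> s 0 \<epsilon> x))" by (intro defs_intro)
  from Ord_least[OF this b] obtain y where y: "Ord y" "\<not> (x \<epsilon> y \<or> x = y \<or> y \<epsilon> x)"
    "\<And>c. c \<epsilon> y \<Longrightarrow> x \<epsilon> c \<or> x = c \<or> c \<epsilon> x" by blast
  have "x = y"
  proof (rule set_ext)
    fix z show "z \<epsilon> x \<longleftrightarrow> z \<epsilon> y"
      using x(3)[of z y] y(3)[of z] x(1) y(1,2) Ord_trans by blast
  qed
  then show False using y by blast
qed

lemma ordinal_iff [simp]: "ordinal a \<longleftrightarrow> Ord a"
proof
  assume o: "ordinal a"
  have 1: "y \<epsilon> a" if "y \<epsilon> x" "x \<epsilon> a" for x y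
    using o that unfolding ordinal_def by (elim conjE) metis
  have 2: "x \<epsilon> z" if "z \<epsilon> a" "x \<epsilon> y" "y \<epsilon> z" for x y z
    using o that 1[of y z] 1[of x y] unfolding ordinal_def by (elim conjE) metis
  show "Ord a" unfolding Ord_def tr_def
    by (intro conjI allI impI; elim conjE) (metis 1, metis 2)
next
  assume a: "Ord a"
  have "\<exists>x. x \<epsilon> b \<and> (\<forall>y. y \<epsilon> b \<longrightarrow> x = y \<or> x \<epsilon> y)" if "subset_of b a" "b \<noteq> emp" for b
  proof -
    obtain y where "y \<epsilon> b" using \<open>b \<noteq> emp\<close> nonempty_iff by blast
    from set_minimal[OF this] obtain x where x: "x \<epsilon> b" "\<And>z. z \<epsilon> x \<Longrightarrow> \<not> z \<epsilon> b" by blast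
    have "x = y \<or> x \<epsilon> y" if "y \<epsilon> b" for y
    proof -
      have "Ord x" "Ord y" using x(1) that \<open>subset_of b a\<close> Ord_mem[OF a] unfolding subset_of_def by auto
      from Ord_linear[OF this] show ?thesis using x(2)[of y] that by blast
    qed
    then show ?thesis using x(1) by blast
  qed
  moreover have "tr a" "\<And>x. x \<epsilon> a \<Longrightarrow> tr x" using a unfolding Ord_def by auto
  moreover have "x \<epsilon> y \<or> x = y \<or> y \<epsilon> x" if "x \<epsilon> a" "y \<epsilon> a" for x y
    using Ord_linear[OF Ord_mem[OF a that(1)] Ord_mem[OF a that(2)]] .
  moreover have "x \<epsilon> z" if "z \<epsilon> a" "x \<epsilon> y" "y \<epsilon> z" for x y z
    using that Ord_trans[OF Ord_mem[OF a that(1)]] by blast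
  moreover have "y \<epsilon> a" if "y \<epsilon> x" "x \<epsilon> a" for x y
    using that Ord_trans[OF a] by blast
  ultimately show "ordinal a" unfolding ordinal_def empty_set_iff using mem_irrefl
    by (intro conjI allI impI; (elim conjE)?) metis+
qed

lemma Ord_subset: "Ord a \<Longrightarrow> Ord b \<Longrightarrow> subset_of a b \<longleftrightarrow> a \<epsilon> b \<or> a = b"
  unfolding subset_of_def using Ord_linear[of a b] Ord_trans mem_irrefl by blast

lemma Ord_mem_sc: "Ord b \<Longrightarrow> a \<epsilon> b \<Longrightarrow> sc a \<epsilon> b \<or> sc a = b"
  using Ord_linear[of "sc a" b] Ord_sc[OF Ord_mem, of b a] mem_asym[of a b] by (metis mem_sc mem_irrefl)

lemma Ord_bound: "(\<And>x. x \<epsilon> a \<Longrightarrow> Ord x) \<Longrightarrow> \<exists>b. Ord b \<and> (\<forall>x. x \<epsilon> a \<longrightarrow> x \<epsilon> b)"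
proof -
  assume *: "\<And>x. x \<epsilon> a \<Longrightarrow> Ord x"
  then have o: "Ord (sc (Uni a))" by (intro Ord_sc Ord_Uni)
  have "x \<epsilon> sc (Uni a)" if "x \<epsilon> a" for x
  proof -
    have "subset_of x (Uni a)" using that by (auto simp: subset_of_def)
    then show ?thesis using that * Ord_Uni Ord_subset by simp
  qed
  then show ?thesis using o by blast
qed

lemma no_set_of_ordinals: "\<exists>b. Ord b \<and> \<not> b \<epsilon> a"
proof -
  have *: "x \<epsilon> Sep a Ord \<longleftrightarrow> x \<epsilon> a \<and> Ord x" for x by (rule mem_Sep) (intro defs_intro)
  then obtain b where "Ord b" "\<And>x. x \<epsilon> a \<Longrightarrow> Ord x \<Longrightarrow> x \<epsilon> b" using Ord_bound[of "Sep a Ord"] by blast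
  then show ?thesis using mem_irrefl by blast
qed

section \<open>Natural numbers and iteration\<close>

definition isnat where "isnat n \<longleftrightarrow> Ord n \<and> (\<forall>m. m \<epsilon> sc n \<longrightarrow> m = emp \<or> (\<exists>k. m = sc k))"

definition om where "om = the1 (\<lambda>w. \<forall>n. n \<epsilon> w \<longleftrightarrow> isnat n)"

lemma defp_isnat [defs_intro]: "deft t \<Longrightarrow> defp (\<lambda>s. isnat (t s))"
  by (rule defp_app1[where P = isnat]) (unfold isnat_def, intro defs_intro)

lemma mem_om_iff: "n \<epsilon> om \<longleftrightarrow> isnat n"
proof -
  obtain a where a: "emp \<epsilon> a" "\<And>x. x \<epsilon> a \<Longrightarrow> sc x \<epsilon> a" using infinity by auto
  have "n \<epsilon> a" if nat_n: "isnat n" for n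
  proof (rule ccontr)
    assume n: "\<not> n \<epsilon> a"
    have d: "defp (\<lambda>s. isnat (s 0) \<and> \<not> s 0 \<epsilon> a)" by (intro defs_intro)
    have "Ord n" using that by (simp add: isnat_def)
    from Ord_least[OF d this] obtain m where m: "isnat m" "\<not> m \<epsilon> a" "\<And>c. c \<epsilon> m \<Longrightarrow> isnat c \<Longrightarrow> c \<epsilon> a"
      using nat_n n by blast
    then have "m \<noteq> emp" using a(1) by blast
    then obtain k where k: "m = sc k" using m(1) unfolding isnat_def by auto
    have "Ord k" using m(1) Ord_mem[of m k] unfolding isnat_def k by simp
    then have "isnat k" using m(1) unfolding isnat_def k by simp
    then have "k \<epsilon> a" using m(3)[of k] k by simp
    then show False using a(2) m(2) k by blast
  qed
  then have "n \<epsilon> Sep a isnat \<longleftrightarrow> isnat n" for n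
    by (subst mem_Sep) (intro defs_intro, blast)
  then have "\<exists>w. \<forall>n. n \<epsilon> w \<longleftrightarrow> isnat n" by blast
  then show ?thesis unfolding om_def by (rule mem_the1)
qed

lemma om_emp [simp]: "emp \<epsilon> om"
  by (simp add: mem_om_iff isnat_def)

lemma om_sc [simp]: "sc n \<epsilon> om \<longleftrightarrow> n \<epsilon> om"
proof
  assume "n \<epsilon> om" then show "sc n \<epsilon> om"
    unfolding mem_om_iff isnat_def by (auto intro: Ord_sc)
next
  assume *: "sc n \<epsilon> om"
  then have "Ord (sc n)" by (simp add: mem_om_iff isnat_def)
  then have "Ord n" by (rule Ord_mem) simp
  then show "n \<epsilon> om" using * unfolding mem_om_iff isnat_def by auto
qed

lemma om_cases: "n \<epsilon> om \<Longrightarrow> n = emp \<or> (\<exists>k. k \<epsilon> om \<and> n = sc k)"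
  using om_sc unfolding mem_om_iff isnat_def by (metis mem_sc)

lemma om_induct [consumes 2, case_names zero succ]:
  assumes "defp (\<lambda>s. P (s 0))" "n \<epsilon> om" "P emp" "\<And>n. n \<epsilon> om \<Longrightarrow> P n \<Longrightarrow> P (sc n)"
  shows "P n"
proof (rule ccontr)
  assume n: "\<not> P n"
  have d: "defp (\<lambda>s. s 0 \<epsilon> om \<and> \<not> P (s 0))" by (intro defs_intro assms)
  have "Ord n" using assms(2) by (simp add: mem_om_iff isnat_def)
  from Ord_least[OF d this] obtain m where "m \<epsilon> om" "\<not> P m" "\<And>c. c \<epsilon> m \<Longrightarrow> c \<epsilon> om \<Longrightarrow> P c"
    using assms(2) n by auto
  then show False using om_cases[of m] assms(3,4) by (metis mem_sc)
qed

lemma om_mem: "m \<epsilon> n \<Longrightarrow> n \<epsilon> om \<Longrightarrow> m \<epsilon> om"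
proof -
  assume m: "m \<epsilon> n" and n: "n \<epsilon> om"
  have d: "defp (\<lambda>s. \<forall>m. m \<epsilon> s 0 \<longrightarrow> m \<epsilon> om)" by (intro defs_intro)
  have "\<forall>m. m \<epsilon> n \<longrightarrow> m \<epsilon> om" by (rule om_induct[OF d n]) auto
  then show ?thesis using m by blast
qed

lemma Ord_om: "Ord om"
  unfolding Ord_def tr_def using om_mem mem_om_iff isnat_def Ord_trans by metis

text \<open>The finite approximations agree wherever two of them are defined, so their common value
  is a definable function of \<open>n\<close>, and Replacement makes it a set.\<close>

lemma omega_iteration:
  assumes g: "deft (\<lambda>s. g (s 0))"
  shows "\<exists>f. function_on f om \<and> app f emp = x \<and> (\<forall>n. n \<epsilon> om \<longrightarrow> app f (sc n) = g (app f n))"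
proof -
  define ap where "ap f n \<longleftrightarrow> function_on f (sc n) \<and> app f emp = x \<and>
    (\<forall>m. m \<epsilon> n \<longrightarrow> app f (sc m) = g (app f m))" for f n
  note dg = deft_app1[OF g]
  have dap: "defp (\<lambda>s. ap (t s) (u s))" if "deft t" "deft u" for t u
    by (rule defp_app2[where P = ap, OF _ that]) (unfold ap_def, intro defs_intro dg)
  have uniq: "app f m = app f' m"
    if "ap f n" "ap f' n'" "m \<epsilon> om" "m \<epsilon> sc n" "m \<epsilon> sc n'" "n \<epsilon> om" "n' \<epsilon> om" for f f' m n n'
  proof -
    have d: "defp (\<lambda>s. s 0 \<epsilon> sc n \<and> s 0 \<epsilon> sc n' \<longrightarrow> app f (s 0) = app f' (s 0))" by (intro defs_intro)
    have "m \<epsilon> sc n \<and> m \<epsilon> sc n' \<longrightarrow> app f m = app f' m"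
    proof (rule om_induct[OF d \<open>m \<epsilon> om\<close>])
      show "emp \<epsilon> sc n \<and> emp \<epsilon> sc n' \<longrightarrow> app f emp = app f' emp" using that by (simp add: ap_def)
    next
      fix m assume IH: "m \<epsilon> sc n \<and> m \<epsilon> sc n' \<longrightarrow> app f m = app f' m"
      show "sc m \<epsilon> sc n \<and> sc m \<epsilon> sc n' \<longrightarrow> app f (sc m) = app f' (sc m)"
      proof
        assume *: "sc m \<epsilon> sc n \<and> sc m \<epsilon> sc n'"
        have "Ord n" "Ord n'" using that(6,7) by (auto simp: mem_om_iff isnat_def)
        then have "m \<epsilon> n" "m \<epsilon> n'" using * Ord_trans[of n m "sc m"] Ord_trans[of n' m "sc m"]
          by (metis mem_sc)+
        then show "app f (sc m) = app f' (sc m)" using IH that(1,2) by (simp add: ap_def)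
      qed
    qed
    then show ?thesis using that by blast
  qed
  have ex: "\<exists>f. ap f n" if "n \<epsilon> om" for n
  proof -
    have d: "defp (\<lambda>s. \<exists>f. ap f (s 0))" by (intro defs_intro dap)
    show ?thesis
    proof (rule om_induct[OF d that])
      have d: "deft (\<lambda>s. x)" by (intro defs_intro)
      have "ap (lam (sc emp) (\<lambda>_. x)) emp"
        unfolding ap_def using function_on_lam[OF d] app_lam[OF d] by simp
      then show "\<exists>f. ap f emp" by blast
    next
      fix n assume n: "n \<epsilon> om" and "\<exists>f. ap f n"
      then obtain f where f: "ap f n" by blast
      define h where "h m = (if m = sc n then g (app f n) else app f m)" for m
      have d: "deft (\<lambda>s. h (s 0))" unfolding h_def by (intro defs_intro)
      have o: "Ord n" using n by (simp add: mem_om_iff isnat_def)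
      have 1: "m \<noteq> sc n" if "m \<epsilon> sc n" for m using that mem_irrefl by blast
      have "ap (lam (sc (sc n)) h) (sc n)"
        unfolding ap_def
      proof (intro conjI allI impI function_on_lam[OF d])
        have "emp \<epsilon> sc (sc n)" using Ord_linear[of emp "sc (sc n)"] o by (auto intro: Ord_sc)
        then show "app (lam (sc (sc n)) h) emp = x"
          using f by (simp add: app_lam[OF d] h_def ap_def)
        fix m assume m: "m \<epsilon> sc n"
        then have "sc m \<epsilon> sc (sc n)" using Ord_mem_sc[OF Ord_sc[OF o]] by auto
        moreover have "m \<epsilon> sc (sc n)" using m by simp
        moreover have "h (sc m) = g (h m)"
          using f m 1[OF m] mem_irrefl[of n] unfolding h_def ap_def by auto
        ultimately show "app (lam (sc (sc n)) h) (sc m) = g (app (lam (sc (sc n)) h) m)"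
          by (simp only: app_lam[OF d])
      qed
      then show "\<exists>f. ap f (sc n)" by blast
    qed
  qed
  define F where "F n = the1 (\<lambda>y. \<exists>f. ap f n \<and> y = app f n)" for n
  have F: "F m = app f m" if "ap f n" "n \<epsilon> om" "m \<epsilon> sc n" for f n m
  proof -
    have m: "m \<epsilon> om" using that om_mem[of m n] by auto
    obtain f' where f': "ap f' m" using ex m by blast
    have "app f'' m = app f m" if "ap f'' m" for f''
      using uniq[OF that \<open>ap f n\<close> m] that \<open>m \<epsilon> sc n\<close> m \<open>n \<epsilon> om\<close> by simp
    then show ?thesis unfolding F_def using f' by (intro the1_equality) auto
  qed
  have dF: "deft (\<lambda>s. F (s 0))" unfolding F_def by (intro defs_intro dap)
  have "app (lam om F) emp = x"
    using ex[of emp] F[of _ emp emp] by (auto simp: app_lam[OF dF] ap_def)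
  moreover have "app (lam om F) (sc n) = g (app (lam om F) n)" if n: "n \<epsilon> om" for n
  proof -
    obtain f where "ap f (sc n)" using ex[of "sc n"] n by auto
    then show ?thesis using F[of f "sc n"] n by (simp add: app_lam[OF dF] ap_def)
  qed
  ultimately show ?thesis using function_on_lam[OF dF] by blast
qed

section \<open>Well-founded recursion\<close>

lemma lam_cong:
  assumes "deft (\<lambda>s. f (s 0))" "deft (\<lambda>s. g (s 0))" "\<And>x. x \<epsilon> a \<Longrightarrow> f x = g x"
  shows "lam a f = lam a g"
  by (rule set_ext) (use assms in \<open>auto simp: mem_lam\<close>)

lemma Repl_cong:
  assumes "deft (\<lambda>s. f (s 0))" "deft (\<lambda>s. g (s 0))" "\<And>x. x \<epsilon> a \<Longrightarrow> f x = g x"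
  shows "Repl a f = Repl a g"
  by (rule set_ext) (use assms in \<open>auto simp: mem_Repl\<close>)

text \<open>The transitive closure of \<open>x\<close> for the relation
  \<open>z \<epsilon> p y\<close>, as the union of the iterates of
  \<open>a \<mapsto> \<Union>{p y. y \<in> a}\<close> that start with \<open>{x}\<close>.\<close>

lemma closure_exists:
  assumes p: "deft (\<lambda>s. p (s 0))"
  shows "\<exists>T. x \<epsilon> T \<and> (\<forall>y z. y \<epsilon> T \<longrightarrow> z \<epsilon> p y \<longrightarrow> z \<epsilon> T)"
proof -
  have "deft (\<lambda>s. Uni (Repl (s 0) p))" by (intro defs_intro deft_app1[OF p])
  from omega_iteration[OF this, of "sg x"] obtain f where
    f: "app f emp = sg x" "\<And>n. n \<epsilon> om \<Longrightarrow> app f (sc n) = Uni (Repl (app f n) p)" by blast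
  have d: "deft (\<lambda>s. app f (s 0))" by (intro defs_intro)
  define T where "T = Uni (Repl om (app f))"
  have T: "y \<epsilon> T \<longleftrightarrow> (\<exists>n. n \<epsilon> om \<and> y \<epsilon> app f n)" for y
    unfolding T_def using mem_Repl[OF d] by auto
  have "x \<epsilon> T" unfolding T using f(1) om_emp by (metis mem_sg)
  moreover have "z \<epsilon> T" if y: "y \<epsilon> T" and z: "z \<epsilon> p y" for y z
  proof -
    from y obtain n where n: "n \<epsilon> om" "y \<epsilon> app f n" unfolding T by blast
    then have "z \<epsilon> app f (sc n)" using f(2)[OF n(1)] z mem_Repl[OF p] by auto
    then show ?thesis unfolding T using n om_sc by blast
  qed
  ultimately show ?thesis by blast
qed

context
  fixes p
  assumes p: "deft (\<lambda>s. p (s 0))"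
    and wf: "\<And>z Z. z \<epsilon> Z \<Longrightarrow> \<exists>x. x \<epsilon> Z \<and> (\<forall>y. y \<epsilon> p x \<longrightarrow> \<not> y \<epsilon> Z)"
begin

text \<open>Well-foundedness is assumed for sets only. A counterexample to a class statement is
  brought into a set by the closure of \<open>x\<close> under \<open>p\<close>.\<close>

lemma wf_induct_def:
  assumes P: "defp (\<lambda>s. P (s 0))" and step: "\<And>x. (\<And>y. y \<epsilon> p x \<Longrightarrow> P y) \<Longrightarrow> P x"
  shows "P x"
proof (rule ccontr)
  assume x: "\<not> P x"
  obtain T where T: "x \<epsilon> T" "\<And>y z. y \<epsilon> T \<Longrightarrow> z \<epsilon> p y \<Longrightarrow> z \<epsilon> T"
    using closure_exists[OF p] by blast
  have S: "y \<epsilon> Sep T (\<lambda>y. \<not> P y) \<longleftrightarrow> y \<epsilon> T \<and> \<not> P y" for y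
    by (rule mem_Sep) (intro defs_intro P)
  then have "x \<epsilon> Sep T (\<lambda>y. \<not> P y)" using x T by blast
  from wf[OF this] obtain y where y: "y \<epsilon> T" "\<not> P y" "\<And>z. z \<epsilon> p y \<Longrightarrow> \<not> (z \<epsilon> T \<and> \<not> P z)"
    unfolding S by blast
  have "P y"
  proof (rule step)
    fix z assume "z \<epsilon> p y"
    then show "P z" using y(3)[of z] T(2)[OF y(1)] by blast
  qed
  then show False using y(2) by blast
qed

text \<open>As in \<open>omega_iteration\<close>, with approximations on sets closed under
  \<open>p\<close> in place of initial segments.\<close>

lemma wf_recursion:
  assumes H: "deft (\<lambda>s. H (s 0) (s 1))"
  shows "\<exists>F. deft (\<lambda>s. F (s 0)) \<and> (\<forall>x. F x = H x (lam (p x) F))"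
proof -
  note dp = deft_app1[OF p] and dH = deft_app2[OF H]
  define apx where "apx T f \<longleftrightarrow> (\<forall>y z. y \<epsilon> T \<longrightarrow> z \<epsilon> p y \<longrightarrow> z \<epsilon> T) \<and> function_on f T \<and>
    (\<forall>y. y \<epsilon> T \<longrightarrow> app f y = H y (lam (p y) (app f)))" for T f
  have dapx: "defp (\<lambda>s. apx (t s) (u s))" if "deft t" "deft u" for t u
    by (rule defp_app2[where P = apx, OF _ that]) (unfold apx_def, intro defs_intro dp dH)
  have dapp: "deft (\<lambda>s. app f (s 0))" for f by (intro defs_intro)
  have uniq: "app f y = app f' y" if a: "apx T f" "apx T' f'" "y \<epsilon> T" "y \<epsilon> T'" for T T' f f' y
  proof -
    have d: "defp (\<lambda>s. s 0 \<epsilon> T \<and> s 0 \<epsilon> T' \<longrightarrow> app f (s 0) = app f' (s 0))" by (intro defs_intro)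
    have "y \<epsilon> T \<and> y \<epsilon> T' \<longrightarrow> app f y = app f' y"
    proof (rule wf_induct_def[OF d], rule impI)
      fix x assume IH: "\<And>y. y \<epsilon> p x \<Longrightarrow> y \<epsilon> T \<and> y \<epsilon> T' \<longrightarrow> app f y = app f' y"
        and x: "x \<epsilon> T \<and> x \<epsilon> T'"
      have "lam (p x) (app f) = lam (p x) (app f')"
        by (rule lam_cong[OF dapp dapp]) (use IH x a(1,2) in \<open>auto simp: apx_def\<close>)
      then show "app f x = app f' x" using x a(1,2) by (auto simp: apx_def)
    qed
    then show ?thesis using a by blast
  qed
  define Q where "Q y \<longleftrightarrow> (\<exists>T f. apx T f \<and> y \<epsilon> T)" for y
  define V where "V y = the1 (\<lambda>v. \<exists>T f. apx T f \<and> y \<epsilon> T \<and> v = app f y)" for y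
  have dQ: "defp (\<lambda>s. Q (s 0))" unfolding Q_def by (intro defs_intro dapx)
  have dV: "deft (\<lambda>s. V (s 0))" unfolding V_def by (intro defs_intro dapx)
  note dV' = deft_app1[OF dV]
  have V: "V y = app f y" if a: "apx T f" "y \<epsilon> T" for T f y
    unfolding V_def
  proof (rule the1_equality)
    show "\<exists>T f'. apx T f' \<and> y \<epsilon> T \<and> app f y = app f' y" using a by blast
    show "z = app f y" if "\<exists>T f. apx T f \<and> y \<epsilon> T \<and> z = app f y" for z
      using that uniq[OF a(1) _ a(2)] by metis
  qed
  have V_rec: "V y = H y (lam (p y) V)" and Q_closed: "z \<epsilon> p y \<Longrightarrow> Q z" if y: "Q y" for y z
  proof -
    from y obtain T f where a: "apx T f" "y \<epsilon> T" unfolding Q_def by blast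
    have "lam (p y) (app f) = lam (p y) V"
      by (rule lam_cong[OF dapp dV]) (use V[OF a(1)] a in \<open>auto simp: apx_def\<close>)
    then show "V y = H y (lam (p y) V)" using V[OF a] a by (simp add: apx_def)
    show "Q z" if "z \<epsilon> p y" using that a unfolding Q_def by (auto simp: apx_def)
  qed
  have "Q x" for x
  proof (rule wf_induct_def[OF dQ])
    fix x assume IH: "\<And>y. y \<epsilon> p x \<Longrightarrow> Q y"
    obtain T0 where T0: "x \<epsilon> T0" "\<And>y z. y \<epsilon> T0 \<Longrightarrow> z \<epsilon> p y \<Longrightarrow> z \<epsilon> T0"
      using closure_exists[OF p] by blast
    \<comment> \<open>The part of the closure of \<open>x\<close> on which values exist already. By
      the induction hypothesis it contains \<open>p x\<close>, so that adding \<open>x\<close> gives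
      a domain closed under \<open>p\<close>.\<close>
    define W where "W = Sep T0 Q"
    have W: "y \<epsilon> W \<longleftrightarrow> y \<epsilon> T0 \<and> Q y" for y unfolding W_def by (rule mem_Sep[OF dQ])
    define T1 where "T1 = un W (sg x)"
    define h where "h u = H u (lam (p u) V)" for u
    have dh: "deft (\<lambda>s. h (s 0))" unfolding h_def by (intro defs_intro dp dH dV')
    have cl: "z \<epsilon> W" if "y \<epsilon> T1" "z \<epsilon> p y" for y z
      using that IH T0 Q_closed unfolding T1_def by (auto simp: W)
    have "apx T1 (lam T1 h)"
      unfolding apx_def
    proof (intro conjI allI impI function_on_lam[OF dh])
      show "z \<epsilon> T1" if "y \<epsilon> T1" "z \<epsilon> p y" for y z using cl[OF that] unfolding T1_def by simp
      fix y assume y: "y \<epsilon> T1"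
      have "V z = app (lam T1 h) z" if z: "z \<epsilon> p y" for z
      proof -
        have "z \<epsilon> T1" using cl[OF y z] unfolding T1_def by simp
        then show ?thesis using V_rec[of z] cl[OF y z] unfolding W by (simp add: app_lam[OF dh] h_def)
      qed
      then have "lam (p y) V = lam (p y) (app (lam T1 h))" by (rule lam_cong[OF dV dapp])
      then show "app (lam T1 h) y = H y (lam (p y) (app (lam T1 h)))"
        using y by (simp add: app_lam[OF dh]) (simp add: h_def)
    qed
    then show "Q x" unfolding Q_def by (intro exI[of _ T1] exI[of _ "lam T1 h"]) (simp add: T1_def)
  qed
  then show ?thesis using V_rec dV by blast
qed

end

lemma eps_induct:
  assumes "defp (\<lambda>s. P (s 0))" "\<And>x. (\<And>y. y \<epsilon> x \<Longrightarrow> P y) \<Longrightarrow> P x"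
  shows "P x"
proof (rule wf_induct_def[where p = "\<lambda>x. x"])
  show "deft (\<lambda>s. s 0)" by (intro defs_intro)
  show "\<exists>x. x \<epsilon> Z \<and> (\<forall>y. y \<epsilon> x \<longrightarrow> \<not> y \<epsilon> Z)" if "z \<epsilon> Z" for z Z
    using set_minimal[OF that] .
qed (fact assms)+

lemma eps_recursion:
  assumes "deft (\<lambda>s. H (s 0) (s 1))"
  shows "\<exists>F. deft (\<lambda>s. F (s 0)) \<and> (\<forall>x. F x = H x (lam x F))"
proof (rule wf_recursion[where p = "\<lambda>x. x"])
  show "deft (\<lambda>s. s 0)" by (intro defs_intro)
  show "\<exists>x. x \<epsilon> Z \<and> (\<forall>y. y \<epsilon> x \<longrightarrow> \<not> y \<epsilon> Z)" if "z \<epsilon> Z" for z Z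
    using set_minimal[OF that] .
qed (fact assms)

section \<open>The cumulative hierarchy and ranks\<close>

text \<open>The recursion runs over all sets, not just ordinals; by \<open>mem_Vs_rk\<close> the
  value depends on the rank only. \<open>SOME\<close> fixes a definable solution, which
  \<open>union_recursion\<close> provides.\<close>

definition Vs where
  "Vs = (SOME F. deft (\<lambda>s. F (s 0)) \<and> (\<forall>x. F x = Uni (Repl x (\<lambda>y. Pow (F y)))))"

definition rk where
  "rk = (SOME F. deft (\<lambda>s. F (s 0)) \<and> (\<forall>x. F x = Uni (Repl x (\<lambda>y. sc (F y)))))"

lemma union_recursion:
  assumes G: "deft (\<lambda>s. G (s 0))"
  shows "\<exists>F. deft (\<lambda>s. F (s 0)) \<and> (\<forall>x. F x = Uni (Repl x (\<lambda>y. G (F y))))"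
proof -
  note dG = deft_app1[OF G]
  have "deft (\<lambda>s. Uni (Repl (s 0) (\<lambda>y. G (app (s 1) y))))" by (intro defs_intro dG)
  from eps_recursion[OF this] obtain F where
    F: "deft (\<lambda>s. F (s 0))" "\<And>x. F x = Uni (Repl x (\<lambda>y. G (app (lam x F) y)))" by blast
  have "Repl x (\<lambda>y. G (app (lam x F) y)) = Repl x (\<lambda>y. G (F y))" for x
    by (rule Repl_cong) (auto simp: app_lam[OF F(1)] intro!: defs_intro dG deft_app1[OF F(1)])
  then show ?thesis using F by metis
qed

lemma Vs_props: "deft (\<lambda>s. Vs (s 0)) \<and> (\<forall>x. Vs x = Uni (Repl x (\<lambda>y. Pow (Vs y))))"
proof -
  have "deft (\<lambda>s. Pow (s 0))" by (intro defs_intro)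
  from someI_ex[OF union_recursion[OF this]] show ?thesis unfolding Vs_def .
qed

lemma rk_props: "deft (\<lambda>s. rk (s 0)) \<and> (\<forall>x. rk x = Uni (Repl x (\<lambda>y. sc (rk y))))"
proof -
  have "deft (\<lambda>s. sc (s 0))" by (intro defs_intro)
  from someI_ex[OF union_recursion[OF this]] show ?thesis unfolding rk_def .
qed

lemma deft_Vs [defs_intro]: "deft t \<Longrightarrow> deft (\<lambda>s. Vs (t s))"
  using Vs_props deft_app1 by blast

lemma deft_rk [defs_intro]: "deft t \<Longrightarrow> deft (\<lambda>s. rk (t s))"
  using rk_props deft_app1 by blast

lemma mem_Vs: "x \<epsilon> Vs a \<longleftrightarrow> (\<exists>b. b \<epsilon> a \<and> subset_of x (Vs b))"
proof -
  have d: "deft (\<lambda>s. Pow (Vs (s 0)))" by (intro defs_intro)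
  have "x \<epsilon> Uni (Repl a (\<lambda>y. Pow (Vs y))) \<longleftrightarrow> (\<exists>b. b \<epsilon> a \<and> subset_of x (Vs b))"
    by (auto simp: mem_Repl[OF d])
  then show ?thesis using Vs_props by metis
qed

lemma mem_rk: "x \<epsilon> rk a \<longleftrightarrow> (\<exists>b. b \<epsilon> a \<and> x \<epsilon> sc (rk b))"
proof -
  have d: "deft (\<lambda>s. sc (rk (s 0)))" by (intro defs_intro)
  have "x \<epsilon> Uni (Repl a (\<lambda>y. sc (rk y))) \<longleftrightarrow> (\<exists>b. b \<epsilon> a \<and> x \<epsilon> sc (rk b))"
    by (auto simp: mem_Repl[OF d])
  then show ?thesis using rk_props by metis
qed

lemma Ord_rk [simp]: "Ord (rk a)"
proof -
  have d: "defp (\<lambda>s. Ord (rk (s 0)))" by (intro defs_intro)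
  show ?thesis
  proof (rule eps_induct[OF d])
    fix x assume IH: "\<And>y. y \<epsilon> x \<Longrightarrow> Ord (rk y)"
    have d: "deft (\<lambda>s. sc (rk (s 0)))" by (intro defs_intro)
    have "Ord (Uni (Repl x (\<lambda>y. sc (rk y))))"
      by (rule Ord_Uni) (use IH in \<open>auto simp: mem_Repl[OF d] intro: Ord_sc\<close>)
    then show "Ord (rk x)" using rk_props by metis
  qed
qed

lemma rk_mem: "b \<epsilon> a \<Longrightarrow> rk b \<epsilon> rk a"
  using mem_rk[of "rk b" a] by auto

lemma rk_le: "Ord c \<Longrightarrow> subset_of (rk a) c \<longleftrightarrow> (\<forall>b. b \<epsilon> a \<longrightarrow> rk b \<epsilon> c)"
proof
  assume c: "Ord c" and *: "\<forall>b. b \<epsilon> a \<longrightarrow> rk b \<epsilon> c"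
  have "x \<epsilon> c" if "x \<epsilon> rk a" for x
  proof -
    obtain b where b: "b \<epsilon> a" "x \<epsilon> sc (rk b)" using \<open>x \<epsilon> rk a\<close> mem_rk by blast
    then show ?thesis using * Ord_trans[OF c, of x "rk b"] by auto
  qed
  then show "subset_of (rk a) c" by (simp add: subset_of_def)
qed (auto simp: subset_of_def rk_mem)

lemma rk_Ord: "Ord a \<Longrightarrow> rk a = a"
proof -
  assume a: "Ord a"
  have d: "defp (\<lambda>s. rk (s 0) = s 0)" by (intro defs_intro)
  show ?thesis
  proof (rule Ord_induct[OF d a])
    fix a assume a: "Ord a" and IH: "\<forall>b. b \<epsilon> a \<longrightarrow> rk b = b"
    show "rk a = a"
    proof (rule set_ext)
      fix x
      show "x \<epsilon> rk a \<longleftrightarrow> x \<epsilon> a"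
        unfolding mem_rk using IH Ord_trans[OF a] by (metis mem_sc)
    qed
  qed
qed

lemma mem_Vs_rk: "x \<epsilon> Vs a \<longleftrightarrow> rk x \<epsilon> rk a"
proof -
  have d: "defp (\<lambda>s. \<forall>x. x \<epsilon> Vs (s 0) \<longleftrightarrow> rk x \<epsilon> rk (s 0))" by (intro defs_intro)
  have "\<forall>x. x \<epsilon> Vs a \<longleftrightarrow> rk x \<epsilon> rk a"
  proof (rule eps_induct[OF d], rule allI)
    fix a x assume IH: "\<And>b. b \<epsilon> a \<Longrightarrow> \<forall>x. x \<epsilon> Vs b \<longleftrightarrow> rk x \<epsilon> rk b"
    have "subset_of x (Vs b) \<longleftrightarrow> rk x \<epsilon> sc (rk b)" if b: "b \<epsilon> a" for b
    proof -
      have "subset_of x (Vs b) \<longleftrightarrow> subset_of (rk x) (rk b)"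
        unfolding rk_le[OF Ord_rk] using IH[OF b] by (auto simp: subset_of_def)
      then show ?thesis using Ord_subset[of "rk x" "rk b"] by simp
    qed
    then show "x \<epsilon> Vs a \<longleftrightarrow> rk x \<epsilon> rk a" unfolding mem_Vs mem_rk[of "rk x"] by blast
  qed
  then show ?thesis by blast
qed

lemma mem_Vs_Ord: "Ord a \<Longrightarrow> x \<epsilon> Vs a \<longleftrightarrow> rk x \<epsilon> a"
  by (simp add: mem_Vs_rk rk_Ord)

lemma Vs_tr: "y \<epsilon> x \<Longrightarrow> x \<epsilon> Vs a \<Longrightarrow> y \<epsilon> Vs a"
  unfolding mem_Vs_rk using Ord_trans[OF Ord_rk] rk_mem by blast

lemma Vs_sub: "subset_of y x \<Longrightarrow> x \<epsilon> Vs a \<Longrightarrow> y \<epsilon> Vs a"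
  unfolding mem_Vs[of x] mem_Vs[of y] subset_of_def by blast

lemma Vs_emp [simp]: "Vs emp = emp"
  by (rule set_ext) (simp add: mem_Vs_Ord)

lemma Vs_mono: "Ord b \<Longrightarrow> a \<epsilon> b \<Longrightarrow> x \<epsilon> Vs a \<Longrightarrow> x \<epsilon> Vs b"
  using mem_Vs_Ord[of a] mem_Vs_Ord[of b] Ord_mem Ord_trans by blast

lemma in_some_Vs: "x \<epsilon> Vs (sc (rk x))"
  by (simp add: mem_Vs_Ord Ord_sc)

lemma Vs_sc: "Ord a \<Longrightarrow> Vs (sc a) = Pow (Vs a)"
proof (rule set_ext)
  fix x assume a: "Ord a"
  show "x \<epsilon> Vs (sc a) \<longleftrightarrow> x \<epsilon> Pow (Vs a)"
    using Vs_mono[OF a] unfolding mem_Vs[of x] by (auto simp: subset_of_def)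
qed

lemma Vs_mem_Vs: "Ord a \<Longrightarrow> b \<epsilon> a \<Longrightarrow> Vs b \<epsilon> Vs a"
  unfolding mem_Vs[of "Vs b"] by (auto simp: subset_of_def)

lemma Ord_in_Vs: "Ord a \<Longrightarrow> Ord b \<Longrightarrow> b \<epsilon> Vs a \<longleftrightarrow> b \<epsilon> a"
  by (simp add: mem_Vs_Ord rk_Ord)

definition lim where "lim l \<longleftrightarrow> Ord l \<and> l \<noteq> emp \<and> (\<forall>x. x \<epsilon> l \<longrightarrow> sc x \<epsilon> l)"

lemma defp_lim [defs_intro]: "deft t \<Longrightarrow> defp (\<lambda>s. lim (t s))"
  by (rule defp_app1[where P = lim]) (unfold lim_def, intro defs_intro)

lemma lim_Ord: "lim l \<Longrightarrow> Ord l"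
  by (simp add: lim_def)

lemma lim_emp: "lim l \<Longrightarrow> emp \<epsilon> l"
  unfolding lim_def using Ord_linear[of emp l] by auto

lemma Vs_lim_up: assumes "lim l" "x \<epsilon> Vs l" "y \<epsilon> Vs l" shows "up x y \<epsilon> Vs l"
proof -
  have l: "Ord l" using assms by (simp add: lim_def)
  have "\<exists>b. b \<epsilon> l \<and> rk x \<epsilon> b \<and> rk y \<epsilon> b"
  proof -
    have "rk x \<epsilon> l" "rk y \<epsilon> l" using assms l by (auto simp: mem_Vs_Ord)
    then have "sc (rk x) \<epsilon> l" "sc (rk y) \<epsilon> l" using assms(1) by (auto simp: lim_def)
    moreover have "rk x \<epsilon> sc (rk y) \<or> rk y \<epsilon> sc (rk x)" using Ord_linear[of "rk x" "rk y"] by auto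
    ultimately show ?thesis by (meson mem_sc)
  qed
  then obtain b where b: "b \<epsilon> l" "rk x \<epsilon> b" "rk y \<epsilon> b" by blast
  have "Ord b" using b l Ord_mem by blast
  then have "subset_of (up x y) (Vs b)" using b by (auto simp: subset_of_def mem_Vs_Ord)
  then show ?thesis using b(1) mem_Vs[of "up x y" l] by blast
qed

lemma Vs_lim_pr: "lim l \<Longrightarrow> pr x y \<epsilon> Vs l \<longleftrightarrow> x \<epsilon> Vs l \<and> y \<epsilon> Vs l"
proof
  assume l: "lim l" and p: "pr x y \<epsilon> Vs l"
  have "up x y \<epsilon> pr x y" by (simp add: pr_def)
  then have "up x y \<epsilon> Vs l" using p Vs_tr by blast
  then show "x \<epsilon> Vs l \<and> y \<epsilon> Vs l" using Vs_tr[of _ "up x y"] by simp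
qed (auto simp: pr_def sg_def intro: Vs_lim_up)

lemma Vs_lim_sg: "lim l \<Longrightarrow> sg x \<epsilon> Vs l \<longleftrightarrow> x \<epsilon> Vs l"
  unfolding sg_def using Vs_lim_up Vs_tr[of x "up x x"] by auto

lemma emp_in_Vs: "lim l \<Longrightarrow> emp \<epsilon> Vs l"
  by (simp add: mem_Vs_Ord lim_Ord rk_Ord lim_emp)

lemma Vs_lim_Pow: "lim l \<Longrightarrow> x \<epsilon> Vs l \<Longrightarrow> Pow x \<epsilon> Vs l"
proof -
  assume l: "lim l" and x: "x \<epsilon> Vs l"
  then obtain b where b: "b \<epsilon> l" "subset_of x (Vs b)" by (auto simp: mem_Vs[of x])
  have "Ord b" "sc b \<epsilon> l" using b l Ord_mem by (auto simp: lim_def)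
  then have "subset_of (Pow x) (Vs (sc b))" using b by (auto simp: subset_of_def Vs_sc)
  then show ?thesis using \<open>sc b \<epsilon> l\<close> mem_Vs[of "Pow x" l] by blast
qed

lemma lim_above: "\<exists>l. lim l \<and> a \<epsilon> Vs l"
proof -
  have "deft (\<lambda>s. sc (s 0))" by (intro defs_intro)
  from omega_iteration[OF this, of "sc (rk a)"] obtain f where
    f: "app f emp = sc (rk a)" "\<And>n. n \<epsilon> om \<Longrightarrow> app f (sc n) = sc (app f n)" by blast
  have d: "deft (\<lambda>s. app f (s 0))" by (intro defs_intro)
  have o: "Ord (app f n)" if n: "n \<epsilon> om" for n
  proof -
    have d: "defp (\<lambda>s. Ord (app f (s 0)))" by (intro defs_intro)
    show ?thesis by (rule om_induct[OF d n]) (auto simp: f intro: Ord_sc)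
  qed
  define l where "l = Uni (Repl om (app f))"
  have l: "x \<epsilon> l \<longleftrightarrow> (\<exists>n. n \<epsilon> om \<and> x \<epsilon> app f n)" for x
    unfolding l_def by (auto simp: mem_Repl[OF d])
  have Ol: "Ord l" unfolding l_def by (rule Ord_Uni) (auto simp: mem_Repl[OF d] o)
  have r: "rk a \<epsilon> l" unfolding l using f(1) om_emp by (metis mem_sc)
  have "sc x \<epsilon> l" if x: "x \<epsilon> l" for x
  proof -
    obtain n where n: "n \<epsilon> om" "x \<epsilon> app f n" using x l by blast
    then have "sc x \<epsilon> app f (sc n)" using Ord_mem_sc[OF o[OF n(1)] n(2)] f(2) by auto
    then show ?thesis unfolding l using n(1) by (intro exI[of _ "sc n"]) simp
  qed
  moreover have "l \<noteq> emp" using r by auto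
  ultimately have "lim l" using Ol by (simp add: lim_def)
  then show ?thesis using r Ol mem_Vs_Ord by blast
qed

lemma V_level_iff: "Ord a \<Longrightarrow> V_level a v \<longleftrightarrow> v = Vs a"
proof -
  assume a: "Ord a"
  have 1: "app f b = Vs b" if h: "cumulative_hierarchy d f" and d: "Ord d" and b: "b \<epsilon> d" for d f b
  proof -
    have f: "function_on f d" using h by (simp add: cumulative_hierarchy_def)
    have h': "(c = emp \<longrightarrow> app f c = emp) \<and> (\<forall>g. c = sc g \<and> g \<epsilon> d \<longrightarrow> app f c = Pow (app f g)) \<and>
       (c \<noteq> emp \<and> \<not> (\<exists>g. c = sc g) \<longrightarrow> (\<forall>x. x \<epsilon> app f c \<longleftrightarrow> (\<exists>g. g \<epsilon> c \<and> g \<epsilon> d \<and> x \<epsilon> app f g)))"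
      if c: "c \<epsilon> d" for c
    proof -
      have "related f c (app f c)" using pr_app[OF f c] by simp
      then show ?thesis using h unfolding cumulative_hierarchy_def
        by (auto simp: function_on_pr[OF f])
    qed
    have dd: "defp (\<lambda>s. s 0 \<epsilon> d \<longrightarrow> app f (s 0) = Vs (s 0))" by (intro defs_intro)
    have "b \<epsilon> d \<longrightarrow> app f b = Vs b"
    proof (rule Ord_induct[OF dd Ord_mem[OF d b]], rule impI)
      fix c assume c: "Ord c" "c \<epsilon> d" and IH: "\<forall>b. b \<epsilon> c \<longrightarrow> b \<epsilon> d \<longrightarrow> app f b = Vs b"
      have cd: "g \<epsilon> d" if "g \<epsilon> c" for g using Ord_trans[OF d that c(2)] .
      consider "c = emp" | g where "c = sc g" | "c \<noteq> emp" "\<not> (\<exists>g. c = sc g)" by blast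
      then show "app f c = Vs c"
      proof cases
        case 1
        then show ?thesis using h'[OF c(2)] by simp
      next
        case (2 g)
        then have "app f c = Pow (Vs g)" using h'[OF c(2)] cd IH by auto
        then show ?thesis using 2 Vs_sc[of g] Ord_mem[OF c(1), of g] by simp
      next
        case 3
        show ?thesis
        proof (rule set_ext)
          fix x
          have "x \<epsilon> app f c \<longleftrightarrow> (\<exists>g. g \<epsilon> c \<and> x \<epsilon> Vs g)" using h'[OF c(2)] 3 cd IH by auto
          also have "\<dots> \<longleftrightarrow> (\<exists>g. g \<epsilon> c \<and> rk x \<epsilon> g)" using mem_Vs_Ord Ord_mem[OF c(1)] by blast
          also have "\<dots> \<longleftrightarrow> rk x \<epsilon> c"
            using Ord_mem_sc[OF c(1), of "rk x"] 3 Ord_trans[OF c(1)] by (metis mem_sc)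
          finally show "x \<epsilon> app f c \<longleftrightarrow> x \<epsilon> Vs c" by (simp add: mem_Vs_Ord c(1))
        qed
      qed
    qed
    then show ?thesis using b by blast
  qed
  have dV: "deft (\<lambda>s. Vs (s 0))" by (intro defs_intro)
  have 2: "cumulative_hierarchy (sc a) (lam (sc a) Vs)"
    unfolding cumulative_hierarchy_def
  proof (intro conjI allI impI function_on_lam[OF dV])
    fix b v assume "related (lam (sc a) Vs) b v"
    then have b: "b \<epsilon> sc a" "v = Vs b" by (auto simp: mem_lam[OF dV])
    have ob: "Ord b" using Ord_mem[OF Ord_sc[OF a] b(1)] .
    show "empty_set v" if "empty_set b" using that b by simp
    show "powerset w v" if "succ g b \<and> related (lam (sc a) Vs) g w" for g w
      using that b Vs_sc[of g] Ord_mem[OF ob, of g] by (auto simp: mem_lam[OF dV])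
    fix x assume 3: "\<not> empty_set b \<and> \<not> (\<exists>g. succ g b)"
    have "x \<epsilon> v \<longleftrightarrow> rk x \<epsilon> b" using b ob by (simp add: mem_Vs_Ord)
    also have "\<dots> \<longleftrightarrow> (\<exists>g. g \<epsilon> b \<and> rk x \<epsilon> g)"
      using Ord_mem_sc[OF ob, of "rk x"] 3 Ord_trans[OF ob] by (metis mem_sc succ_iff)
    also have "\<dots> \<longleftrightarrow> (\<exists>g. g \<epsilon> b \<and> x \<epsilon> Vs g)" using mem_Vs_Ord Ord_mem[OF ob] by blast
    also have "\<dots> \<longleftrightarrow> (\<exists>g w. g \<epsilon> b \<and> related (lam (sc a) Vs) g w \<and> x \<epsilon> w)"
      using Ord_trans[OF Ord_sc[OF a] _ b(1)] by (auto simp: mem_lam[OF dV])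
    finally show "x \<epsilon> v \<longleftrightarrow> (\<exists>g w. g \<epsilon> b \<and> related (lam (sc a) Vs) g w \<and> x \<epsilon> w)" .
  qed
  have *: "V_level a v \<longleftrightarrow> (\<exists>f. cumulative_hierarchy (sc a) f \<and> related f a v)"
    unfolding V_level_def by simp
  have 3: "related f a v \<longleftrightarrow> v = Vs a" if h: "cumulative_hierarchy (sc a) f" for f
  proof -
    have "function_on f (sc a)" using h by (simp add: cumulative_hierarchy_def)
    then show ?thesis using 1[OF h Ord_sc[OF a], of a] by (simp add: function_on_pr)
  qed
  show ?thesis unfolding * using 2 3 by blast
qed

section \<open>Choice and cardinals\<close>

lemma choice_function: "\<exists>c. \<forall>x. x \<epsilon> a \<longrightarrow> x \<noteq> emp \<longrightarrow> app c x \<epsilon> x"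
proof -
  have *: "x \<epsilon> Sep a (\<lambda>x. x \<noteq> emp) \<longleftrightarrow> x \<epsilon> a \<and> x \<noteq> emp" for x by (rule mem_Sep) (intro defs_intro)
  then have "\<forall>x. x \<epsilon> Sep a (\<lambda>x. x \<noteq> emp) \<longrightarrow> \<not> empty_set x" by simp
  then obtain c where c: "function_on c (Sep a (\<lambda>x. x \<noteq> emp))" "\<forall>x y. related c x y \<longrightarrow> y \<epsilon> x"
    using choice by blast
  have "app c x \<epsilon> x" if "x \<epsilon> a" "x \<noteq> emp" for x
    using pr_app[OF c(1), of x] c(2) * that by auto
  then show ?thesis by blast
qed

text \<open>Scott's trick: the witnesses of least rank form a set \<open>S x\<close>, from which a
  choice function for sets can pick.\<close>

lemma choice_predicate:
  assumes "defp (\<lambda>s. P (s 0) (s 1))"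
  shows "\<exists>f. function_on f a \<and> (\<forall>x. x \<epsilon> a \<longrightarrow> (\<exists>z. P x z) \<longrightarrow> P x (app f x))"
proof -
  note dP = defp_app2[OF assms]
  define W where "W x b \<longleftrightarrow> Ord b \<and> (\<exists>z. z \<epsilon> Vs b \<and> P x z)" for x b
  have dW: "defp (\<lambda>s. W (t s) (u s))" if "deft t" "deft u" for t u
    by (rule defp_app2[where P = W, OF _ that]) (unfold W_def, intro defs_intro dP)
  define S where "S x = Sep (Vs (the1 (\<lambda>b. W x b \<and> (\<forall>c. c \<epsilon> b \<longrightarrow> \<not> W x c)))) (P x)" for x
  have dS: "deft (\<lambda>s. S (s 0))" unfolding S_def by (intro defs_intro dW dP)
  have S: "z \<epsilon> S x \<Longrightarrow> P x z" for x z
    unfolding S_def by (subst (asm) mem_Sep) (auto intro!: dP defs_intro)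
  have S_ne: "S x \<noteq> emp" if z: "P x z" for x z
  proof -
    have "W x (sc (rk z))" unfolding W_def using z in_some_Vs by (auto intro: Ord_sc)
    then obtain b where b: "Ord b" "W x b" "\<And>c. c \<epsilon> b \<Longrightarrow> \<not> W x c"
      using Ord_least[of "W x" "sc (rk z)"] dW[OF deft_const deft_var] Ord_sc by auto
    have "the1 (\<lambda>b. W x b \<and> (\<forall>c. c \<epsilon> b \<longrightarrow> \<not> W x c)) = b"
    proof (rule the1_equality)
      fix c assume c: "W x c \<and> (\<forall>d. d \<epsilon> c \<longrightarrow> \<not> W x d)"
      then have "Ord c" by (simp add: W_def)
      then show "c = b" using Ord_linear[of b c] b c by blast
    qed (use b in blast)
    moreover obtain z where "z \<epsilon> Vs b" "P x z" using b(2) by (auto simp: W_def)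
    ultimately have "z \<epsilon> S x" unfolding S_def by (subst mem_Sep) (auto intro!: dP defs_intro)
    then show ?thesis by auto
  qed
  obtain c where c: "\<And>x. x \<epsilon> Repl a S \<Longrightarrow> x \<noteq> emp \<Longrightarrow> app c x \<epsilon> x" using choice_function by blast
  have d: "deft (\<lambda>s. app c (S (s 0)))" by (intro defs_intro dS)
  have "P x (app (lam a (\<lambda>x. app c (S x))) x)" if x: "x \<epsilon> a" and z: "P x z" for x z
  proof -
    have "S x \<epsilon> Repl a S" using x mem_Repl[OF dS] by blast
    then show ?thesis using c S_ne[OF z] S x by (simp add: app_lam[OF d])
  qed
  then show ?thesis using function_on_lam[OF d] by blast
qed

lemma bijection_iff: "bijection f a b \<longleftrightarrow> maps f a b \<and>
    (\<forall>x x'. x \<epsilon> a \<longrightarrow> x' \<epsilon> a \<longrightarrow> app f x = app f x' \<longrightarrow> x = x') \<and>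
    (\<forall>y. y \<epsilon> b \<longrightarrow> (\<exists>x. x \<epsilon> a \<and> app f x = y))"
proof (cases "maps f a b")
  case True
  then have f: "function_on f a" by (simp add: maps_iff)
  show ?thesis unfolding bijection_def using True by (auto simp: function_on_pr[OF f])
qed (simp add: bijection_def)

lemma defp_bijection [defs_intro]: "deft t \<Longrightarrow> deft u \<Longrightarrow> deft v \<Longrightarrow> defp (\<lambda>s. bijection (t s) (u s) (v s))"
  by (rule defp_app3[where P = bijection]) (unfold bijection_def, intro defs_intro)

lemma bijection_comp:
  assumes "bijection f a b" "bijection g b c"
  shows "bijection (lam a (\<lambda>x. app g (app f x))) a c"
proof -
  have d: "deft (\<lambda>s. app g (app f (s 0)))" by (intro defs_intro)
  show ?thesis using assms unfolding bijection_iff maps_iff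
    by (simp add: app_lam[OF d] function_on_lam[OF d] cong: conj_cong) metis
qed

text \<open>Zermelo's argument: \<open>G a f\<close> is what the values of \<open>f\<close> on
  \<open>a\<close> leave of \<open>D\<close>. If the enumeration never exhausted \<open>D\<close>,
  its inverse \<open>I\<close> would have all ordinals among its values on \<open>D\<close>.\<close>

lemma well_ordering: "\<exists>\<theta> f. Ord \<theta> \<and> bijection f \<theta> D"
proof -
  obtain c where c: "\<And>x. x \<epsilon> Pow D \<Longrightarrow> x \<noteq> emp \<Longrightarrow> app c x \<epsilon> x" using choice_function by blast
  define G where "G a f = Sep D (\<lambda>d. \<not> (\<exists>b. b \<epsilon> a \<and> d = app f b))" for a f
  have dG: "deft (\<lambda>s. G (t s) (u s))" if "deft t" "deft u" for t u
    by (rule deft_app2[where f = G, OF _ that]) (unfold G_def, intro defs_intro)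
  have "deft (\<lambda>s. app c (G (s 0) (s 1)))" by (intro defs_intro dG)
  from eps_recursion[OF this] obtain F where
    F: "deft (\<lambda>s. F (s 0))" "\<And>x. F x = app c (G x (lam x F))" by blast
  have G: "d \<epsilon> G a (lam a F) \<longleftrightarrow> d \<epsilon> D \<and> \<not> (\<exists>b. b \<epsilon> a \<and> d = F b)" for d a
  proof -
    have "d \<epsilon> G a (lam a F) \<longleftrightarrow> d \<epsilon> D \<and> \<not> (\<exists>b. b \<epsilon> a \<and> d = app (lam a F) b)"
      unfolding G_def by (rule mem_Sep) (intro defs_intro)
    then show ?thesis by (simp add: app_lam[OF F(1)] cong: conj_cong)
  qed
  have FG: "F a \<epsilon> D \<and> \<not> (\<exists>b. b \<epsilon> a \<and> F a = F b)" if "G a (lam a F) \<noteq> emp" for a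
  proof -
    have "subset_of (G a (lam a F)) D" by (simp add: subset_of_def G)
    then have "F a \<epsilon> G a (lam a F)" using c[of "G a (lam a F)"] F(2) that by simp
    then show ?thesis by (simp add: G)
  qed
  have "\<exists>a. Ord a \<and> G a (lam a F) = emp"
  proof (rule ccontr)
    assume "\<not> ?thesis"
    then have inj: "F a \<epsilon> D \<and> \<not> (\<exists>b. b \<epsilon> a \<and> F a = F b)" if "Ord a" for a using FG that by blast
    define I where "I d = the1 (\<lambda>a. Ord a \<and> F a = d)" for d
    have dI: "deft (\<lambda>s. I (s 0))" unfolding I_def by (intro defs_intro deft_app1[OF F(1)])
    have "I (F a) = a" if a: "Ord a" for a
      unfolding I_def
    proof (rule the1_equality)
      fix b assume b: "Ord b \<and> F b = F a"
      then show "b = a" using Ord_linear[of a b] inj[of a] inj[of b] a by metis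
    qed (use a in simp)
    then have "a \<epsilon> Repl D I" if "Ord a" for a using that inj mem_Repl[OF dI] by metis
    then show False using no_set_of_ordinals by blast
  qed
  then obtain a where a: "Ord a" "G a (lam a F) = emp" by blast
  have "defp (\<lambda>s. G (s 0) (lam (s 0) F) = emp)" by (intro defs_intro dG deft_app1[OF F(1)])
  from Ord_least[OF this a] obtain \<theta> where \<theta>: "Ord \<theta>" "G \<theta> (lam \<theta> F) = emp"
    "\<And>b. b \<epsilon> \<theta> \<Longrightarrow> G b (lam b F) \<noteq> emp" by blast
  have 1: "F b \<epsilon> D \<and> \<not> (\<exists>c. c \<epsilon> b \<and> F b = F c)" if "b \<epsilon> \<theta>" for b using FG \<theta>(3) that by blast
  have "bijection (lam \<theta> F) \<theta> D"
    unfolding bijection_iff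
  proof (intro conjI allI impI maps_lam[OF F(1)])
    show "F x \<epsilon> D" if "x \<epsilon> \<theta>" for x using 1 that by blast
    show "x = x'" if "x \<epsilon> \<theta>" "x' \<epsilon> \<theta>" "app (lam \<theta> F) x = app (lam \<theta> F) x'" for x x'
      using that 1[of x] 1[of x'] Ord_linear[of x x'] Ord_mem[OF \<theta>(1)] by (simp add: app_lam[OF F(1)]) metis
    show "\<exists>x. x \<epsilon> \<theta> \<and> app (lam \<theta> F) x = y" if y: "y \<epsilon> D" for y
    proof -
      have "\<not> y \<epsilon> G \<theta> (lam \<theta> F)" using \<theta>(2) by simp
      then obtain b where "b \<epsilon> \<theta>" "y = F b" using y G by blast
      then show ?thesis using app_lam[OF F(1)] by metis
    qed
  qed
  then show ?thesis using \<theta>(1) by blast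
qed

text \<open>The cardinality of the power set of \<open>b\<close>. If it were at most
  \<open>b\<close>, Cantor's diagonal set \<open>A\<close> would be missing from the
  enumeration.\<close>

lemma cardinal_above: assumes b: "Ord b" shows "\<exists>\<theta>. cardinal \<theta> \<and> b \<epsilon> \<theta>"
proof -
  have d: "defp (\<lambda>s. \<exists>f. bijection f (s 0) (Pow b))" by (intro defs_intro)
  obtain a where "Ord a" "\<exists>f. bijection f a (Pow b)" using well_ordering by blast
  from Ord_least[OF d this] obtain \<theta> where \<theta>: "Ord \<theta>" "\<exists>f. bijection f \<theta> (Pow b)"
    "\<And>c f. c \<epsilon> \<theta> \<Longrightarrow> \<not> bijection f c (Pow b)" by blast
  obtain f where f: "bijection f \<theta> (Pow b)" using \<theta>(2) by blast
  have "\<not> bijection g c \<theta>" if "c \<epsilon> \<theta>" for g c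
    using bijection_comp[OF _ f] \<theta>(3)[OF that] by blast
  then have "cardinal \<theta>" using \<theta>(1) by (auto simp: cardinal_def)
  moreover have "b \<epsilon> \<theta>"
  proof (rule ccontr)
    assume "\<not> b \<epsilon> \<theta>"
    then have "\<theta> \<epsilon> b \<or> \<theta> = b" using Ord_linear[OF b \<theta>(1)] by blast
    then have sub: "x \<epsilon> b" if "x \<epsilon> \<theta>" for x using that Ord_trans[OF b] by blast
    define A where "A = Sep b (\<lambda>x. \<not> x \<epsilon> app f x)"
    have A: "x \<epsilon> A \<longleftrightarrow> x \<epsilon> b \<and> \<not> x \<epsilon> app f x" for x
      unfolding A_def by (rule mem_Sep) (intro defs_intro)
    have "A \<epsilon> Pow b" by (simp add: subset_of_def A)
    then obtain x where "x \<epsilon> \<theta>" "app f x = A" using f unfolding bijection_iff by blast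
    then show False using A[of x] sub by blast
  qed
  ultimately show ?thesis by blast
qed

end

named_theorems def0_intro

section \<open>Bounded formulas and the Levy classes\<close>

text \<open>A bounded conjunct moves inside the quantifier prefix, so it does not raise the level.
  The renaming \<open>r\<close> lets the two formulas speak about different variables, as is needed
  for the range of a class function.\<close>

lemma levy_conj:
  shows "levy_Sigma n \<phi> \<Longrightarrow> Delta0 \<delta> \<Longrightarrow>
      \<exists>\<psi>. levy_Sigma n \<psi> \<and> (\<forall>s. sat E UNIV \<psi> s \<longleftrightarrow> sat E UNIV \<delta> s \<and> sat E UNIV \<phi> (\<lambda>i. s (r i)))"
    and "levy_Pi n \<phi> \<Longrightarrow> Delta0 \<delta> \<Longrightarrow>
      \<exists>\<psi>. levy_Pi n \<psi> \<and> (\<forall>s. sat E UNIV \<psi> s \<longleftrightarrow> sat E UNIV \<delta> s \<and> sat E UNIV \<phi> (\<lambda>i. s (r i)))"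
proof (induction arbitrary: r and r rule: levy_Sigma_levy_Pi.inducts)
  case (1 \<phi>)
  then show ?case
    by (intro exI[of _ "And \<delta> (sub \<phi> r)"]) (auto simp: sat_sub intro: levy_Sigma_levy_Pi.intros Delta0.intros Delta0_sub)
next
  case (2 \<phi>)
  then show ?case
    by (intro exI[of _ "And \<delta> (sub \<phi> r)"]) (auto simp: sat_sub intro: levy_Sigma_levy_Pi.intros Delta0.intros Delta0_sub)
next
  case (3 n \<phi>)
  then show ?case using levy_Sigma_levy_Pi.intros(3) by metis
next
  case (5 n \<phi>)
  then show ?case using levy_Sigma_levy_Pi.intros(5) by metis
next
  case (4 n \<phi> m)
  define m' where "m' = Suc (Max (insert 0 (fv \<delta> \<union> r ` fv \<phi>)))"
  have fr: "i < m'" if "i \<in> fv \<delta> \<or> i \<in> r ` fv \<phi>" for i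
    using that by (auto simp: m'_def finite_fv less_Suc_eq_le)
  obtain \<psi> where \<psi>: "levy_Sigma (Suc n) \<psi>"
    "\<And>s. sat E UNIV \<psi> s \<longleftrightarrow> sat E UNIV \<delta> s \<and> sat E UNIV \<phi> (\<lambda>i. s ((r(m := m')) i))"
    using 4 by blast
  have 1: "sat E UNIV \<delta> (s(m' := x)) = sat E UNIV \<delta> s" for s x
    by (rule sat_cong) (use fr in auto)
  have 2: "sat E UNIV \<phi> (\<lambda>i. (s(m' := x)) ((r(m := m')) i)) = sat E UNIV \<phi> ((\<lambda>i. s (r i))(m := x))" for s x
    by (rule sat_cong) (use fr in fastforce)
  show ?case
    by (intro exI[of _ "Exists m' \<psi>"] conjI levy_Sigma_levy_Pi.intros(4) \<psi>(1))
      (simp only: sat.simps \<psi>(2) 1 2, blast)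
next
  case (6 n \<phi> m)
  define m' where "m' = Suc (Max (insert 0 (fv \<delta> \<union> r ` fv \<phi>)))"
  have fr: "i < m'" if "i \<in> fv \<delta> \<or> i \<in> r ` fv \<phi>" for i
    using that by (auto simp: m'_def finite_fv less_Suc_eq_le)
  obtain \<psi> where \<psi>: "levy_Pi (Suc n) \<psi>"
    "\<And>s. sat E UNIV \<psi> s \<longleftrightarrow> sat E UNIV \<delta> s \<and> sat E UNIV \<phi> (\<lambda>i. s ((r(m := m')) i))"
    using 6 by blast
  have 1: "sat E UNIV \<delta> (s(m' := x)) = sat E UNIV \<delta> s" for s x
    by (rule sat_cong) (use fr in auto)
  have 2: "sat E UNIV \<phi> (\<lambda>i. (s(m' := x)) ((r(m := m')) i)) = sat E UNIV \<phi> ((\<lambda>i. s (r i))(m := x))" for s x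
    by (rule sat_cong) (use fr in fastforce)
  show ?case
    by (intro exI[of _ "Forall m' \<psi>"] conjI levy_Sigma_levy_Pi.intros(6) \<psi>(1))
      (simp only: sat.simps \<psi>(2) 1 2, blast)
qed

lemma levy_Pi_mono: "levy_Pi 1 \<phi> \<Longrightarrow> levy_Sigma 2 \<phi>"
  using levy_Sigma_levy_Pi.intros(3)[of 1 \<phi>] by (simp add: numeral_2_eq_2)

context membership
begin

text \<open>The bounded counterpart of \<open>defp\<close>. The classes in the principles are
  lightface, so there are no parameters and variables need not be interleaved.\<close>

definition def0 :: "((nat \<Rightarrow> 'v) \<Rightarrow> bool) \<Rightarrow> bool" where
  "def0 P \<longleftrightarrow> (\<exists>\<phi>. Delta0 \<phi> \<and> (\<forall>s. sat (\<epsilon>) UNIV \<phi> s \<longleftrightarrow> P s))"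

lemma def0_subst: "def0 P \<Longrightarrow> def0 (\<lambda>s. P (\<lambda>i. s (r i)))"
  unfolding def0_def using sat_sub Delta0_sub by metis

lemma def0_mem [def0_intro]: "def0 (\<lambda>s. s i \<epsilon> s j)"
  unfolding def0_def by (rule exI[of _ "Member i j"]) (simp add: Delta0.intros)

lemma def0_eq [def0_intro]: "def0 (\<lambda>s. s i = s j)"
  unfolding def0_def by (rule exI[of _ "Equal i j"]) (simp add: Delta0.intros)

lemma def0_neg [def0_intro]: "def0 P \<Longrightarrow> def0 (\<lambda>s. \<not> P s)"
  unfolding def0_def using Delta0.intros(3) sat.simps(3) by metis

lemma def0_conj [def0_intro]: "def0 P \<Longrightarrow> def0 Q \<Longrightarrow> def0 (\<lambda>s. P s \<and> Q s)"
  unfolding def0_def using Delta0.intros(4) sat.simps(4) by metis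

lemma def0_disj [def0_intro]: assumes "def0 P" "def0 Q" shows "def0 (\<lambda>s. P s \<or> Q s)"
proof -
  have "def0 (\<lambda>s. \<not> (\<not> P s \<and> \<not> Q s))" by (intro def0_neg def0_conj assms)
  then show ?thesis by simp
qed

lemma def0_imp [def0_intro]: assumes "def0 P" "def0 Q" shows "def0 (\<lambda>s. P s \<longrightarrow> Q s)"
proof -
  have "def0 (\<lambda>s. \<not> (P s \<and> \<not> Q s))" by (intro def0_neg def0_conj assms)
  then show ?thesis by simp
qed

lemma def0_iff [def0_intro]: assumes "def0 P" "def0 Q" shows "def0 (\<lambda>s. P s \<longleftrightarrow> Q s)"
proof -
  have "def0 (\<lambda>s. (P s \<longrightarrow> Q s) \<and> (Q s \<longrightarrow> P s))" by (intro def0_imp def0_conj assms)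
  then show ?thesis by (simp add: iff_conv_conj_imp)
qed

lemma def0_bex [def0_intro]:
  assumes "def0 (\<lambda>s. Q (\<lambda>i. s (Suc i)) (s 0))"
  shows "def0 (\<lambda>s. \<exists>x. x \<epsilon> s k \<and> Q s x)"
proof -
  from assms obtain \<phi> where
    \<phi>: "Delta0 \<phi>" "\<And>s. sat (\<epsilon>) UNIV \<phi> s \<longleftrightarrow> Q (\<lambda>i. s (Suc i)) (s 0)"
    unfolding def0_def by blast
  define m where "m = Suc (Max (insert k (fv \<phi>)))"
  have m: "i < m" if "i \<in> fv \<phi> \<or> i = k" for i
    using that by (auto simp: m_def finite_fv less_Suc_eq_le)
  define r where "r = (\<lambda>i. case i of 0 \<Rightarrow> m | Suc i \<Rightarrow> i)"
  have "sat (\<epsilon>) UNIV (sub \<phi> r) (s(m := x)) \<longleftrightarrow> Q s x" for s x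
  proof -
    have "sat (\<epsilon>) UNIV (sub \<phi> r) (s(m := x)) \<longleftrightarrow> sat (\<epsilon>) UNIV \<phi> (case_nat x s)"
      unfolding sat_sub
      by (rule sat_cong) (use m in \<open>fastforce simp: r_def split: nat.split\<close>)
    then show ?thesis unfolding \<phi>(2) by simp
  qed
  moreover have "(s(m := x)) k = s k" for s :: "nat \<Rightarrow> 'v" and x using m[of k] by simp
  ultimately have "sat (\<epsilon>) UNIV (Exists m (And (Member m k) (sub \<phi> r))) s \<longleftrightarrow> (\<exists>x. x \<epsilon> s k \<and> Q s x)" for s
    by simp
  moreover have "Delta0 (Exists m (And (Member m k) (sub \<phi> r)))"
    by (intro Delta0.intros Delta0_sub \<phi>(1)) (use m[of k] in simp)
  ultimately show ?thesis unfolding def0_def by blast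
qed

lemma def0_ball [def0_intro]:
  assumes "def0 (\<lambda>s. Q (\<lambda>i. s (Suc i)) (s 0))"
  shows "def0 (\<lambda>s. \<forall>x. x \<epsilon> s k \<longrightarrow> Q s x)"
proof -
  have "def0 (\<lambda>s. \<not> (\<exists>x. x \<epsilon> s k \<and> \<not> Q s x))" by (intro def0_neg def0_bex assms)
  then show ?thesis by simp
qed

lemma sat_Foralls:
  "sat (\<epsilon>) UNIV (foldr Forall xs \<phi>) t \<longleftrightarrow>
     (\<forall>s. (\<forall>i. i \<notin> set xs \<longrightarrow> s i = t i) \<longrightarrow> sat (\<epsilon>) UNIV \<phi> s)"
proof (induction xs arbitrary: t)
  case Nil
  have "(\<forall>i. s i = t i) \<longleftrightarrow> s = t" for s by (auto simp: fun_eq_iff)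
  then show ?case by simp
next
  case (Cons x xs)
  have "(\<exists>v. \<forall>i. i \<notin> set xs \<longrightarrow> s i = (t(x := v)) i) \<longleftrightarrow> (\<forall>i. i \<notin> set (x # xs) \<longrightarrow> s i = t i)" for s
    by (auto intro: exI[of _ "s x"])
  then show ?case by (simp add: Cons.IH) metis
qed

text \<open>All free variables except 0 are quantified in one block. Auxiliary objects of a
  \<open>\<Pi>\<^sub>1\<close> definition can thus be named by further entries of the
  environment.\<close>

lemma definable_by_Pi1:
  assumes "def0 P"
  shows "definable_by (levy_Pi 1) {x. \<forall>s. s 0 = x \<longrightarrow> P s}"
proof -
  from assms obtain \<phi> where \<phi>: "Delta0 \<phi>" "\<And>s. sat (\<epsilon>) UNIV \<phi> s \<longleftrightarrow> P s"
    unfolding def0_def by blast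
  obtain xs where xs: "set xs = fv \<phi> - {0}" using finite_list[of "fv \<phi> - {0}"] finite_fv[of \<phi>] by auto
  have 1: "levy_Pi 1 (foldr Forall ys \<phi>)" for ys
    using \<phi>(1) by (induction ys) (auto intro: levy_Sigma_levy_Pi.intros)
  have "fv (foldr Forall ys \<phi>) = fv \<phi> - set ys" for ys
    by (induction ys) auto
  then have 2: "fv (foldr Forall xs \<phi>) \<subseteq> {0}" using xs by auto
  have "sat (\<epsilon>) UNIV (foldr Forall xs \<phi>) (\<lambda>_. x) \<longleftrightarrow> (\<forall>s. s 0 = x \<longrightarrow> P s)" for x
  proof
    assume *: "sat (\<epsilon>) UNIV (foldr Forall xs \<phi>) (\<lambda>_. x)"
    show "\<forall>s. s 0 = x \<longrightarrow> P s"
    proof (intro allI impI)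
      fix s :: "nat \<Rightarrow> 'v" assume "s 0 = x"
      then have "sat (\<epsilon>) UNIV \<phi> (\<lambda>i. if i \<in> set xs then s i else x) = sat (\<epsilon>) UNIV \<phi> s"
        by (intro sat_cong) (auto simp: xs)
      moreover have "sat (\<epsilon>) UNIV \<phi> (\<lambda>i. if i \<in> set xs then s i else x)"
        using * unfolding sat_Foralls by simp
      ultimately show "P s" using \<phi>(2) by simp
    qed
  qed (auto simp: sat_Foralls \<phi>(2) xs)
  then show ?thesis unfolding definable_by_def using 1 2 by blast
qed

lemma sat_transitive:
  assumes "Delta0 \<phi>" "transitive_class M" "\<And>i. s i \<in> M"
  shows "sat (\<epsilon>) M \<phi> s = sat (\<epsilon>) UNIV \<phi> s"
  using assms(1,3)
proof (induction arbitrary: s rule: Delta0.induct)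
  case (5 \<phi> m n)
  have "sat (\<epsilon>) M \<phi> (s(m := x)) = sat (\<epsilon>) UNIV \<phi> (s(m := x))" if "x \<epsilon> s n" for x
  proof (rule 5)
    have "x \<in> M" using assms(2) that 5(4)[of n] unfolding transitive_class_def by blast
    then show "(s(m := x)) i \<in> M" for i using 5 by simp
  qed
  moreover have "x \<in> M" if "x \<epsilon> s n" for x
    using assms(2) that 5(4)[of n] unfolding transitive_class_def by blast
  ultimately show ?case using \<open>m \<noteq> n\<close> by auto
qed auto

end

context ZFC
begin

lemma def0_emp [def0_intro]: "def0 (\<lambda>s. s i = emp)"
proof -
  have *: "z = emp \<longleftrightarrow> \<not> (\<exists>x. x \<epsilon> z \<and> x = x)" for z using nonempty_iff[of z] by blast
  show ?thesis unfolding * by (intro def0_intro)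
qed

lemma def0_subset_of [def0_intro]: "def0 (\<lambda>s. subset_of (s i) (s j))"
  unfolding subset_of_def by (intro def0_intro)

lemma def0_up [def0_intro]: "def0 (\<lambda>s. s i = up (s j) (s k))"
proof -
  have "z = up x y \<longleftrightarrow> x \<epsilon> z \<and> y \<epsilon> z \<and> (\<forall>w. w \<epsilon> z \<longrightarrow> w = x \<or> w = y)" for x y z
    by (auto intro: set_ext)
  then show ?thesis by (simp only:) (intro def0_intro)
qed

lemma def0_sg [def0_intro]: "def0 (\<lambda>s. s i = sg (s j))"
  unfolding sg_def by (intro def0_intro)

lemma def0_sc [def0_intro]: "def0 (\<lambda>s. s i = sc (s j))"
proof -
  have "z = sc x \<longleftrightarrow> x \<epsilon> z \<and> (\<forall>w. w \<epsilon> x \<longrightarrow> w \<epsilon> z) \<and> (\<forall>w. w \<epsilon> z \<longrightarrow> w \<epsilon> x \<or> w = x)" for x z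
    by (rule iffI, simp, rule set_ext, auto)
  then show ?thesis by (simp only:) (intro def0_intro)
qed

lemma def0_pr [def0_intro]: "def0 (\<lambda>s. s i = pr (s j) (s k))"
proof -
  have "z = pr x y \<longleftrightarrow> (\<exists>a. a \<epsilon> z \<and> (\<exists>b. b \<epsilon> z \<and> a = sg x \<and> b = up x y \<and> z = up a b))" for x y z
    by (auto simp: pr_def)
  then show ?thesis by (simp only:) (intro def0_intro)
qed

lemma def0_pr_mem [def0_intro]: "def0 (\<lambda>s. pr (s i) (s j) \<epsilon> s k)"
proof -
  have "def0 (\<lambda>s. \<exists>p. p \<epsilon> s k \<and> p = pr (s i) (s j))" by (intro def0_intro)
  then show ?thesis by (rule back_subst[of def0]) auto
qed

text \<open>Both components lie in the member \<open>up x y\<close> of the pair, which bounds the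
  two quantifiers.\<close>

lemma def0_ex_pair [def0_intro]:
  assumes "def0 (\<lambda>s. Q (\<lambda>i. s (Suc (Suc i))) (s 1) (s 0))"
  shows "def0 (\<lambda>s. \<exists>x y. s k = pr x y \<and> Q s x y)"
proof -
  have "def0 (\<lambda>s. Q (\<lambda>i. s (Suc (Suc (Suc i)))) (s (Suc 0)) (s 0))"
    using def0_subst[OF assms, where r = "\<lambda>i. case i of 0 \<Rightarrow> 0 | Suc i \<Rightarrow> (case i of 0 \<Rightarrow> 1 | Suc i \<Rightarrow> Suc (Suc (Suc i)))"]
    by simp
  then have "def0 (\<lambda>s. \<exists>b. b \<epsilon> s k \<and> (\<exists>x. x \<epsilon> b \<and> (\<exists>y. y \<epsilon> b \<and> s k = pr x y \<and> Q s x y)))"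
    by (intro def0_bex def0_conj def0_pr)
  moreover have "(\<exists>b. b \<epsilon> z \<and> (\<exists>x. x \<epsilon> b \<and> (\<exists>y. y \<epsilon> b \<and> z = pr x y \<and> Q s x y))) \<longleftrightarrow>
      (\<exists>x y. z = pr x y \<and> Q s x y)" for s z
  proof -
    have "up x y \<epsilon> pr x y \<and> x \<epsilon> up x y \<and> y \<epsilon> up x y" for x y by (simp add: pr_def)
    then show ?thesis by blast
  qed
  ultimately show ?thesis by simp
qed

lemma def0_all_pair [def0_intro]:
  assumes "def0 (\<lambda>s. Q (\<lambda>i. s (Suc (Suc i))) (s 1) (s 0))"
  shows "def0 (\<lambda>s. \<forall>x y. s k = pr x y \<longrightarrow> Q s x y)"
proof -
  have "def0 (\<lambda>s. \<not> (\<exists>x y. s k = pr x y \<and> \<not> Q s x y))" by (intro def0_neg def0_ex_pair assms)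
  then show ?thesis by simp
qed

lemma def0_ex_pair_mem [def0_intro]:
  assumes "def0 (\<lambda>s. Q (\<lambda>i. s (Suc (Suc i))) (s 1) (s 0))"
  shows "def0 (\<lambda>s. \<exists>x y. pr x y \<epsilon> s k \<and> Q s x y)"
proof -
  have *: "def0 (\<lambda>s. Q (\<lambda>i. s (Suc (Suc (Suc i)))) (s 1) (s 0))"
    using def0_subst[OF assms, where r = "\<lambda>i. case i of 0 \<Rightarrow> 0 | Suc i \<Rightarrow> (case i of 0 \<Rightarrow> 1 | Suc i \<Rightarrow> Suc (Suc (Suc i)))"]
    by simp
  have "def0 (\<lambda>s. \<exists>p. p \<epsilon> s k \<and> (\<exists>x y. p = pr x y \<and> Q s x y))"
    by (intro def0_bex def0_ex_pair) (rule *)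
  then show ?thesis by (rule back_subst[of def0]) auto
qed

lemma def0_all_pair_mem [def0_intro]:
  assumes "def0 (\<lambda>s. Q (\<lambda>i. s (Suc (Suc i))) (s 1) (s 0))"
  shows "def0 (\<lambda>s. \<forall>x y. pr x y \<epsilon> s k \<longrightarrow> Q s x y)"
proof -
  have "def0 (\<lambda>s. \<not> (\<exists>x y. pr x y \<epsilon> s k \<and> \<not> Q s x y))" by (intro def0_neg def0_ex_pair_mem assms)
  then show ?thesis by simp
qed

lemma def0_function_on [def0_intro]: "def0 (\<lambda>s. function_on (s i) (s j))"
proof -
  have *: "function_on f a \<longleftrightarrow> (\<forall>p. p \<epsilon> f \<longrightarrow> (\<exists>x y. p = pr x y \<and> x \<epsilon> a)) \<and>
     (\<forall>x. x \<epsilon> a \<longrightarrow> (\<exists>p. p \<epsilon> f \<and> (\<exists>x' y. p = pr x' y \<and> x' = x))) \<and>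
     (\<forall>p. p \<epsilon> f \<longrightarrow> (\<forall>q. q \<epsilon> f \<longrightarrow> (\<forall>x y. p = pr x y \<longrightarrow> (\<forall>x' y'. q = pr x' y' \<longrightarrow> x = x' \<longrightarrow> y = y'))))"
    (is "_ \<longleftrightarrow> ?R") for f a
  proof
    assume "function_on f a"
    then have f: "p \<epsilon> f \<longleftrightarrow> (\<exists>x. x \<epsilon> a \<and> p = pr x (app f x))" for p
      by (rule function_on_mem)
    show ?R unfolding f by auto
  next
    assume R: ?R
    have "\<exists>!y. pr x y \<epsilon> f" if x: "x \<epsilon> a" for x
    proof -
      from R have "\<exists>p. p \<epsilon> f \<and> (\<exists>x' y. p = pr x' y \<and> x' = x)" using x by blast
      then obtain y where y: "pr x y \<epsilon> f" by blast
      have "y' = y" if y': "pr x y' \<epsilon> f" for y'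
        using conjunct2[OF conjunct2[OF R]] y y' by blast
      then show ?thesis using y by blast
    qed
    moreover have "\<forall>p. p \<epsilon> f \<longrightarrow> (\<exists>x y. x \<epsilon> a \<and> p = pr x y)" using conjunct1[OF R] by blast
    ultimately show "function_on f a" unfolding function_on_iff by blast
  qed
  show ?thesis unfolding * by (intro def0_intro)
qed

lemma def0_maps [def0_intro]: "def0 (\<lambda>s. maps (s i) (s j) (s k))"
proof -
  have *: "maps f a b \<longleftrightarrow> function_on f a \<and> (\<forall>x y. pr x y \<epsilon> f \<longrightarrow> y \<epsilon> b)" for f a b
    unfolding maps_def by simp
  show ?thesis unfolding * by (intro def0_intro)
qed

lemma def0_tr [def0_intro]: "def0 (\<lambda>s. tr (s i))"
proof -
  have *: "tr a \<longleftrightarrow> (\<forall>x. x \<epsilon> a \<longrightarrow> (\<forall>y. y \<epsilon> x \<longrightarrow> y \<epsilon> a))" for a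
    unfolding tr_def by blast
  show ?thesis unfolding * by (intro def0_intro)
qed

lemma def0_Ord [def0_intro]: "def0 (\<lambda>s. Ord (s i))"
  unfolding Ord_def by (intro def0_intro)

lemma def0_lim [def0_intro]: "def0 (\<lambda>s. lim (s i))"
proof -
  have *: "lim a \<longleftrightarrow> Ord a \<and> a \<noteq> emp \<and> (\<forall>x. x \<epsilon> a \<longrightarrow> (\<exists>y. y \<epsilon> a \<and> y = sc x))" for a
    unfolding lim_def by auto
  show ?thesis unfolding * by (intro def0_intro)
qed

lemma def0_bijection [def0_intro]: "def0 (\<lambda>s. bijection (s i) (s j) (s k))"
proof -
  have *: "bijection f a b \<longleftrightarrow> maps f a b \<and>
     (\<forall>x y. pr x y \<epsilon> f \<longrightarrow> (\<forall>x' y'. pr x' y' \<epsilon> f \<longrightarrow> y = y' \<longrightarrow> x = x')) \<and>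
     (\<forall>y. y \<epsilon> b \<longrightarrow> (\<exists>x y'. pr x y' \<epsilon> f \<and> y = y'))" for f a b
    unfolding bijection_def by auto
  show ?thesis unfolding * by (intro def0_intro)
qed

lemma vertex_iff: "vertex A x \<longleftrightarrow> (\<exists>G R. A = pr G R \<and> x \<epsilon> G)"
  unfolding vertex_def by simp

lemma edge_iff: "edge A x y \<longleftrightarrow> (\<exists>G R. A = pr G R \<and> pr x y \<epsilon> R)"
  unfolding edge_def by simp

section \<open>Elementary embeddings\<close>

context
  fixes j M
  assumes el: "elementary_embedding j M" and trM: "transitive_class M"
begin

lemma el_deft: assumes t: "deft t" shows "deft (\<lambda>s. j (t s))"
proof (rule deft_app1[where f = j, OF _ t])
  have "definable_class {p. \<exists>x. opair x (j x) p}" using el by (simp add: elementary_embedding_def)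
  from defp_class[OF this, of "\<lambda>s. pr (s 1) (s 0)"]
  have "defp (\<lambda>s. pr (s 1) (s 0) \<in> {p. \<exists>x. opair x (j x) p})" by (simp add: defs_intro)
  moreover have "pr x y \<in> {p. \<exists>x. opair x (j x) p} \<longleftrightarrow> y = j x" for x y by auto
  ultimately have "defp (\<lambda>s. s 0 = j (s 1))" by (simp only:)
  then show "deft (\<lambda>s. j (s 0))" unfolding deft_def by simp
qed

lemma el_class: "definable_class M"
  using el by (simp add: elementary_embedding_def)

lemma el_in [simp]: "j x \<in> M"
  using el by (simp add: elementary_embedding_def)

lemma M_trans: "x \<in> M \<Longrightarrow> y \<epsilon> x \<Longrightarrow> y \<in> M"
  using trM unfolding transitive_class_def by blast

lemma el_sat: "sat (\<epsilon>) UNIV \<phi> s \<longleftrightarrow> sat (\<epsilon>) M \<phi> (\<lambda>i. j (s i))"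
  using el by (simp add: elementary_embedding_def comp_def)

lemma el_env: assumes "def0 P" shows "P s \<longleftrightarrow> P (\<lambda>i. j (s i))"
proof -
  from assms obtain \<phi> where \<phi>: "Delta0 \<phi>" "\<And>s. sat (\<epsilon>) UNIV \<phi> s \<longleftrightarrow> P s"
    unfolding def0_def by blast
  have "sat (\<epsilon>) M \<phi> (\<lambda>i. j (s i)) = sat (\<epsilon>) UNIV \<phi> (\<lambda>i. j (s i))"
    by (rule sat_transitive[OF \<phi>(1) trM]) simp
  then show ?thesis unfolding \<phi>(2)[symmetric] using el_sat[of \<phi> s] by (simp only:)
qed

text \<open>Elementarity relativizes the quantifier to \<open>M\<close>, whereas the bounded matrix
  is absolute. One universal quantifier suffices to transfer the hierarchy and the Jonsson
  property.\<close>

lemma el_all: assumes "def0 P" shows "(\<forall>x. P (case_nat x s)) \<longleftrightarrow> (\<forall>x\<in>M. P (case_nat x (\<lambda>i. j (s i))))"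
proof -
  from assms obtain \<phi> where \<phi>: "Delta0 \<phi>" "\<And>s. sat (\<epsilon>) UNIV \<phi> s \<longleftrightarrow> P s"
    unfolding def0_def by blast
  define t where "t = case_nat emp s"
  have [simp]: "t(0 := x) = case_nat x s" "(\<lambda>i. j (t i))(0 := x) = case_nat x (\<lambda>i. j (s i))" for x
    by (auto simp: t_def fun_eq_iff split: nat.split)
  have "(\<forall>x. P (case_nat x s)) \<longleftrightarrow> sat (\<epsilon>) UNIV (Forall 0 \<phi>) t"
    by (simp add: \<phi>(2))
  also have "\<dots> \<longleftrightarrow> (\<forall>x\<in>M. sat (\<epsilon>) M \<phi> (case_nat x (\<lambda>i. j (s i))))"
    by (subst el_sat) simp
  also have "\<dots> \<longleftrightarrow> (\<forall>x\<in>M. P (case_nat x (\<lambda>i. j (s i))))"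
    unfolding \<phi>(2)[symmetric]
    by (intro ball_cong refl sat_transitive[OF \<phi>(1) trM]) (auto split: nat.split)
  finally show ?thesis .
qed

lemma el_rel1: "def0 (\<lambda>s. R (s 0)) \<Longrightarrow> R x \<longleftrightarrow> R (j x)"
  by (drule el_env[where s = "\<lambda>i. x"])

lemma el_rel2: "def0 (\<lambda>s. R (s 0) (s 1)) \<Longrightarrow> R x y \<longleftrightarrow> R (j x) (j y)"
  by (drule el_env[where s = "\<lambda>i. if i = 0 then x else y"]) simp

lemma el_rel3: "def0 (\<lambda>s. R (s 0) (s 1) (s 2)) \<Longrightarrow> R x y z \<longleftrightarrow> R (j x) (j y) (j z)"
  by (drule el_env[where s = "\<lambda>i. if i = 0 then x else if i = 1 then y else z"]) simp

lemma el_all1: "def0 (\<lambda>s. R (s 0) (s 1)) \<Longrightarrow> (\<forall>x. R x a) \<longleftrightarrow> (\<forall>x\<in>M. R x (j a))"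
  by (drule el_all[where s = "\<lambda>i. a"]) simp

lemma el_all3: "def0 (\<lambda>s. R (s 0) (s 1) (s 2) (s 3)) \<Longrightarrow>
    (\<forall>x. R x a b c) \<longleftrightarrow> (\<forall>x\<in>M. R x (j a) (j b) (j c))"
  by (drule el_all[where s = "\<lambda>i. if i = 0 then a else if i = 1 then b else c"])
    (simp add: numeral_2_eq_2 numeral_3_eq_3)

lemma el_mem: "j x \<epsilon> j y \<longleftrightarrow> x \<epsilon> y"
  using el_rel2[of "(\<epsilon>)", OF def0_mem] by blast

lemma el_eq: "j x = j y \<longleftrightarrow> x = y"
  using el_rel2[of "(=)", OF def0_eq] by blast

lemma el_emp: "j emp = emp"
  using el_rel1[where R = "\<lambda>x. x = emp", OF def0_emp] by blast

lemma el_pr: "j (pr x y) = pr (j x) (j y)"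
  using el_rel3[of "\<lambda>x y z. z = pr x y", OF def0_pr] by blast

lemma el_sg: "j (sg x) = sg (j x)"
  using el_rel2[of "\<lambda>x y. x = sg y", OF def0_sg] by blast

lemma el_sc: "j (sc x) = sc (j x)"
  using el_rel2[of "\<lambda>x y. x = sc y", OF def0_sc] by blast

lemma el_Ord: "Ord (j x) \<longleftrightarrow> Ord x"
  using el_rel1[where R = Ord, OF def0_Ord] by blast

lemma el_function_on: "function_on (j f) (j a) \<longleftrightarrow> function_on f a"
  using el_rel2[where R = function_on, OF def0_function_on] by blast

lemma el_app: "function_on f a \<Longrightarrow> x \<epsilon> a \<Longrightarrow> app (j f) (j x) = j (app f x)"
  using el_function_on[of f a] pr_app[of f a x] app_eq[of "j f" "j a" "j x"] el_mem el_pr by metis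

lemma el_om: "n \<epsilon> om \<Longrightarrow> j n = n"
proof -
  assume n: "n \<epsilon> om"
  have d: "defp (\<lambda>s. j (s 0) = s 0)" by (intro defs_intro el_deft)
  show ?thesis by (rule om_induct[OF d n]) (auto simp: el_emp el_sc)
qed

text \<open>\<open>R x h\<close> is a bounded form of the recursion clause of the hierarchy for the
  single element \<open>x\<close>. It passes to \<open>j h\<close> for all \<open>x\<close> in
  \<open>M\<close>, and induction identifies the values of \<open>j h\<close> with the levels
  intersected with \<open>M\<close>.\<close>

lemma el_Vs: assumes a: "Ord a" shows "x \<epsilon> j (Vs a) \<longleftrightarrow> x \<in> M \<and> x \<epsilon> Vs (j a)"
proof -
  have dV: "deft (\<lambda>s. Vs (s 0))" by (intro defs_intro)
  define h where "h = lam (sc a) Vs"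
  have h: "function_on h (sc a)" "\<And>b. b \<epsilon> sc a \<Longrightarrow> app h b = Vs b"
    unfolding h_def using function_on_lam[OF dV] app_lam[OF dV] by auto
  have hj: "function_on (j h) (sc (j a))" using el_function_on[of h "sc a"] h(1) by (simp add: el_sc)
  define R where "R x h \<longleftrightarrow> (\<forall>b v. pr b v \<epsilon> h \<longrightarrow>
     (x \<epsilon> v \<longleftrightarrow> (\<exists>c. c \<epsilon> b \<and> (\<exists>c' w. pr c' w \<epsilon> h \<and> c' = c \<and> subset_of x w))))" for x h
  have dR: "def0 (\<lambda>s. R (s 0) (s 1))" unfolding R_def by (intro def0_intro)
  have oa: "Ord (sc a)" "Ord (sc (j a))" using a by (auto intro: Ord_sc simp: el_Ord)
  have R_iff: "R x f \<longleftrightarrow> (\<forall>c. c \<epsilon> sc b \<longrightarrow> (x \<epsilon> app f c \<longleftrightarrow> (\<exists>e. e \<epsilon> c \<and> subset_of x (app f e))))"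
    if "function_on f (sc b)" "Ord (sc b)" for x f b
  proof -
    note f = function_on_pr[OF that(1)]
    have "(\<exists>e. e \<epsilon> c \<and> (\<exists>c' w. pr c' w \<epsilon> f \<and> c' = e \<and> subset_of x w)) \<longleftrightarrow>
        (\<exists>e. e \<epsilon> c \<and> subset_of x (app f e))" if "c \<epsilon> sc b" for c
      using Ord_trans[OF \<open>Ord (sc b)\<close> _ that] unfolding f by blast
    then show ?thesis unfolding R_def f by (metis (no_types, lifting))
  qed
  have "\<forall>x. R x h"
    using h(2) mem_Vs Ord_trans[OF oa(1)] unfolding R_iff[OF h(1) oa(1)] by (metis (no_types, lifting))
  then have *: "\<forall>x\<in>M. R x (j h)"
    using el_all1[where R = R, OF dR] by blast
  have d: "defp (\<lambda>s. s 0 \<epsilon> sc (j a) \<longrightarrow> (\<forall>x. x \<epsilon> app (j h) (s 0) \<longleftrightarrow> x \<in> M \<and> x \<epsilon> Vs (s 0)))"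
    by (intro defs_intro defp_class[OF el_class])
  have "j a \<epsilon> sc (j a) \<longrightarrow> (\<forall>x. x \<epsilon> app (j h) (j a) \<longleftrightarrow> x \<in> M \<and> x \<epsilon> Vs (j a))"
  proof (rule Ord_induct[OF d])
    show "Ord (j a)" using a el_Ord by blast
    fix b assume b: "Ord b" and IH: "\<forall>c. c \<epsilon> b \<longrightarrow> c \<epsilon> sc (j a) \<longrightarrow> (\<forall>x. x \<epsilon> app (j h) c \<longleftrightarrow> x \<in> M \<and> x \<epsilon> Vs c)"
    show "b \<epsilon> sc (j a) \<longrightarrow> (\<forall>x. x \<epsilon> app (j h) b \<longleftrightarrow> x \<in> M \<and> x \<epsilon> Vs b)"
    proof (intro impI allI)
      fix x assume bs: "b \<epsilon> sc (j a)"
      have c: "c \<epsilon> sc (j a)" if "c \<epsilon> b" for c using Ord_trans[OF oa(2) that bs] .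
      have "app (j h) b \<in> M"
      proof -
        have "pr b (app (j h) b) \<in> M" using pr_app[OF hj bs] M_trans el_in by blast
        then have "up b (app (j h) b) \<in> M" by (rule M_trans) (simp add: pr_def)
        then show ?thesis by (rule M_trans) simp
      qed
      then have 1: "x \<in> M" if "x \<epsilon> app (j h) b" using that M_trans by blast
      have 2: "x \<epsilon> app (j h) b \<longleftrightarrow> x \<epsilon> Vs b" if x: "x \<in> M"
      proof -
        have "x \<epsilon> app (j h) b \<longleftrightarrow> (\<exists>e. e \<epsilon> b \<and> subset_of x (app (j h) e))"
          using * x bs R_iff[OF hj oa(2)] by blast
        also have "\<dots> \<longleftrightarrow> (\<exists>e. e \<epsilon> b \<and> subset_of x (Vs e))"
          using IH c M_trans[OF x] unfolding subset_of_def by metis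
        finally show ?thesis using mem_Vs[of x b] by simp
      qed
      show "x \<epsilon> app (j h) b \<longleftrightarrow> x \<in> M \<and> x \<epsilon> Vs b" using 1 2 by blast
    qed
  qed
  moreover have "app (j h) (j a) = j (Vs a)" using el_app[OF h(1), of a] h(2)[of a] by simp
  ultimately show ?thesis by simp
qed

end

end

context ZFC
begin

section \<open>Operations on subsets of a level of the hierarchy\<close>

text \<open>
  Preimages under the maps \<open>(x, y) \<mapsto> x\<close>, \<open>(x, y) \<mapsto> y\<close>, \<open>t \<mapsto> (t, t)\<close>, \<open>t \<mapsto> ((t, t), t)\<close>,
  \<open>((x, y), z) \<mapsto> (x, z)\<close> and \<open>((x, y), z) \<mapsto> (y, z)\<close>; a Sheffer stroke, in which the
  third and fourth map serve to code two sets into one; and a bounded quantifier.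
  All of them commute with the truncation \<open>X \<mapsto> X \<inter> V_l\<close>, for limit \<open>l\<close>.
\<close>

definition opc :: "nat \<Rightarrow> 'a \<Rightarrow> 'a \<Rightarrow> bool" where
  "opc m X t \<longleftrightarrow>
     (if m = 0 then \<exists>x y. t = pr x y \<and> x \<epsilon> X
      else if m = 1 then \<exists>x y. t = pr x y \<and> y \<epsilon> X
      else if m = 2 then pr t t \<epsilon> X
      else if m = 3 then pr (pr t t) t \<epsilon> X
      else if m = 4 then \<exists>q z. t = pr q z \<and> (\<exists>x y. q = pr x y \<and> pr x z \<epsilon> X)
      else if m = 5 then \<exists>q z. t = pr q z \<and> (\<exists>x y. q = pr x y \<and> pr y z \<epsilon> X)
      else if m = 6 then \<not> (pr t t \<epsilon> X \<and> pr (pr t t) t \<epsilon> X)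
      else \<exists>y x. t = pr y x \<and> (\<exists>z. z \<epsilon> x \<and> pr y z \<epsilon> X))"

lemma opc_simps:
  "opc 0 X t \<longleftrightarrow> (\<exists>x y. t = pr x y \<and> x \<epsilon> X)"
  "opc (Suc 0) X t \<longleftrightarrow> (\<exists>x y. t = pr x y \<and> y \<epsilon> X)"
  "opc 2 X t \<longleftrightarrow> pr t t \<epsilon> X"
  "opc 3 X t \<longleftrightarrow> pr (pr t t) t \<epsilon> X"
  "opc 4 X t \<longleftrightarrow> (\<exists>x y z. t = pr (pr x y) z \<and> pr x z \<epsilon> X)"
  "opc 5 X t \<longleftrightarrow> (\<exists>x y z. t = pr (pr x y) z \<and> pr y z \<epsilon> X)"
  "opc 6 X t \<longleftrightarrow> \<not> (pr t t \<epsilon> X \<and> pr (pr t t) t \<epsilon> X)"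
  "opc 7 X t \<longleftrightarrow> (\<exists>y x. t = pr y x \<and> (\<exists>z. z \<epsilon> x \<and> pr y z \<epsilon> X))"
  by (auto simp: opc_def)

lemma defp_opc [defs_intro]:
  assumes "deft t" "deft u"
  shows "defp (\<lambda>s. opc m (t s) (u s))"
proof (rule defp_app2[where P = "opc m", OF _ assms])
  show "defp (\<lambda>s. opc m (s 0) (s 1))"
    unfolding opc_def
    by (cases "m = 0"; cases "m = 1"; cases "m = 2"; cases "m = 3"; cases "m = 4"; cases "m = 5"; cases "m = 6"; simp)
      (intro defs_intro)+
qed

definition opn :: "nat \<Rightarrow> 'a \<Rightarrow> 'a \<Rightarrow> 'a" where
  "opn m v X = Sep v (opc m X)"

lemma mem_opn: "t \<epsilon> opn m v X \<longleftrightarrow> t \<epsilon> v \<and> opc m X t"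
  unfolding opn_def by (rule mem_Sep) (intro defs_intro)

lemma deft_opn [defs_intro]: "deft t \<Longrightarrow> deft u \<Longrightarrow> deft (\<lambda>s. opn m (t s) (u s))"
  by (rule deft_app2[where f = "opn m"]) (unfold opn_def, intro defs_intro)

text \<open>
  The first components in \<open>A\<close> are meant to be the Zermelo numerals, so that a bad \<open>A\<close> is an
  infinite descending sequence in the sections of \<open>X\<close>.
\<close>

definition bad where
  "bad A X \<longleftrightarrow> (\<forall>p. p \<epsilon> A \<longrightarrow> (\<exists>n x. p = pr n x \<and> (\<exists>m y. pr m y \<epsilon> A \<and> m = sg n \<and>
     (\<exists>k r. pr k r \<epsilon> X \<and> k = n \<and> r = pr y x))))"

lemma bad_iff: "bad A X \<longleftrightarrow> (\<forall>p. p \<epsilon> A \<longrightarrow> (\<exists>n x y. p = pr n x \<and> pr (sg n) y \<epsilon> A \<and> pr n (pr y x) \<epsilon> X))"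
proof -
  have "(\<exists>m y. pr m y \<epsilon> A \<and> m = sg n \<and> (\<exists>k r. pr k r \<epsilon> X \<and> k = n \<and> r = pr y x)) \<longleftrightarrow>
      (\<exists>y. pr (sg n) y \<epsilon> A \<and> pr n (pr y x) \<epsilon> X)" for n x by auto
  then show ?thesis unfolding bad_def by simp
qed

text \<open>The relation may change from step to step of a descent. In \<open>pd_wf\<close> the
  section of \<open>X\<close> at a numeral compares the values of two successive representing
  functions.\<close>

definition wfd where
  "wfd v X \<longleftrightarrow> \<not> (\<exists>A. subset_of A v \<and> A \<noteq> emp \<and> bad A X)"

lemma defp_bad [defs_intro]: "deft t \<Longrightarrow> deft u \<Longrightarrow> defp (\<lambda>s. bad (t s) (u s))"
  by (rule defp_app2[where P = bad]) (unfold bad_def, intro defs_intro)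

lemma defp_wfd [defs_intro]: "deft t \<Longrightarrow> deft u \<Longrightarrow> defp (\<lambda>s. wfd (t s) (u s))"
  by (rule defp_app2[where P = wfd]) (unfold wfd_def, intro defs_intro)

text \<open>Two levels occur because homomorphisms between different graphs induce such maps;
  endomorphisms are the case \<open>w = v\<close>. Well-foundedness is to be preserved, not
  reflected.\<close>

definition morph where
  "morph w v H \<longleftrightarrow> (\<forall>X. subset_of X w \<longrightarrow> subset_of (H X) v \<and>
     (\<forall>m<8. H (opn m w X) = opn m v (H X)) \<and> (wfd w X \<longrightarrow> wfd v (H X)))"

lemma subset_ofD: "subset_of x y \<Longrightarrow> z \<epsilon> x \<Longrightarrow> z \<epsilon> y"
  by (simp add: subset_of_def)

lemma subset_of_refl [simp]: "subset_of x x"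
  by (simp add: subset_of_def)

lemma subset_of_opn [simp]: "subset_of (opn m v X) v"
  by (simp add: subset_of_def mem_opn)

lemma subset_of_Sep: "defp (\<lambda>s. P (s 0)) \<Longrightarrow> subset_of (Sep v P) v"
  by (simp add: subset_of_def mem_Sep)

lemma pr_neq: "pr x y \<noteq> x" "x \<noteq> pr x y" "pr x y \<noteq> y" "y \<noteq> pr x y"
proof -
  have *: "up x y \<epsilon> pr x y" "x \<epsilon> up x y" "y \<epsilon> up x y" by (auto simp: pr_def)
  show "pr x y \<noteq> x" "pr x y \<noteq> y" using * mem_asym by metis+
  then show "x \<noteq> pr x y" "y \<noteq> pr x y" by metis+
qed

definition cap where "cap X v = Sep X (\<lambda>t. t \<epsilon> v)"

lemma mem_cap [simp]: "t \<epsilon> cap X v \<longleftrightarrow> t \<epsilon> X \<and> t \<epsilon> v"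
  unfolding cap_def by (rule mem_Sep) (intro defs_intro)

lemma deft_cap [defs_intro]: "deft t \<Longrightarrow> deft u \<Longrightarrow> deft (\<lambda>s. cap (t s) (u s))"
  by (rule deft_app2[where f = cap]) (unfold cap_def, intro defs_intro)

text \<open>At a point of \<open>V_l\<close> each operation looks up \<open>X\<close> only at points
  of \<open>V_l\<close>: a limit level is transitive and closed under pairs and their
  components.\<close>

lemma opc_cap:
  assumes "lim l" "t \<epsilon> Vs l" "m < 8"
  shows "opc m (cap X (Vs l)) t \<longleftrightarrow> opc m X t"
proof -
  have p: "pr x y \<epsilon> Vs l \<longleftrightarrow> x \<epsilon> Vs l \<and> y \<epsilon> Vs l" for x y by (rule Vs_lim_pr[OF assms(1)])
  have z: "z \<epsilon> Vs l" if "z \<epsilon> x" "x \<epsilon> Vs l" for x z using Vs_tr that .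
  consider "m = 0" | "m = 1" | "m = 2" | "m = 3" | "m = 4" | "m = 5" | "m = 6" | "m = 7"
    using assms(3) by linarith
  then show ?thesis
    by cases (use assms(2) in \<open>auto simp: opc_simps p, blast intro: z\<close>)
qed

lemma Vs_subset: "Ord g \<Longrightarrow> l \<epsilon> g \<or> l = g \<Longrightarrow> subset_of (Vs l) (Vs g)"
  using Vs_mono by (auto simp: subset_of_def)

lemma wfd_cap: "subset_of v w \<Longrightarrow> wfd w X \<Longrightarrow> wfd v (cap X v)"
  unfolding wfd_def bad_iff subset_of_def by (metis mem_cap)

text \<open>Both components of every entry of a bad \<open>A\<close> also occur in an element of
  \<open>X\<close>, so that a counterexample cannot leave \<open>V_l\<close>.\<close>

lemma wfd_larger:
  assumes "lim l" "subset_of X (Vs l)" "wfd (Vs l) X"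
  shows "wfd w X"
  unfolding wfd_def
proof
  assume "\<exists>A. subset_of A w \<and> A \<noteq> emp \<and> bad A X"
  then obtain A where A: "A \<noteq> emp" "bad A X" by blast
  have "p \<epsilon> Vs l" if p: "p \<epsilon> A" for p
  proof -
    obtain n x y where "p = pr n x" "pr n (pr y x) \<epsilon> X" using A(2) p unfolding bad_iff by blast
    moreover have "pr n (pr y x) \<epsilon> Vs l" using calculation(2) assms(2) by (simp add: subset_of_def)
    ultimately show ?thesis by (simp add: Vs_lim_pr[OF assms(1)])
  qed
  then have "subset_of A (Vs l)" by (simp add: subset_of_def)
  then show False using A assms(3) unfolding wfd_def by blast
qed

lemma morph_cap:
  assumes "lim l" "lim g" "l \<epsilon> g \<or> l = g"
  shows "morph (Vs g) (Vs l) (\<lambda>X. cap X (Vs l))"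
  unfolding morph_def
proof (intro allI impI conjI)
  have s: "subset_of (Vs l) (Vs g)" using Vs_subset lim_Ord assms by blast
  fix X assume "subset_of X (Vs g)"
  show "subset_of (cap X (Vs l)) (Vs l)" by (simp add: subset_of_def)
  show "cap (opn m (Vs g) X) (Vs l) = opn m (Vs l) (cap X (Vs l))" if "m < 8" for m
    by (rule set_ext) (use s opc_cap[OF assms(1) _ that] in \<open>auto simp: mem_opn subset_of_def\<close>)
  show "wfd (Vs l) (cap X (Vs l))" if "wfd (Vs g) X" using wfd_cap[OF s that] .
qed

section \<open>Morphisms between levels\<close>

context
  fixes l g H
  assumes l: "lim l" and g: "lim g" and H: "morph (Vs g) (Vs l) H"
begin

lemma H_sub: "subset_of X (Vs g) \<Longrightarrow> t \<epsilon> H X \<Longrightarrow> t \<epsilon> Vs l"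
  using H unfolding morph_def subset_of_def by blast

lemma H_op: "subset_of X (Vs g) \<Longrightarrow> m < 8 \<Longrightarrow> H (opn m (Vs g) X) = opn m (Vs l) (H X)"
  using H unfolding morph_def by blast

lemma H_wfd: "subset_of X (Vs g) \<Longrightarrow> wfd (Vs g) X \<Longrightarrow> wfd (Vs l) (H X)"
  using H unfolding morph_def by blast

text \<open>The operations are unary, so \<open>X\<close> and \<open>Y\<close> are packed into one
  set \<open>W\<close>. The codes \<open>(x, x)\<close> and \<open>((y, y), y)\<close> never
  coincide, because a pair differs from its components.\<close>

lemma H_nand:
  assumes X: "subset_of X (Vs g)" and Y: "subset_of Y (Vs g)"
    and Z: "\<And>t. t \<epsilon> Z \<longleftrightarrow> t \<epsilon> Vs g \<and> \<not> (t \<epsilon> X \<and> t \<epsilon> Y)"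
  shows "t \<epsilon> H Z \<longleftrightarrow> t \<epsilon> Vs l \<and> \<not> (t \<epsilon> H X \<and> t \<epsilon> H Y)"
proof -
  define W where "W = Sep (Vs g) (\<lambda>p. (\<exists>x. x \<epsilon> X \<and> p = pr x x) \<or> (\<exists>y. y \<epsilon> Y \<and> p = pr (pr y y) y))"
  have W: "p \<epsilon> W \<longleftrightarrow> p \<epsilon> Vs g \<and> ((\<exists>x. x \<epsilon> X \<and> p = pr x x) \<or> (\<exists>y. y \<epsilon> Y \<and> p = pr (pr y y) y))" for p
    unfolding W_def by (rule mem_Sep) (intro defs_intro)
  have Ws: "subset_of W (Vs g)" by (simp add: subset_of_def W)
  note p = Vs_lim_pr[OF g]
  have w: "pr t t \<epsilon> W \<longleftrightarrow> t \<epsilon> X" "pr (pr t t) t \<epsilon> W \<longleftrightarrow> t \<epsilon> Y" for t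
    using subset_ofD[OF X] subset_ofD[OF Y] by (auto simp: W p pr_neq)
  have 1: "opn 2 (Vs g) W = X"
    by (rule set_ext) (use subset_ofD[OF X] in \<open>auto simp: mem_opn opc_simps w\<close>)
  have 2: "opn 3 (Vs g) W = Y"
    by (rule set_ext) (use subset_ofD[OF Y] in \<open>auto simp: mem_opn opc_simps w\<close>)
  have 3: "opn 6 (Vs g) W = Z"
    by (rule set_ext) (auto simp: mem_opn opc_simps w Z)
  have "t \<epsilon> H Z \<longleftrightarrow> t \<epsilon> opn 6 (Vs l) (H W)" using H_op[OF Ws, of 6] 3 by simp
  also have "\<dots> \<longleftrightarrow> t \<epsilon> Vs l \<and> \<not> (t \<epsilon> opn 2 (Vs l) (H W) \<and> t \<epsilon> opn 3 (Vs l) (H W))"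
    by (auto simp: mem_opn opc_simps)
  also have "\<dots> \<longleftrightarrow> t \<epsilon> Vs l \<and> \<not> (t \<epsilon> H X \<and> t \<epsilon> H Y)"
    using H_op[OF Ws, of 2] H_op[OF Ws, of 3] 1 2 by simp
  finally show ?thesis .
qed

text \<open>Read: \<open>P\<close> holds almost everywhere with respect to the seed
  \<open>t\<close>. The lemmas that follow are the laws of an ultrafilter, in terms of
  predicates.\<close>

definition hh where "hh P t \<longleftrightarrow> t \<epsilon> H (Sep (Vs g) P)"

lemma hh_V: "defp (\<lambda>s. P (s 0)) \<Longrightarrow> hh P t \<Longrightarrow> t \<epsilon> Vs l"
  unfolding hh_def using H_sub subset_of_Sep by blast

lemma hh_neg:
  assumes P: "defp (\<lambda>s. P (s 0))"
  shows "hh (\<lambda>t. \<not> P t) t \<longleftrightarrow> t \<epsilon> Vs l \<and> \<not> hh P t"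
proof -
  have "t \<epsilon> Sep (Vs g) (\<lambda>t. \<not> P t) \<longleftrightarrow> t \<epsilon> Vs g \<and> \<not> (t \<epsilon> Sep (Vs g) P \<and> t \<epsilon> Sep (Vs g) P)" for t
    using mem_Sep[OF P] mem_Sep[OF defp_neg[OF P]] by blast
  from H_nand[OF subset_of_Sep[OF P] subset_of_Sep[OF P] this] show ?thesis
    unfolding hh_def by blast
qed

lemma hh_conj:
  assumes P: "defp (\<lambda>s. P (s 0))" and Q: "defp (\<lambda>s. Q (s 0))"
  shows "hh (\<lambda>t. P t \<and> Q t) t \<longleftrightarrow> hh P t \<and> hh Q t"
proof -
  have PQ: "defp (\<lambda>s. \<not> (P (s 0) \<and> Q (s 0)))" by (intro defs_intro P Q)
  have "t \<epsilon> Sep (Vs g) (\<lambda>t. \<not> (P t \<and> Q t)) \<longleftrightarrow> t \<epsilon> Vs g \<and> \<not> (t \<epsilon> Sep (Vs g) P \<and> t \<epsilon> Sep (Vs g) Q)" for t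
    using mem_Sep[OF P] mem_Sep[OF Q] mem_Sep[OF PQ] by blast
  from H_nand[OF subset_of_Sep[OF P] subset_of_Sep[OF Q] this]
  have "hh (\<lambda>t. \<not> (P t \<and> Q t)) t \<longleftrightarrow> t \<epsilon> Vs l \<and> \<not> (hh P t \<and> hh Q t)"
    unfolding hh_def by blast
  moreover have "hh (\<lambda>t. \<not> (P t \<and> Q t)) t \<longleftrightarrow> t \<epsilon> Vs l \<and> \<not> hh (\<lambda>t. P t \<and> Q t) t"
    by (rule hh_neg) (intro defs_intro P Q)
  ultimately show ?thesis using hh_V[OF P] hh_V[of "\<lambda>t. P t \<and> Q t"] defp_conj[OF P Q] by blast
qed

lemma hh_cong:
  assumes P: "defp (\<lambda>s. P (s 0))" and Q: "defp (\<lambda>s. Q (s 0))" and "\<And>t. t \<epsilon> Vs g \<Longrightarrow> P t \<longleftrightarrow> Q t"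
  shows "hh P t \<longleftrightarrow> hh Q t"
proof -
  have "Sep (Vs g) P = Sep (Vs g) Q"
    by (rule set_ext) (use assms in \<open>auto simp: mem_Sep[OF P] mem_Sep[OF Q]\<close>)
  then show ?thesis by (simp add: hh_def)
qed

lemma hh_mono:
  assumes P: "defp (\<lambda>s. P (s 0))" and Q: "defp (\<lambda>s. Q (s 0))" and "\<And>t. t \<epsilon> Vs g \<Longrightarrow> P t \<Longrightarrow> Q t"
    and "hh P t"
  shows "hh Q t"
proof -
  have "hh (\<lambda>t. P t \<and> Q t) t \<longleftrightarrow> hh P t"
    by (rule hh_cong) (use assms in \<open>auto intro: P defp_conj[OF P Q]\<close>)
  then show ?thesis using hh_conj[OF P Q] assms(4) by blast
qed

lemma hh_true:
  assumes P: "defp (\<lambda>s. P (s 0))" and "\<And>t. t \<epsilon> Vs g \<Longrightarrow> P t" and "t \<epsilon> Vs l"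
  shows "hh P t"
proof (rule ccontr)
  assume "\<not> hh P t"
  then have "hh (\<lambda>t. \<not> P t) t" using hh_neg[OF P] assms(3) by blast
  then have "hh P t" by (rule hh_mono[OF defp_neg[OF P] P, rotated]) (use assms in blast)
  then show False using \<open>\<not> hh P t\<close> by blast
qed

lemma hh_op:
  assumes P: "defp (\<lambda>s. P (s 0))" and m: "m < 8"
    and Q: "defp (\<lambda>s. Q (s 0))" "\<And>t. t \<epsilon> Vs g \<Longrightarrow> Q t \<longleftrightarrow> opc m (Sep (Vs g) P) t"
  shows "hh Q t \<longleftrightarrow> t \<epsilon> Vs l \<and> opc m (H (Sep (Vs g) P)) t"
proof -
  have "Sep (Vs g) Q = opn m (Vs g) (Sep (Vs g) P)"
    by (rule set_ext) (use Q(2) in \<open>auto simp: mem_opn mem_Sep[OF Q(1)]\<close>)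
  then show ?thesis
    unfolding hh_def by (simp add: H_op[OF subset_of_Sep[OF P] m] mem_opn)
qed

text \<open>Operation 7 acts on pairs, so \<open>P\<close> is lifted by operation 1 to pairs with
  the dummy first component \<open>emp\<close>; applying 1 after the quantifier gives the same set
  as applying 7 after the lifting. The outcome says that a seed behaves like a set with its true
  elements.\<close>

lemma hh_dia:
  assumes P: "defp (\<lambda>s. P (s 0))"
  shows "hh (\<lambda>x. \<exists>z. z \<epsilon> x \<and> P z) b \<longleftrightarrow> b \<epsilon> Vs l \<and> (\<exists>z. z \<epsilon> b \<and> hh P z)"
proof (cases "b \<epsilon> Vs l")
  case True
  note dP = defp_app1[OF P]
  have d: "defp (\<lambda>s. \<exists>x y. s 0 = pr x y \<and> P y)" "defp (\<lambda>s. \<exists>z. z \<epsilon> s 0 \<and> P z)"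
    "defp (\<lambda>s. \<exists>y x. s 0 = pr y x \<and> (\<exists>z. z \<epsilon> x \<and> P z))" by (intro defs_intro dP)+
  note p = Vs_lim_pr[OF g] and p' = Vs_lim_pr[OF l]
  have e: "emp \<epsilon> Vs l" using emp_in_Vs[OF l] .
  have tr: "z \<epsilon> Vs g" if "z \<epsilon> x" "x \<epsilon> Vs g" for x z using Vs_tr that .
  have tr': "z \<epsilon> Vs l" if "z \<epsilon> x" "x \<epsilon> Vs l" for x z using Vs_tr that .
  have 1: "hh (\<lambda>t. \<exists>x y. t = pr x y \<and> P y) t \<longleftrightarrow> t \<epsilon> Vs l \<and> opc 1 (H (Sep (Vs g) P)) t" for t
    by (rule hh_op[OF P _ d(1)]) (auto simp: opc_simps mem_Sep[OF P] p)
  have 2: "hh (\<lambda>t. \<exists>y x. t = pr y x \<and> (\<exists>z. z \<epsilon> x \<and> P z)) (pr emp b) \<longleftrightarrow>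
      pr emp b \<epsilon> Vs l \<and> opc 7 (H (Sep (Vs g) (\<lambda>t. \<exists>x y. t = pr x y \<and> P y))) (pr emp b)"
    by (rule hh_op[OF d(1) _ d(3)]) (auto simp: opc_simps mem_Sep[OF d(1)] p, blast intro: tr)
  have 3: "hh (\<lambda>t. \<exists>y x. t = pr y x \<and> (\<exists>z. z \<epsilon> x \<and> P z)) (pr emp b) \<longleftrightarrow>
      pr emp b \<epsilon> Vs l \<and> opc 1 (H (Sep (Vs g) (\<lambda>x. \<exists>z. z \<epsilon> x \<and> P z))) (pr emp b)"
    by (rule hh_op[OF d(2) _ d(3)]) (auto simp: opc_simps mem_Sep[OF d(2)] p)
  have "hh (\<lambda>x. \<exists>z. z \<epsilon> x \<and> P z) b \<longleftrightarrow> (\<exists>z. z \<epsilon> b \<and> pr emp z \<epsilon> H (Sep (Vs g) (\<lambda>t. \<exists>x y. t = pr x y \<and> P y)))"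
    using 2 3 True e by (simp add: opc_simps p' hh_def)
  also have "\<dots> \<longleftrightarrow> (\<exists>z. z \<epsilon> b \<and> hh P z)"
    using 1 True e tr' by (simp add: opc_simps p' hh_def) blast
  finally show ?thesis using True by blast
next
  case False
  have "defp (\<lambda>s. \<exists>z. z \<epsilon> s 0 \<and> P z)" by (intro defs_intro defp_app1[OF P])
  from hh_V[OF this] show ?thesis using False by blast
qed

text \<open>The analogue of \<open>j(m) \<ge> m\<close>. A set in \<open>V_m\<close> is included in
  some earlier \<open>V_b\<close>; a failure of this inclusion is a bounded existential statement,
  which \<open>hh_dia\<close> reduces to the elements, where the induction hypothesis
  applies.\<close>

lemma Vs_le_H:
  assumes m: "Ord m" "m \<epsilon> l \<or> m = l" and a: "a \<epsilon> Vs m"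
    and dH: "deft (\<lambda>s. H (s 0))"
  shows "hh (\<lambda>x. x \<epsilon> Vs m) a"
proof -
  have dhh: "defp (\<lambda>s. hh (\<lambda>x. x \<epsilon> Vs (t s)) (u s))" if t: "deft t" and u: "deft u" for t u
    by (rule defp_app2[where P = "\<lambda>m a. hh (\<lambda>x. x \<epsilon> Vs m) a", OF _ t u])
      (unfold hh_def, intro defs_intro deft_app1[OF dH])
  have d: "defp (\<lambda>s. (s 0 \<epsilon> l \<or> s 0 = l) \<longrightarrow> (\<forall>a. a \<epsilon> Vs (s 0) \<longrightarrow> hh (\<lambda>x. x \<epsilon> Vs (s 0)) a))"
    by (intro defs_intro dhh)
  have ol: "Ord l" using l by (rule lim_Ord)
  have "(m \<epsilon> l \<or> m = l) \<longrightarrow> (\<forall>a. a \<epsilon> Vs m \<longrightarrow> hh (\<lambda>x. x \<epsilon> Vs m) a)"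
  proof (rule Ord_induct[OF d m(1)], intro impI allI)
    fix m a
    assume m: "Ord m" "m \<epsilon> l \<or> m = l" and a: "a \<epsilon> Vs m"
      and IH: "\<forall>b. b \<epsilon> m \<longrightarrow> b \<epsilon> l \<or> b = l \<longrightarrow> (\<forall>a. a \<epsilon> Vs b \<longrightarrow> hh (\<lambda>x. x \<epsilon> Vs b) a)"
    obtain b where b: "b \<epsilon> m" "subset_of a (Vs b)" using a mem_Vs[of a m] by blast
    have bl: "b \<epsilon> l" using b(1) m(2) Ord_trans[OF ol] by blast
    have al: "a \<epsilon> Vs l" using Vs_mono[OF ol _ a] m(2) a by blast
    have d1: "defp (\<lambda>s. s 0 \<epsilon> Vs b)" "defp (\<lambda>s. \<not> s 0 \<epsilon> Vs b)" "defp (\<lambda>s. \<exists>z. z \<epsilon> s 0 \<and> \<not> z \<epsilon> Vs b)"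
      "defp (\<lambda>s. \<not> (\<exists>z. z \<epsilon> s 0 \<and> \<not> z \<epsilon> Vs b))" "defp (\<lambda>s. s 0 \<epsilon> Vs m)" by (intro defs_intro)+
    have "\<not> hh (\<lambda>x. \<not> x \<epsilon> Vs b) z" if "z \<epsilon> a" for z
      using IH b bl that unfolding hh_neg[OF d1(1)] by (auto simp: subset_of_def)
    then have "hh (\<lambda>x. \<not> (\<exists>z. z \<epsilon> x \<and> \<not> z \<epsilon> Vs b)) a"
      unfolding hh_neg[OF d1(3)] hh_dia[OF d1(2)] using al by blast
    then show "hh (\<lambda>x. x \<epsilon> Vs m) a"
      by (rule hh_mono[OF d1(4,5), rotated]) (use b(1) mem_Vs[of _ m] in \<open>auto simp: subset_of_def\<close>)
  qed
  then show ?thesis using m a by blast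
qed

end

text \<open>The maps \<open>h\<close> are sets, so rigidity is a first-order property of
  \<open>l\<close>.\<close>

definition rigid where
  "rigid l \<longleftrightarrow> lim l \<and> (\<forall>h. maps h (Pow (Vs l)) (Pow (Vs l)) \<longrightarrow> morph (Vs l) (Vs l) (app h) \<longrightarrow>
     (\<forall>X. subset_of X (Vs l) \<longrightarrow> app h X = X))"

text \<open>By \<open>Vs_le_H\<close> all of \<open>V_l\<close> is contained in
  \<open>H(V_l)\<close>, so \<open>H\<close> commutes with intersection with \<open>V_l\<close>.
  Therefore its restriction to the power set of \<open>V_l\<close> is an endomorphism, hence the
  identity, and \<open>H X = H (X \<inter> V_l)\<close>.\<close>

lemma rigid_morph:
  assumes r: "rigid l" and g: "lim g" "l \<epsilon> g \<or> l = g"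
    and H: "morph (Vs g) (Vs l) H" and dH: "deft (\<lambda>s. H (s 0))" and X: "subset_of X (Vs g)"
  shows "H X = cap X (Vs l)"
proof -
  have l: "lim l" using r by (simp add: rigid_def)
  note c = l g(1) H
  define v where "v = Vs l"
  define w where "w = Vs g"
  have vw: "subset_of v w" unfolding v_def w_def using Vs_subset lim_Ord g by blast
  have dv: "defp (\<lambda>s. s 0 \<epsilon> v)" by (intro defs_intro)
  have HV: "t \<epsilon> H v" if "t \<epsilon> v" for t
  proof -
    have "hh g H (\<lambda>x. x \<epsilon> Vs l) t"
      using Vs_le_H[OF c lim_Ord[OF l] _ _ dH, of t] that v_def by blast
    moreover have "Sep (Vs g) (\<lambda>x. x \<epsilon> Vs l) = v"
      by (rule set_ext) (use vw mem_Sep[OF dv] in \<open>auto simp: v_def w_def subset_of_def\<close>)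
    ultimately show ?thesis by (simp add: hh_def[OF c])
  qed
  have Hcap: "t \<epsilon> H (cap Y v) \<longleftrightarrow> t \<epsilon> H Y \<and> t \<epsilon> v" if Y: "subset_of Y w" for t Y
  proof -
    have d: "defp (\<lambda>s. s 0 \<epsilon> Y)" by (intro defs_intro)
    have e: "Sep w (\<lambda>t. t \<epsilon> Y \<and> t \<epsilon> v) = cap Y v" "Sep w (\<lambda>t. t \<epsilon> Y) = Y" "Sep w (\<lambda>t. t \<epsilon> v) = v"
      using mem_Sep[OF defp_conj[OF d dv]] mem_Sep[OF d] mem_Sep[OF dv] Y vw
      by (auto intro!: set_ext simp: subset_of_def)
    have "t \<epsilon> H (cap Y v) \<longleftrightarrow> t \<epsilon> H Y \<and> t \<epsilon> H v"
      using hh_conj[OF c d dv, of t] unfolding hh_def[OF c] w_def[symmetric] e .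
    moreover have "t \<epsilon> H v \<longleftrightarrow> t \<epsilon> v"
      using HV H_sub[OF c, of v] vw unfolding v_def w_def by blast
    ultimately show ?thesis by blast
  qed
  define h where "h = lam (Pow v) H"
  have app_h: "app h Y = H Y" if "subset_of Y v" for Y
    unfolding h_def using that by (simp add: app_lam[OF dH])
  have sub: "subset_of Y w" if "subset_of Y v" for Y using that vw by (simp add: subset_of_def)
  have m: "subset_of (H Y) v" if "subset_of Y v" for Y
    using H sub[OF that] unfolding morph_def v_def w_def by blast
  have "maps h (Pow v) (Pow v)"
    unfolding h_def by (rule maps_lam[OF dH]) (simp add: m)
  moreover have "morph v v (app h)"
    unfolding morph_def
  proof (intro allI impI conjI)
    fix Y assume Y: "subset_of Y v"
    show "subset_of (app h Y) v" using m[OF Y] app_h[OF Y] by simp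
    show "app h (opn i v Y) = opn i v (app h Y)" if i: "i < 8" for i
    proof -
      have e: "opn i v Y = cap (opn i w Y) v"
      proof (rule set_ext)
        fix t
        show "t \<epsilon> opn i v Y \<longleftrightarrow> t \<epsilon> cap (opn i w Y) v"
          using vw by (auto simp: mem_opn subset_of_def)
      qed
      have "t \<epsilon> H (cap (opn i w Y) v) \<longleftrightarrow> t \<epsilon> opn i v (H Y)" for t
        using Hcap[of "opn i w Y"] H_op[OF c, of Y i] sub[OF Y] i
        by (auto simp: v_def w_def mem_opn)
      then have "H (cap (opn i w Y) v) = opn i v (H Y)" by (rule set_ext)
      then show ?thesis unfolding app_h[OF Y] app_h[OF subset_of_opn] e[symmetric] .
    qed
    show "wfd v (app h Y)" if "wfd v Y"
      using H_wfd[OF c, of Y] wfd_larger[OF l, of Y w] Y sub[OF Y] that app_h[OF Y]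
      by (simp add: v_def w_def)
  qed
  ultimately have id: "app h Y = Y" if "subset_of Y v" for Y
    using r that unfolding rigid_def v_def by blast
  have "t \<epsilon> H X \<longleftrightarrow> t \<epsilon> cap X v" for t
  proof -
    have "H (cap X v) = cap X v" using id[of "cap X v"] app_h[of "cap X v"] by (simp add: subset_of_def)
    moreover have "t \<epsilon> v" if "t \<epsilon> H X" using H_sub[OF c X that] by (simp add: v_def)
    ultimately show ?thesis using Hcap[of X t] X unfolding w_def by auto
  qed
  then show ?thesis by (auto intro: set_ext simp: v_def)
qed

end

context ZFC
begin

lemma definable_class_UNIV: "definable_class UNIV"
  by (simp add: definable_class_iff defp_const)

section \<open>The ultrapower of an endomorphism\<close>

context
  fixes l H
  assumes l: "lim l" and H: "morph (Vs l) (Vs l) H" and dH: "deft (\<lambda>s. H (s 0))"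
begin

text \<open>
  A seed \<open>a \<in> V_l\<close> stands for the ultrafilter of all \<open>X\<close> with \<open>a \<in> H(X)\<close>; in \<open>h1\<close>, \<open>h2\<close>, \<open>h3\<close>
  a property holds almost everywhere with respect to one, two or three seeds.
\<close>

definition "h1 = hh l H"
definition "h2 R a b \<longleftrightarrow> h1 (\<lambda>t. \<exists>x y. t = pr x y \<and> R x y) (pr a b)"
definition "h3 R a b c \<longleftrightarrow> h2 (\<lambda>u z. \<exists>x y. u = pr x y \<and> R x y z) (pr a b) c"

lemmas p_iff = Vs_lim_pr[OF l]

lemma defp_h1:
  "defp (\<lambda>s. P (\<lambda>i. s (Suc i)) (s 0)) \<Longrightarrow> deft t \<Longrightarrow> defp (\<lambda>s. h1 (P s) (t s))"
  unfolding h1_def hh_def[OF l l H] by (intro defp_mem deft_app1[OF dH] deft_Sep deft_Vs deft_const)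

lemmas h1_neg = hh_neg[OF l l H, folded h1_def]
lemmas h1_conj = hh_conj[OF l l H, folded h1_def]
lemmas h1_mono = hh_mono[OF l l H, folded h1_def]
lemmas h1_cong = hh_cong[OF l l H, folded h1_def]
lemmas h1_true = hh_true[OF l l H, folded h1_def]
lemmas h1_op = hh_op[OF l l H, folded h1_def]
lemmas h1_V = hh_V[OF l l H, folded h1_def]
lemmas h1_dia = hh_dia[OF l l H, folded h1_def]

lemma h1_eq: "t \<epsilon> H (Sep (Vs l) P) \<longleftrightarrow> h1 P t"
  unfolding h1_def hh_def[OF l l H] ..

lemma defp_pairs: "defp (\<lambda>s. R (s 0) (s 1)) \<Longrightarrow> defp (\<lambda>s. \<exists>x y. s 0 = pr x y \<and> R x y)"
proof -
  assume R: "defp (\<lambda>s. R (s 0) (s 1))"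
  show ?thesis by (intro defs_intro defp_app2[OF R])
qed

lemma h2_V: "defp (\<lambda>s. R (s 0) (s 1)) \<Longrightarrow> h2 R a b \<Longrightarrow> a \<epsilon> Vs l \<and> b \<epsilon> Vs l"
  unfolding h2_def using h1_V[OF defp_pairs] p_iff by blast

lemma h2_conj:
  assumes R: "defp (\<lambda>s. R (s 0) (s 1))" and S: "defp (\<lambda>s. S (s 0) (s 1))"
  shows "h2 (\<lambda>x y. R x y \<and> S x y) a b \<longleftrightarrow> h2 R a b \<and> h2 S a b"
proof -
  have "h1 (\<lambda>t. \<exists>x y. t = pr x y \<and> R x y \<and> S x y) (pr a b) \<longleftrightarrow>
     h1 (\<lambda>t. (\<exists>x y. t = pr x y \<and> R x y) \<and> (\<exists>x y. t = pr x y \<and> S x y)) (pr a b)"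
    by (rule h1_cong) (auto intro!: defp_conj defp_pairs[OF R] defp_pairs[OF S] defs_intro
        defp_app2[OF R] defp_app2[OF S])
  then show ?thesis unfolding h2_def using h1_conj[OF defp_pairs[OF R] defp_pairs[OF S]] by blast
qed

lemma h2_mono:
  assumes R: "defp (\<lambda>s. R (s 0) (s 1))" and S: "defp (\<lambda>s. S (s 0) (s 1))"
    and RS: "\<And>x y. x \<epsilon> Vs l \<Longrightarrow> y \<epsilon> Vs l \<Longrightarrow> R x y \<Longrightarrow> S x y" and h: "h2 R a b"
  shows "h2 S a b"
  unfolding h2_def
  by (rule h1_mono[OF defp_pairs[OF R] defp_pairs[OF S] _ h[unfolded h2_def]])
    (use RS in \<open>auto simp: p_iff\<close>)

lemma h1_pair:
  assumes ab: "a \<epsilon> Vs l" "b \<epsilon> Vs l"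
  shows "h1 (\<lambda>t. \<exists>x y. t = pr x y \<and> x \<epsilon> Vs l) (pr a b)"
proof -
  have d: "defp (\<lambda>s. \<exists>x y. s 0 = pr x y \<and> x \<epsilon> Vs l)" "defp (\<lambda>s. s 0 \<epsilon> Vs l)" by (intro defs_intro)+
  have "h1 (\<lambda>t. \<exists>x y. t = pr x y \<and> x \<epsilon> Vs l) (pr a b) \<longleftrightarrow>
      pr a b \<epsilon> Vs l \<and> opc 0 (H (Sep (Vs l) (\<lambda>x. x \<epsilon> Vs l))) (pr a b)"
    by (rule h1_op[OF d(2) _ d(1)]) (auto simp: opc_simps mem_Sep[OF d(2)] p_iff)
  moreover have "h1 (\<lambda>x. x \<epsilon> Vs l) a" by (rule h1_true[OF d(2)]) (use ab in auto)
  ultimately show ?thesis using ab by (simp add: p_iff opc_simps h1_eq)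
qed

lemma h2_true:
  assumes R: "defp (\<lambda>s. R (s 0) (s 1))" and RT: "\<And>x y. x \<epsilon> Vs l \<Longrightarrow> y \<epsilon> Vs l \<Longrightarrow> R x y"
    and ab: "a \<epsilon> Vs l" "b \<epsilon> Vs l"
  shows "h2 R a b"
proof -
  have d: "defp (\<lambda>s. \<exists>x y. s 0 = pr x y \<and> x \<epsilon> Vs l)" by (intro defs_intro)
  show ?thesis unfolding h2_def
    by (rule h1_mono[OF d defp_pairs[OF R] _ h1_pair[OF ab]]) (use RT in \<open>auto simp: p_iff\<close>)
qed

text \<open>The negation inside \<open>h1\<close> also holds at points that are no pairs. These are
  negligible for the seed \<open>(a, b)\<close> by \<open>h1_pair\<close>.\<close>

lemma h2_neg:
  assumes R: "defp (\<lambda>s. R (s 0) (s 1))" and ab: "a \<epsilon> Vs l" "b \<epsilon> Vs l"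
  shows "h2 (\<lambda>x y. \<not> R x y) a b \<longleftrightarrow> \<not> h2 R a b"
proof -
  have R': "defp (\<lambda>s. \<not> R (s 0) (s 1))" by (intro defs_intro R)
  have d: "defp (\<lambda>s. \<exists>x y. s 0 = pr x y \<and> x \<epsilon> Vs l)" by (intro defs_intro)
  have V: "pr a b \<epsilon> Vs l" using ab by (simp add: p_iff)
  have "h2 (\<lambda>x y. \<not> R x y) a b \<longleftrightarrow>
      h1 (\<lambda>t. \<not> (\<exists>x y. t = pr x y \<and> R x y) \<and> (\<exists>x y. t = pr x y \<and> x \<epsilon> Vs l)) (pr a b)"
    unfolding h2_def
    by (rule h1_cong[OF defp_pairs[OF R'] defp_conj[OF defp_neg[OF defp_pairs[OF R]] d]]) (auto simp: p_iff)
  also have "\<dots> \<longleftrightarrow> \<not> h2 R a b"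
    unfolding h1_conj[OF defp_neg[OF defp_pairs[OF R]] d] h1_neg[OF defp_pairs[OF R]] h2_def
    using V h1_pair[OF ab] by blast
  finally show ?thesis .
qed

lemma h2_fst:
  assumes P: "defp (\<lambda>s. P (s 0))" and ab: "a \<epsilon> Vs l" "b \<epsilon> Vs l"
  shows "h2 (\<lambda>x y. P x) a b \<longleftrightarrow> h1 P a"
proof -
  have d: "defp (\<lambda>s. \<exists>x y. s 0 = pr x y \<and> P x)" by (intro defs_intro defp_app1[OF P])
  have "h1 (\<lambda>t. \<exists>x y. t = pr x y \<and> P x) (pr a b) \<longleftrightarrow> pr a b \<epsilon> Vs l \<and> opc 0 (H (Sep (Vs l) P)) (pr a b)"
    by (rule h1_op[OF P _ d]) (auto simp: opc_simps mem_Sep[OF P] p_iff)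
  then show ?thesis using ab by (simp add: p_iff opc_simps h1_eq h2_def)
qed

lemma h2_snd:
  assumes P: "defp (\<lambda>s. P (s 0))" and ab: "a \<epsilon> Vs l" "b \<epsilon> Vs l"
  shows "h2 (\<lambda>x y. P y) a b \<longleftrightarrow> h1 P b"
proof -
  have d: "defp (\<lambda>s. \<exists>x y. s 0 = pr x y \<and> P y)" by (intro defs_intro defp_app1[OF P])
  have "h1 (\<lambda>t. \<exists>x y. t = pr x y \<and> P y) (pr a b) \<longleftrightarrow> pr a b \<epsilon> Vs l \<and> opc 1 (H (Sep (Vs l) P)) (pr a b)"
    by (rule h1_op[OF P _ d]) (auto simp: opc_simps mem_Sep[OF P] p_iff)
  then show ?thesis using ab by (simp add: p_iff opc_simps h1_eq h2_def)
qed

lemma h2_diag: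
  assumes R: "defp (\<lambda>s. R (s 0) (s 1))" and a: "a \<epsilon> Vs l"
  shows "h2 R a a \<longleftrightarrow> h1 (\<lambda>x. R x x) a"
proof -
  have d: "defp (\<lambda>s. R (s 0) (s 0))" by (intro defp_app2[OF R] defs_intro)
  have "h1 (\<lambda>t. R t t) a \<longleftrightarrow> a \<epsilon> Vs l \<and> opc 2 (H (Sep (Vs l) (\<lambda>t. \<exists>x y. t = pr x y \<and> R x y))) a"
    by (rule h1_op[OF defp_pairs[OF R] _ d]) (auto simp: opc_simps mem_Sep[OF defp_pairs[OF R]] p_iff)
  then show ?thesis using a by (simp add: p_iff opc_simps h1_eq h2_def)
qed

text \<open>A quantifier bounded by the second coordinate becomes a true quantifier over the
  elements of the seed \<open>b\<close>. This is what makes the elements of \<open>V_l\<close>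
  represent themselves in \<open>pi_id\<close>.\<close>

lemma h2_Q:
  assumes R: "defp (\<lambda>s. R (s 0) (s 1))" and ab: "a \<epsilon> Vs l" "b \<epsilon> Vs l"
  shows "h2 (\<lambda>y x. \<exists>z. z \<epsilon> x \<and> R y z) a b \<longleftrightarrow> (\<exists>z. z \<epsilon> b \<and> h2 R a z)"
proof -
  have d: "defp (\<lambda>s. \<exists>y x. s 0 = pr y x \<and> (\<exists>z. z \<epsilon> x \<and> R y z))"
    by (intro defs_intro defp_app2[OF R])
  have tr: "z \<epsilon> Vs l" if "z \<epsilon> x" "x \<epsilon> Vs l" for x z using Vs_tr that .
  have "h1 (\<lambda>t. \<exists>y x. t = pr y x \<and> (\<exists>z. z \<epsilon> x \<and> R y z)) (pr a b) \<longleftrightarrow>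
      pr a b \<epsilon> Vs l \<and> opc 7 (H (Sep (Vs l) (\<lambda>t. \<exists>x y. t = pr x y \<and> R x y))) (pr a b)"
    by (rule h1_op[OF defp_pairs[OF R] _ d])
      (auto simp: opc_simps mem_Sep[OF defp_pairs[OF R]] p_iff, blast intro: tr)
  then show ?thesis using ab by (simp add: p_iff opc_simps h1_eq h2_def)
qed

lemma defp_triples:
  "defp (\<lambda>s. R (s 0) (s 1) (s 2)) \<Longrightarrow> defp (\<lambda>s. \<exists>x y. s 0 = pr x y \<and> R x y (s 1))"
proof -
  assume R: "defp (\<lambda>s. R (s 0) (s 1) (s 2))"
  show ?thesis by (intro defs_intro defp_app3[OF R])
qed

lemma h3_conj:
  assumes R: "defp (\<lambda>s. R (s 0) (s 1) (s 2))" and S: "defp (\<lambda>s. S (s 0) (s 1) (s 2))"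
    and "h3 R a b c" "h3 S a b c"
  shows "h3 (\<lambda>x y z. R x y z \<and> S x y z) a b c"
proof -
  have "h2 (\<lambda>u z. (\<exists>x y. u = pr x y \<and> R x y z) \<and> (\<exists>x y. u = pr x y \<and> S x y z)) (pr a b) c"
    using h2_conj[OF defp_triples[OF R] defp_triples[OF S]] assms(3,4) unfolding h3_def by blast
  then show ?thesis unfolding h3_def
    by (rule h2_mono[rotated 3]) (auto intro!: defs_intro defp_app3[OF R] defp_app3[OF S])
qed

lemma h3_mono:
  assumes R: "defp (\<lambda>s. R (s 0) (s 1) (s 2))" and S: "defp (\<lambda>s. S (s 0) (s 1) (s 2))"
    and RS: "\<And>x y z. x \<epsilon> Vs l \<Longrightarrow> y \<epsilon> Vs l \<Longrightarrow> z \<epsilon> Vs l \<Longrightarrow> R x y z \<Longrightarrow> S x y z" and h: "h3 R a b c"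
  shows "h3 S a b c"
  using h unfolding h3_def
  by (rule h2_mono[rotated 3]) (use RS in \<open>auto intro!: defs_intro defp_app3[OF R] defp_app3[OF S] simp: p_iff\<close>)

lemma h3_12:
  assumes R: "defp (\<lambda>s. R (s 0) (s 1))" and abc: "a \<epsilon> Vs l" "b \<epsilon> Vs l" "c \<epsilon> Vs l"
  shows "h3 (\<lambda>x y z. R x y) a b c \<longleftrightarrow> h2 R a b"
  using h2_fst[OF defp_pairs[OF R], of "pr a b" c] abc unfolding h3_def h2_def[of R] by (simp add: p_iff)

lemma h3_13:
  assumes R: "defp (\<lambda>s. R (s 0) (s 1))" and abc: "a \<epsilon> Vs l" "b \<epsilon> Vs l" "c \<epsilon> Vs l"
  shows "h3 (\<lambda>x y z. R x z) a b c \<longleftrightarrow> h2 R a c"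
proof -
  have d: "defp (\<lambda>s. \<exists>u z. s 0 = pr u z \<and> (\<exists>x y. u = pr x y \<and> R x z))" by (intro defs_intro defp_app2[OF R])
  have "h1 (\<lambda>t. \<exists>u z. t = pr u z \<and> (\<exists>x y. u = pr x y \<and> R x z)) (pr (pr a b) c) \<longleftrightarrow>
      pr (pr a b) c \<epsilon> Vs l \<and> opc 4 (H (Sep (Vs l) (\<lambda>t. \<exists>x y. t = pr x y \<and> R x y))) (pr (pr a b) c)"
    by (rule h1_op[OF defp_pairs[OF R] _ d]) (auto simp: opc_simps mem_Sep[OF defp_pairs[OF R]] p_iff)
  then show ?thesis using abc by (simp add: p_iff opc_simps h1_eq h2_def h3_def)
qed

lemma h3_23:
  assumes R: "defp (\<lambda>s. R (s 0) (s 1))" and abc: "a \<epsilon> Vs l" "b \<epsilon> Vs l" "c \<epsilon> Vs l"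
  shows "h3 (\<lambda>x y z. R y z) a b c \<longleftrightarrow> h2 R b c"
proof -
  have d: "defp (\<lambda>s. \<exists>u z. s 0 = pr u z \<and> (\<exists>x y. u = pr x y \<and> R y z))" by (intro defs_intro defp_app2[OF R])
  have "h1 (\<lambda>t. \<exists>u z. t = pr u z \<and> (\<exists>x y. u = pr x y \<and> R y z)) (pr (pr a b) c) \<longleftrightarrow>
      pr (pr a b) c \<epsilon> Vs l \<and> opc 5 (H (Sep (Vs l) (\<lambda>t. \<exists>x y. t = pr x y \<and> R x y))) (pr (pr a b) c)"
    by (rule h1_op[OF defp_pairs[OF R] _ d]) (auto simp: opc_simps mem_Sep[OF defp_pairs[OF R]] p_iff)
  then show ?thesis using abc by (simp add: p_iff opc_simps h1_eq h2_def h3_def)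
qed

lemma defp_02: "defp (\<lambda>s. R (s 0) (s 1)) \<Longrightarrow> defp (\<lambda>s. R (s 0) (s 2))"
  by (rule defp_app2) (auto intro: deft_var)
lemma defp_12: "defp (\<lambda>s. R (s 0) (s 1)) \<Longrightarrow> defp (\<lambda>s. R (s 1) (s 2))"
  by (rule defp_app2) (auto intro: deft_var)

text \<open>Both relations are combined at the triple of seeds; passing to its first and third
  coordinates leaves \<open>T\<close>.\<close>

lemma h2_trans:
  assumes R: "defp (\<lambda>s. R (s 0) (s 1))" and S: "defp (\<lambda>s. S (s 0) (s 1))" and T: "defp (\<lambda>s. T (s 0) (s 1))"
    and h: "h2 R a b" "h2 S b c"
    and RST: "\<And>x y z. x \<epsilon> Vs l \<Longrightarrow> y \<epsilon> Vs l \<Longrightarrow> z \<epsilon> Vs l \<Longrightarrow> R x y \<Longrightarrow> S y z \<Longrightarrow> T x z"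
  shows "h2 T a c"
proof -
  have abc: "a \<epsilon> Vs l" "b \<epsilon> Vs l" "c \<epsilon> Vs l" using h2_V[OF R h(1)] h2_V[OF S h(2)] by auto
  have "h3 (\<lambda>x y z. R x y \<and> S y z) a b c"
    by (rule h3_conj[OF R defp_12[OF S]]) (use h h3_12[OF R abc] h3_23[OF S abc] in auto)
  then have "h3 (\<lambda>x y z. T x z) a b c"
    by (rule h3_mono[OF defp_conj[OF R defp_12[OF S]] defp_02[OF T], rotated]) (use RST in auto)
  then show ?thesis using h3_13[OF T abc] by blast
qed

lemma h2_refl: "a \<epsilon> Vs l \<Longrightarrow> h2 (\<lambda>x y. x = y) a a"
proof -
  assume a: "a \<epsilon> Vs l"
  have d: "defp (\<lambda>s. s 0 = s 1)" "defp (\<lambda>s. s 0 = s 0)" by (intro defs_intro)+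
  show ?thesis unfolding h2_diag[OF d(1) a] by (rule h1_true[OF d(2) _ a]) simp
qed

text \<open>Exchanging coordinates is not among the operations. Instead, the triple
  \<open>(a, b, a)\<close> satisfies \<open>R x y\<close> and \<open>x = z\<close> almost
  everywhere, so its last two coordinates satisfy \<open>T\<close>.\<close>

lemma h2_sym:
  assumes R: "defp (\<lambda>s. R (s 0) (s 1))" and T: "defp (\<lambda>s. T (s 0) (s 1))" and h: "h2 R a b"
    and RT: "\<And>x y. x \<epsilon> Vs l \<Longrightarrow> y \<epsilon> Vs l \<Longrightarrow> R x y \<Longrightarrow> T y x"
  shows "h2 T b a"
proof -
  have ab: "a \<epsilon> Vs l" "b \<epsilon> Vs l" "a \<epsilon> Vs l" using h2_V[OF R h(1)] by auto
  have E: "defp (\<lambda>s. s 0 = s 1)" by (intro defs_intro)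
  have "h3 (\<lambda>x y z. R x y \<and> x = z) a b a"
    by (rule h3_conj[OF R defp_02[OF E]]) (use h h2_refl ab h3_12[OF R ab] h3_13[OF E ab] in auto)
  then have "h3 (\<lambda>x y z. T y z) a b a"
    by (rule h3_mono[OF defp_conj[OF R defp_02[OF E]] defp_12[OF T], rotated]) (use RT in auto)
  then show ?thesis using h3_23[OF T ab] by blast
qed

text \<open>The seed \<open>a\<close> is recovered from the seed \<open>(a, b)\<close> by
  projection; this brings two representatives to a common seed.\<close>

lemma h2_merge1: "a \<epsilon> Vs l \<Longrightarrow> b \<epsilon> Vs l \<Longrightarrow> h2 (\<lambda>t z. z = p1 t) (pr a b) a"
proof -
  assume ab: "a \<epsilon> Vs l" "b \<epsilon> Vs l"
  have E: "defp (\<lambda>s. s 0 = s 1)" by (intro defs_intro)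
  have "h3 (\<lambda>x y z. x = z) a b a" using h3_13[OF E ab ab(1)] h2_refl ab by blast
  then show ?thesis unfolding h3_def by (rule h2_mono[rotated 3]) (auto intro!: defs_intro)
qed

lemma h2_merge2: "a \<epsilon> Vs l \<Longrightarrow> b \<epsilon> Vs l \<Longrightarrow> h2 (\<lambda>t z. z = p2 t) (pr a b) b"
proof -
  assume ab: "a \<epsilon> Vs l" "b \<epsilon> Vs l"
  have E: "defp (\<lambda>s. s 0 = s 1)" by (intro defs_intro)
  have "h3 (\<lambda>x y z. y = z) a b b" using h3_23[OF E ab ab(2)] h2_refl ab by blast
  then show ?thesis unfolding h3_def by (rule h2_mono[rotated 3]) (auto intro!: defs_intro)
qed

text \<open>
  The pair \<open>(a, f)\<close> represents the element \<open>j(f)(a)\<close> of the ultrapower; \<open>mm\<close> and \<open>ee\<close> are membership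
  and equality of represented elements.
\<close>

definition "mm a f b g \<longleftrightarrow> h2 (\<lambda>x y. app f x \<epsilon> app g y) a b"
definition "ee a f b g \<longleftrightarrow> h2 (\<lambda>x y. app f x = app g y) a b"

lemma d_mm: "defp (\<lambda>s. app f (s 0) \<epsilon> app g (s 1))" and d_ee: "defp (\<lambda>s. app f (s 0) = app g (s 1))"
  by (intro defs_intro)+

lemma defp_mm: "deft t \<Longrightarrow> deft u \<Longrightarrow> deft v \<Longrightarrow> deft w \<Longrightarrow> defp (\<lambda>s. mm (t s) (u s) (v s) (w s))"
  by (rule defp_app4[where P = mm]) (unfold mm_def h2_def, intro defp_h1 defs_intro)

lemma defp_ee: "deft t \<Longrightarrow> deft u \<Longrightarrow> deft v \<Longrightarrow> deft w \<Longrightarrow> defp (\<lambda>s. ee (t s) (u s) (v s) (w s))"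
  by (rule defp_app4[where P = ee]) (unfold ee_def h2_def, intro defp_h1 defs_intro)

lemma mm_V: "mm a f b g \<Longrightarrow> a \<epsilon> Vs l \<and> b \<epsilon> Vs l"
  unfolding mm_def by (rule h2_V[OF d_mm])

lemma ee_sym: "ee a f b g \<Longrightarrow> ee b g a f"
  unfolding ee_def by (rule h2_sym[OF d_ee d_ee]) auto

lemma ee_trans: "ee a f b g \<Longrightarrow> ee b g c k \<Longrightarrow> ee a f c k"
  unfolding ee_def by (rule h2_trans[OF d_ee d_ee d_ee]) auto

lemma mm_ee: "mm a f b g \<Longrightarrow> ee b g c k \<Longrightarrow> mm a f c k"
  unfolding ee_def mm_def by (rule h2_trans[OF d_mm d_ee d_mm]) auto

lemma ee_mm: "ee a f b g \<Longrightarrow> mm b g c k \<Longrightarrow> mm a f c k"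
  unfolding ee_def mm_def by (rule h2_trans[OF d_ee d_mm d_mm]) auto

section \<open>Set-likeness and well-foundedness of membership in the ultrapower\<close>

definition "Rf f = un (sg emp) (Uni (Repl (Vs l) (app f)))"

text \<open>All representatives of members of a represented element form a proper class. Functions
  into \<open>Rf\<close> suffice by \<open>mm_restrict\<close>, and there is only a set of these;
  \<open>emp\<close> belongs to \<open>Rf\<close> as a default value.\<close>

definition "pd z = Sep (cross (Vs l) (Fun (Vs l) (Rf (p2 z)))) (\<lambda>q. mm (p1 q) (p2 q) (p1 z) (p2 z))"

lemma mem_Rf: "y \<epsilon> Rf f \<longleftrightarrow> y = emp \<or> (\<exists>x. x \<epsilon> Vs l \<and> y \<epsilon> app f x)"
proof -
  have "deft (\<lambda>s. app f (s 0))" by (intro defs_intro)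
  then show ?thesis unfolding Rf_def by (auto simp: mem_Repl)
qed

lemma deft_pd: "deft t \<Longrightarrow> deft (\<lambda>s. pd (t s))"
  by (rule deft_app1[where f = pd]) (unfold pd_def Rf_def, intro defs_intro defp_mm)

lemma mem_pd: "q \<epsilon> pd z \<longleftrightarrow> (\<exists>b g. q = pr b g \<and> b \<epsilon> Vs l \<and> maps g (Vs l) (Rf (p2 z)) \<and> mm b g (p1 z) (p2 z))"
proof -
  have "defp (\<lambda>s. mm (p1 (s 0)) (p2 (s 0)) (p1 z) (p2 z))" by (intro defs_intro defp_mm)
  from mem_Sep[OF this] show ?thesis unfolding pd_def by auto
qed

text \<open>Replacing the values of \<open>g\<close> outside of \<open>Rf f\<close> by
  \<open>emp\<close> changes \<open>g\<close> on a negligible set only.\<close>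

lemma mm_restrict:
  assumes m: "mm b g a f"
  shows "\<exists>g'. maps g' (Vs l) (Rf f) \<and> ee b g b g'"
proof -
  define k where "k y = (if app g y \<epsilon> Rf f then app g y else emp)" for y
  have dk: "deft (\<lambda>s. k (s 0))" unfolding k_def by (intro defs_intro)
  have "maps (lam (Vs l) k) (Vs l) (Rf f)"
    by (rule maps_lam[OF dk]) (auto simp: k_def mem_Rf)
  moreover have "ee b g b (lam (Vs l) k)"
  proof -
    have ab: "b \<epsilon> Vs l" "a \<epsilon> Vs l" using mm_V[OF m] by auto
    have d1: "defp (\<lambda>s. app g (s 0) \<epsilon> Rf f)" by (intro defs_intro)
    have "h2 (\<lambda>y x. app g y \<epsilon> Rf f) b a"
      using m unfolding mm_def by (rule h2_mono[rotated 3]) (auto intro!: defs_intro simp: mem_Rf)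
    then have "h1 (\<lambda>y. app g y \<epsilon> Rf f) b" using h2_fst[OF d1 ab] by blast
    then have "h1 (\<lambda>y. app g y = app (lam (Vs l) k) y) b"
      by (rule h1_mono[rotated 3]) (auto intro!: defs_intro simp: app_lam[OF dk] k_def)
    then show ?thesis unfolding ee_def h2_diag[OF d_ee ab(1)] .
  qed
  ultimately show ?thesis by blast
qed

text \<open>\<open>H\<close> fixes the Zermelo numerals; tagging the terms of a descending sequence by them contradicts \<open>wfd\<close>.\<close>

lemma pd_wf:
  assumes z0: "z0 \<epsilon> Z"
  shows "\<exists>x. x \<epsilon> Z \<and> (\<forall>y. y \<epsilon> pd x \<longrightarrow> \<not> y \<epsilon> Z)"
proof (rule ccontr)
  assume neg: "\<not> ?thesis"
  have "defp (\<lambda>s. s 1 \<epsilon> Z \<and> s 1 \<epsilon> pd (s 0))" by (intro defs_intro deft_pd)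
  from choice_predicate[where P = "\<lambda>x y. y \<epsilon> Z \<and> y \<epsilon> pd x", OF this] obtain c where
    c: "\<And>x. x \<epsilon> Z \<Longrightarrow> app c x \<epsilon> Z \<and> app c x \<epsilon> pd x" using neg by (metis (no_types, lifting))
  \<comment> \<open>One iteration produces the Zermelo numerals \<open>t n\<close> and the
    descending sequence \<open>z n\<close> side by side.\<close>
  have "deft (\<lambda>s. pr (sg (p1 (s 0))) (app c (p2 (s 0))))" by (intro defs_intro)
  from omega_iteration[OF this, of "pr emp z0"] obtain f where
    f: "app f emp = pr emp z0"
      "\<And>n. n \<epsilon> om \<Longrightarrow> app f (sc n) = pr (sg (p1 (app f n))) (app c (p2 (app f n)))" by blast
  define t z where "t n = p1 (app f n)" and "z n = p2 (app f n)" for n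
  have dt: "deft (\<lambda>s. t (s 0))" "deft (\<lambda>s. z (s 0))" unfolding t_def z_def by (intro defs_intro)+
  note dt' = deft_app1[OF dt(1)] deft_app1[OF dt(2)]
  have t: "t emp = emp" "\<And>n. n \<epsilon> om \<Longrightarrow> t (sc n) = sg (t n)"
    and z: "z emp = z0" "\<And>n. n \<epsilon> om \<Longrightarrow> z (sc n) = app c (z n)"
    by (auto simp: t_def z_def f)
  have zZ: "z n \<epsilon> Z" if n: "n \<epsilon> om" for n
  proof -
    have d: "defp (\<lambda>s. z (s 0) \<epsilon> Z)" by (intro defs_intro dt')
    show ?thesis by (rule om_induct[OF d n]) (auto simp: z c z0)
  qed
  define F a where "F n = p2 (z n)" and "a n = p1 (z n)" for n
  have dF: "deft (\<lambda>s. F (s 0))" "deft (\<lambda>s. a (s 0))" unfolding F_def a_def by (intro defs_intro dt')+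
  note dF' = deft_app1[OF dF(1)] deft_app1[OF dF(2)]
  have mmn: "mm (a (sc n)) (F (sc n)) (a n) (F n)" if n: "n \<epsilon> om" for n
    using c[OF zZ[OF n]] z(2)[OF n] unfolding F_def a_def mem_pd by auto
  have tV: "t n \<epsilon> Vs l" if n: "n \<epsilon> om" for n
  proof -
    have d: "defp (\<lambda>s. t (s 0) \<epsilon> Vs l)" by (intro defs_intro dt')
    show ?thesis by (rule om_induct[OF d n]) (auto simp: t emp_in_Vs[OF l] Vs_lim_sg[OF l])
  qed
  have inj: "t m = t n \<Longrightarrow> m = n" if m: "m \<epsilon> om" and n: "n \<epsilon> om" for m n
  proof -
    have d: "defp (\<lambda>s. \<forall>n. n \<epsilon> om \<longrightarrow> t (s 0) = t n \<longrightarrow> s 0 = n)" by (intro defs_intro dt')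
    have sg_ne: "sg x \<noteq> emp" for x by (metis mem_sg mem_emp)
    have "\<forall>n. n \<epsilon> om \<longrightarrow> t m = t n \<longrightarrow> m = n"
    proof (rule om_induct[OF d m]; intro allI impI)
      fix n assume n: "n \<epsilon> om" and e: "t emp = t n"
      show "emp = n" using om_cases[OF n] e t sg_ne by metis
    next
      fix m n assume m: "m \<epsilon> om" and IH: "\<forall>n. n \<epsilon> om \<longrightarrow> t m = t n \<longrightarrow> m = n"
        and n: "n \<epsilon> om" and e: "t (sc m) = t n"
      have "n \<noteq> emp" using e t m sg_ne by metis
      then obtain k where k: "k \<epsilon> om" "n = sc k" using om_cases[OF n] by blast
      then have "t m = t k" using e t(2) m by simp
      then show "sc m = n" using IH k by blast
    qed
    then show "t m = t n \<Longrightarrow> m = n" using n by blast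
  qed
  \<comment> \<open>At the tag \<open>t n\<close> the values of two successive representing
    functions are compared. A descent through the tags would be a descent of values along
    \<open>\<epsilon>\<close>, so \<open>W\<close> is well-founded.\<close>
  define W where "W = Sep (Vs l) (\<lambda>u. \<exists>n y x. n \<epsilon> om \<and> u = pr (t n) (pr y x) \<and> app (F (sc n)) y \<epsilon> app (F n) x)"
  have dW: "defp (\<lambda>s. \<exists>n y x. n \<epsilon> om \<and> s 0 = pr (t n) (pr y x) \<and> app (F (sc n)) y \<epsilon> app (F n) x)"
    by (intro defs_intro dt' dF')
  have W: "u \<epsilon> W \<longleftrightarrow> u \<epsilon> Vs l \<and> (\<exists>n y x. n \<epsilon> om \<and> u = pr (t n) (pr y x) \<and> app (F (sc n)) y \<epsilon> app (F n) x)" for u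
    unfolding W_def by (rule mem_Sep[OF dW])
  have Ws: "subset_of W (Vs l)" by (simp add: subset_of_def W)
  have "wfd (Vs l) W"
    unfolding wfd_def
  proof
    assume "\<exists>A. subset_of A (Vs l) \<and> A \<noteq> emp \<and> bad A W"
    then obtain A where A: "A \<noteq> emp" "bad A W" by blast
    \<comment> \<open>\<open>n \<noteq> n\<close> stands for falsity: no entry of \<open>A\<close>
      with a numeral as its tag has the value in question.\<close>
    have d: "defp (\<lambda>s. \<forall>n x. n \<epsilon> om \<and> pr (t n) x \<epsilon> A \<and> app (F n) x = s 0 \<longrightarrow> n \<noteq> n)"
      by (intro defs_intro dt' dF')
    have *: "\<forall>n x. n \<epsilon> om \<and> pr (t n) x \<epsilon> A \<and> app (F n) x = k \<longrightarrow> n \<noteq> n" for k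
    proof (rule eps_induct[OF d], intro allI impI)
      fix k n x
      assume IH: "\<And>y. y \<epsilon> k \<Longrightarrow> \<forall>n x. n \<epsilon> om \<and> pr (t n) x \<epsilon> A \<and> app (F n) x = y \<longrightarrow> n \<noteq> n"
        and n: "n \<epsilon> om \<and> pr (t n) x \<epsilon> A \<and> app (F n) x = k"
      obtain n' x' y where y: "pr (t n) x = pr n' x'" "pr (sg n') y \<epsilon> A" "pr n' (pr y x') \<epsilon> W"
        using A(2) n unfolding bad_iff by blast
      then have y': "pr (t (sc n)) y \<epsilon> A" "pr (t n) (pr y x) \<epsilon> W" using t n by auto
      then obtain m where "m \<epsilon> om" "t m = t n" "app (F (sc m)) y \<epsilon> app (F m) x" unfolding W by auto
      then have "app (F (sc n)) y \<epsilon> k" using inj[of m n] n by auto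
      then show "n \<noteq> n" using IH y' n om_sc by blast
    qed
    obtain p where p: "p \<epsilon> A" using A(1) nonempty_iff by blast
    then obtain n' x y where y: "p = pr n' x" "pr n' (pr y x) \<epsilon> W" using A(2) unfolding bad_iff by blast
    then obtain n where "n \<epsilon> om" "n' = t n" unfolding W by auto
    then show False using * p y(1) by blast
  qed
  then have wf: "wfd (Vs l) (H W)" using H_wfd[OF l l H Ws] by blast
  \<comment> \<open>Each numeral is characterized from the previous one by quantifiers bounded by
    it, and \<open>h1_dia\<close> evaluates these at the seed.\<close>
  have tfix: "h1 (\<lambda>x. x = t n) (t n)" if n: "n \<epsilon> om" for n
  proof -
    have d: "defp (\<lambda>s. h1 (\<lambda>x. x = t (s 0)) (t (s 0)))" by (intro defp_h1 defs_intro dt')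
    show ?thesis
    proof (rule om_induct[OF d n])
      have d: "defp (\<lambda>s. s 0 = s 0)" "defp (\<lambda>s. \<exists>z. z \<epsilon> s 0 \<and> z = z)" by (intro defs_intro)+
      have "\<not> h1 (\<lambda>x. \<exists>z. z \<epsilon> x \<and> z = z) emp" unfolding h1_dia[OF d(1)] by simp
      then have "h1 (\<lambda>x. \<not> (\<exists>z. z \<epsilon> x \<and> z = z)) emp"
        unfolding h1_neg[OF d(2)] using emp_in_Vs[OF l] by blast
      then show "h1 (\<lambda>x. x = t emp) (t emp)" unfolding t
        by (rule h1_mono[rotated 3]) (auto intro!: defs_intro set_ext)
    next
      fix n assume n: "n \<epsilon> om" and IH: "h1 (\<lambda>x. x = t n) (t n)"
      have d: "defp (\<lambda>s. s 0 = t n)" "defp (\<lambda>s. \<not> s 0 = t n)" by (intro defs_intro)+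
      have d': "defp (\<lambda>s. \<exists>z. z \<epsilon> s 0 \<and> z = t n)" "defp (\<lambda>s. \<exists>z. z \<epsilon> s 0 \<and> \<not> z = t n)" by (intro defs_intro)+
      have V: "sg (t n) \<epsilon> Vs l" using tV[OF n] by (simp add: Vs_lim_sg[OF l])
      have "h1 (\<lambda>x. \<exists>z. z \<epsilon> x \<and> z = t n) (sg (t n))" unfolding h1_dia[OF d(1)] using V IH by simp
      moreover have "h1 (\<lambda>x. \<not> (\<exists>z. z \<epsilon> x \<and> \<not> z = t n)) (sg (t n))"
        unfolding h1_neg[OF d'(2)] h1_dia[OF d(2)] h1_neg[OF d(1)] using V IH by auto
      ultimately have h: "h1 (\<lambda>x. (\<exists>z. z \<epsilon> x \<and> z = t n) \<and> \<not> (\<exists>z. z \<epsilon> x \<and> \<not> z = t n)) (sg (t n))"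
        using h1_conj[OF d'(1) defp_neg[OF d'(2)]] by blast
      have ds: "defp (\<lambda>s. s 0 = sg (t n))" by (intro defs_intro)
      have "x = sg (t n)" if "(\<exists>z. z \<epsilon> x \<and> z = t n) \<and> \<not> (\<exists>z. z \<epsilon> x \<and> \<not> z = t n)" for x
      proof (rule set_ext)
        show "z \<epsilon> x \<longleftrightarrow> z \<epsilon> sg (t n)" for z using that unfolding mem_sg by blast
      qed
      then show "h1 (\<lambda>x. x = t (sc n)) (t (sc n))" unfolding t(2)[OF n]
        by (rule h1_mono[OF defp_conj[OF d'(1) defp_neg[OF d'(2)]] ds _ h])
    qed
  qed
  have HW: "pr (t n) (pr (a (sc n)) (a n)) \<epsilon> H W" if n: "n \<epsilon> om" for n
  proof -
    define X where "X u \<longleftrightarrow> (\<exists>y x. u = pr y x \<and> app (F (sc n)) y \<epsilon> app (F n) x)" for u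
    have dX: "defp (\<lambda>s. X (s 0))" unfolding X_def by (intro defs_intro)
    note dX' = defp_app1[OF dX]
    have "h1 X (pr (a (sc n)) (a n))" using mmn[OF n] unfolding mm_def h2_def X_def .
    moreover have V: "pr (a (sc n)) (a n) \<epsilon> Vs l" using mm_V[OF mmn[OF n]] by (simp add: p_iff)
    ultimately have "h2 (\<lambda>m u. X u) (t n) (pr (a (sc n)) (a n))" using h2_snd[OF dX tV[OF n]] by blast
    moreover have "h2 (\<lambda>m u. m = t n) (t n) (pr (a (sc n)) (a n))"
    proof -
      have d: "defp (\<lambda>s. s 0 = t n)" by (intro defs_intro)
      show ?thesis using h2_fst[OF d tV[OF n] V] tfix[OF n] by blast
    qed
    moreover have d1: "defp (\<lambda>s. X (s 1))" "defp (\<lambda>s. s 0 = t n)" by (intro defs_intro dX')+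
    ultimately have h: "h2 (\<lambda>m u. X u \<and> m = t n) (t n) (pr (a (sc n)) (a n))"
      using h2_conj[OF d1] by blast
    have "h1 (\<lambda>u. \<exists>n y x. n \<epsilon> om \<and> u = pr (t n) (pr y x) \<and> app (F (sc n)) y \<epsilon> app (F n) x)
        (pr (t n) (pr (a (sc n)) (a n)))"
      by (rule h1_mono[OF defp_pairs[OF defp_conj[OF d1]] dW _ h[unfolded h2_def]])
        (use n in \<open>auto simp: X_def\<close>)
    then show ?thesis unfolding W_def h1_eq .
  qed
  have d: "deft (\<lambda>s. pr (t (s 0)) (a (s 0)))" by (intro defs_intro dt' dF')
  \<comment> \<open>The seeds of the sequence, tagged by the numerals, descend in
    \<open>H W\<close>.\<close>
  define A where "A = Repl om (\<lambda>n. pr (t n) (a n))"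
  have A: "p \<epsilon> A \<longleftrightarrow> (\<exists>n. n \<epsilon> om \<and> p = pr (t n) (a n))" for p unfolding A_def by (rule mem_Repl[OF d])
  have "subset_of A (Vs l)"
    unfolding subset_of_def A using tV mm_V[OF mmn] by (auto simp: p_iff)
  moreover have "A \<noteq> emp" using A om_emp nonempty_iff by blast
  moreover have "bad A (H W)"
    unfolding bad_iff
  proof (intro allI impI)
    fix p assume "p \<epsilon> A"
    then obtain n where n: "n \<epsilon> om" "p = pr (t n) (a n)" unfolding A by blast
    have "pr (sg (t n)) (a (sc n)) \<epsilon> A" unfolding A using n t(2) by (intro exI[of _ "sc n"]) simp
    then show "\<exists>n x y. p = pr n x \<and> pr (sg n) y \<epsilon> A \<and> pr n (pr y x) \<epsilon> H W" using n HW by blast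
  qed
  ultimately show False using wf unfolding wfd_def by blast
qed

section \<open>The transitive collapse\<close>

definition "pi = (SOME F. deft (\<lambda>s. F (s 0)) \<and> (\<forall>x. F x = Repl (pd x) F))"

lemma pi_props: "deft (\<lambda>s. pi (s 0)) \<and> (\<forall>x. pi x = Repl (pd x) pi)"
proof -
  have p: "deft (\<lambda>s. pd (s 0))" by (intro deft_pd defs_intro)
  have "deft (\<lambda>s. Repl (pd (s 0)) (app (s 1)))" by (intro defs_intro deft_pd)
  from wf_recursion[where p = pd, OF p _ this] pd_wf obtain F where
    F: "deft (\<lambda>s. F (s 0))" "\<And>x. F x = Repl (pd x) (app (lam (pd x) F))" by blast
  have "Repl (pd x) (app (lam (pd x) F)) = Repl (pd x) F" for x
    by (rule Repl_cong) (auto simp: app_lam[OF F(1)] intro!: defs_intro F(1))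
  then have "\<exists>F. deft (\<lambda>s. F (s 0)) \<and> (\<forall>x. F x = Repl (pd x) F)" using F by metis
  from someI_ex[OF this] show ?thesis unfolding pi_def .
qed

lemma deft_pi: "deft t \<Longrightarrow> deft (\<lambda>s. pi (t s))"
  using pi_props deft_app1 by blast

lemma mem_pi: "y \<epsilon> pi z \<longleftrightarrow> (\<exists>q. q \<epsilon> pd z \<and> y = pi q)"
proof -
  have "y \<epsilon> Repl (pd z) pi \<longleftrightarrow> (\<exists>q. q \<epsilon> pd z \<and> y = pi q)"
    using pi_props by (intro mem_Repl) blast
  then show ?thesis using pi_props by metis
qed

lemma pd_pair: "q \<epsilon> pd z \<Longrightarrow> \<exists>b g. q = pr b g"
  unfolding mem_pd by blast

lemma pd_mm: "pr b g \<epsilon> pd z \<Longrightarrow> mm b g (p1 z) (p2 z)"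
  unfolding mem_pd by auto

lemma pi_E:
  assumes "x \<epsilon> pi z"
  obtains b g where "pr b g \<epsilon> pd z" "x = pi (pr b g)" "mm b g (p1 z) (p2 z)" "b \<epsilon> Vs l"
proof -
  obtain q where q: "q \<epsilon> pd z" "x = pi q" using assms mem_pi by blast
  then obtain b g where bg: "q = pr b g" using pd_pair by blast
  then have m: "mm b g (p1 z) (p2 z)" using pd_mm q(1) by blast
  show ?thesis using that[of b g] q bg m mm_V[OF m] by blast
qed

lemma pi_I: "q \<epsilon> pd z \<Longrightarrow> pi q \<epsilon> pi z"
  unfolding mem_pi by blast

lemma pd_induct:
  assumes "defp (\<lambda>s. P (s 0))" "\<And>x. (\<And>y. y \<epsilon> pd x \<Longrightarrow> P y) \<Longrightarrow> P x"
  shows "P x"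
proof (rule wf_induct_def[where p = pd])
  show "deft (\<lambda>s. pd (s 0))" by (intro deft_pd defs_intro)
qed (fact pd_wf assms)+

lemma pd_restrict:
  assumes "mm b g (p1 z) (p2 z)"
  shows "\<exists>g'. pr b g' \<epsilon> pd z \<and> ee b g b g'"
proof -
  obtain g' where g: "maps g' (Vs l) (Rf (p2 z))" "ee b g b g'" using mm_restrict[OF assms] by blast
  then have "mm b g' (p1 z) (p2 z)" using ee_mm[OF ee_sym assms] by blast
  then show ?thesis using g mm_V[OF assms] unfolding mem_pd by blast
qed

text \<open>Equal elements have predecessors represented by functions into different sets
  \<open>Rf\<close>; \<open>pd_restrict\<close> exchanges the representatives, and the induction
  hypothesis says that their collapses agree.\<close>

lemma pi_ee: "ee a f b g \<Longrightarrow> pi (pr a f) = pi (pr b g)"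
proof -
  assume e: "ee a f b g"
  have d: "defp (\<lambda>s. \<forall>b g. ee (p1 (s 0)) (p2 (s 0)) b g \<longrightarrow> pi (s 0) = pi (pr b g))"
    by (intro defs_intro defp_ee deft_pi)
  have "\<forall>b g. ee (p1 z) (p2 z) b g \<longrightarrow> pi z = pi (pr b g)" for z
  proof (rule pd_induct[OF d], intro allI impI)
    fix z b g
    assume IH: "\<And>y. y \<epsilon> pd z \<Longrightarrow> \<forall>b g. ee (p1 y) (p2 y) b g \<longrightarrow> pi y = pi (pr b g)"
      and e: "ee (p1 z) (p2 z) b g"
    show "pi z = pi (pr b g)"
    proof (rule set_ext)
      fix x show "x \<epsilon> pi z \<longleftrightarrow> x \<epsilon> pi (pr b g)"
      proof
        assume "x \<epsilon> pi z"
        then obtain c k where c: "pr c k \<epsilon> pd z" "x = pi (pr c k)" "mm c k (p1 z) (p2 z)" by (rule pi_E)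
        have "mm c k (p1 (pr b g)) (p2 (pr b g))" using mm_ee[OF c(3) e] by simp
        then obtain k' where k': "pr c k' \<epsilon> pd (pr b g)" "ee c k c k'" using pd_restrict by blast
        then have "x = pi (pr c k')" using IH[OF c(1)] c(2) by simp
        then show "x \<epsilon> pi (pr b g)" using pi_I[OF k'(1)] by simp
      next
        assume "x \<epsilon> pi (pr b g)"
        then obtain c k where c: "x = pi (pr c k)" "mm c k (p1 (pr b g)) (p2 (pr b g))" by (rule pi_E)
        have "mm c k (p1 z) (p2 z)" using mm_ee[OF _ ee_sym[OF e]] c(2) by simp
        then obtain k' where k': "pr c k' \<epsilon> pd z" "ee c k c k'" using pd_restrict by blast
        then have "x = pi (pr c k')" using IH[OF k'(1)] ee_sym[OF k'(2)] c(1) by simp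
        then show "x \<epsilon> pi z" using pi_I[OF k'(1)] by simp
      qed
    qed
  qed
  from this[of "pr a f"] show ?thesis using e by simp
qed

lemma pi_mm: "mm b g a f \<Longrightarrow> pi (pr b g) \<epsilon> pi (pr a f)"
proof -
  assume m: "mm b g a f"
  obtain g' where g': "pr b g' \<epsilon> pd (pr a f)" "ee b g b g'" using pd_restrict[of b g "pr a f"] m by auto
  then show ?thesis using pi_ee[OF g'(2)] pi_I[OF g'(1)] by simp
qed

text \<open>If two representatives differ, a choice function yields an element of the difference.\<close>

lemma ee_witness:
  assumes h: "h2 (\<lambda>x y. \<exists>z. z \<epsilon> app f x \<and> \<not> z \<epsilon> app g y) a b"
  shows "\<exists>c k. mm c k a f \<and> \<not> mm c k b g"
proof -
  have d: "defp (\<lambda>s. \<exists>z. z \<epsilon> app f (s 0) \<and> \<not> z \<epsilon> app g (s 1))" by (intro defs_intro)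
  have ab: "a \<epsilon> Vs l" "b \<epsilon> Vs l" using h2_V[OF d h] by auto
  have V: "pr a b \<epsilon> Vs l" using ab by (simp add: p_iff)
  have "defp (\<lambda>s. s 1 \<epsilon> app f (p1 (s 0)) \<and> \<not> s 1 \<epsilon> app g (p2 (s 0)))" by (intro defs_intro)
  from choice_predicate[where P = "\<lambda>t z. z \<epsilon> app f (p1 t) \<and> \<not> z \<epsilon> app g (p2 t)", OF this] obtain k where
    *: "\<forall>t. t \<epsilon> Vs l \<longrightarrow> (\<exists>z. z \<epsilon> app f (p1 t) \<and> \<not> z \<epsilon> app g (p2 t)) \<longrightarrow>
      app k t \<epsilon> app f (p1 t) \<and> \<not> app k t \<epsilon> app g (p2 t)" by blast
  have k: "app k (pr x y) \<epsilon> app f x \<and> \<not> app k (pr x y) \<epsilon> app g y"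
    if xy: "x \<epsilon> Vs l" "y \<epsilon> Vs l" "\<exists>z. z \<epsilon> app f x \<and> \<not> z \<epsilon> app g y" for x y
  proof -
    have "\<exists>z. z \<epsilon> app f (p1 (pr x y)) \<and> \<not> z \<epsilon> app g (p2 (pr x y))" using xy(3) by simp
    moreover have "pr x y \<epsilon> Vs l" using xy by (simp add: p_iff)
    ultimately show ?thesis using *[THEN spec, of "pr x y"] unfolding p1_pr p2_pr by blast
  qed
  have dd: "defp (\<lambda>s. app k (pr (s 0) (s 1)) \<epsilon> app f (s 0))" "defp (\<lambda>s. \<not> app k (pr (s 0) (s 1)) \<epsilon> app g (s 1))"
    "defp (\<lambda>s. s 0 = s 1)" by (intro defs_intro)+
  have dd3: "defp (\<lambda>s. app k (pr (s 0) (s 1)) \<epsilon> app f (s 0) \<and> s 0 = s 2)"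
    "defp (\<lambda>s. \<not> app k (pr (s 0) (s 1)) \<epsilon> app g (s 1) \<and> s 1 = s 2)" by (intro defs_intro)+
  have 1: "h2 (\<lambda>x y. app k (pr x y) \<epsilon> app f x) a b"
    by (rule h2_mono[OF d dd(1) _ h]) (use k in blast)
  have 2: "h2 (\<lambda>x y. \<not> app k (pr x y) \<epsilon> app g y) a b"
    by (rule h2_mono[OF d dd(2) _ h]) (use k in blast)
  have "h3 (\<lambda>x y z. app k (pr x y) \<epsilon> app f x \<and> x = z) a b a"
    by (rule h3_conj[OF dd(1) defp_02[OF dd(3)]])
      (use 1 h2_refl ab h3_12[OF dd(1)] h3_13[OF dd(3)] in auto)
  then have "mm (pr a b) k a f" unfolding h3_def mm_def
    by (rule h2_mono[OF defp_triples[OF dd3(1)] d_mm, rotated]) auto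
  moreover have "h3 (\<lambda>x y z. \<not> app k (pr x y) \<epsilon> app g y \<and> y = z) a b b"
    by (rule h3_conj[OF dd(2) defp_12[OF dd(3)]])
      (use 2 h2_refl ab h3_12[OF dd(2)] h3_23[OF dd(3)] in auto)
  then have "h2 (\<lambda>u z. \<not> app k u \<epsilon> app g z) (pr a b) b" unfolding h3_def
    by (rule h2_mono[OF defp_triples[OF dd3(2)] defp_neg[OF d_mm], rotated]) auto
  then have "\<not> mm (pr a b) k b g" unfolding mm_def using h2_neg[OF d_mm V ab(2)] by blast
  ultimately show ?thesis by blast
qed

lemma ee_cases:
  assumes ab: "a \<epsilon> Vs l" "b \<epsilon> Vs l" and n: "\<not> ee a f b g"
  shows "\<exists>c k. (mm c k a f \<and> \<not> mm c k b g) \<or> (mm c k b g \<and> \<not> mm c k a f)"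
proof -
  have d: "defp (\<lambda>s. \<exists>z. z \<epsilon> app f (s 0) \<and> \<not> z \<epsilon> app g (s 1))"
    "defp (\<lambda>s. \<exists>z. z \<epsilon> app g (s 1) \<and> \<not> z \<epsilon> app f (s 0))"
    "defp (\<lambda>s. \<exists>z. z \<epsilon> app g (s 0) \<and> \<not> z \<epsilon> app f (s 1))" by (intro defs_intro)+
  consider "h2 (\<lambda>x y. \<exists>z. z \<epsilon> app f x \<and> \<not> z \<epsilon> app g y) a b"
    | "h2 (\<lambda>x y. \<exists>z. z \<epsilon> app g y \<and> \<not> z \<epsilon> app f x) a b"
    | "h2 (\<lambda>x y. \<not> (\<exists>z. z \<epsilon> app f x \<and> \<not> z \<epsilon> app g y) \<and> \<not> (\<exists>z. z \<epsilon> app g y \<and> \<not> z \<epsilon> app f x)) a b"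
    using h2_neg[OF d(1) ab] h2_neg[OF d(2) ab] h2_conj[OF defp_neg[OF d(1)] defp_neg[OF d(2)]] by blast
  then show ?thesis
  proof cases
    case 1
    from ee_witness[OF this] show ?thesis by blast
  next
    case 2
    have "h2 (\<lambda>y x. \<exists>z. z \<epsilon> app g y \<and> \<not> z \<epsilon> app f x) b a"
      by (rule h2_sym[OF d(2) d(3) 2])
    from ee_witness[OF this] show ?thesis by blast
  next
    case 3
    have "ee a f b g" unfolding ee_def
      by (rule h2_mono[OF defp_conj[OF defp_neg[OF d(1)] defp_neg[OF d(2)]] d_ee _ 3]) (blast intro: set_ext)
    then show ?thesis using n by blast
  qed
qed

text \<open>Extensionality of the ultrapower: if the elements differ, \<open>ee_cases\<close> yields
  a represented element that belongs to only one of them, and by the induction hypothesis the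
  collapses differ as well.\<close>

lemma pi_eq: "a \<epsilon> Vs l \<Longrightarrow> b \<epsilon> Vs l \<Longrightarrow> pi (pr a f) = pi (pr b g) \<Longrightarrow> ee a f b g"
proof -
  assume ab: "a \<epsilon> Vs l" "b \<epsilon> Vs l" and e: "pi (pr a f) = pi (pr b g)"
  have d: "defp (\<lambda>s. \<forall>b g. p1 (s 0) \<epsilon> Vs l \<and> b \<epsilon> Vs l \<and> pi (s 0) = pi (pr b g) \<longrightarrow> ee (p1 (s 0)) (p2 (s 0)) b g)"
    by (intro defs_intro defp_ee deft_pi)
  have "\<forall>b g. p1 z \<epsilon> Vs l \<and> b \<epsilon> Vs l \<and> pi z = pi (pr b g) \<longrightarrow> ee (p1 z) (p2 z) b g" for z
  proof (rule pd_induct[OF d], intro allI impI)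
    fix z b g
    assume IH: "\<And>y. y \<epsilon> pd z \<Longrightarrow> \<forall>b g. p1 y \<epsilon> Vs l \<and> b \<epsilon> Vs l \<and> pi y = pi (pr b g) \<longrightarrow> ee (p1 y) (p2 y) b g"
      and z: "p1 z \<epsilon> Vs l \<and> b \<epsilon> Vs l \<and> pi z = pi (pr b g)"
    show "ee (p1 z) (p2 z) b g"
    proof (rule ccontr)
      assume n: "\<not> ?thesis"
      from ee_cases[OF _ _ n] z obtain c k where
        "(mm c k (p1 z) (p2 z) \<and> \<not> mm c k b g) \<or> (mm c k b g \<and> \<not> mm c k (p1 z) (p2 z))" by blast
      then show False
      proof
        assume m: "mm c k (p1 z) (p2 z) \<and> \<not> mm c k b g"
        obtain k' where k': "pr c k' \<epsilon> pd z" "ee c k c k'" using pd_restrict m by blast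
        have "pi (pr c k') \<epsilon> pi (pr b g)" using z pi_I[OF k'(1)] by simp
        then obtain e i where i: "pi (pr c k') = pi (pr e i)" "mm e i (p1 (pr b g)) (p2 (pr b g))" "e \<epsilon> Vs l"
          by (rule pi_E)
        have "c \<epsilon> Vs l" using mm_V m by blast
        then have "ee c k' e i" using IH[OF k'(1)] i by simp
        then have "mm c k b g" using ee_mm[OF ee_trans[OF k'(2)]] i(2) by simp
        then show False using m by blast
      next
        assume m: "mm c k b g \<and> \<not> mm c k (p1 z) (p2 z)"
        then have "pi (pr c k) \<epsilon> pi z" using pi_mm z by simp
        then obtain e i where i: "pr e i \<epsilon> pd z" "pi (pr c k) = pi (pr e i)" "mm e i (p1 z) (p2 z)" "e \<epsilon> Vs l"
          by (rule pi_E)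
        have "c \<epsilon> Vs l" using mm_V m by blast
        then have "ee e i c k" using IH[OF i(1)] i by simp
        then have "mm c k (p1 z) (p2 z)" using ee_mm[OF ee_sym i(3)] by blast
        then show False using m by blast
      qed
    qed
  qed
  from this[of "pr a f"] show ?thesis using ab e by simp
qed

lemma pi_mem: "a \<epsilon> Vs l \<Longrightarrow> b \<epsilon> Vs l \<Longrightarrow> pi (pr b g) \<epsilon> pi (pr a f) \<Longrightarrow> mm b g a f"
proof -
  assume ab: "a \<epsilon> Vs l" "b \<epsilon> Vs l" and m: "pi (pr b g) \<epsilon> pi (pr a f)"
  obtain c k where c: "pi (pr b g) = pi (pr c k)" "mm c k (p1 (pr a f)) (p2 (pr a f))" "c \<epsilon> Vs l"
    using m by (rule pi_E)
  then show ?thesis using ee_mm[OF pi_eq[OF ab(2) c(3) c(1)]] by simp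
qed

section \<open>The ultrapower as a transitive class, and its elementarity\<close>

definition "UM = {x. \<exists>a f. a \<epsilon> Vs l \<and> x = pi (pr a f)}"

lemma UM_trans: "transitive_class UM"
  unfolding transitive_class_def
proof (intro allI impI)
  fix x y assume "x \<in> UM \<and> y \<epsilon> x"
  then obtain z where "y \<epsilon> pi z" unfolding UM_def by blast
  then obtain b g where "y = pi (pr b g)" "b \<epsilon> Vs l" by (rule pi_E)
  then show "y \<in> UM" unfolding UM_def by blast
qed

lemma UM_class: "definable_class UM"
  unfolding definable_class_iff UM_def mem_Collect_eq by (intro defs_intro deft_pi)

text \<open>In the existential case a witness comes with a seed \<open>b\<close> of its own. After
  merging the seeds it becomes a function on pairs, and projecting to the coordinate
  \<open>a\<close> leaves the existence statement. Conversely, a choice function supplies a witness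
  at the seed \<open>a\<close>.\<close>

lemma los:
  "a \<epsilon> Vs l \<Longrightarrow> sat (\<epsilon>) UM \<phi> (\<lambda>i. pi (pr a (F i))) \<longleftrightarrow> h1 (\<lambda>x. sat (\<epsilon>) UNIV \<phi> (\<lambda>i. app (F i) x)) a"
proof (induction \<phi> arbitrary: a F)
  case (Member m n)
  have "pi (pr a (F m)) \<epsilon> pi (pr a (F n)) \<longleftrightarrow> mm a (F m) a (F n)"
    using pi_mm[of a "F m" a "F n"] pi_mem[OF Member Member, of "F m" "F n"] by blast
  then show ?case using h2_diag[OF d_mm Member, of "F m" "F n"] unfolding mm_def by simp
next
  case (Equal m n)
  have "pi (pr a (F m)) = pi (pr a (F n)) \<longleftrightarrow> ee a (F m) a (F n)"
    using pi_ee[of a "F m" a "F n"] pi_eq[OF Equal Equal, of "F m" "F n"] by blast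
  then show ?case using h2_diag[OF d_ee Equal, of "F m" "F n"] unfolding ee_def by simp
next
  case (Neg \<phi>)
  have "defp (\<lambda>s. sat (\<epsilon>) UNIV \<phi> (\<lambda>i. app (F i) (s 0)))"
    by (intro defp_sat definable_class_UNIV defs_intro)
  from h1_neg[OF this] show ?case using Neg by simp
next
  case (And \<phi> \<psi>)
  have "defp (\<lambda>s. sat (\<epsilon>) UNIV \<phi> (\<lambda>i. app (F i) (s 0)))" "defp (\<lambda>s. sat (\<epsilon>) UNIV \<psi> (\<lambda>i. app (F i) (s 0)))"
    by (intro defp_sat definable_class_UNIV defs_intro)+
  from h1_conj[OF this] show ?case using And by simp
next
  case (Exists n \<phi>)
  have dG: "defp (\<lambda>s. sat (\<epsilon>) UNIV \<phi> (\<lambda>i. app (G i) (s 0)))" for G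
    by (intro defp_sat definable_class_UNIV defs_intro)
  have fu: "(\<lambda>i. app (F i) x)(n := z) = (\<lambda>i. (if i = n then z else app (F i) x))" for x z by auto
  have dt: "deft (\<lambda>s. if i = n then s (Suc 0) else app (F i) (s 0))" for i
    by (cases "i = n") (auto intro!: defs_intro)
  have dE2: "defp (\<lambda>s. sat (\<epsilon>) UNIV \<phi> ((\<lambda>i. app (F i) (s 0))(n := s 1)))"
    unfolding fu One_nat_def by (intro defp_sat definable_class_UNIV dt)
  have dE: "defp (\<lambda>s. \<exists>z. sat (\<epsilon>) UNIV \<phi> ((\<lambda>i. app (F i) (s 0))(n := z)))"
    by (intro defs_intro defp_app2[where P = "\<lambda>x z. sat (\<epsilon>) UNIV \<phi> ((\<lambda>i. app (F i) x)(n := z))", OF dE2])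
  have "(\<exists>x\<in>UM. sat (\<epsilon>) UM \<phi> ((\<lambda>i. pi (pr a (F i)))(n := x))) \<longleftrightarrow>
      h1 (\<lambda>x. \<exists>z. sat (\<epsilon>) UNIV \<phi> ((\<lambda>i. app (F i) x)(n := z))) a"
  proof
    assume "\<exists>x\<in>UM. sat (\<epsilon>) UM \<phi> ((\<lambda>i. pi (pr a (F i)))(n := x))"
    then obtain b g where b: "b \<epsilon> Vs l" and s: "sat (\<epsilon>) UM \<phi> ((\<lambda>i. pi (pr a (F i)))(n := pi (pr b g)))"
      unfolding UM_def by blast
    have V: "pr a b \<epsilon> Vs l" using Exists.prems b by (simp add: p_iff)
    define F' where "F' i = (if i = n then lam (Vs l) (\<lambda>t. app g (p2 t)) else lam (Vs l) (\<lambda>t. app (F i) (p1 t)))" for i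
    have dl: "deft (\<lambda>s. app g (p2 (s 0)))" "deft (\<lambda>s. app (F i) (p1 (s 0)))" for i by (intro defs_intro)+
    have "ee (pr a b) (F' i) a (F i)" if "i \<noteq> n" for i
      unfolding ee_def
      by (rule h2_mono[OF _ d_ee _ h2_merge1[OF Exists.prems b]])
        (use that in \<open>auto intro!: defs_intro simp: F'_def app_lam[OF dl(2)]\<close>)
    moreover have "ee (pr a b) (F' n) b g"
      unfolding ee_def
      by (rule h2_mono[OF _ d_ee _ h2_merge2[OF Exists.prems b]])
        (auto intro!: defs_intro simp: F'_def app_lam[OF dl(1)])
    ultimately have "(\<lambda>i. pi (pr a (F i)))(n := pi (pr b g)) = (\<lambda>i. pi (pr (pr a b) (F' i)))"
      using pi_ee by (intro HOL.ext) (simp, metis)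
    then have "h1 (\<lambda>t. sat (\<epsilon>) UNIV \<phi> (\<lambda>i. app (F' i) t)) (pr a b)" using s Exists.IH[OF V] by simp
    \<comment> \<open>\<open>x = x\<close> is a filler; what matters is that almost all points for
      the seed \<open>(a, b)\<close> are pairs.\<close>
    moreover have d0: "defp (\<lambda>s. \<exists>x y. s 0 = pr x y \<and> x = x)" by (intro defs_intro)
    moreover have "h1 (\<lambda>t. \<exists>x y. t = pr x y \<and> x = x) (pr a b)"
      using h2_true[of "\<lambda>x y. x = x" a b] Exists.prems b unfolding h2_def by (simp add: defs_intro)
    ultimately have "h1 (\<lambda>t. sat (\<epsilon>) UNIV \<phi> (\<lambda>i. app (F' i) t) \<and> (\<exists>x y. t = pr x y \<and> x = x)) (pr a b)"
      using h1_conj[OF dG d0] by blast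
    then have "h2 (\<lambda>x y. \<exists>z. sat (\<epsilon>) UNIV \<phi> ((\<lambda>i. app (F i) x)(n := z))) a b"
      unfolding h2_def
    proof (rule h1_mono[rotated 3])
      show "defp (\<lambda>s. \<exists>x y. s 0 = pr x y \<and> (\<exists>z. sat (\<epsilon>) UNIV \<phi> ((\<lambda>i. app (F i) x)(n := z))))"
        by (intro defs_intro defp_app1[OF dE])
      show "defp (\<lambda>s. sat (\<epsilon>) UNIV \<phi> (\<lambda>i. app (F' i) (s 0)) \<and> (\<exists>x y. s 0 = pr x y \<and> x = x))"
        by (intro defp_conj dG d0)
      fix t assume t: "t \<epsilon> Vs l" and "sat (\<epsilon>) UNIV \<phi> (\<lambda>i. app (F' i) t) \<and> (\<exists>x y. t = pr x y \<and> x = x)"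
      then obtain x y where xy: "t = pr x y" "sat (\<epsilon>) UNIV \<phi> (\<lambda>i. app (F' i) t)" by blast
      have "(\<lambda>i. app (F' i) t) = (\<lambda>i. app (F i) x)(n := app g y)"
        using t xy(1) by (auto simp: F'_def app_lam[OF dl(1)] app_lam[OF dl(2)])
      then show "\<exists>x y. t = pr x y \<and> (\<exists>z. sat (\<epsilon>) UNIV \<phi> ((\<lambda>i. app (F i) x)(n := z)))" using xy by metis
    qed
    then show "h1 (\<lambda>x. \<exists>z. sat (\<epsilon>) UNIV \<phi> ((\<lambda>i. app (F i) x)(n := z))) a"
      using h2_fst[OF dE Exists.prems b] by blast
  next
    assume h: "h1 (\<lambda>x. \<exists>z. sat (\<epsilon>) UNIV \<phi> ((\<lambda>i. app (F i) x)(n := z))) a"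
    obtain k where k: "\<And>x. x \<epsilon> Vs l \<Longrightarrow> \<exists>z. sat (\<epsilon>) UNIV \<phi> ((\<lambda>i. app (F i) x)(n := z)) \<Longrightarrow>
        sat (\<epsilon>) UNIV \<phi> ((\<lambda>i. app (F i) x)(n := app k x))"
      using choice_predicate[where P = "\<lambda>x z. sat (\<epsilon>) UNIV \<phi> ((\<lambda>i. app (F i) x)(n := z))", OF dE2] by blast
    have e: "(\<lambda>i. app ((F(n := k)) i) x) = (\<lambda>i. app (F i) x)(n := app k x)" for x by auto
    have "h1 (\<lambda>x. sat (\<epsilon>) UNIV \<phi> (\<lambda>i. app ((F(n := k)) i) x)) a"
      using h by (rule h1_mono[OF dE dG, rotated]) (unfold e, rule k)
    then have "sat (\<epsilon>) UM \<phi> (\<lambda>i. pi (pr a ((F(n := k)) i)))" using Exists by blast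
    moreover have "(\<lambda>i. pi (pr a ((F(n := k)) i))) = (\<lambda>i. pi (pr a (F i)))(n := pi (pr a k))" by auto
    ultimately show "\<exists>x\<in>UM. sat (\<epsilon>) UM \<phi> ((\<lambda>i. pi (pr a (F i)))(n := x))"
      using Exists.prems unfolding UM_def by auto
  qed
  then show ?case by simp
qed

text \<open>For a constant function all seeds represent the same element; \<open>emp\<close> is one
  that belongs to every limit level.\<close>

definition "uj x = pi (pr emp (lam (Vs l) (\<lambda>_. x)))"

lemma app_const: "t \<epsilon> a \<Longrightarrow> app (lam a (\<lambda>_. x)) t = x"
  by (rule app_lam[OF deft_const])

lemma uj_elementary: "elementary_embedding uj UM"
  unfolding elementary_embedding_def
proof (intro conjI allI)
  have "defp (\<lambda>s. \<exists>x. opair x (uj x) (s 0))"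
    unfolding uj_def by (intro defs_intro deft_pi)
  then show "definable_class {p. \<exists>x. opair x (uj x) p}" by (simp add: definable_class_iff)
  show "definable_class UM" by (rule UM_class)
  show "uj x \<in> UM" for x unfolding uj_def UM_def using emp_in_Vs[OF l] by blast
  fix \<phi> s
  have d: "defp (\<lambda>s'. sat (\<epsilon>) UNIV \<phi> (\<lambda>i. app (lam (Vs l) (\<lambda>_. s i)) (s' 0)))"
    by (intro defp_sat definable_class_UNIV defs_intro)
  have dc: "defp (\<lambda>s'. sat (\<epsilon>) UNIV \<phi> s)" by (rule defp_const)
  have e: "emp \<epsilon> Vs l" by (rule emp_in_Vs[OF l])
  have "sat (\<epsilon>) UM \<phi> (uj \<circ> s) \<longleftrightarrow> h1 (\<lambda>x. sat (\<epsilon>) UNIV \<phi> (\<lambda>i. app (lam (Vs l) (\<lambda>_. s i)) x)) emp"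
    unfolding los[OF e, symmetric] by (simp add: uj_def comp_def)
  also have "\<dots> \<longleftrightarrow> h1 (\<lambda>x. sat (\<epsilon>) UNIV \<phi> s) emp"
    by (rule h1_cong[OF d dc]) (simp add: app_const)
  also have "\<dots> \<longleftrightarrow> sat (\<epsilon>) UNIV \<phi> s"
  proof (cases "sat (\<epsilon>) UNIV \<phi> s")
    case True
    then show ?thesis using h1_true[OF dc] e by simp
  next
    case False
    then have "h1 (\<lambda>x. \<not> sat (\<epsilon>) UNIV \<phi> s) emp" using h1_true[OF defp_neg[OF dc]] e by simp
    then show ?thesis using h1_neg[OF dc] False by simp
  qed
  finally show "sat (\<epsilon>) UNIV \<phi> s \<longleftrightarrow> sat (\<epsilon>) UM \<phi> (uj \<circ> s)" by simp
qed

text \<open>The seed \<open>a\<close> represents itself by means of the identity function: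
  \<open>h2_Q\<close> shows that it has no members in the ultrapower besides its own elements. Hence
  \<open>V_l\<close> is contained in \<open>UM\<close>.\<close>

lemma pi_id: "a \<epsilon> Vs l \<Longrightarrow> pi (pr a (lam (Vs l) (\<lambda>x. x))) = a"
proof -
  define i where "i = lam (Vs l) (\<lambda>x. x)"
  have di: "deft (\<lambda>s. s 0)" by (intro defs_intro)
  have i: "app i x = x" if "x \<epsilon> Vs l" for x unfolding i_def using that by (rule app_lam[OF di])
  have tr: "z \<epsilon> Vs l" if "z \<epsilon> x" "x \<epsilon> Vs l" for x z using Vs_tr that .
  have d: "defp (\<lambda>s. s 0 \<epsilon> Vs l \<longrightarrow> pi (pr (s 0) i) = s 0)" by (intro defs_intro deft_pi)
  have "a \<epsilon> Vs l \<longrightarrow> pi (pr a i) = a"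
  proof (rule eps_induct[OF d], rule impI)
    fix a assume IH: "\<And>c. c \<epsilon> a \<Longrightarrow> c \<epsilon> Vs l \<longrightarrow> pi (pr c i) = c" and a: "a \<epsilon> Vs l"
    have IH': "pi (pr c i) = c" if "c \<epsilon> a" for c using IH[OF that] tr[OF that a] by blast
    show "pi (pr a i) = a"
    proof (rule set_ext)
      fix x show "x \<epsilon> pi (pr a i) \<longleftrightarrow> x \<epsilon> a"
      proof
        assume x: "x \<epsilon> a"
        have E: "defp (\<lambda>s. s 0 = s 1)" by (intro defs_intro)
        have "h2 (\<lambda>y x. \<exists>z. z \<epsilon> x \<and> y = z) x a" unfolding h2_Q[OF E tr[OF x a] a] using x h2_refl tr[OF x a] by blast
        then have "mm x i a i" unfolding mm_def
          by (rule h2_mono[rotated 3]) (auto intro!: defs_intro simp: i)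
        then show "x \<epsilon> pi (pr a i)" using pi_mm IH'[OF x] by metis
      next
        assume "x \<epsilon> pi (pr a i)"
        then obtain b g where b: "x = pi (pr b g)" "mm b g (p1 (pr a i)) (p2 (pr a i))" by (rule pi_E)
        then have m: "mm b g a i" by simp
        then have ba: "b \<epsilon> Vs l" "a \<epsilon> Vs l" using mm_V by auto
        have E: "defp (\<lambda>s. app g (s 0) = s 1)" by (intro defs_intro)
        have "h2 (\<lambda>y x. \<exists>z. z \<epsilon> x \<and> app g y = z) b a"
          using m unfolding mm_def by (rule h2_mono[rotated 3]) (auto intro!: defs_intro simp: i)
        then obtain c where c: "c \<epsilon> a" "h2 (\<lambda>y z. app g y = z) b c" using h2_Q[OF E ba] by blast
        have "ee b g c i" using c(2) unfolding ee_def
          by (rule h2_mono[rotated 3]) (auto intro!: defs_intro simp: i)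
        then show "x \<epsilon> a" using pi_ee IH'[OF c(1)] b(1) c(1) by metis
      qed
    qed
  qed
  then show "a \<epsilon> Vs l \<Longrightarrow> pi (pr a (lam (Vs l) (\<lambda>x. x))) = a" unfolding i_def by blast
qed

lemma Vs_UM: "a \<epsilon> Vs l \<Longrightarrow> a \<in> UM"
  using pi_id unfolding UM_def mem_Collect_eq by metis

text \<open>Both sides say that \<open>X\<close> belongs to the ultrafilter of the seed
  \<open>a\<close>: on the left, \<open>a\<close> is the identity function and \<open>uj X\<close> a
  constant one.\<close>

lemma uj_H: "subset_of X (Vs l) \<Longrightarrow> a \<epsilon> Vs l \<Longrightarrow> a \<epsilon> uj X \<longleftrightarrow> a \<epsilon> H X"
proof -
  assume X: "subset_of X (Vs l)" and a: "a \<epsilon> Vs l"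
  define i where "i = lam (Vs l) (\<lambda>x. x)"
  have di: "deft (\<lambda>s. s 0)" by (intro defs_intro)
  have i: "app i x = x" if "x \<epsilon> Vs l" for x unfolding i_def using that by (rule app_lam[OF di])
  have e: "emp \<epsilon> Vs l" by (rule emp_in_Vs[OF l])
  have d: "defp (\<lambda>s. s 0 \<epsilon> X)" by (intro defs_intro)
  have "a \<epsilon> uj X \<longleftrightarrow> mm a i emp (lam (Vs l) (\<lambda>_. X))"
    using pi_mm[of a i emp] pi_mem[OF e a] pi_id[OF a] unfolding uj_def i_def by metis
  also have "\<dots> \<longleftrightarrow> h2 (\<lambda>x y. x \<epsilon> X) a emp"
    unfolding mm_def
    by (auto elim!: h2_mono[rotated 3] intro!: defs_intro simp: i app_const)
  also have "\<dots> \<longleftrightarrow> h1 (\<lambda>x. x \<epsilon> X) a" by (rule h2_fst[OF d a e])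
  also have "\<dots> \<longleftrightarrow> a \<epsilon> H X"
  proof -
    have "Sep (Vs l) (\<lambda>x. x \<epsilon> X) = X" by (rule set_ext) (use X in \<open>auto simp: mem_Sep[OF d] subset_of_def\<close>)
    then show ?thesis using h1_eq[of a "\<lambda>x. x \<epsilon> X"] by simp
  qed
  finally show ?thesis .
qed

end

end

context ZFC
begin

section \<open>Critical points of endomorphisms\<close>

lemma defp_all_less:
  fixes n :: nat
  assumes "\<And>m. m < n \<Longrightarrow> defp (P m)"
  shows "defp (\<lambda>s. \<forall>m<n. P m s)"
  using assms
proof (induction n)
  case (Suc n)
  have "defp (\<lambda>s. (\<forall>m<n. P m s) \<and> P n s)" using Suc by (intro defp_conj) auto
  moreover have "(\<forall>m<Suc n. P m s) \<longleftrightarrow> (\<forall>m<n. P m s) \<and> P n s" for s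
    by (auto simp: less_Suc_eq)
  ultimately show ?case by simp
qed (simp add: defp_const)

lemma defp_if [defs_intro]:
  assumes "defp P" "defp Q" "defp R"
  shows "defp (\<lambda>s. if P s then Q s else R s)"
proof -
  have "defp (\<lambda>s. (P s \<longrightarrow> Q s) \<and> (\<not> P s \<longrightarrow> R s))" by (intro defs_intro assms)
  then show ?thesis by (simp add: if_bool_eq_conj)
qed

lemma defp_morph:
  assumes "deft t" "deft u" "deft h"
  shows "defp (\<lambda>s. morph (t s) (u s) (app (h s)))"
  by (rule defp_app3[where P = "\<lambda>w v h. morph w v (app h)", OF _ assms])
    (unfold morph_def, intro defs_intro defp_all_less)

text \<open>The condition \<open>\<xi> \<epsilon> app h (sg \<xi>)\<close> expresses that the
  embedding derived from \<open>h\<close> fixes \<xi>. Thus \<kappa> is its critical point, stated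
  without mentioning classes.\<close>

definition crit_at where
  "crit_at \<kappa> l \<longleftrightarrow> lim l \<and> \<kappa> \<epsilon> l \<and> (\<exists>h. maps h (Pow (Vs l)) (Pow (Vs l)) \<and> morph (Vs l) (Vs l) (app h) \<and>
     \<not> \<kappa> \<epsilon> app h (sg \<kappa>) \<and> (\<forall>\<xi>. \<xi> \<epsilon> \<kappa> \<longrightarrow> \<xi> \<epsilon> app h (sg \<xi>)))"

lemma defp_crit_at [defs_intro]: "deft t \<Longrightarrow> deft u \<Longrightarrow> defp (\<lambda>s. crit_at (t s) (u s))"
  by (rule defp_app2[where P = crit_at]) (unfold crit_at_def, intro defs_intro defp_morph)

text \<open>If the derived embedding fixed all ordinals below \<open>l\<close>, it would fix every
  element of \<open>V_l\<close> by induction on levels, and \<open>h\<close>, being its truncation,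
  would be the identity. So some ordinal below \<open>l\<close> is moved, and the least one is
  critical.\<close>

lemma not_rigid_crit_at:
  assumes l: "lim l" and n: "\<not> rigid l"
  shows "\<exists>\<kappa>. crit_at \<kappa> l"
proof -
  obtain h X where h: "maps h (Pow (Vs l)) (Pow (Vs l))" "morph (Vs l) (Vs l) (app h)"
    and X: "subset_of X (Vs l)" "app h X \<noteq> X"
    using l n unfolding rigid_def by blast
  have dh: "deft (\<lambda>s. app h (s 0))" by (intro defs_intro)
  note c = l h(2) dh
  define j where "j = uj l (app h)"
  define M where "M = UM l (app h)"
  have el: "elementary_embedding j M" and tr: "transitive_class M"
    unfolding j_def M_def using uj_elementary[OF c] UM_trans[OF c] by auto
  note e = el tr
  have jh: "a \<epsilon> j Y \<longleftrightarrow> a \<epsilon> app h Y" if "subset_of Y (Vs l)" "a \<epsilon> Vs l" for a Y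
    unfolding j_def using uj_H[OF c that] .
  have ol: "Ord l" using l by (rule lim_Ord)
  have j_ord: "\<xi> \<epsilon> app h (sg \<xi>) \<longleftrightarrow> j \<xi> = \<xi>" if "\<xi> \<epsilon> l" for \<xi>
  proof -
    have V: "\<xi> \<epsilon> Vs l" using that ol Ord_in_Vs Ord_mem by blast
    have "subset_of (sg \<xi>) (Vs l)" using V by (simp add: subset_of_def)
    then have "\<xi> \<epsilon> app h (sg \<xi>) \<longleftrightarrow> \<xi> \<epsilon> j (sg \<xi>)" using jh V by blast
    then show ?thesis by (auto simp: el_sg[OF e])
  qed
  have "\<exists>\<xi>. \<xi> \<epsilon> l \<and> j \<xi> \<noteq> \<xi>"
  proof (rule ccontr)
    assume "\<not> ?thesis"
    then have fixl: "j \<xi> = \<xi>" if "\<xi> \<epsilon> l" for \<xi> using that by blast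
    have d: "defp (\<lambda>s. s 0 \<epsilon> l \<longrightarrow> (\<forall>a. a \<epsilon> Vs (s 0) \<longrightarrow> j a = a))" by (intro defs_intro el_deft[OF e])
    have fixV: "\<forall>a. a \<epsilon> Vs \<xi> \<longrightarrow> j a = a" if x: "\<xi> \<epsilon> l" for \<xi>
    proof -
      have "\<xi> \<epsilon> l \<longrightarrow> (\<forall>a. a \<epsilon> Vs \<xi> \<longrightarrow> j a = a)"
      proof (rule Ord_induct[OF d Ord_mem[OF ol x]], intro impI allI)
        fix \<xi> a
        assume o: "Ord \<xi>" and IH: "\<forall>b. b \<epsilon> \<xi> \<longrightarrow> b \<epsilon> l \<longrightarrow> (\<forall>a. a \<epsilon> Vs b \<longrightarrow> j a = a)"
          and x: "\<xi> \<epsilon> l" and a: "a \<epsilon> Vs \<xi>"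
        obtain b where b: "b \<epsilon> \<xi>" "subset_of a (Vs b)" using a mem_Vs[of a \<xi>] by blast
        have bl: "b \<epsilon> l" and ob: "Ord b" using b(1) x Ord_trans[OF ol] Ord_mem[OF o] by blast+
        have fb: "j y = y" if "y \<epsilon> Vs b" for y using IH b(1) bl that by blast
        have "subset_of (j a) (j (Vs b))"
          using b(2) el_rel2[OF e, where R = subset_of, OF def0_subset_of] by blast
        then have sub: "y \<epsilon> Vs b" if "y \<epsilon> j a" for y
          using that el_Vs[OF e ob] fixl[OF bl] by (simp add: subset_of_def)
        show "j a = a"
        proof (rule set_ext)
          fix y show "y \<epsilon> j a \<longleftrightarrow> y \<epsilon> a"
            using sub[of y] fb[of y] b(2) el_mem[OF e, of y a] unfolding subset_of_def by metis
        qed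
      qed
      then show ?thesis using x by blast
    qed
    have fa: "j a = a" if a: "a \<epsilon> Vs l" for a
    proof -
      have "sc (rk a) \<epsilon> l" using a l mem_Vs_Ord[OF ol] by (simp add: lim_def)
      then show ?thesis using fixV in_some_Vs by blast
    qed
    have "app h X = X"
    proof (rule set_ext)
      fix a
      have hX: "subset_of (app h X) (Vs l)" using h(1) X(1) by (simp add: maps_iff)
      show "a \<epsilon> app h X \<longleftrightarrow> a \<epsilon> X"
      proof (cases "a \<epsilon> Vs l")
        case True
        then show ?thesis using jh[OF X(1) True] fa[OF True] el_mem[OF e, of a X] by simp
      qed (use hX X(1) in \<open>auto simp: subset_of_def\<close>)
    qed
    then show False using X(2) by blast
  qed
  then obtain \<xi> where x: "\<xi> \<epsilon> l" "j \<xi> \<noteq> \<xi>" by blast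
  have d: "defp (\<lambda>s. s 0 \<epsilon> l \<and> \<not> s 0 \<epsilon> app h (sg (s 0)))" by (intro defs_intro)
  have "\<xi> \<epsilon> l \<and> \<not> \<xi> \<epsilon> app h (sg \<xi>)" using x j_ord by blast
  from Ord_least[OF d Ord_mem[OF ol x(1)] this] obtain \<kappa> where \<kappa>: "\<kappa> \<epsilon> l" "\<not> \<kappa> \<epsilon> app h (sg \<kappa>)"
    "\<forall>c. c \<epsilon> \<kappa> \<longrightarrow> \<not> (c \<epsilon> l \<and> \<not> c \<epsilon> app h (sg c))" by blast
  then have "\<forall>\<xi>. \<xi> \<epsilon> \<kappa> \<longrightarrow> \<xi> \<epsilon> app h (sg \<xi>)" using Ord_trans[OF ol] by blast
  then show ?thesis unfolding crit_at_def using l h \<kappa>(1,2) by blast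
qed

lemma crit_at_strong:
  assumes c: "crit_at \<kappa> l"
  shows "cardinal \<kappa>" and "\<mu> \<epsilon> l \<Longrightarrow> strong_upto \<kappa> \<mu>"
proof -
  from c obtain h where l: "lim l" and \<kappa>: "\<kappa> \<epsilon> l" and h: "maps h (Pow (Vs l)) (Pow (Vs l))"
    "morph (Vs l) (Vs l) (app h)" "\<not> \<kappa> \<epsilon> app h (sg \<kappa>)" "\<And>\<xi>. \<xi> \<epsilon> \<kappa> \<Longrightarrow> \<xi> \<epsilon> app h (sg \<xi>)"
    unfolding crit_at_def by blast
  have dh: "deft (\<lambda>s. app h (s 0))" by (intro defs_intro)
  note c = l h(2) dh
  define j where "j = uj l (app h)"
  define M where "M = UM l (app h)"
  have el: "elementary_embedding j M" and tr: "transitive_class M"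
    unfolding j_def M_def using uj_elementary[OF c] UM_trans[OF c] by auto
  note e = el tr
  have VM: "a \<in> M" if "a \<epsilon> Vs l" for a unfolding M_def using Vs_UM[OF c that] .
  have ol: "Ord l" using l by (rule lim_Ord)
  have ok: "Ord \<kappa>" using ol \<kappa> Ord_mem by blast
  have j_ord: "\<xi> \<epsilon> app h (sg \<xi>) \<longleftrightarrow> j \<xi> = \<xi>" if "\<xi> \<epsilon> l" for \<xi>
  proof -
    have V: "\<xi> \<epsilon> Vs l" using that ol Ord_in_Vs Ord_mem by blast
    have "subset_of (sg \<xi>) (Vs l)" using V by (simp add: subset_of_def)
    then have "\<xi> \<epsilon> app h (sg \<xi>) \<longleftrightarrow> \<xi> \<epsilon> j (sg \<xi>)" using uj_H[OF c] V unfolding j_def by blast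
    then show ?thesis by (auto simp: el_sg[OF e])
  qed
  have jk: "j \<kappa> \<noteq> \<kappa>" using j_ord[OF \<kappa>] h(3) by blast
  have jx: "j \<xi> = \<xi>" if "\<xi> \<epsilon> \<kappa>" for \<xi> using j_ord[of \<xi>] h(4) that Ord_trans[OF ol that \<kappa>] by blast
  have crit: "critical_point j \<kappa>" unfolding critical_point_def using ok jk jx by simp
  have kjk: "\<kappa> \<epsilon> j \<kappa>"
  proof -
    have "Ord (j \<kappa>)" using el_Ord[OF e] ok by blast
    moreover have "\<not> j \<kappa> \<epsilon> \<kappa>" using jx[of "j \<kappa>"] el_eq[OF e] jk by blast
    ultimately show ?thesis using Ord_linear[OF ok] jk by metis
  qed
  show "cardinal \<kappa>"
    unfolding cardinal_def
  proof (intro conjI notI)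
    show "ordinal \<kappa>" using ok by simp
    assume "\<exists>\<beta> f. \<beta> \<epsilon> \<kappa> \<and> bijection f \<beta> \<kappa>"
    then obtain \<beta> f where b: "\<beta> \<epsilon> \<kappa>" and f: "bijection f \<beta> \<kappa>" by blast
    \<comment> \<open>The image of \<open>f\<close> takes the value \<kappa>, which is below
      \<open>j \<kappa>\<close>, at some \<open>x < \<beta>\<close> fixed by \<open>j\<close>. Then
      \<kappa> would be \<open>j (f x) = f x\<close>, an element of \<kappa>.\<close>
    have "bijection (j f) (j \<beta>) (j \<kappa>)" using f el_rel3[OF e, where R = bijection, OF def0_bijection] by blast
    then obtain x where x: "x \<epsilon> \<beta>" "app (j f) x = \<kappa>"
      using kjk jx[OF b] unfolding bijection_iff by auto
    have ff: "function_on f \<beta>" "app f x \<epsilon> \<kappa>" using f x(1) unfolding bijection_iff maps_iff by auto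
    have "j x = x" using jx Ord_trans[OF ok x(1) b] by blast
    then have "\<kappa> = j (app f x)" using el_app[OF e ff(1) x(1)] x(2) by simp
    then show False using jx[OF ff(2)] ff(2) mem_irrefl by metis
  qed
  show "strong_upto \<kappa> \<mu>" if m: "\<mu> \<epsilon> l"
    unfolding strong_upto_def
  proof (intro exI[of _ j] exI[of _ M] conjI el tr crit allI impI)
    fix v x assume v: "V_level \<mu> v" and x: "x \<epsilon> v"
    have "v = Vs \<mu>" using v V_level_iff Ord_mem[OF ol m] by blast
    then have "x \<epsilon> Vs l" using x Vs_mono[OF ol m] by blast
    then show "x \<in> M" by (rule VM)
  qed
qed

lemma Ord_un: "Ord a \<Longrightarrow> Ord b \<Longrightarrow> Ord (un a b)"
  unfolding un_def by (rule Ord_Uni) auto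

text \<open>If \<open>crit_at k l\<close> held for unboundedly many \<open>l\<close>, then
  \<open>k\<close> would be strong. So these \<open>l\<close> have a bound \<open>B k\<close>, and
  \<open>B\<close> is definable because \<open>crit_at\<close> is. A limit \<open>l > a\<close>
  closed under \<open>B\<close> is rigid: otherwise \<open>crit_at k l\<close> for some
  \<open>k < l\<close>, whence \<open>l < B k < l\<close>.\<close>

lemma rigid_unbounded:
  assumes ns: "\<not> (\<exists>\<kappa>. strong_cardinal \<kappa>)" and a: "Ord a"
  shows "\<exists>l. rigid l \<and> a \<epsilon> l"
proof -
  define W where "W k b \<longleftrightarrow> Ord b \<and> (\<forall>l. crit_at k l \<longrightarrow> l \<epsilon> b)" for k b
  have dW: "defp (\<lambda>s. W (t s) (u s))" if "deft t" "deft u" for t u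
    by (rule defp_app2[where P = W, OF _ that]) (unfold W_def, intro defs_intro)
  have ex: "\<exists>b. W k b" for k
  proof (rule ccontr)
    assume n: "\<not> ?thesis"
    have *: "\<exists>l. crit_at k l \<and> \<mu> \<epsilon> l" if m: "Ord \<mu>" for \<mu>
    proof -
      obtain l where l: "crit_at k l" "\<not> l \<epsilon> sc \<mu>" using n Ord_sc[OF m] unfolding W_def by blast
      then have "Ord l" by (simp add: crit_at_def lim_Ord)
      then show ?thesis using Ord_linear[OF m] l by auto
    qed
    have "strong_cardinal k"
      unfolding strong_cardinal_def
    proof (intro conjI allI impI)
      show "cardinal k" using *[OF Ord_emp] crit_at_strong(1) by blast
      fix \<mu> assume "cardinal \<mu> \<and> k \<epsilon> \<mu>"
      then have "Ord \<mu>" by (simp add: cardinal_def)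
      then show "strong_upto k \<mu>" using * crit_at_strong(2) by blast
    qed
    then show False using ns by blast
  qed
  define B where "B k = the1 (\<lambda>b. W k b \<and> (\<forall>c. c \<epsilon> b \<longrightarrow> \<not> W k c))" for k
  have dB: "deft (\<lambda>s. B (s 0))" unfolding B_def by (intro defs_intro dW)
  note dB' = deft_app1[OF dB]
  have B: "W k (B k)" for k
  proof -
    obtain b where b: "W k b" using ex by blast
    have d: "defp (\<lambda>s. W k (s 0))" by (intro dW defs_intro)
    have "Ord b" using b by (simp add: W_def)
    from Ord_least[OF d this b] obtain c where c: "Ord c" "W k c" "\<forall>d. d \<epsilon> c \<longrightarrow> \<not> W k d" by blast
    have "B k = c" unfolding B_def
    proof (rule the1_equality)
      fix d assume d: "W k d \<and> (\<forall>c. c \<epsilon> d \<longrightarrow> \<not> W k c)"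
      then have "Ord d" by (simp add: W_def)
      then show "d = c" using d c Ord_linear by blast
    qed (use c in blast)
    then show ?thesis using c by simp
  qed
  define g where "g b = sc (un b (Uni (Repl b B)))" for b
  have dg: "deft (\<lambda>s. g (s 0))" unfolding g_def by (intro defs_intro dB')
  have g: "Ord (g b) \<and> b \<epsilon> g b \<and> (\<forall>k. k \<epsilon> b \<longrightarrow> B k \<epsilon> g b)" if b: "Ord b" for b
  proof -
    have o: "Ord (B k)" for k using B[of k] by (simp add: W_def)
    have u: "Ord (un b (Uni (Repl b B)))"
      by (intro Ord_un b Ord_Uni) (auto simp: mem_Repl[OF dB] o)
    have "subset_of b (un b (Uni (Repl b B)))" by (simp add: subset_of_def)
    moreover have "subset_of (B k) (un b (Uni (Repl b B)))" if "k \<epsilon> b" for k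
      using that by (auto simp: subset_of_def mem_Repl[OF dB])
    ultimately show ?thesis unfolding g_def using Ord_subset[OF _ u] b o Ord_sc[OF u] by simp
  qed
  from omega_iteration[OF dg, of "sc a"] obtain f where
    f: "app f emp = sc a" "\<And>n. n \<epsilon> om \<Longrightarrow> app f (sc n) = g (app f n)" by blast
  have d: "deft (\<lambda>s. app f (s 0))" by (intro defs_intro)
  have o: "Ord (app f n)" if n: "n \<epsilon> om" for n
  proof -
    have d: "defp (\<lambda>s. Ord (app f (s 0)))" by (intro defs_intro)
    show ?thesis by (rule om_induct[OF d n]) (auto simp: f g a intro: Ord_sc)
  qed
  define l where "l = Uni (Repl om (app f))"
  have l: "x \<epsilon> l \<longleftrightarrow> (\<exists>n. n \<epsilon> om \<and> x \<epsilon> app f n)" for x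
    unfolding l_def by (auto simp: mem_Repl[OF d])
  have Ol: "Ord l" unfolding l_def by (rule Ord_Uni) (auto simp: mem_Repl[OF d] o)
  have al: "a \<epsilon> l" unfolding l using f(1) om_emp by (metis mem_sc)
  have up: "B x \<epsilon> l \<and> sc x \<epsilon> l" if x: "x \<epsilon> l" for x
  proof -
    obtain n where n: "n \<epsilon> om" "x \<epsilon> app f n" using x l by blast
    have "app f n \<epsilon> app f (sc n)" "B x \<epsilon> app f (sc n)" "Ord (app f (sc n))"
      using g[OF o[OF n(1)]] n f(2) by auto
    moreover have "sc x \<epsilon> app f n \<or> sc x = app f n" using Ord_mem_sc[OF o[OF n(1)] n(2)] .
    ultimately have "sc x \<epsilon> app f (sc n)" "B x \<epsilon> app f (sc n)" by (metis Ord_trans, simp)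
    then show ?thesis unfolding l using n(1) om_sc by blast
  qed
  have "l \<noteq> emp" using al by auto
  then have lim: "lim l" using Ol up by (simp add: lim_def)
  have "rigid l"
  proof (rule ccontr)
    assume "\<not> rigid l"
    then obtain k where k: "crit_at k l" using not_rigid_crit_at lim by blast
    then have "k \<epsilon> l" "l \<epsilon> B k" using B[of k] by (auto simp: crit_at_def W_def)
    then show False using up mem_asym by blast
  qed
  then show ?thesis using al by blast
qed

section \<open>The graphs\<close>

text \<open>
  A graph has six levels, each a copy of the power set of \<open>V_l\<close>. Its edges go upwards, so
  that the paths of length six force a homomorphism to preserve the levels; the edges between
  consecutive levels force it to act in the same way on all levels; and the ten ways to skip a
  level carry the operations and predicates of a structure.
\<close>

primrec nm :: "nat \<Rightarrow> 'a" where
  "nm 0 = emp"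
| "nm (Suc n) = sc (nm n)"

lemma nm_inject [simp]: "nm m = nm n \<longleftrightarrow> m = n"
proof (induction m arbitrary: n)
  case 0
  then show ?case by (cases n) auto
next
  case (Suc m)
  then show ?case by (cases n) auto
qed

lemma mem_nm: "x \<epsilon> nm n \<longleftrightarrow> (\<exists>i<n. x = nm i)"
  by (induction n) (auto simp: less_Suc_eq)

text \<open>The ten pairs with \<open>i + 2 \<le> j < 6\<close> carry eight operations and two
  predicates. Row 0 has the operations 0 to 3, row 1 has 4 to 6, and \<open>(2, 4)\<close> has 7;
  \<open>(2, 5)\<close> and \<open>(3, 5)\<close> are left for the predicates.\<close>

definition opi :: "nat \<Rightarrow> nat \<Rightarrow> nat" where
  "opi i j = (if i = 0 then j - 2 else if i = 1 then j + 1 else 7)"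

definition link where
  "link a v i j X Y \<longleftrightarrow>
     (if j = Suc i then Y = X
      else if i = 2 \<and> j = 5 then Y = X \<and> wfd v X
      else if i = 3 \<and> j = 5 then Y = X \<and> subset_of a X
      else i + 2 \<le> j \<and> Y = opn (opi i j) v X)"

text \<open>The existential quantifiers over the six levels are written as negated universal ones,
  to fit the rules for \<open>\<forall>m<n\<close> among the definability lemmas.\<close>

definition ledge where
  "ledge a v p \<longleftrightarrow> (\<exists>x y. p = pr x y \<and> (\<exists>i X. x = pr i X \<and> (\<exists>j Y. y = pr j Y \<and>
     \<not> (\<forall>i'<6. \<forall>j'<6. \<not> (i = nm i' \<and> j = nm j' \<and> link a v i' j' X Y)))))"

definition gver where "gver l = cross (nm 6) (Pow (Vs l))"

definition gedg where "gedg a l = Sep (cross (gver l) (gver l)) (ledge a (Vs l))"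

definition gr where "gr a l = pr (gver l) (gedg a l)"

lemma defp_link [defs_intro]:
  assumes "deft t" "deft u" "deft v" "deft w"
  shows "defp (\<lambda>s. link (t s) (u s) i j (v s) (w s))"
  unfolding link_def by (intro defs_intro assms)

lemma defp_ledge [defs_intro]: "deft t \<Longrightarrow> deft u \<Longrightarrow> deft v \<Longrightarrow> defp (\<lambda>s. ledge (t s) (u s) (v s))"
  by (rule defp_app3[where P = ledge]) (unfold ledge_def, intro defs_intro defp_all_less)

lemma mem_gver: "x \<epsilon> gver l \<longleftrightarrow> (\<exists>i<6. \<exists>X. subset_of X (Vs l) \<and> x = pr (nm i) X)"
  unfolding gver_def by (auto simp: mem_nm)

lemma mem_gedg: "pr (pr (nm i) X) (pr (nm j) Y) \<epsilon> gedg a l \<longleftrightarrow>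
    i < 6 \<and> j < 6 \<and> subset_of X (Vs l) \<and> subset_of Y (Vs l) \<and> link a (Vs l) i j X Y"
proof -
  have "defp (\<lambda>s. ledge a (Vs l) (s 0))" by (intro defs_intro)
  from mem_Sep[where P = "ledge a (Vs l)", OF this] show ?thesis
    unfolding gedg_def by (auto simp: ledge_def mem_gver)
qed

lemma gedg_pair: "p \<epsilon> gedg a l \<Longrightarrow> \<exists>x y. x \<epsilon> gver l \<and> y \<epsilon> gver l \<and> p = pr x y"
proof -
  have "defp (\<lambda>s. ledge a (Vs l) (s 0))" by (intro defs_intro)
  from mem_Sep[where P = "ledge a (Vs l)", OF this] show "p \<epsilon> gedg a l \<Longrightarrow> ?thesis" unfolding gedg_def by auto
qed

lemma gr_graph: "graph (gr a l)"
proof -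
  have "pr (nm 0) emp \<epsilon> gver l" unfolding mem_gver
    by (rule exI[of _ 0], rule conjI, simp, rule exI[of _ emp], simp add: subset_of_def)
  then have "gver l \<noteq> emp" by auto
  then show ?thesis unfolding graph_def gr_def using gedg_pair by simp
qed

section \<open>Homomorphisms between the graphs\<close>

lemma homomorphism_pr: "homomorphism h (pr G R) (pr G' R') \<longleftrightarrow>
    maps h G G' \<and> (\<forall>x y. pr x y \<epsilon> R \<longrightarrow> x \<epsilon> G \<longrightarrow> y \<epsilon> G \<longrightarrow> pr (app h x) (app h y) \<epsilon> R')"
proof (cases "maps h G G'")
  case True
  then have "function_on h G" by (simp add: maps_iff)
  then show ?thesis unfolding homomorphism_def by (auto simp: True function_on_pr)
qed (simp add: homomorphism_def)

lemma link_less: "link a v i j X Y \<Longrightarrow> i < j"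
  unfolding link_def by (auto split: if_splits)

lemma gr_hom_levels:
  assumes h: "homomorphism h (gr b g) (gr a l)"
  defines "H \<equiv> (\<lambda>X. p2 (app h (pr (nm 0) X)))"
  assumes X: "subset_of X (Vs g)" and i: "i < 6"
  shows "app h (pr (nm i) X) = pr (nm i) (H X)" and "subset_of (H X) (Vs l)"
proof -
  have h1: "maps h (gver g) (gver l)" and
    h2: "\<And>x y. pr x y \<epsilon> gedg b g \<Longrightarrow> x \<epsilon> gver g \<Longrightarrow> y \<epsilon> gver g \<Longrightarrow> pr (app h x) (app h y) \<epsilon> gedg a l"
    using h unfolding gr_def homomorphism_pr by auto
  have v: "pr (nm i) X \<epsilon> gver g" if "i < 6" for i using that X by (auto simp: mem_gver)
  have "\<exists>k Y. k < 6 \<and> subset_of Y (Vs l) \<and> app h (pr (nm i) X) = pr (nm k) Y" if "i < 6" for i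
    using h1 v[OF that] unfolding maps_iff mem_gver by blast
  then obtain k Y where kY: "\<And>i. i < 6 \<Longrightarrow> k i < 6 \<and> subset_of (Y i) (Vs l) \<and> app h (pr (nm i) X) = pr (nm (k i)) (Y i)"
    by metis
  have step: "link a (Vs l) (k i) (k (Suc i)) (Y i) (Y (Suc i))" if "Suc i < 6" for i
  proof -
    have "pr (pr (nm i) X) (pr (nm (Suc i)) X) \<epsilon> gedg b g"
      unfolding mem_gedg using that X by (simp add: link_def)
    from h2[OF this v v] that kY[of i] kY[of "Suc i"] show ?thesis by (simp add: mem_gedg)
  qed
  have "k i < k (Suc i)" if "Suc i < 6" for i using link_less[OF step[OF that]] .
  then have "k 0 < k 1" "k 1 < k 2" "k 2 < k 3" "k 3 < k 4" "k 4 < k 5" "k 5 < 6"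
    using kY[of 5] by (simp_all add: numeral_eq_Suc)
  \<comment> \<open>Six increasing numbers below 6 leave no choice.\<close>
  then have k: "k 0 = 0" "k 1 = 1" "k 2 = 2" "k 3 = 3" "k 4 = 4" "k 5 = 5" by linarith+
  have 6: "i < 6 \<longleftrightarrow> i = 0 \<or> i = 1 \<or> i = 2 \<or> i = 3 \<or> i = 4 \<or> i = 5" for i :: nat by linarith
  have ki: "k i = i" if "i < 6" for i using that k unfolding 6 by auto
  have YS: "Y (Suc i) = Y i" if "Suc i < 6" for i
    using step[OF that] ki[of i] ki[of "Suc i"] that by (simp add: link_def)
  have Y: "Y i = Y 0" if "i < 6" for i
    using that by (induction i) (auto simp: YS)
  have H: "H X = Y 0" unfolding H_def using kY[of 0] by simp
  show "app h (pr (nm i) X) = pr (nm i) (H X)" using kY[OF i] ki[OF i] Y[OF i] H by simp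
  show "subset_of (H X) (Vs l)" using kY[of 0] H by simp
qed

lemma gr_hom_morph:
  assumes h: "homomorphism h (gr b g) (gr a l)"
  defines "H \<equiv> (\<lambda>X. p2 (app h (pr (nm 0) X)))"
  shows "morph (Vs g) (Vs l) H" and "subset_of X (Vs g) \<Longrightarrow> subset_of b X \<Longrightarrow> subset_of a (H X)"
proof -
  have h2: "\<And>x y. pr x y \<epsilon> gedg b g \<Longrightarrow> x \<epsilon> gver g \<Longrightarrow> y \<epsilon> gver g \<Longrightarrow> pr (app h x) (app h y) \<epsilon> gedg a l"
    using h unfolding gr_def homomorphism_pr by auto
  have link: "link a (Vs l) i j (H X) (H Y)"
    if "i < 6" "j < 6" "subset_of X (Vs g)" "subset_of Y (Vs g)" "link b (Vs g) i j X Y" for i j X Y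
  proof -
    have "pr (pr (nm i) X) (pr (nm j) Y) \<epsilon> gedg b g" unfolding mem_gedg using that by simp
    from h2[OF this] have "pr (app h (pr (nm i) X)) (app h (pr (nm j) Y)) \<epsilon> gedg a l"
      using that by (auto simp: mem_gver)
    then show ?thesis
      unfolding H_def gr_hom_levels(1)[OF h that(3,1)] gr_hom_levels(1)[OF h that(4,2)] mem_gedg by simp
  qed
  show "morph (Vs g) (Vs l) H"
    unfolding morph_def
  proof (intro allI impI conjI)
    fix X assume X: "subset_of X (Vs g)"
    show "subset_of (H X) (Vs l)" unfolding H_def by (rule gr_hom_levels(2)[OF h X, where i = 0]) simp
    show "wfd (Vs l) (H X)" if "wfd (Vs g) X"
      using link[of 2 5 X X] X that by (simp add: link_def)
    fix m :: nat assume m: "m < 8"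
    have "\<exists>i j. i < 6 \<and> j < 6 \<and> i + 2 \<le> j \<and> j \<noteq> Suc i \<and> \<not> (i = 2 \<and> j = 5) \<and> \<not> (i = 3 \<and> j = 5) \<and> opi i j = m"
    proof -
      consider "m < 4" | "m = 4 \<or> m = 5 \<or> m = 6" | "m = 7" using m by linarith
      then show ?thesis
      proof cases
        case 1
        then show ?thesis by (intro exI[of _ 0] exI[of _ "m + 2"]) (auto simp: opi_def)
      next
        case 2
        then show ?thesis by (intro exI[of _ 1] exI[of _ "m - 1"]) (auto simp: opi_def)
      next
        case 3
        then show ?thesis by (intro exI[of _ 2] exI[of _ 4]) (auto simp: opi_def)
      qed
    qed
    then obtain i j where ij: "i < 6" "j < 6" "i + 2 \<le> j" "j \<noteq> Suc i" "\<not> (i = 2 \<and> j = 5)" "\<not> (i = 3 \<and> j = 5)" "opi i j = m"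
      by blast
    have "link b (Vs g) i j X (opn m (Vs g) X)" unfolding link_def using ij by auto
    from link[OF ij(1,2) X subset_of_opn this] show "H (opn m (Vs g) X) = opn m (Vs l) (H X)"
      unfolding link_def using ij by (auto split: if_splits)
  qed
  show "subset_of X (Vs g) \<Longrightarrow> subset_of b X \<Longrightarrow> subset_of a (H X)"
    using link[of 3 5 X X] by (simp add: link_def)
qed

lemma opi_less: "i < 6 \<Longrightarrow> j < 6 \<Longrightarrow> opi i j < 8"
  by (auto simp: opi_def)

lemma gr_cap_hom:
  assumes l: "lim l" "lim g" "l \<epsilon> g \<or> l = g" and a: "subset_of a b" "subset_of a (Vs l)"
  defines "h \<equiv> lam (gver g) (\<lambda>x. pr (p1 x) (cap (p2 x) (Vs l)))"
  shows "homomorphism h (gr b g) (gr a l)"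
proof -
  have d: "deft (\<lambda>s. pr (p1 (s 0)) (cap (p2 (s 0)) (Vs l)))" by (intro defs_intro)
  have m: "morph (Vs g) (Vs l) (\<lambda>X. cap X (Vs l))" by (rule morph_cap[OF l])
  have ap: "app h (pr (nm i) X) = pr (nm i) (cap X (Vs l))" if "i < 6" "subset_of X (Vs g)" for i X
    unfolding h_def using that by (subst app_lam[OF d]) (auto simp: mem_gver)
  have sub: "subset_of (cap X (Vs l)) (Vs l)" for X by (simp add: subset_of_def)
  show ?thesis
    unfolding gr_def homomorphism_pr
  proof (intro conjI allI impI)
    show "maps h (gver g) (gver l)"
      unfolding h_def by (rule maps_lam[OF d]) (auto simp: mem_gver sub)
    fix x y assume e: "pr x y \<epsilon> gedg b g" and "x \<epsilon> gver g" "y \<epsilon> gver g"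
    then obtain i X j Y where xy: "i < 6" "subset_of X (Vs g)" "x = pr (nm i) X"
      "j < 6" "subset_of Y (Vs g)" "y = pr (nm j) Y" unfolding mem_gver by blast
    then have k: "link b (Vs g) i j X Y" using e by (simp add: mem_gedg)
    have "link a (Vs l) i j (cap X (Vs l)) (cap Y (Vs l))"
    proof -
      have "cap (opn (opi i j) (Vs g) X) (Vs l) = opn (opi i j) (Vs l) (cap X (Vs l))"
        using m xy(2) opi_less[OF xy(1,4)] unfolding morph_def by blast
      moreover have "wfd (Vs g) X \<Longrightarrow> wfd (Vs l) (cap X (Vs l))"
        using m xy(2) unfolding morph_def by blast
      moreover have "subset_of b X \<Longrightarrow> subset_of a (cap X (Vs l))"
        using a by (simp add: subset_of_def)
      ultimately show ?thesis using k unfolding link_def by (auto split: if_splits)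
    qed
    then show "pr (app h x) (app h y) \<epsilon> gedg a l"
      using xy ap sub by (simp add: mem_gedg)
  qed
qed

lemma gr_hom_unique:
  assumes r: "rigid l" and g: "lim g" "l \<epsilon> g \<or> l = g"
    and h: "homomorphism h (gr b g) (gr a l)" and h': "homomorphism h' (gr b g) (gr a l)"
  shows "h = h'"
proof -
  have H: "p2 (app k (pr (nm 0) X)) = cap X (Vs l)"
    if k: "homomorphism k (gr b g) (gr a l)" and X: "subset_of X (Vs g)" for k X
    by (rule rigid_morph[OF r g gr_hom_morph(1)[OF k] _ X]) (intro defs_intro)
  have f: "function_on h (gver g)" "function_on h' (gver g)"
    using h h' unfolding gr_def homomorphism_pr maps_iff by auto
  show ?thesis
  proof (rule function_ext[OF f])
    fix x assume "x \<epsilon> gver g"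
    then obtain i X where x: "i < 6" "subset_of X (Vs g)" "x = pr (nm i) X" unfolding mem_gver by blast
    then show "app h x = app h' x"
      using gr_hom_levels(1)[OF h x(2,1)] gr_hom_levels(1)[OF h' x(2,1)] H[OF h x(2)] H[OF h' x(2)] by simp
  qed
qed

text \<open>Truncation followed by \<open>H\<close> is an endomorphism of the level
  \<open>g\<close>, hence the identity, and so \<open>H a = a\<close>; but the tags force
  \<open>b\<close> to be a subset of \<open>H a\<close>. The tags are needed since different indices
  may share one rigid level.\<close>

lemma gr_no_hom:
  assumes r: "rigid g" and l: "lim l" "l \<epsilon> g \<or> l = g" and a: "Ord b" "a \<epsilon> b" "a \<epsilon> l"
  shows "\<not> homomorphism h (gr a l) (gr b g)"
proof
  assume h: "homomorphism h (gr a l) (gr b g)"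
  define H where "H X = p2 (app h (pr (nm 0) X))" for X
  have dH: "deft (\<lambda>s. H (s 0))" unfolding H_def by (intro defs_intro)
  have g: "lim g" using r by (simp add: rigid_def)
  have mH: "morph (Vs l) (Vs g) H" unfolding H_def by (rule gr_hom_morph(1)[OF h])
  have mc: "morph (Vs g) (Vs l) (\<lambda>X. cap X (Vs l))" by (rule morph_cap[OF l(1) g l(2)])
  have m: "morph (Vs g) (Vs g) (\<lambda>X. H (cap X (Vs l)))"
    using mH mc unfolding morph_def by (metis (no_types, lifting))
  have oa: "Ord a" using a Ord_mem by blast
  have sub: "subset_of a (Vs l)"
    using Ord_trans[OF lim_Ord[OF l(1)] _ a(3)] Ord_mem[OF oa] Ord_in_Vs[OF lim_Ord[OF l(1)]]
    by (simp add: subset_of_def)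
  have sub': "subset_of a (Vs g)"
    using sub Vs_subset[OF lim_Ord[OF g] l(2)] by (simp add: subset_of_def)
  have "H (cap a (Vs l)) = cap a (Vs g)"
    by (rule rigid_morph[OF r g _ m _ sub']) (auto intro!: defs_intro deft_app1[OF dH])
  moreover have "cap a (Vs l) = a" "cap a (Vs g) = a"
    by (rule set_ext, use sub sub' in \<open>auto simp: subset_of_def\<close>)+
  moreover have "subset_of b (H a)"
    unfolding H_def by (rule gr_hom_morph(2)[OF h sub]) simp
  ultimately have "subset_of b a" by simp
  then show False using a(2) mem_irrefl by (auto simp: subset_of_def)
qed

section \<open>Definability of the graphs\<close>

lemma def0_const: "def0 (\<lambda>s. c)"
  unfolding def0_def by (rule exI[of _ "if c then Equal 0 0 else Neg (Equal 0 0)"]) (auto intro: Delta0.intros)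

lemma def0_all_less [def0_intro]:
  fixes n :: nat
  assumes "\<And>m. def0 (P m)"
  shows "def0 (\<lambda>s. \<forall>m<n. P m s)"
proof (induction n)
  case (Suc n)
  have "def0 (\<lambda>s. (\<forall>m<n. P m s) \<and> P n s)" using Suc assms by (intro def0_conj) auto
  moreover have "(\<forall>m<Suc n. P m s) \<longleftrightarrow> (\<forall>m<n. P m s) \<and> P n s" for s
    by (auto simp: less_Suc_eq)
  ultimately show ?case by simp
qed (simp add: def0_const)

lemma def0_if [def0_intro]: "def0 P \<Longrightarrow> def0 Q \<Longrightarrow> def0 (\<lambda>s. if c then P s else Q s)"
  by (cases c) simp_all

lemma def0_is_pair [def0_intro]: "def0 (\<lambda>s. \<exists>x y. s k = pr x y)"
  using def0_ex_pair[where Q = "\<lambda>_ _ _. True", OF def0_const] by simp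

lemma def0_conj_const [def0_intro]: "def0 P \<Longrightarrow> def0 (\<lambda>s. c \<and> P s)"
  by (intro def0_conj def0_const)

lemma def0_nm [def0_intro]: "def0 (\<lambda>s. s i = nm n)"
proof (induction n arbitrary: i)
  case 0
  show ?case by (simp add: def0_emp)
next
  case (Suc n)
  have *: "x = nm (Suc n) \<longleftrightarrow> (\<exists>y. y \<epsilon> x \<and> y = nm n \<and> x = sc y)" for x by auto
  show ?case unfolding * by (intro def0_intro Suc)
qed

lemma def0_opc [def0_intro]: "def0 (\<lambda>s. opc m (s i) (s j))"
proof -
  have *: "pr (pr t t) t \<epsilon> X \<longleftrightarrow> (\<exists>q u. pr q u \<epsilon> X \<and> q = pr t t \<and> u = t)" for t X by auto
  show ?thesis unfolding opc_def * by (intro def0_intro)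
qed

lemma def0_bad [def0_intro]: "def0 (\<lambda>s. bad (s i) (s j))"
  unfolding bad_def by (intro def0_intro)

text \<open>
  Bounded versions of the notions above; \<open>w\<close> stands for the power set of \<open>v\<close>.
\<close>

definition wfd0 where "wfd0 w X \<longleftrightarrow> (\<forall>A. A \<epsilon> w \<longrightarrow> A \<noteq> emp \<longrightarrow> \<not> bad A X)"

definition opn0 where
  "opn0 m v X Y \<longleftrightarrow> (\<forall>t. t \<epsilon> Y \<longrightarrow> t \<epsilon> v \<and> opc m X t) \<and> (\<forall>t. t \<epsilon> v \<longrightarrow> opc m X t \<longrightarrow> t \<epsilon> Y)"

definition mor0 where
  "mor0 h v w \<longleftrightarrow> (\<forall>X X'. pr X X' \<epsilon> h \<longrightarrow> (wfd0 w X \<longrightarrow> wfd0 w X') \<and>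
     (\<forall>Y Y'. pr Y Y' \<epsilon> h \<longrightarrow> (\<forall>m<8. opn0 m v X Y \<longrightarrow> opn0 m v X' Y')))"

definition idn0 where "idn0 h w \<longleftrightarrow> (\<forall>X. X \<epsilon> w \<longrightarrow> pr X X \<epsilon> h)"

text \<open>\<open>c\<close> is a set of levels of the cumulative hierarchy which are cofinal in \<open>v\<close>.\<close>

definition lev0 where
  "lev0 c v w \<longleftrightarrow> (\<forall>y. y \<epsilon> v \<longrightarrow> y \<epsilon> w) \<and>
     (\<forall>z. z \<epsilon> c \<longrightarrow> (\<forall>y. y \<epsilon> w \<longrightarrow> (y \<epsilon> z \<longleftrightarrow> (\<exists>u. u \<epsilon> c \<and> u \<epsilon> z \<and> subset_of y u)))) \<and>
     (\<forall>y. y \<epsilon> w \<longrightarrow> (y \<epsilon> v \<longleftrightarrow> (\<exists>u. u \<epsilon> c \<and> subset_of y u)))"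

definition ords0 where
  "ords0 v k \<longleftrightarrow> (\<forall>x. x \<epsilon> k \<longrightarrow> x \<epsilon> v \<and> Ord x) \<and> (\<forall>x. x \<epsilon> v \<longrightarrow> Ord x \<longrightarrow> x \<epsilon> k)"

definition link0 where
  "link0 a v w i j X Y \<longleftrightarrow>
     (if j = Suc i then Y = X
      else if i = 2 \<and> j = 5 then Y = X \<and> wfd0 w X
      else if i = 3 \<and> j = 5 then Y = X \<and> subset_of a X
      else i + 2 \<le> j \<and> opn0 (opi i j) v X Y)"

definition edge0 where
  "edge0 a v w x y \<longleftrightarrow> (\<exists>i X. x = pr i X \<and> (\<exists>j Y. y = pr j Y \<and> X \<epsilon> w \<and> Y \<epsilon> w \<and>
     \<not> (\<forall>i'<6. \<forall>j'<6. \<not> (i = nm i' \<and> j = nm j' \<and> link0 a v w i' j' X Y))))"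

text \<open>\<open>w\<close>, \<open>v\<close> and \<open>k\<close> are uniquely determined by \<open>U\<close>, whatever \<open>U\<close> is.\<close>

definition comp0 where
  "comp0 U w v k \<longleftrightarrow>
     (\<forall>X. X \<epsilon> w \<longrightarrow> (\<exists>u. u \<epsilon> U \<and> (\<exists>i Y. u = pr i Y \<and> i = emp \<and> Y = X))) \<and>
     (\<forall>u. u \<epsilon> U \<longrightarrow> (\<forall>i Y. u = pr i Y \<longrightarrow> i = emp \<longrightarrow> Y \<epsilon> w)) \<and>
     (\<forall>x. x \<epsilon> v \<longrightarrow> (\<exists>X. X \<epsilon> w \<and> x \<epsilon> X)) \<and> (\<forall>X. X \<epsilon> w \<longrightarrow> (\<forall>x. x \<epsilon> X \<longrightarrow> x \<epsilon> v)) \<and> ords0 v k"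

definition gver0 where
  "gver0 U w \<longleftrightarrow> (\<forall>u. u \<epsilon> U \<longrightarrow> (\<exists>i X. u = pr i X \<and> X \<epsilon> w \<and> \<not> (\<forall>m<6. \<not> i = nm m))) \<and>
     (\<forall>X. X \<epsilon> w \<longrightarrow> (\<forall>m<6. \<exists>u. u \<epsilon> U \<and> (\<exists>i Y. u = pr i Y \<and> i = nm m \<and> Y = X)))"

text \<open>Gathers the conditions that do not involve the index. The variables \<open>x\<close> and
  \<open>h\<close> carry the two unbounded quantifiers, both universal: \<open>w\<close> contains
  all subsets of \<open>v\<close>, and all endomorphisms are trivial.\<close>

definition main0 where
  "main0 U w v k x h \<longleftrightarrow> (subset_of x v \<longrightarrow> x \<epsilon> w) \<and> (\<exists>c. c \<epsilon> w \<and> lev0 c v w) \<and> lim k \<and>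
     (maps h w w \<longrightarrow> mor0 h v w \<longrightarrow> idn0 h w) \<and> gver0 U w"

text \<open>Failure of rigidity at \<open>m\<close>, with all witnesses sought in \<open>v\<close>.
  If \<open>v\<close> is a limit level above \<open>m\<close>, it contains the power set of
  \<open>V_m\<close> and its endomorphisms; so minimality of the level becomes a bounded
  condition.\<close>

definition flaw0 where
  "flaw0 m v \<longleftrightarrow> (\<exists>v'. v' \<epsilon> v \<and> (\<exists>w'. w' \<epsilon> v \<and> (\<exists>h. h \<epsilon> v \<and> ords0 v' m \<and>
     (\<forall>y. y \<epsilon> v \<longrightarrow> subset_of y v' \<longrightarrow> y \<epsilon> w') \<and> (\<forall>y. y \<epsilon> w' \<longrightarrow> subset_of y v') \<and>
     (\<exists>c. c \<epsilon> w' \<and> lev0 c v' w') \<and> maps h w' w' \<and> mor0 h v' w' \<and> \<not> idn0 h w')))"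

text \<open>All conditions on the index \<open>a\<close>. They are bounded, so that a bounded
  quantifier over \<open>a\<close> can be put in front of them for \<open>gcls\<close>.\<close>

definition tag0 where
  "tag0 a U R w v k \<longleftrightarrow> a \<epsilon> k \<and> (\<forall>m. m \<epsilon> k \<longrightarrow> lim m \<longrightarrow> a \<epsilon> m \<longrightarrow> flaw0 m v) \<and>
     (\<forall>p. p \<epsilon> R \<longrightarrow> (\<exists>x y. p = pr x y \<and> edge0 a v w x y)) \<and>
     (\<forall>x. x \<epsilon> U \<longrightarrow> (\<forall>y. y \<epsilon> U \<longrightarrow> edge0 a v w x y \<longrightarrow> pr x y \<epsilon> R))"

lemma def0_wfd0 [def0_intro]: "def0 (\<lambda>s. wfd0 (s i) (s j))"
  unfolding wfd0_def by (intro def0_intro)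

lemma def0_opn0 [def0_intro]: "def0 (\<lambda>s. opn0 m (s i) (s j) (s k))"
  unfolding opn0_def by (intro def0_intro)

lemma def0_mor0 [def0_intro]: "def0 (\<lambda>s. mor0 (s i) (s j) (s k))"
  unfolding mor0_def by (intro def0_intro)

lemma def0_idn0 [def0_intro]: "def0 (\<lambda>s. idn0 (s i) (s j))"
  unfolding idn0_def by (intro def0_intro)

lemma def0_lev0 [def0_intro]: "def0 (\<lambda>s. lev0 (s i) (s j) (s k))"
  unfolding lev0_def by (intro def0_intro)

lemma def0_ords0 [def0_intro]: "def0 (\<lambda>s. ords0 (s i) (s j))"
  unfolding ords0_def by (intro def0_intro)

lemma def0_link0 [def0_intro]: "def0 (\<lambda>s. link0 (s a) (s v) (s w) i j (s k) (s l))"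
  unfolding link0_def by (intro def0_intro)

lemma def0_edge0 [def0_intro]: "def0 (\<lambda>s. edge0 (s a) (s v) (s w) (s i) (s j))"
  unfolding edge0_def by (intro def0_intro)

lemma def0_comp0 [def0_intro]: "def0 (\<lambda>s. comp0 (s a) (s v) (s w) (s i))"
  unfolding comp0_def by (intro def0_intro)

lemma def0_gver0 [def0_intro]: "def0 (\<lambda>s. gver0 (s a) (s v))"
  unfolding gver0_def by (intro def0_intro)

lemma def0_main0 [def0_intro]: "def0 (\<lambda>s. main0 (s a) (s b) (s c) (s d) (s e) (s f))"
  unfolding main0_def by (intro def0_intro)

lemma def0_flaw0 [def0_intro]: "def0 (\<lambda>s. flaw0 (s a) (s b))"
  unfolding flaw0_def by (intro def0_intro)

lemma def0_tag0 [def0_intro]: "def0 (\<lambda>s. tag0 (s a) (s b) (s c) (s d) (s e) (s f))"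
  unfolding tag0_def by (intro def0_intro)

lemma wfd0_Pow: "wfd0 (Pow v) X \<longleftrightarrow> wfd v X"
  unfolding wfd0_def wfd_def by auto

lemma opn0_iff: "opn0 m v X Y \<longleftrightarrow> Y = opn m v X"
  unfolding opn0_def using mem_opn by (auto intro!: set_ext)

lemma link0_Pow: "link0 a v (Pow v) i j X Y \<longleftrightarrow> link a v i j X Y"
  unfolding link0_def link_def wfd0_Pow opn0_iff ..

lemma mor0_Pow:
  assumes h: "maps h (Pow v) (Pow v)"
  shows "mor0 h v (Pow v) \<longleftrightarrow> morph v v (app h)"
proof -
  have f: "pr X X' \<epsilon> h \<longleftrightarrow> subset_of X v \<and> X' = app h X" for X X'
    using h function_on_pr[of h "Pow v"] by (auto simp: maps_iff)
  have s: "subset_of (app h X) v" if "subset_of X v" for X using h that by (auto simp: maps_iff)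
  have o: "subset_of (opn m v X) v" for m X by (simp add: subset_of_def mem_opn)
  have "mor0 h v (Pow v) \<longleftrightarrow> (\<forall>X. subset_of X v \<longrightarrow> (wfd v X \<longrightarrow> wfd v (app h X)) \<and>
      (\<forall>Y. subset_of Y v \<longrightarrow> (\<forall>m<8. Y = opn m v X \<longrightarrow> app h Y = opn m v (app h X))))"
    unfolding mor0_def f opn0_iff wfd0_Pow by (simp add: imp_conjL)
  also have "\<dots> \<longleftrightarrow> (\<forall>X. subset_of X v \<longrightarrow> (wfd v X \<longrightarrow> wfd v (app h X)) \<and>
      (\<forall>m<8. app h (opn m v X) = opn m v (app h X)))"
  proof -
    have "(\<forall>Y. subset_of Y v \<longrightarrow> (\<forall>m<8::nat. Y = opn m v X \<longrightarrow> app h Y = opn m v (app h X))) \<longleftrightarrow>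
        (\<forall>m<8. app h (opn m v X) = opn m v (app h X))" for X
      using o by blast
    then show ?thesis by simp
  qed
  also have "\<dots> \<longleftrightarrow> morph v v (app h)" unfolding morph_def using s by blast
  finally show ?thesis .
qed

lemma idn0_Pow:
  assumes h: "maps h (Pow v) (Pow v)"
  shows "idn0 h (Pow v) \<longleftrightarrow> (\<forall>X. subset_of X v \<longrightarrow> app h X = X)"
proof -
  have "function_on h (Pow v)" using h by (simp add: maps_iff)
  then show ?thesis unfolding idn0_def by (auto simp: function_on_pr)
qed

text \<open>An element \<open>y\<close> of \<open>V_(rk z)\<close> has rank at most that of some
  \<open>b\<close> in \<open>z\<close>; as \<open>b\<close> is included in a level \<open>u\<close>,
  so is \<open>y\<close>. The predicate \<open>Q\<close> allows for two uses: members
  \<open>z\<close> of \<open>c\<close>, with \<open>Q u\<close> meaning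
  \<open>u \<epsilon> z\<close>, and \<open>v\<close> itself, with \<open>Q\<close> trivial.\<close>

lemma lev0_level:
  assumes sub: "subset_of z (Pow v)" and c: "\<And>u. u \<epsilon> c \<Longrightarrow> u \<epsilon> v" and v: "\<And>y. y \<epsilon> v \<Longrightarrow> subset_of y v"
    and z: "\<And>y. subset_of y v \<Longrightarrow> y \<epsilon> z \<longleftrightarrow> (\<exists>u. u \<epsilon> c \<and> Q u \<and> subset_of y u)"
    and IH: "\<And>u. u \<epsilon> c \<Longrightarrow> Q u \<Longrightarrow> u = Vs (rk u)"
  shows "z = Vs (rk z)"
proof (rule set_ext)
  fix y
  have rr: "rk (rk z) = rk z" by (rule rk_Ord) simp
  show "y \<epsilon> z \<longleftrightarrow> y \<epsilon> Vs (rk z)"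
  proof
    assume "y \<epsilon> z"
    then show "y \<epsilon> Vs (rk z)" unfolding mem_Vs_rk rr by (rule rk_mem)
  next
    assume "y \<epsilon> Vs (rk z)"
    then have "rk y \<epsilon> rk z" unfolding mem_Vs_rk rr .
    then obtain b where b: "b \<epsilon> z" "rk y \<epsilon> sc (rk b)" using mem_rk[of "rk y" z] by blast
    have "subset_of b v" using sub b(1) by (simp add: subset_of_def)
    then obtain u where u: "u \<epsilon> c" "Q u" "subset_of b u" using z b(1) by blast
    have uV: "x \<epsilon> u \<longleftrightarrow> rk x \<epsilon> rk u" for x
      using IH[OF u(1,2)] mem_Vs_Ord[of "rk u" x] by simp
    have "rk x \<epsilon> rk u" if "x \<epsilon> y" for x
    proof -
      have "subset_of (rk b) (rk u)" unfolding rk_le[OF Ord_rk] using u(3) uV by (auto simp: subset_of_def)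
      moreover have "rk x \<epsilon> rk b" using rk_mem[OF that] b(2) Ord_trans[OF Ord_rk[of b], of "rk x" "rk y"] by auto
      ultimately show ?thesis by (simp add: subset_of_def)
    qed
    then have yu: "subset_of y u" by (simp add: subset_of_def uV)
    moreover have "subset_of y v" using yu v[OF c[OF u(1)]] by (simp add: subset_of_def)
    ultimately show "y \<epsilon> z" using z u by blast
  qed
qed

lemma lev0_Vs:
  assumes c: "c \<epsilon> Pow v" "lev0 c v (Pow v)" and k: "ords0 v k"
  shows "Ord k" "v = Vs k"
proof -
  have cv: "\<And>u. u \<epsilon> c \<Longrightarrow> u \<epsilon> v" using c(1) by (simp add: subset_of_def)
  have vv: "\<And>y. y \<epsilon> v \<Longrightarrow> subset_of y v" and
    z: "\<And>z y. z \<epsilon> c \<Longrightarrow> subset_of y v \<Longrightarrow> y \<epsilon> z \<longleftrightarrow> (\<exists>u. u \<epsilon> c \<and> u \<epsilon> z \<and> subset_of y u)" and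
    y: "\<And>y. subset_of y v \<Longrightarrow> y \<epsilon> v \<longleftrightarrow> (\<exists>u. u \<epsilon> c \<and> subset_of y u)"
    using c(2) unfolding lev0_def mem_Pow by blast+
  have d: "defp (\<lambda>s. s 0 \<epsilon> c \<longrightarrow> s 0 = Vs (rk (s 0)))" by (intro defs_intro)
  have lev: "u \<epsilon> c \<longrightarrow> u = Vs (rk u)" for u
  proof (rule eps_induct[OF d], rule impI)
    fix u assume IH: "\<And>y. y \<epsilon> u \<Longrightarrow> y \<epsilon> c \<longrightarrow> y = Vs (rk y)" and u: "u \<epsilon> c"
    have "subset_of u (Pow v)" using vv cv[OF u] by (simp add: subset_of_def) (metis subset_of_def)
    from lev0_level[OF this cv vv z[OF u]] IH show "u = Vs (rk u)" by blast
  qed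
  have "v = Vs (rk v)"
  proof (rule lev0_level[where c = c and Q = "\<lambda>_. True"])
    show "subset_of v (Pow v)" using vv by (simp add: subset_of_def)
    show "u \<epsilon> v" if "u \<epsilon> c" for u using that by (rule cv)
    show "subset_of y v" if "y \<epsilon> v" for y using that by (rule vv)
    show "y \<epsilon> v \<longleftrightarrow> (\<exists>u. u \<epsilon> c \<and> True \<and> subset_of y u)" if "subset_of y v" for y using y[OF that] by simp
    show "u = Vs (rk u)" if "u \<epsilon> c" for u using lev that by blast
  qed
  moreover have "k = rk v"
  proof (rule set_ext)
    fix x
    have "x \<epsilon> k \<longleftrightarrow> x \<epsilon> v \<and> Ord x" using k unfolding ords0_def by blast
    also have "\<dots> \<longleftrightarrow> x \<epsilon> Vs (rk v) \<and> Ord x" using calculation \<open>v = Vs (rk v)\<close> by simp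
    also have "\<dots> \<longleftrightarrow> x \<epsilon> rk v" using Ord_in_Vs[OF Ord_rk] Ord_mem[OF Ord_rk] by blast
    finally show "x \<epsilon> k \<longleftrightarrow> x \<epsilon> rk v" .
  qed
  ultimately show "Ord k" "v = Vs k" by auto
qed

lemma lev0_exists:
  assumes k: "Ord k"
  shows "\<exists>c. c \<epsilon> Pow (Vs k) \<and> lev0 c (Vs k) (Pow (Vs k))" and "ords0 (Vs k) k"
proof -
  have d: "deft (\<lambda>s. Vs (s 0))" by (intro defs_intro)
  define c where "c = Repl k Vs"
  have c: "u \<epsilon> c \<longleftrightarrow> (\<exists>a. a \<epsilon> k \<and> u = Vs a)" for u unfolding c_def by (rule mem_Repl[OF d])
  have 1: "c \<epsilon> Pow (Vs k)" by (auto simp: subset_of_def c Vs_mem_Vs[OF k])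
  have 2: "y \<epsilon> Vs b \<longleftrightarrow> (\<exists>u. u \<epsilon> c \<and> u \<epsilon> Vs b \<and> subset_of y u)" if b: "b \<epsilon> k" for b y
  proof
    have ob: "Ord b" using k b Ord_mem by blast
    assume "y \<epsilon> Vs b"
    then obtain a where a: "a \<epsilon> b" "subset_of y (Vs a)" using mem_Vs[of y b] by blast
    then have "Vs a \<epsilon> c" "Vs a \<epsilon> Vs b" using Ord_trans[OF k a(1) b] Vs_mem_Vs[OF ob] by (auto simp: c)
    then show "\<exists>u. u \<epsilon> c \<and> u \<epsilon> Vs b \<and> subset_of y u" using a by blast
  next
    assume "\<exists>u. u \<epsilon> c \<and> u \<epsilon> Vs b \<and> subset_of y u"
    then show "y \<epsilon> Vs b" using Vs_sub by blast
  qed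
  have "lev0 c (Vs k) (Pow (Vs k))"
    unfolding lev0_def
  proof (intro conjI allI impI)
    show "y \<epsilon> Pow (Vs k)" if "y \<epsilon> Vs k" for y using that Vs_tr by (auto simp: subset_of_def)
    show "y \<epsilon> z \<longleftrightarrow> (\<exists>u. u \<epsilon> c \<and> u \<epsilon> z \<and> subset_of y u)" if "z \<epsilon> c" for y z
      using that 2 unfolding c[of z] by blast
    show "y \<epsilon> Vs k \<longleftrightarrow> (\<exists>u. u \<epsilon> c \<and> subset_of y u)" for y
      unfolding c mem_Vs[of y k] by blast
  qed
  then show "\<exists>c. c \<epsilon> Pow (Vs k) \<and> lev0 c (Vs k) (Pow (Vs k))" using 1 by blast
  show "ords0 (Vs k) k"
    unfolding ords0_def using Ord_in_Vs[OF k] Ord_mem[OF k] by blast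
qed

lemma rigid_iff0: "rigid l \<longleftrightarrow> lim l \<and> (\<forall>h. maps h (Pow (Vs l)) (Pow (Vs l)) \<longrightarrow>
    mor0 h (Vs l) (Pow (Vs l)) \<longrightarrow> idn0 h (Pow (Vs l)))"
  unfolding rigid_def using mor0_Pow idn0_Pow by meson

lemma maps_in_Vs: "lim k \<Longrightarrow> w \<epsilon> Vs k \<Longrightarrow> maps h w w \<Longrightarrow> h \<epsilon> Vs k"
proof -
  assume k: "lim k" and w: "w \<epsilon> Vs k" and h: "maps h w w"
  have "subset_of h (Pow (Pow w))"
    using h function_on_mem[of h w] by (auto simp: maps_iff subset_of_def pr_def)
  moreover have "Pow (Pow w) \<epsilon> Vs k" using k w by (intro Vs_lim_Pow)
  ultimately show ?thesis using Vs_sub by blast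
qed

lemma flaw0_iff:
  assumes k: "lim k" and m: "m \<epsilon> k" "lim m"
  shows "flaw0 m (Vs k) \<longleftrightarrow> \<not> rigid m"
proof
  have om: "Ord m" using m(2) by (rule lim_Ord)
  assume "flaw0 m (Vs k)"
  then obtain v w h c where v: "v \<epsilon> Vs k" "ords0 v m" "\<And>y. y \<epsilon> Vs k \<Longrightarrow> subset_of y v \<Longrightarrow> y \<epsilon> w"
    "\<And>y. y \<epsilon> w \<Longrightarrow> subset_of y v" and c: "c \<epsilon> w" "lev0 c v w" and h: "maps h w w" "mor0 h v w" "\<not> idn0 h w"
    unfolding flaw0_def by blast
  have w: "w = Pow v" by (rule set_ext) (use v Vs_sub in auto)
  have "v = Vs m" using lev0_Vs(2)[of c v m] c v(2) unfolding w by blast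
  then show "\<not> rigid m" unfolding rigid_iff0 using h unfolding w by blast
next
  have om: "Ord m" using m(2) by (rule lim_Ord)
  assume "\<not> rigid m"
  then obtain h where h: "maps h (Pow (Vs m)) (Pow (Vs m))" "mor0 h (Vs m) (Pow (Vs m))" "\<not> idn0 h (Pow (Vs m))"
    unfolding rigid_iff0 using m(2) by blast
  have v: "Vs m \<epsilon> Vs k" using Vs_mem_Vs[OF lim_Ord[OF k] m(1)] .
  have w: "Pow (Vs m) \<epsilon> Vs k" using Vs_lim_Pow[OF k v] .
  have hk: "h \<epsilon> Vs k" using maps_in_Vs[OF k w h(1)] .
  show "flaw0 m (Vs k)"
    unfolding flaw0_def
    by (rule exI[of _ "Vs m"], rule conjI[OF v], rule exI[of _ "Pow (Vs m)"], rule conjI[OF w],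
        rule exI[of _ h]) (use hk h lev0_exists[OF om] in auto)
qed

section \<open>Recognizing the graph of a least rigid level\<close>

definition least_rigid where
  "least_rigid a l \<longleftrightarrow> rigid l \<and> a \<epsilon> l \<and> (\<forall>m. m \<epsilon> l \<longrightarrow> a \<epsilon> m \<longrightarrow> \<not> rigid m)"

text \<open>The \<open>\<Pi>\<^sub>1\<close> definitions speak about all \<open>w\<close>,
  \<open>v\<close>, \<open>k\<close> with \<open>comp0\<close>. Existence keeps them from being
  satisfied vacuously.\<close>

lemma comp0_exists: "\<exists>w v k. comp0 U w v k"
proof -
  have d: "deft (\<lambda>s. p2 (s 0))" "defp (\<lambda>s. pr emp (s 0) \<epsilon> U)" "defp (\<lambda>s. Ord (s 0))" by (intro defs_intro)+
  define w where "w = Sep (Repl U p2) (\<lambda>X. pr emp X \<epsilon> U)"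
  have w: "X \<epsilon> w \<longleftrightarrow> pr emp X \<epsilon> U" for X
    unfolding w_def mem_Sep[OF d(2)] mem_Repl[OF d(1)] by (metis p2_pr)
  have "comp0 U w (Uni w) (Sep (Uni w) Ord)"
    unfolding comp0_def ords0_def mem_Sep[OF d(3)] by (auto simp: w)
  then show ?thesis by blast
qed

lemma edge0_iff:
  "edge0 a (Vs l) (Pow (Vs l)) x y \<longleftrightarrow> (\<exists>i<6. \<exists>j<6. \<exists>X Y. x = pr (nm i) X \<and> y = pr (nm j) Y \<and>
     subset_of X (Vs l) \<and> subset_of Y (Vs l) \<and> link a (Vs l) i j X Y)"
  unfolding edge0_def link0_Pow by auto

lemma gver0_iff: "gver0 U (Pow (Vs l)) \<longleftrightarrow> U = gver l"
proof -
  have *: "gver0 U (Pow (Vs l)) \<longleftrightarrow> (\<forall>u. u \<epsilon> U \<longleftrightarrow> (\<exists>i<6. \<exists>X. subset_of X (Vs l) \<and> u = pr (nm i) X))"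
    unfolding gver0_def by (auto; metis)
  show ?thesis unfolding * mem_gver[symmetric] by (auto intro: set_ext)
qed

lemma tag0_edges:
  "(\<forall>p. p \<epsilon> R \<longrightarrow> (\<exists>x y. p = pr x y \<and> edge0 a (Vs l) (Pow (Vs l)) x y)) \<and>
   (\<forall>x. x \<epsilon> gver l \<longrightarrow> (\<forall>y. y \<epsilon> gver l \<longrightarrow> edge0 a (Vs l) (Pow (Vs l)) x y \<longrightarrow> pr x y \<epsilon> R)) \<longleftrightarrow> R = gedg a l"
  (is "?L \<longleftrightarrow> _")
proof -
  have e: "edge0 a (Vs l) (Pow (Vs l)) x y \<longleftrightarrow> pr x y \<epsilon> gedg a l" for x y
  proof
    assume "edge0 a (Vs l) (Pow (Vs l)) x y"
    then show "pr x y \<epsilon> gedg a l" unfolding edge0_iff by (auto simp: mem_gedg)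
  next
    assume "pr x y \<epsilon> gedg a l"
    moreover obtain i X j Y where "x = pr (nm i) X" "y = pr (nm j) Y"
      using gedg_pair[OF calculation] unfolding mem_gver by auto
    ultimately show "edge0 a (Vs l) (Pow (Vs l)) x y" unfolding edge0_iff by (auto simp: mem_gedg)
  qed
  show ?thesis
  proof
    assume L: ?L
    then have 1: "\<And>p. p \<epsilon> R \<Longrightarrow> \<exists>x y. p = pr x y \<and> pr x y \<epsilon> gedg a l"
      and 2: "\<And>x y. x \<epsilon> gver l \<Longrightarrow> y \<epsilon> gver l \<Longrightarrow> pr x y \<epsilon> gedg a l \<Longrightarrow> pr x y \<epsilon> R"
      unfolding e by simp_all
    show "R = gedg a l"
    proof (rule set_ext)
      fix p
      have "p \<epsilon> R" if p: "p \<epsilon> gedg a l"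
      proof -
        obtain x y where xy: "x \<epsilon> gver l" "y \<epsilon> gver l" "p = pr x y" using gedg_pair[OF p] by blast
        then show ?thesis using 2[OF xy(1,2)] p by simp
      qed
      moreover have "p \<epsilon> gedg a l" if "p \<epsilon> R" using 1[OF that] by auto
      ultimately show "p \<epsilon> R \<longleftrightarrow> p \<epsilon> gedg a l" by (rule iffI[rotated])
    qed
  next
    assume R: "R = gedg a l"
    have "\<exists>x y. p = pr x y \<and> pr x y \<epsilon> gedg a l" if p: "p \<epsilon> gedg a l" for p
    proof -
      obtain x y where "p = pr x y" using gedg_pair[OF p] by blast
      then show ?thesis using p by auto
    qed
    then show ?L unfolding e R by simp
  qed
qed

text \<open>The power set, the level and its height are recovered from the vertices alone. For a
  graph \<open>gr a l\<close> the recovered \<open>k\<close> is \<open>l\<close>, which is above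
  \<open>a\<close>; this gives the second claim.\<close>

lemma graph_char:
  assumes c: "comp0 U w v k"
  shows "(\<forall>x h. main0 U w v k x h) \<and> tag0 a U R w v k \<longleftrightarrow>
    (\<exists>l. least_rigid a l \<and> pr U R = gr a l)" (is "?L \<longleftrightarrow> ?R")
    and "(\<exists>l. least_rigid a l \<and> pr U R = gr a l) \<Longrightarrow> a \<epsilon> k"
proof -
  have w: "X \<epsilon> w \<longleftrightarrow> pr emp X \<epsilon> U" and v: "x \<epsilon> v \<longleftrightarrow> (\<exists>X. X \<epsilon> w \<and> x \<epsilon> X)" and k: "ords0 v k" for X x
    using c unfolding comp0_def by blast+
  have LR: "least_rigid a k \<and> pr U R = gr a k" if L: ?L
  proof -
    have "X \<epsilon> w \<longleftrightarrow> subset_of X v" for X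
      using L v unfolding main0_def subset_of_def by blast
    then have wP: "w = Pow v" by (auto intro: set_ext)
    obtain c where "c \<epsilon> Pow v" "lev0 c v (Pow v)" using L unfolding main0_def wP by blast
    from lev0_Vs[OF this k] have vk: "v = Vs k" by blast
    have lk: "lim k" using L unfolding main0_def by blast
    have r: "rigid k" unfolding rigid_iff0 using L lk unfolding main0_def wP vk by blast
    have U: "U = gver k" using L unfolding main0_def wP vk gver0_iff by blast
    have t: "tag0 a (gver k) R (Pow (Vs k)) (Vs k) k" using L unfolding wP vk U by blast
    then have R: "R = gedg a k" unfolding tag0_def tag0_edges[symmetric] by blast
    have "\<not> rigid m" if "m \<epsilon> k" "a \<epsilon> m" for m
    proof
      assume "rigid m"
      moreover have "lim m" using calculation by (simp add: rigid_def)
      ultimately show False using t flaw0_iff[OF lk that(1)] that unfolding tag0_def by blast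
    qed
    moreover have "a \<epsilon> k" using t unfolding tag0_def by blast
    ultimately show ?thesis unfolding least_rigid_def gr_def using r U R by blast
  qed
  have RL: "a \<epsilon> k \<and> ?L" if R: "least_rigid a l" "pr U R = gr a l" for l
  proof -
    have U: "U = gver l" and Re: "R = gedg a l" using R(2) unfolding gr_def by auto
    have ll: "lim l" and r: "rigid l" using R(1) unfolding least_rigid_def rigid_def by auto
    have wP: "w = Pow (Vs l)"
    proof (rule set_ext)
      fix X
      have "pr emp X \<epsilon> gver l \<longleftrightarrow> subset_of X (Vs l)"
      proof
        assume "subset_of X (Vs l)"
        then have "pr (nm 0) X \<epsilon> gver l" unfolding mem_gver by (intro exI[of _ 0]) auto
        then show "pr emp X \<epsilon> gver l" by simp
      qed (auto simp: mem_gver)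
      then show "X \<epsilon> w \<longleftrightarrow> X \<epsilon> Pow (Vs l)" unfolding w U by simp
    qed
    have vV: "v = Vs l"
    proof (rule set_ext)
      fix x show "x \<epsilon> v \<longleftrightarrow> x \<epsilon> Vs l"
        unfolding v wP by (auto simp: subset_of_def)
    qed
    have kl: "k = l"
    proof (rule set_ext)
      fix x show "x \<epsilon> k \<longleftrightarrow> x \<epsilon> l"
        using k lev0_exists(2)[OF lim_Ord[OF ll]] unfolding vV ords0_def by blast
    qed
    have "main0 U w v k x h" for x h
      unfolding main0_def vV kl wP U using ll r lev0_exists(1)[OF lim_Ord[OF ll]]
      by (simp add: gver0_iff rigid_iff0)
    moreover have "tag0 a U R w v k"
      unfolding tag0_def vV kl wP U
      using R(1) flaw0_iff[OF ll] tag0_edges[of R a l] Re unfolding least_rigid_def by blast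
    ultimately show ?thesis using R(1) unfolding kl least_rigid_def by blast
  qed
  show "?L \<longleftrightarrow> ?R" using LR RL by blast
  show "?R \<Longrightarrow> a \<epsilon> k" using RL by blast
qed

section \<open>The sequence and its range are \<open>\<Pi>\<^sub>1\<close>\<close>

definition gseq where "gseq = {p. \<exists>a l. p = pr a (gr a l) \<and> least_rigid a l}"
definition gcls where "gcls = {G. \<exists>a l. G = gr a l \<and> least_rigid a l}"

text \<open>The entries 1 to 9 of the environment are the index, the graph, its vertices
  \<open>U\<close> and edges \<open>R\<close>, the recovered \<open>w\<close>, \<open>v\<close>,
  \<open>k\<close>, and the variables \<open>x\<close>, \<open>h\<close> of \<open>main0\<close>.
  Entry 0 determines the first seven of these, so that quantifying them universally is
  harmless.\<close>

lemma gseq_definable: "definable_by (levy_Pi 1) gseq"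
proof -
  define P where "P s \<longleftrightarrow> (\<exists>a G. s 0 = pr a G \<and> (\<exists>U R. G = pr U R)) \<and>
    (s 0 = pr (s 1) (s 2) \<longrightarrow> s 2 = pr (s 3) (s 4) \<longrightarrow> comp0 (s 3) (s 5) (s 6) (s 7) \<longrightarrow>
      main0 (s 3) (s 5) (s 6) (s 7) (s 8) (s 9) \<and> tag0 (s 1) (s 3) (s 4) (s 5) (s 6) (s 7))" for s :: "nat \<Rightarrow> 'a"
  have "def0 P" unfolding P_def by (intro def0_intro)
  moreover have "(\<forall>s. s 0 = p \<longrightarrow> P s) \<longleftrightarrow> p \<in> gseq" for p
  proof
    assume *: "\<forall>s. s 0 = p \<longrightarrow> P s"
    have "P (\<lambda>_. p)" using *[rule_format, of "\<lambda>_. p"] by simp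
    then obtain a U R where p: "p = pr a (pr U R)" unfolding P_def by blast
    obtain w v k where c: "comp0 U w v k" using comp0_exists by blast
    have "main0 U w v k x h \<and> tag0 a U R w v k" for x h
    proof -
      define s where "s = (\<lambda>i::nat. [p, a, pr U R, U, R, w, v, k, x, h] ! i)"
      have "P s" using *[rule_format, of s] by (simp add: s_def)
      then show ?thesis unfolding P_def by (simp add: s_def p c numeral_eq_Suc)
    qed
    then have "(\<forall>x h. main0 U w v k x h) \<and> tag0 a U R w v k" by simp
    then have "\<exists>l. least_rigid a l \<and> pr U R = gr a l" by (rule graph_char(1)[OF c, THEN iffD1])
    then show "p \<in> gseq" unfolding gseq_def p by auto
  next
    assume "p \<in> gseq"
    then obtain a l where p: "p = pr a (gr a l)" "least_rigid a l" unfolding gseq_def by blast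
    show "\<forall>s. s 0 = p \<longrightarrow> P s"
    proof (intro allI impI)
      fix s :: "nat \<Rightarrow> 'a" assume s: "s 0 = p"
      have "\<exists>U R. gr a l = pr U R" unfolding gr_def by blast
      moreover have "main0 (s 3) (s 5) (s 6) (s 7) (s 8) (s 9) \<and> tag0 (s 1) (s 3) (s 4) (s 5) (s 6) (s 7)"
        if e: "s 0 = pr (s 1) (s 2)" "s 2 = pr (s 3) (s 4)" and c: "comp0 (s 3) (s 5) (s 6) (s 7)"
      proof -
        have "\<exists>l. least_rigid (s 1) l \<and> pr (s 3) (s 4) = gr (s 1) l" using e s p by auto
        then show ?thesis using graph_char(1)[OF c] by blast
      qed
      ultimately show "P s" unfolding P_def using s p by blast
    qed
  qed
  ultimately show ?thesis using definable_by_Pi1[of P] by simp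
qed

text \<open>The range of a \<open>\<Pi>\<^sub>1\<close> sequence need not be
  \<open>\<Pi>\<^sub>1\<close>, because of the existential quantifier over the index. Here the index
  lies below the height \<open>k\<close> of the level, so this quantifier is bounded.\<close>

lemma gcls_definable: "definable_by (levy_Pi 1) gcls"
proof -
  define P where "P s \<longleftrightarrow> (\<exists>U R. s 0 = pr U R) \<and>
    (s 0 = pr (s 3) (s 4) \<longrightarrow> comp0 (s 3) (s 5) (s 6) (s 7) \<longrightarrow>
      main0 (s 3) (s 5) (s 6) (s 7) (s 8) (s 9) \<and>
      (\<exists>a. a \<epsilon> s 7 \<and> tag0 a (s 3) (s 4) (s 5) (s 6) (s 7)))" for s :: "nat \<Rightarrow> 'a"
  have "def0 P" unfolding P_def by (intro def0_intro)
  moreover have "(\<forall>s. s 0 = p \<longrightarrow> P s) \<longleftrightarrow> p \<in> gcls" for p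
  proof
    assume *: "\<forall>s. s 0 = p \<longrightarrow> P s"
    have "P (\<lambda>_. p)" using *[rule_format, of "\<lambda>_. p"] by simp
    then obtain U R where p: "p = pr U R" unfolding P_def by blast
    obtain w v k where c: "comp0 U w v k" using comp0_exists by blast
    have "main0 U w v k x h \<and> (\<exists>a. tag0 a U R w v k)" for x h
    proof -
      define s where "s = (\<lambda>i::nat. [p, p, p, U, R, w, v, k, x, h] ! i)"
      have "P s" using *[rule_format, of s] by (simp add: s_def)
      then show ?thesis unfolding P_def by (auto simp: s_def p c numeral_eq_Suc)
    qed
    then obtain a where "(\<forall>x h. main0 U w v k x h) \<and> tag0 a U R w v k" by blast
    then have "\<exists>l. least_rigid a l \<and> pr U R = gr a l" by (rule graph_char(1)[OF c, THEN iffD1])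
    then show "p \<in> gcls" unfolding gcls_def p by auto
  next
    assume "p \<in> gcls"
    then obtain a l where p: "p = gr a l" "least_rigid a l" unfolding gcls_def by blast
    show "\<forall>s. s 0 = p \<longrightarrow> P s"
    proof (intro allI impI)
      fix s :: "nat \<Rightarrow> 'a" assume s: "s 0 = p"
      have "\<exists>U R. gr a l = pr U R" unfolding gr_def by blast
      moreover have "main0 (s 3) (s 5) (s 6) (s 7) (s 8) (s 9) \<and> a \<epsilon> s 7 \<and> tag0 a (s 3) (s 4) (s 5) (s 6) (s 7)"
        if e: "s 0 = pr (s 3) (s 4)" and c: "comp0 (s 3) (s 5) (s 6) (s 7)"
      proof -
        have "\<exists>l. least_rigid a l \<and> pr (s 3) (s 4) = gr a l" using e s p by auto
        then show ?thesis using graph_char[OF c] by blast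
      qed
      ultimately show "P s" unfolding P_def unfolding s p(1) by (intro conjI impI; (elim exE)?; blast)
    qed
  qed
  ultimately show ?thesis using definable_by_Pi1[of P] by simp
qed

section \<open>Sequences violating the principles\<close>

definition descending where
  "descending F \<longleftrightarrow> (\<forall>a b A B. Ord a \<and> Ord b \<and> value_at F a A \<and> value_at F b B \<longrightarrow>
     (a \<epsilon> b \<or> a = b \<longrightarrow> (\<exists>h. homomorphism h B A)) \<and> (a \<epsilon> b \<longrightarrow> \<not> (\<exists>h. homomorphism h A B)))"

lemma value_at_iff: "value_at F x y \<longleftrightarrow> pr x y \<in> F"
  unfolding value_at_def by auto

lemma defp_homomorphism [defs_intro]:
  "deft t \<Longrightarrow> deft u \<Longrightarrow> deft v \<Longrightarrow> defp (\<lambda>s. homomorphism (t s) (u s) (v s))"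
  by (rule defp_app3[where P = homomorphism]) (unfold homomorphism_def, intro defs_intro)

lemma graph_pr: "graph A \<Longrightarrow> \<exists>G R. A = pr G R \<and> G \<noteq> emp \<and> (\<forall>p. p \<epsilon> R \<longrightarrow> (\<exists>x y. x \<epsilon> G \<and> y \<epsilon> G \<and> p = pr x y))"
  unfolding graph_def by simp

lemma hom_comp:
  assumes h: "homomorphism h A B" and k: "homomorphism k B D"
  shows "\<exists>e. homomorphism e A D"
proof -
  obtain G R G' R' where AB: "A = pr G R" "B = pr G' R'" using h unfolding homomorphism_def by auto
  obtain G'' R'' where D: "D = pr G'' R''" using k unfolding homomorphism_def by auto
  have h': "maps h G G'" "\<And>x y. pr x y \<epsilon> R \<Longrightarrow> x \<epsilon> G \<Longrightarrow> y \<epsilon> G \<Longrightarrow> pr (app h x) (app h y) \<epsilon> R'"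
    using h unfolding AB homomorphism_pr by simp_all
  have k': "maps k G' G''" "\<And>x y. pr x y \<epsilon> R' \<Longrightarrow> x \<epsilon> G' \<Longrightarrow> y \<epsilon> G' \<Longrightarrow> pr (app k x) (app k y) \<epsilon> R''"
    using k unfolding AB D homomorphism_pr by simp_all
  have hG: "app h x \<epsilon> G'" if "x \<epsilon> G" for x using h'(1) that by (simp add: maps_iff)
  have d: "deft (\<lambda>s. app k (app h (s 0)))" by (intro defs_intro)
  have "homomorphism (lam G (\<lambda>x. app k (app h x))) A D"
    unfolding AB D homomorphism_pr
  proof (intro conjI allI impI)
    show "maps (lam G (\<lambda>x. app k (app h x))) G G''"
      by (rule maps_lam[OF d]) (use k'(1) hG in \<open>simp add: maps_iff\<close>)
    show "pr (app (lam G (\<lambda>x. app k (app h x))) x) (app (lam G (\<lambda>x. app k (app h x))) y) \<epsilon> R''"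
      if "pr x y \<epsilon> R" "x \<epsilon> G" "y \<epsilon> G" for x y
      using k'(2)[OF h'(2)[OF that] hG[OF that(2)] hG[OF that(3)]] that by (simp add: app_lam[OF d])
  qed
  then show ?thesis by blast
qed

lemma product_iff: "product S P \<longleftrightarrow> (\<exists>U R. P = pr U R \<and>
    (\<forall>f. f \<epsilon> U \<longleftrightarrow> function_on f S \<and> (\<forall>A. A \<epsilon> S \<longrightarrow> vertex A (app f A))) \<and>
    (\<forall>p. p \<epsilon> R \<longleftrightarrow> (\<exists>f g. f \<epsilon> U \<and> g \<epsilon> U \<and> p = pr f g \<and>
      (\<forall>A. A \<epsilon> S \<longrightarrow> edge A (app f A) (app g A)))))"
proof -
  have 1: "function_on f S \<and> (\<forall>A x. related f A x \<longrightarrow> vertex A x) \<longleftrightarrow>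
      function_on f S \<and> (\<forall>A. A \<epsilon> S \<longrightarrow> vertex A (app f A))" for f
    by (cases "function_on f S") (simp_all add: function_on_pr)
  have 2: "(\<forall>A x y. A \<epsilon> S \<and> related f A x \<and> related g A y \<longrightarrow> edge A x y) \<longleftrightarrow>
      (\<forall>A. A \<epsilon> S \<longrightarrow> edge A (app f A) (app g A))" if "function_on f S" "function_on g S" for f g
    using that by (simp add: function_on_pr)
  have 3: "(\<exists>f g. f \<epsilon> U \<and> g \<epsilon> U \<and> p = pr f g \<and>
        (\<forall>A x y. A \<epsilon> S \<and> related f A x \<and> related g A y \<longrightarrow> edge A x y)) \<longleftrightarrow>
      (\<exists>f g. f \<epsilon> U \<and> g \<epsilon> U \<and> p = pr f g \<and> (\<forall>A. A \<epsilon> S \<longrightarrow> edge A (app f A) (app g A)))"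
    if U: "\<And>f. f \<epsilon> U \<Longrightarrow> function_on f S" for U p
    using 2 U by (intro ex_cong1 conj_cong refl) blast+
  show ?thesis unfolding product_def opair_iff 1 by (intro ex_cong1 conj_cong refl all_cong1) (subst 3; blast)
qed

lemma hom_to_product:
  assumes P: "product S P" and k: "\<And>A. A \<epsilon> S \<Longrightarrow> \<exists>h. homomorphism h (pr G R) A"
  shows "\<exists>h. homomorphism h (pr G R) P"
proof -
  obtain U T where PU: "P = pr U T"
    and U: "\<And>f. f \<epsilon> U \<longleftrightarrow> function_on f S \<and> (\<forall>A. A \<epsilon> S \<longrightarrow> vertex A (app f A))"
    and T: "\<And>p. p \<epsilon> T \<longleftrightarrow> (\<exists>f g. f \<epsilon> U \<and> g \<epsilon> U \<and> p = pr f g \<and>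
        (\<forall>A. A \<epsilon> S \<longrightarrow> edge A (app f A) (app g A)))"
    using P unfolding product_iff by blast
  have d: "defp (\<lambda>s. homomorphism (s 1) (pr G R) (s 0))" by (intro defs_intro)
  obtain k where k: "\<And>A. A \<epsilon> S \<Longrightarrow> homomorphism (app k A) (pr G R) A"
    using choice_predicate[where P = "\<lambda>A h. homomorphism h (pr G R) A", OF d, of S] k by blast
  have kA: "vertex A (app (app k A) x)" if A: "A \<epsilon> S" and x: "x \<epsilon> G" for A x
  proof -
    obtain G' R' where "A = pr G' R'" using k[OF A] unfolding homomorphism_def by auto
    then show ?thesis using k[OF A] x unfolding vertex_iff by (auto simp: homomorphism_pr maps_iff)
  qed
  have kR: "edge A (app (app k A) x) (app (app k A) y)"
    if A: "A \<epsilon> S" and x: "pr x y \<epsilon> R" "x \<epsilon> G" "y \<epsilon> G" for A x y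
  proof -
    obtain G' R' where "A = pr G' R'" using k[OF A] unfolding homomorphism_def by auto
    then show ?thesis using k[OF A] x unfolding edge_iff by (auto simp: homomorphism_pr)
  qed
  define e where "e x = lam S (\<lambda>A. app (app k A) x)" for x
  have de: "deft (\<lambda>s. e (s 0))" unfolding e_def by (intro defs_intro)
  have dk: "deft (\<lambda>s. app (app k (s 0)) x)" for x by (intro defs_intro)
  have ea: "app (e x) A = app (app k A) x" if "A \<epsilon> S" for x A unfolding e_def using app_lam[OF dk that] .
  have eU: "e x \<epsilon> U" if x: "x \<epsilon> G" for x
    unfolding U using function_on_lam[OF dk] kA x by (simp add: ea) (simp add: e_def)
  have "homomorphism (lam G e) (pr G R) P"
    unfolding PU homomorphism_pr
  proof (intro conjI allI impI)
    show "maps (lam G e) G U" by (rule maps_lam[OF de eU])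
    show "pr (app (lam G e) x) (app (lam G e) y) \<epsilon> T" if "pr x y \<epsilon> R" "x \<epsilon> G" "y \<epsilon> G" for x y
      unfolding T by (rule exI[of _ "e x"], rule exI[of _ "e y"])
        (use kR that eU in \<open>simp add: ea app_lam[OF de]\<close>)
  qed
  then show ?thesis by blast
qed

text \<open>
  If \<open>b\<close> bounds the indices of the graphs in \<open>S\<close>, then \<open>G\<^sub>b\<close> maps to all of them, hence to their
  product, which therefore does not map to \<open>G\<^sub>c\<close> for \<open>c > b\<close>.
\<close>

lemma descending_range:
  assumes F: "definable_class F" "graph_sequence F" "descending F"
  defines "C \<equiv> {A. \<exists>a. Ord a \<and> value_at F a A}"
  shows "proper_class C"
    and "\<And>S. (\<And>A. A \<epsilon> S \<Longrightarrow> A \<in> C) \<Longrightarrow> \<exists>G\<in>C. \<forall>P h. product S P \<longrightarrow> \<not> homomorphism h P G"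
proof -
  have ex: "\<exists>A. pr a A \<in> F" if "Ord a" for a
    using F(2) that unfolding graph_sequence_def value_at_iff by auto
  have gr: "graph A" "Ord a" if "pr a A \<in> F" for a A
  proof -
    have "\<forall>p\<in>F. \<exists>a G. p = pr a G \<and> Ord a \<and> graph G" using F(2) unfolding graph_sequence_def by simp
    then show "graph A" "Ord a" using that by fastforce+
  qed
  have down: "\<exists>h. homomorphism h B A" if "pr a A \<in> F" "pr b B \<in> F" "a \<epsilon> b \<or> a = b" for a b A B
    using F(3) that gr unfolding descending_def value_at_iff by blast
  have up: "\<not> homomorphism h A B" if "pr a A \<in> F" "pr b B \<in> F" "a \<epsilon> b" for a b A B h
    using F(3) that gr unfolding descending_def value_at_iff by blast
  have bound: "\<exists>b. Ord b \<and> (\<forall>A. A \<epsilon> S \<longrightarrow> (\<exists>a. a \<epsilon> b \<and> pr a A \<in> F))" if S: "\<And>A. A \<epsilon> S \<Longrightarrow> A \<in> C" for S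
  proof -
    have d: "defp (\<lambda>s. pr (s 1) (s 0) \<in> F)" by (intro defp_class[OF F(1)] defs_intro)
    obtain f where f: "\<And>A. A \<epsilon> S \<Longrightarrow> \<exists>a. pr a A \<in> F \<Longrightarrow> pr (app f A) A \<in> F"
      using choice_predicate[where P = "\<lambda>A a. pr a A \<in> F", OF d] by blast
    have fF: "pr (app f A) A \<in> F" if "A \<epsilon> S" for A
      using f[OF that] S[OF that] unfolding C_def value_at_iff by blast
    have da: "deft (\<lambda>s. app f (s 0))" by (intro defs_intro)
    have "Ord x" if "x \<epsilon> Repl S (app f)" for x
      using that gr(2)[OF fF] unfolding mem_Repl[OF da] by blast
    then obtain b where b: "Ord b" "\<And>x. x \<epsilon> Repl S (app f) \<Longrightarrow> x \<epsilon> b" using Ord_bound by blast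
    have "app f A \<epsilon> b" if "A \<epsilon> S" for A using b(2) that mem_Repl[OF da] by blast
    then show ?thesis using b(1) fF by blast
  qed
  show "proper_class C"
    unfolding proper_class_def
  proof
    assume "\<exists>a. \<forall>x. x \<epsilon> a \<longleftrightarrow> x \<in> C"
    then obtain S where S: "\<And>x. x \<epsilon> S \<longleftrightarrow> x \<in> C" by blast
    then obtain b where b: "Ord b" "\<And>A. A \<epsilon> S \<Longrightarrow> \<exists>a. a \<epsilon> b \<and> pr a A \<in> F" using bound by blast
    \<comment> \<open>\<open>B\<close> also has an index below \<open>b\<close>. A homomorphism from
      \<open>B\<close> to itself, which exists downwards, would then be one upwards.\<close>
    obtain B where B: "pr b B \<in> F" using ex b(1) by blast
    then have "B \<epsilon> S" unfolding S C_def value_at_iff using b(1) by blast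
    then obtain a where "a \<epsilon> b" "pr a B \<in> F" using b(2) by blast
    then show False using up[OF _ B] down[OF B B] by blast
  qed
  fix S assume S: "\<And>A. A \<epsilon> S \<Longrightarrow> A \<in> C"
  obtain b where b: "Ord b" "\<And>A. A \<epsilon> S \<Longrightarrow> \<exists>a. a \<epsilon> b \<and> pr a A \<in> F" using bound[OF S] by blast
  obtain B where B: "pr b B \<in> F" using ex b(1) by blast
  obtain D where D: "pr (sc b) D \<in> F" using ex Ord_sc[OF b(1)] by blast
  have kh: "\<exists>h. homomorphism h B A" if "A \<epsilon> S" for A
    using b(2)[OF that] down[OF _ B] by blast
  obtain GB RB where GB: "B = pr GB RB" using graph_pr[OF gr(1)[OF B]] by blast
  have "\<not> homomorphism h P D" if P: "product S P" for P h
  proof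
    assume h: "homomorphism h P D"
    obtain e where e: "homomorphism e B P" using hom_to_product[OF P] kh unfolding GB by blast
    obtain k where "homomorphism k B D" using hom_comp[OF e h] by blast
    moreover have "b \<epsilon> sc b" by simp
    ultimately show False using up[OF B D] by blast
  qed
  moreover have "D \<in> C" unfolding C_def value_at_iff using D gr(2) by blast
  ultimately show "\<exists>G\<in>C. \<forall>P h. product S P \<longrightarrow> \<not> homomorphism h P G" by blast
qed

section \<open>Failure of the principles in the absence of strong cardinals\<close>

lemma least_rigid_exists:
  assumes ns: "\<not> (\<exists>\<kappa>. strong_cardinal \<kappa>)" and a: "Ord a"
  shows "\<exists>!l. least_rigid a l"
proof -
  obtain l where l: "rigid l" "a \<epsilon> l" using rigid_unbounded[OF ns a] by blast
  have ol: "Ord l" using l(1) by (simp add: rigid_def lim_Ord)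
  have d: "defp (\<lambda>s. rigid (s 0) \<and> a \<epsilon> s 0)"
    unfolding rigid_def by (intro defs_intro defp_morph)
  from Ord_least[OF d ol] l obtain m where "Ord m" "rigid m \<and> a \<epsilon> m" "\<forall>c. c \<epsilon> m \<longrightarrow> \<not> (rigid c \<and> a \<epsilon> c)"
    by blast
  then have "least_rigid a m" unfolding least_rigid_def by blast
  moreover have "m' = m''" if "least_rigid a m'" "least_rigid a m''" for m' m''
  proof -
    have "Ord m'" "Ord m''" using that by (auto simp: least_rigid_def rigid_def lim_Ord)
    then show ?thesis using that Ord_linear unfolding least_rigid_def by blast
  qed
  ultimately show ?thesis by blast
qed

lemma least_rigid_mono:
  assumes "least_rigid a l" "least_rigid b g" "a \<epsilon> b \<or> a = b" "Ord b"
  shows "l \<epsilon> g \<or> l = g"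
proof -
  have "lim l" "lim g" using assms by (auto simp: least_rigid_def rigid_def)
  then have o: "Ord l" "Ord g" by (auto simp: lim_Ord)
  have "a \<epsilon> g" using assms Ord_trans[OF o(2)] unfolding least_rigid_def by blast
  then show ?thesis using Ord_linear[OF o] assms(1,2) unfolding least_rigid_def by blast
qed

lemma gseq_props:
  assumes ns: "\<not> (\<exists>\<kappa>. strong_cardinal \<kappa>)"
  shows "graph_sequence gseq" "descending gseq"
    and "\<And>a b A B h h'. value_at gseq a A \<Longrightarrow> value_at gseq b B \<Longrightarrow> a \<epsilon> b \<or> a = b \<Longrightarrow>
      homomorphism h B A \<Longrightarrow> homomorphism h' B A \<Longrightarrow> h = h'"
    and "gcls = {A. \<exists>a. Ord a \<and> value_at gseq a A}"
proof -
  have oa: "Ord a" if "least_rigid a l" for a l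
    using that by (auto simp: least_rigid_def rigid_def dest: lim_Ord Ord_mem)
  have v: "value_at gseq a A \<longleftrightarrow> (\<exists>l. least_rigid a l \<and> A = gr a l)" for a A
    unfolding value_at_iff gseq_def by auto
  show "graph_sequence gseq"
    unfolding graph_sequence_def
  proof (intro conjI ballI allI impI)
    fix p assume "p \<in> gseq"
    then show "\<exists>a G. opair a G p \<and> ordinal a \<and> graph G"
      unfolding gseq_def using oa gr_graph by auto
  next
    fix a assume "ordinal a"
    then show "\<exists>!G. value_at gseq a G" unfolding v using least_rigid_exists[OF ns, of a] by auto
  qed
  show "descending gseq"
    unfolding descending_def
  proof (intro allI impI, elim conjE)
    fix a b A B assume o: "Ord a" "Ord b" and AB: "value_at gseq a A" "value_at gseq b B"
    obtain l g where lg: "least_rigid a l" "A = gr a l" "least_rigid b g" "B = gr b g"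
      using AB unfolding v by blast
    have r: "rigid l" "rigid g" "lim l" "lim g" "a \<epsilon> l" using lg by (auto simp: least_rigid_def rigid_def)
    have sub: "subset_of a (Vs l)"
      using Ord_trans[OF lim_Ord[OF r(3)] _ r(5)] Ord_mem[OF o(1)] Ord_in_Vs[OF lim_Ord[OF r(3)]]
      by (simp add: subset_of_def)
    show "(a \<epsilon> b \<or> a = b \<longrightarrow> (\<exists>h. homomorphism h B A)) \<and> (a \<epsilon> b \<longrightarrow> \<not> (\<exists>h. homomorphism h A B))"
    proof (intro conjI impI)
      assume ab: "a \<epsilon> b \<or> a = b"
      then have "subset_of a b" using Ord_subset[OF o] by blast
      then show "\<exists>h. homomorphism h B A"
        using gr_cap_hom[OF r(3,4) least_rigid_mono[OF lg(1,3) ab o(2)] _ sub] lg by blast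
    next
      assume ab: "a \<epsilon> b"
      then show "\<not> (\<exists>h. homomorphism h A B)"
        using gr_no_hom[OF r(2,3) least_rigid_mono[OF lg(1,3) _ o(2)] o(2) ab r(5)] lg by blast
    qed
  qed
  show "h = h'" if AB: "value_at gseq a A" "value_at gseq b B" and ab: "a \<epsilon> b \<or> a = b"
    and h: "homomorphism h B A" "homomorphism h' B A" for a b A B h h'
  proof -
    obtain l g where lg: "least_rigid a l" "A = gr a l" "least_rigid b g" "B = gr b g"
      using AB unfolding v by blast
    have r: "rigid l" "lim g" using lg by (auto simp: least_rigid_def rigid_def)
    show ?thesis
      using gr_hom_unique[OF r least_rigid_mono[OF lg(1,3) ab oa[OF lg(3)]]] h unfolding lg by blast
  qed
  show "gcls = {A. \<exists>a. Ord a \<and> value_at gseq a A}"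
    unfolding gcls_def v using oa by blast
qed

lemma no_strong_not_WVP:
  assumes "\<not> (\<exists>\<kappa>. strong_cardinal \<kappa>)"
  shows "\<not> WVP (levy_Pi 1)"
  unfolding WVP_def not_not
proof (intro exI[of _ gseq] conjI gseq_definable gseq_props(1)[OF assms] allI impI; elim conjE)
  fix a b A B assume ab: "ordinal a" "ordinal b" "value_at gseq a A" "value_at gseq b B"
  then have d: "(a \<epsilon> b \<or> a = b \<longrightarrow> (\<exists>h. homomorphism h B A)) \<and> (a \<epsilon> b \<longrightarrow> \<not> (\<exists>h. homomorphism h A B))"
    using gseq_props(2)[OF assms] unfolding descending_def by simp
  show "\<exists>!h. homomorphism h B A" if "a \<epsilon> b \<or> a = b"
    using d that gseq_props(3)[OF assms ab(3,4) that] by blast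
  show "\<not> (\<exists>h. homomorphism h A B)" if "a \<epsilon> b" using d that by blast
qed

lemma no_strong_not_PRP:
  assumes "\<not> (\<exists>\<kappa>. strong_cardinal \<kappa>)"
  shows "\<not> PRP (levy_Pi 1)"
proof
  assume P: "PRP (levy_Pi 1)"
  have F: "definable_class gseq" using gseq_definable by (rule definable_by_imp_definable_class)
  note d = descending_range[OF F gseq_props(1,2)[OF assms], folded gseq_props(4)[OF assms]]
  have "\<forall>G\<in>gcls. graph G" unfolding gcls_def using gr_graph by auto
  then obtain S where "\<And>A. A \<epsilon> S \<Longrightarrow> A \<in> gcls" "\<forall>G\<in>gcls. \<exists>P h. product S P \<and> homomorphism h P G"
    using P gcls_definable d(1) unfolding PRP_def by blast
  then show False using d(2)[of S] by blast
qed

section \<open>\<open>\<Sigma>\<^sub>2\<close>-definable classes\<close>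

lemma sat_Exists:
  "sat (\<epsilon>) UNIV (foldr Exists xs \<phi>) t \<longleftrightarrow>
     (\<exists>s. (\<forall>i. i \<notin> set xs \<longrightarrow> s i = t i) \<and> sat (\<epsilon>) UNIV \<phi> s)"
proof -
  have "sat (\<epsilon>) UNIV (foldr Exists xs \<phi>) t \<longleftrightarrow> \<not> sat (\<epsilon>) UNIV (foldr Forall xs (Neg \<phi>)) t"
    by (induction xs arbitrary: t) auto
  then show ?thesis unfolding sat_Foralls by simp
qed

lemma definable_by_Sigma:
  assumes \<phi>: "levy_Sigma (Suc n) \<phi>"
  shows "definable_by (levy_Sigma (Suc n)) {x. \<exists>s. s 0 = x \<and> sat (\<epsilon>) UNIV \<phi> s}"
proof -
  obtain xs where xs: "set xs = fv \<phi> - {0}" using finite_list[of "fv \<phi> - {0}"] finite_fv[of \<phi>] by auto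
  have 1: "levy_Sigma (Suc n) (foldr Exists ys \<phi>)" for ys
    using \<phi> by (induction ys) (auto intro: levy_Sigma_levy_Pi.intros)
  have "fv (foldr Exists ys \<phi>) = fv \<phi> - set ys" for ys
    by (induction ys) auto
  then have 2: "fv (foldr Exists xs \<phi>) \<subseteq> {0}" using xs by auto
  have "sat (\<epsilon>) UNIV (foldr Exists xs \<phi>) (\<lambda>_. x) \<longleftrightarrow> (\<exists>s. s 0 = x \<and> sat (\<epsilon>) UNIV \<phi> s)" for x
  proof
    assume "\<exists>s. s 0 = x \<and> sat (\<epsilon>) UNIV \<phi> s"
    then obtain s where s: "s 0 = x" "sat (\<epsilon>) UNIV \<phi> s" by blast
    have "sat (\<epsilon>) UNIV \<phi> (\<lambda>i. if i \<in> set xs then s i else x) = sat (\<epsilon>) UNIV \<phi> s"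
      by (intro sat_cong) (auto simp: xs s(1))
    then show "sat (\<epsilon>) UNIV (foldr Exists xs \<phi>) (\<lambda>_. x)"
      unfolding sat_Exists using s(2) by (intro exI[of _ "\<lambda>i. if i \<in> set xs then s i else x"]) simp
  qed (auto simp: sat_Exists xs)
  then show ?thesis unfolding definable_by_def using 1 2 by blast
qed

lemma PRP_imp_SWVP:
  assumes P: "PRP (levy_Sigma 2)"
  shows "SWVP (levy_Sigma 2)"
  unfolding SWVP_def
proof (rule notI, elim exE conjE)
  fix F
  assume F: "definable_by (levy_Sigma 2) F" and seq: "graph_sequence F"
    and desc: "\<forall>\<alpha> \<beta> A B. ordinal \<alpha> \<and> ordinal \<beta> \<and> value_at F \<alpha> A \<and> value_at F \<beta> B \<longrightarrow>
      (\<alpha> \<epsilon> \<beta> \<or> \<alpha> = \<beta> \<longrightarrow> (\<exists>h. homomorphism h B A)) \<and> (\<alpha> \<epsilon> \<beta> \<longrightarrow> \<not> (\<exists>h. homomorphism h A B))"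
  have desc: "descending F" using desc unfolding descending_def ordinal_iff .
  define C where "C = {A. \<exists>a. Ord a \<and> value_at F a A}"
  obtain \<phi> where \<phi>: "levy_Sigma 2 \<phi>" "F = {p. sat (\<epsilon>) UNIV \<phi> (\<lambda>_. p)}"
    using F unfolding definable_by_def by blast
  \<comment> \<open>\<open>A\<close> is in the range iff some pair in \<open>F\<close> has second
    component \<open>A\<close>. The pair is variable 1 and \<open>A\<close> is variable 0; the
    quantifier over the pair is existential, so the range stays
    \<open>\<Sigma>\<^sub>2\<close>.\<close>
  have "def0 (\<lambda>s. \<exists>x y. s 1 = pr x y \<and> y = s 0)" by (intro def0_intro)
  then obtain \<delta> where \<delta>: "Delta0 \<delta>" "\<And>s. sat (\<epsilon>) UNIV \<delta> s \<longleftrightarrow> (\<exists>x y. s 1 = pr x y \<and> y = s 0)"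
    unfolding def0_def by blast
  obtain \<psi> where \<psi>: "levy_Sigma 2 \<psi>"
    "\<And>s. sat (\<epsilon>) UNIV \<psi> s \<longleftrightarrow> sat (\<epsilon>) UNIV \<delta> s \<and> sat (\<epsilon>) UNIV \<phi> (\<lambda>i. s 1)"
    using levy_conj(1)[OF \<phi>(1) \<delta>(1), of "(\<epsilon>)" "\<lambda>_. 1"] by blast
  have "p \<in> F \<Longrightarrow> \<exists>a G. p = pr a G \<and> Ord a \<and> graph G" for p
    using seq unfolding graph_sequence_def by simp
  then have F': "pr a A \<in> F \<Longrightarrow> Ord a \<and> graph A" for a A by fastforce
  have "(\<exists>s. s 0 = A \<and> sat (\<epsilon>) UNIV \<psi> s) \<longleftrightarrow> A \<in> C" for A
  proof
    assume "\<exists>s. s 0 = A \<and> sat (\<epsilon>) UNIV \<psi> s"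
    then obtain x where "pr x A \<in> F" unfolding \<psi>(2) \<delta>(2) \<phi>(2) by auto
    then show "A \<in> C" unfolding C_def value_at_iff using F' by blast
  next
    assume "A \<in> C"
    then obtain a where "pr a A \<in> F" unfolding C_def value_at_iff by blast
    then show "\<exists>s. s 0 = A \<and> sat (\<epsilon>) UNIV \<psi> s"
      unfolding \<psi>(2) \<delta>(2) \<phi>(2) by (intro exI[of _ "\<lambda>i. if i = 0 then A else pr a A"]) auto
  qed
  then have "C = {A. \<exists>s. s 0 = A \<and> sat (\<epsilon>) UNIV \<psi> s}" by blast
  then have "definable_by (levy_Sigma 2) C"
    using definable_by_Sigma[of 1 \<psi>] \<psi>(1) by (simp add: numeral_2_eq_2)
  moreover note d = descending_range[OF definable_by_imp_definable_class[OF F] seq desc, folded C_def]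
  moreover have "\<forall>G\<in>C. graph G" unfolding C_def value_at_iff using F' by blast
  ultimately obtain S where "\<And>A. A \<epsilon> S \<Longrightarrow> A \<in> C" "\<forall>G\<in>C. \<exists>P h. product S P \<and> homomorphism h P G"
    using P d(1) unfolding PRP_def by blast
  then show False using d(2)[of S] by blast
qed

text \<open>\<open>a\<close> contains witnesses for the outer existential quantifiers of \<open>\<phi>\<close>.\<close>

lemma Sigma2_witnesses:
  assumes "levy_Sigma 2 \<phi>" "sat (\<epsilon>) UNIV \<phi> s"
  shows "\<exists>a. \<forall>M. transitive_class M \<longrightarrow> (\<forall>x. x \<epsilon> a \<longrightarrow> x \<in> M) \<longrightarrow> (\<forall>i. s i \<in> M) \<longrightarrow> sat (\<epsilon>) M \<phi> s"
proof -
  let ?down = "\<lambda>\<phi>. \<forall>M s. transitive_class M \<longrightarrow> (\<forall>i. s i \<in> M) \<longrightarrow> sat (\<epsilon>) UNIV \<phi> s \<longrightarrow> sat (\<epsilon>) M \<phi> s"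
  \<comment> \<open>The simultaneous induction carries one claim for each level that occurs:
    \<open>\<Sigma>\<^sub>0\<close> formulas are bounded, \<open>\<Pi>\<^sub>1\<close> formulas pass
    down to transitive classes, and \<open>\<Sigma>\<^sub>2\<close> formulas do so once witnesses
    are present.\<close>
  have "levy_Sigma n \<phi> \<Longrightarrow> (n = 0 \<longrightarrow> Delta0 \<phi>) \<and> (n = 2 \<longrightarrow> (\<forall>s. sat (\<epsilon>) UNIV \<phi> s \<longrightarrow>
      (\<exists>a. \<forall>M. transitive_class M \<longrightarrow> (\<forall>x. x \<epsilon> a \<longrightarrow> x \<in> M) \<longrightarrow> (\<forall>i. s i \<in> M) \<longrightarrow> sat (\<epsilon>) M \<phi> s)))"
    and "levy_Pi n \<phi> \<Longrightarrow> n = 1 \<longrightarrow> ?down \<phi>" for n \<phi>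
  proof (induction rule: levy_Sigma_levy_Pi.inducts)
    case (4 n \<phi> m)
    show ?case
    proof (intro conjI impI allI)
      fix s assume n: "Suc n = 2" and "sat (\<epsilon>) UNIV (Exists m \<phi>) s"
      then obtain x where x: "sat (\<epsilon>) UNIV \<phi> (s(m := x))" by auto
      obtain a where a: "\<And>M. transitive_class M \<Longrightarrow> (\<And>x. x \<epsilon> a \<Longrightarrow> x \<in> M) \<Longrightarrow>
          (\<And>i. (s(m := x)) i \<in> M) \<Longrightarrow> sat (\<epsilon>) M \<phi> (s(m := x))"
        using 4(2) n x by blast
      show "\<exists>a. \<forall>M. transitive_class M \<longrightarrow> (\<forall>x. x \<epsilon> a \<longrightarrow> x \<in> M) \<longrightarrow> (\<forall>i. s i \<in> M) \<longrightarrow>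
          sat (\<epsilon>) M (Exists m \<phi>) s"
      proof (intro exI[of _ "un a (sg x)"] allI impI)
        fix M assume M: "transitive_class M" "\<forall>y. y \<epsilon> un a (sg x) \<longrightarrow> y \<in> M" "\<forall>i. s i \<in> M"
        have "sat (\<epsilon>) M \<phi> (s(m := x))" by (rule a[OF M(1)]) (use M in auto)
        then show "sat (\<epsilon>) M (Exists m \<phi>) s" using M(2) by auto
      qed
    qed simp
  next
    case (5 n \<phi>)
    then show ?case by (auto simp: sat_transitive)
  next
    case (6 n \<phi> m)
    show ?case
    proof (intro impI allI)
      fix M and s :: "nat \<Rightarrow> 'a"
      assume n: "Suc n = 1" and M: "transitive_class M" "\<forall>i. s i \<in> M" and s: "sat (\<epsilon>) UNIV (Forall m \<phi>) s"
      have "sat (\<epsilon>) M \<phi> (s(m := x))" if "x \<in> M" for x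
        using 6(2) n M s that by auto
      then show "sat (\<epsilon>) M (Forall m \<phi>) s" by simp
    qed
  qed auto
  then show ?thesis using assms by blast
qed

section \<open>Projections and products\<close>

lemma product_exists: "\<exists>P. product S P"
proof -
  \<comment> \<open>A vertex of \<open>A = (G, R)\<close> belongs to
    \<open>G \<in> {G} \<in> A \<in> S\<close>; hence three unions.\<close>
  define W where "W = Sep (Pow (cross S (Uni (Uni (Uni S)))))
    (\<lambda>f. function_on f S \<and> (\<forall>A. A \<epsilon> S \<longrightarrow> vertex A (app f A)))"
  have d: "defp (\<lambda>s. function_on (s 0) S \<and> (\<forall>A. A \<epsilon> S \<longrightarrow> vertex A (app (s 0) A)))"
    unfolding vertex_def by (intro defs_intro)
  have W: "f \<epsilon> W \<longleftrightarrow> function_on f S \<and> (\<forall>A. A \<epsilon> S \<longrightarrow> vertex A (app f A))" for f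
  proof -
    have "subset_of f (cross S (Uni (Uni (Uni S))))"
      if f: "function_on f S" "\<forall>A. A \<epsilon> S \<longrightarrow> vertex A (app f A)"
      unfolding subset_of_def
    proof (intro allI impI)
      fix p assume "p \<epsilon> f"
      then obtain A where A: "A \<epsilon> S" "p = pr A (app f A)" using function_on_mem[OF f(1)] by blast
      obtain G R where G: "A = pr G R" "app f A \<epsilon> G" using f(2) A(1) unfolding vertex_iff by blast
      have "sg G \<epsilon> A" "G \<epsilon> sg G" unfolding G(1) pr_def by simp_all
      then have "app f A \<epsilon> Uni (Uni (Uni S))" unfolding mem_Uni using A(1) G(2) by blast
      then show "p \<epsilon> cross S (Uni (Uni (Uni S)))" using A by simp
    qed
    then show ?thesis unfolding W_def mem_Sep[OF d] by auto
  qed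
  define R where "R = Sep (cross W W) (\<lambda>p. \<forall>A. A \<epsilon> S \<longrightarrow> edge A (app (p1 p) A) (app (p2 p) A))"
  have d: "defp (\<lambda>s. \<forall>A. A \<epsilon> S \<longrightarrow> edge A (app (p1 (s 0)) A) (app (p2 (s 0)) A))"
    unfolding edge_def by (intro defs_intro)
  have "p \<epsilon> R \<longleftrightarrow> (\<exists>f g. f \<epsilon> W \<and> g \<epsilon> W \<and> p = pr f g \<and> (\<forall>A. A \<epsilon> S \<longrightarrow> edge A (app f A) (app g A)))" for p
    unfolding R_def mem_Sep[OF d] by auto
  then have "product S (pr W R)" unfolding product_iff using W by blast
  then show ?thesis by blast
qed

lemma projection_hom:
  assumes P: "product S P" and A: "A \<epsilon> S" "graph A"
  shows "\<exists>h. homomorphism h P A"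
proof -
  obtain U T where PU: "P = pr U T"
    and U: "\<And>f. f \<epsilon> U \<longleftrightarrow> function_on f S \<and> (\<forall>A. A \<epsilon> S \<longrightarrow> vertex A (app f A))"
    and T: "\<And>p. p \<epsilon> T \<longleftrightarrow> (\<exists>f g. f \<epsilon> U \<and> g \<epsilon> U \<and> p = pr f g \<and>
        (\<forall>A. A \<epsilon> S \<longrightarrow> edge A (app f A) (app g A)))"
    using P unfolding product_iff by blast
  obtain G R where AG: "A = pr G R" using graph_pr[OF A(2)] by blast
  have d: "deft (\<lambda>s. app (s 0) A)" by (intro defs_intro)
  have "homomorphism (lam U (\<lambda>f. app f A)) P A"
    unfolding PU AG homomorphism_pr
  proof (intro conjI allI impI)
    show "maps (lam U (\<lambda>f. app f (pr G R))) U G"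
      by (rule maps_lam[OF d[unfolded AG]]) (use U A(1) AG in \<open>auto simp: vertex_iff\<close>)
    show "pr (app (lam U (\<lambda>f. app f (pr G R))) f) (app (lam U (\<lambda>f. app f (pr G R))) g) \<epsilon> R"
      if "pr f g \<epsilon> T" "f \<epsilon> U" "g \<epsilon> U" for f g
      using that T A(1) AG by (auto simp: app_lam[OF d[unfolded AG]] edge_iff)
  qed
  then show ?thesis by blast
qed

text \<open>To be a point of the product, or an edge of it, is expressed by bounded formulas about
  functions on \<open>S\<close>. These pass to \<open>j f\<close> and \<open>j g\<close>, and may
  then be evaluated at the member \<open>G\<close> of \<open>j S\<close>.\<close>

lemma product_hom_target:
  assumes el: "elementary_embedding j M" and trM: "transitive_class M"
    and P: "product S P" and G: "G \<epsilon> j S" "graph G"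
  shows "\<exists>h. homomorphism h P G"
proof -
  note e = el trM
  obtain U T where PU: "P = pr U T"
    and U: "\<And>f. f \<epsilon> U \<longleftrightarrow> function_on f S \<and> (\<forall>A. A \<epsilon> S \<longrightarrow> vertex A (app f A))"
    and T: "\<And>p. p \<epsilon> T \<longleftrightarrow> (\<exists>f g. f \<epsilon> U \<and> g \<epsilon> U \<and> p = pr f g \<and>
        (\<forall>A. A \<epsilon> S \<longrightarrow> edge A (app f A) (app g A)))"
    using P unfolding product_iff by blast
  obtain H R where GH: "G = pr H R" using graph_pr[OF G(2)] by blast
  have jf: "function_on (j f) (j S)" "vertex G (app (j f) G)" if f: "f \<epsilon> U" for f
  proof -
    have fs: "function_on f S" using f U by blast
    then show js: "function_on (j f) (j S)" using el_function_on[OF e] by blast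
    have "def0 (\<lambda>s. \<forall>A x. pr A x \<epsilon> s 0 \<longrightarrow> vertex A x)" unfolding vertex_iff by (intro def0_intro)
    note r = el_rel1[OF e, where R = "\<lambda>f. \<forall>A x. pr A x \<epsilon> f \<longrightarrow> vertex A x", OF this]
    have "\<forall>A x. pr A x \<epsilon> f \<longrightarrow> vertex A x" using f U by (simp add: function_on_pr[OF fs])
    then have "\<forall>A x. pr A x \<epsilon> j f \<longrightarrow> vertex A x" using r[of f] by blast
    then show "vertex G (app (j f) G)" using G(1) by (simp add: function_on_pr[OF js])
  qed
  have je: "edge G (app (j f) G) (app (j g) G)" if fg: "pr f g \<epsilon> T" for f g
  proof -
    have fU: "f \<epsilon> U" "g \<epsilon> U" and fe: "\<forall>A. A \<epsilon> S \<longrightarrow> edge A (app f A) (app g A)" using fg T by auto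
    then have fs: "function_on f S" "function_on g S" using U by blast+
    have "def0 (\<lambda>s. \<forall>A x. pr A x \<epsilon> s 0 \<longrightarrow> (\<forall>B y. pr B y \<epsilon> s 1 \<longrightarrow> A = B \<longrightarrow> edge A x y))"
      unfolding edge_iff by (intro def0_intro)
    note r = el_rel2[OF e, where R = "\<lambda>f g. \<forall>A x. pr A x \<epsilon> f \<longrightarrow> (\<forall>B y. pr B y \<epsilon> g \<longrightarrow> A = B \<longrightarrow> edge A x y)", OF this]
    have "\<forall>A x. pr A x \<epsilon> f \<longrightarrow> (\<forall>B y. pr B y \<epsilon> g \<longrightarrow> A = B \<longrightarrow> edge A x y)"
      using fe by (simp add: function_on_pr[OF fs(1)] function_on_pr[OF fs(2)])
    then have "\<forall>A x. pr A x \<epsilon> j f \<longrightarrow> (\<forall>B y. pr B y \<epsilon> j g \<longrightarrow> A = B \<longrightarrow> edge A x y)" using r[of f g] by blast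
    then show ?thesis
      using G(1) by (simp add: function_on_pr[OF jf(1)[OF fU(1)]] function_on_pr[OF jf(1)[OF fU(2)]])
  qed
  have d: "deft (\<lambda>s. app (j (s 0)) G)" by (intro defs_intro el_deft[OF e])
  have "homomorphism (lam U (\<lambda>f. app (j f) G)) P G"
    unfolding PU GH homomorphism_pr
  proof (intro conjI allI impI)
    show "maps (lam U (\<lambda>f. app (j f) (pr H R))) U H"
      by (rule maps_lam[OF d[unfolded GH]]) (use jf(2) GH in \<open>auto simp: vertex_iff\<close>)
    show "pr (app (lam U (\<lambda>f. app (j f) (pr H R))) f) (app (lam U (\<lambda>f. app (j f) (pr H R))) g) \<epsilon> R"
      if "pr f g \<epsilon> T" "f \<epsilon> U" "g \<epsilon> U" for f g
      using je[OF that(1)] that GH by (auto simp: app_lam[OF d[unfolded GH]] edge_iff)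
  qed
  then show ?thesis by blast
qed

section \<open>Kunen's argument\<close>

text \<open>
  A transfinite construction along the least ordinal into which \<open>D\<close> injects: fewer than \<open>|D|\<close>
  values are forbidden at each step.
\<close>

lemma injective_choice:
  assumes dB: "deft (\<lambda>s. B (s 0))" and dQ: "deft (\<lambda>s. Q (s 0) (s 1))"
    and QB: "\<And>d e. d \<epsilon> D \<Longrightarrow> e \<epsilon> D \<Longrightarrow> Q d e \<epsilon> B d"
    and Qinj: "\<And>d e e'. d \<epsilon> D \<Longrightarrow> e \<epsilon> D \<Longrightarrow> e' \<epsilon> D \<Longrightarrow> Q d e = Q d e' \<Longrightarrow> e = e'"
  shows "\<exists>g. deft (\<lambda>s. g (s 0)) \<and> (\<forall>d. d \<epsilon> D \<longrightarrow> g d \<epsilon> B d) \<and>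
    (\<forall>d e. d \<epsilon> D \<longrightarrow> e \<epsilon> D \<longrightarrow> g d = g e \<longrightarrow> d = e)"
proof -
  note dB' = deft_app1[OF dB] and dQ' = deft_app2[OF dQ]
  \<comment> \<open>\<open>I f c\<close> says that \<open>f\<close> injects \<open>D\<close> into
    \<open>c\<close>. Below the least such ordinal \<theta> no ordinal receives an injection of
    \<open>D\<close>.\<close>
  define I where "I f c \<longleftrightarrow> function_on f D \<and> (\<forall>d. d \<epsilon> D \<longrightarrow> app f d \<epsilon> c) \<and>
    (\<forall>d e. d \<epsilon> D \<longrightarrow> e \<epsilon> D \<longrightarrow> app f d = app f e \<longrightarrow> d = e)" for f c
  have dI: "defp (\<lambda>s. \<exists>f. I f (s 0))" unfolding I_def by (intro defs_intro)
  obtain c k where c: "Ord c" and k: "bijection k c D" using well_ordering by blast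
  have d: "defp (\<lambda>s. s 0 \<epsilon> c \<and> app k (s 0) = s 1)" by (intro defs_intro)
  obtain f where f: "function_on f D" "\<And>d. d \<epsilon> D \<Longrightarrow> \<exists>a. a \<epsilon> c \<and> app k a = d \<Longrightarrow> app f d \<epsilon> c \<and> app k (app f d) = d"
    using choice_predicate[where P = "\<lambda>d a. a \<epsilon> c \<and> app k a = d" and a = D] d by (auto simp: defs_intro)
  have "app f d \<epsilon> c \<and> app k (app f d) = d" if "d \<epsilon> D" for d
    using f(2)[OF that] k that unfolding bijection_iff by blast
  then have "I f c" unfolding I_def using f(1) by metis
  then obtain \<theta> where \<theta>: "Ord \<theta>" "\<exists>f. I f \<theta>" "\<And>c. c \<epsilon> \<theta> \<Longrightarrow> \<not> (\<exists>f. I f c)"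
    using Ord_least[OF dI c] by blast
  obtain f where f: "I f \<theta>" using \<theta>(2) by blast
  define inv where "inv x = the1 (\<lambda>d. d \<epsilon> D \<and> app f d = x)" for x
  have dinv: "deft (\<lambda>s. inv (s 0))"
    unfolding inv_def by (rule deft_the1_app1[where P = "\<lambda>x d. d \<epsilon> D \<and> app f d = x"]) (intro defs_intro)+
  have inv: "inv (app f d) = d" if "d \<epsilon> D" for d
    unfolding inv_def by (rule the1_equality) (use that f in \<open>auto simp: I_def\<close>)
  obtain ch where ch: "\<And>x. x \<epsilon> Pow (Uni (Repl D B)) \<Longrightarrow> x \<noteq> emp \<Longrightarrow> app ch x \<epsilon> x"
    using choice_function by blast
  define H where "H x G = app ch (Sep (B (inv x)) (\<lambda>w. \<not> (\<exists>y. pr y w \<epsilon> G)))" for x G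
  have "deft (\<lambda>s. H (s 0) (s 1))"
    unfolding H_def by (intro defs_intro dB' deft_app1[OF dinv])
  from eps_recursion[OF this] obtain K where
    K: "deft (\<lambda>s. K (s 0))" "\<And>x. K x = H x (lam x K)" by blast
  note dK' = deft_app1[OF K(1)]
  have *: "K (app f d) \<epsilon> B d \<and> (\<forall>y. y \<epsilon> app f d \<longrightarrow> K (app f d) \<noteq> K y)" if d: "d \<epsilon> D" for d
  proof -
    define x where "x = app f d"
    have x: "x \<epsilon> \<theta>" "inv x = d" using d f inv unfolding x_def I_def by auto
    define N where "N = Sep (B d) (\<lambda>w. \<not> (\<exists>y. pr y w \<epsilon> lam x K))"
    have dN: "defp (\<lambda>s. \<not> (\<exists>y. pr y (s 0) \<epsilon> lam x K))" by (intro defs_intro dK')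
    have N: "w \<epsilon> N \<longleftrightarrow> w \<epsilon> B d \<and> (\<forall>y. y \<epsilon> x \<longrightarrow> w \<noteq> K y)" for w
      unfolding N_def mem_Sep[OF dN] by (auto simp: mem_lam[OF K(1)])
    \<comment> \<open>If all candidates \<open>Q d e\<close> were taken, sending \<open>e\<close> to
      an earlier index with the value \<open>Q d e\<close> would inject \<open>D\<close> into
      \<open>x < \<theta>\<close>.\<close>
    have "N \<noteq> emp"
    proof
      assume "N = emp"
      then have ex: "\<exists>y. y \<epsilon> x \<and> Q d e = K y" if "e \<epsilon> D" for e
        using N[of "Q d e"] QB[OF d that] by auto
      have dP: "defp (\<lambda>s. s 1 \<epsilon> x \<and> Q d (s 0) = K (s 1))" by (intro defs_intro dK' dQ')
      obtain h where h: "function_on h D" "\<And>e. e \<epsilon> D \<Longrightarrow> app h e \<epsilon> x \<and> Q d e = K (app h e)"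
        using choice_predicate[where P = "\<lambda>e y. y \<epsilon> x \<and> Q d e = K y" and a = D, OF dP] ex by blast
      have "e = e'" if "e \<epsilon> D" "e' \<epsilon> D" "app h e = app h e'" for e e'
        using Qinj[OF d that(1,2)] h(2)[OF that(1)] h(2)[OF that(2)] that(3) by simp
      then have "I h x" unfolding I_def using h by blast
      then show False using \<theta>(3)[OF x(1)] by blast
    qed
    moreover have "N \<epsilon> Pow (Uni (Repl D B))"
      using d unfolding mem_Pow subset_of_def mem_Uni mem_Repl[OF dB] N by blast
    ultimately have "app ch N \<epsilon> N" using ch by blast
    then have "K x \<epsilon> N" using K(2)[of x] unfolding H_def x(2) N_def by simp
    then show ?thesis unfolding N x_def by simp
  qed
  have "d = e" if de: "d \<epsilon> D" "e \<epsilon> D" "K (app f d) = K (app f e)" for d e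
  proof -
    have "app f d \<epsilon> \<theta>" "app f e \<epsilon> \<theta>" using f de unfolding I_def by auto
    then have "Ord (app f d)" "Ord (app f e)" using Ord_mem[OF \<theta>(1)] by auto
    then have "app f d = app f e" using Ord_linear *[OF de(1)] *[OF de(2)] de(3) by metis
    then show ?thesis using f de unfolding I_def by blast
  qed
  moreover have "deft (\<lambda>s. K (app f (s 0)))" by (intro defs_intro dK')
  ultimately show ?thesis using * by (intro exI[of _ "\<lambda>d. K (app f d)"]) blast
qed

text \<open>
  An \<open>\<omega>\<close>-Jonsson function: every injection of \<open>V\<^sub>\<delta>\<close> into itself has all values in the image under
  \<open>F\<close> of the sequences in its range. As \<open>\<delta>\<close> has cofinality \<open>\<omega>\<close>, there are as many sequences
  as pairs of an injection \<open>i\<close> and a point \<open>y\<close>: code the pair by \<open>\<langle>(y, i \<inter> V\<^sub>r\<^sub>(\<^sub>n\<^sub>))\<rangle>\<^sub>n\<close>.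
\<close>

lemma jonsson_function:
  assumes l: "lim \<delta>" and r: "\<And>n. n \<epsilon> om \<Longrightarrow> app r n \<epsilon> \<delta>" "\<And>x. x \<epsilon> \<delta> \<Longrightarrow> \<exists>n. n \<epsilon> om \<and> x \<epsilon> app r n"
  shows "\<exists>F. (\<forall>w y z. pr w y \<epsilon> F \<longrightarrow> pr w z \<epsilon> F \<longrightarrow> y = z) \<and>
    (\<forall>i y. maps i (Vs \<delta>) (Vs \<delta>) \<longrightarrow> (\<forall>x z v. pr x v \<epsilon> i \<longrightarrow> pr z v \<epsilon> i \<longrightarrow> x = z) \<longrightarrow> y \<epsilon> Vs \<delta> \<longrightarrow>
      (\<exists>w. pr w y \<epsilon> F \<and> function_on w om \<and> (\<forall>n v. pr n v \<epsilon> w \<longrightarrow> (\<exists>x. pr x v \<epsilon> i))))"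
proof -
  define X where "X = Vs \<delta>"
  define D where "D = Sep (cross (Fun X X) X) (\<lambda>d. \<forall>x z. x \<epsilon> X \<longrightarrow> z \<epsilon> X \<longrightarrow> app (p1 d) x = app (p1 d) z \<longrightarrow> x = z)"
  have dD: "defp (\<lambda>s. \<forall>x z. x \<epsilon> X \<longrightarrow> z \<epsilon> X \<longrightarrow> app (p1 (s 0)) x = app (p1 (s 0)) z \<longrightarrow> x = z)"
    by (intro defs_intro)
  have D: "d \<epsilon> D \<longleftrightarrow> (\<exists>i y. d = pr i y \<and> maps i X X \<and> y \<epsilon> X \<and>
      (\<forall>x z. x \<epsilon> X \<longrightarrow> z \<epsilon> X \<longrightarrow> app i x = app i z \<longrightarrow> x = z))" for d
    unfolding D_def mem_Sep[OF dD] by auto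
  define B where "B d = Sep (Fun om X) (\<lambda>w. \<forall>n. n \<epsilon> om \<longrightarrow> (\<exists>x. x \<epsilon> X \<and> app (p1 d) x = app w n))" for d
  have dBP: "defp (\<lambda>s. \<forall>n. n \<epsilon> om \<longrightarrow> (\<exists>x. x \<epsilon> X \<and> app (p1 d) x = app (s 0) n))" for d
    by (intro defs_intro)
  have dB: "deft (\<lambda>s. B (s 0))" unfolding B_def by (intro defs_intro)
  have B: "w \<epsilon> B d \<longleftrightarrow> maps w om X \<and> (\<forall>n. n \<epsilon> om \<longrightarrow> (\<exists>x. x \<epsilon> X \<and> app (p1 d) x = app w n))" for w d
    unfolding B_def mem_Sep[OF dBP] by simp
  define q where "q e n = pr (p2 e) (Sep (p1 e) (\<lambda>z. z \<epsilon> Vs (app r n)))" for e n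
  have dq: "deft (\<lambda>s. q (s 0) (s 1))" unfolding q_def by (intro defs_intro)
  note dq' = deft_app2[OF dq]
  \<comment> \<open>The code of \<open>e\<close> is transported by the injection in
    \<open>d\<close>: its values lie in the range of that injection, and the code can be recovered
    from them.\<close>
  define Q where "Q d e = lam om (\<lambda>n. app (p1 d) (q e n))" for d e
  have dQ: "deft (\<lambda>s. Q (s 0) (s 1))" unfolding Q_def by (intro defs_intro dq')
  have dQn: "deft (\<lambda>s. app (p1 d) (q e (s 0)))" for d e by (intro defs_intro dq')
  have dz: "defp (\<lambda>s. s 0 \<epsilon> Vs a)" for a by (intro defs_intro)
  have Qn: "app (Q d e) n = app (p1 d) (q e n)" if "n \<epsilon> om" for d e n
    unfolding Q_def using app_lam[OF dQn that] .
  have qX: "q e n \<epsilon> X" if e: "e \<epsilon> D" and n: "n \<epsilon> om" for e n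
  proof -
    obtain i y where iy: "e = pr i y" "y \<epsilon> X" using e unfolding D by blast
    have "subset_of (Sep i (\<lambda>z. z \<epsilon> Vs (app r n))) (Vs (app r n))"
      by (simp add: subset_of_def mem_Sep[OF dz])
    then have "Sep i (\<lambda>z. z \<epsilon> Vs (app r n)) \<epsilon> X"
      unfolding X_def using Vs_sub Vs_mem_Vs[OF lim_Ord[OF l] r(1)[OF n]] by blast
    then show ?thesis using iy unfolding q_def X_def Vs_lim_pr[OF l] by simp
  qed
  have QB: "Q d e \<epsilon> B d" if d: "d \<epsilon> D" and e: "e \<epsilon> D" for d e
  proof -
    obtain i y where iy: "d = pr i y" "maps i X X" using d unfolding D by blast
    have "function_on (Q d e) om" unfolding Q_def by (rule function_on_lam[OF dQn])
    then show ?thesis unfolding B maps_iff using qX[OF e] iy Qn by (auto simp: maps_iff)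
  qed
  have Qinj: "e = e'" if d: "d \<epsilon> D" and e: "e \<epsilon> D" "e' \<epsilon> D" and eq: "Q d e = Q d e'" for d e e'
  proof -
    obtain i y where iy: "d = pr i y" "\<And>x z. x \<epsilon> X \<Longrightarrow> z \<epsilon> X \<Longrightarrow> app i x = app i z \<Longrightarrow> x = z"
      using d unfolding D by blast
    have qq: "q e n = q e' n" if n: "n \<epsilon> om" for n
      using iy(2)[OF qX[OF e(1) n] qX[OF e(2) n]] Qn[OF n, of d e] Qn[OF n, of d e'] eq iy(1) by simp
    obtain a b where ab: "e = pr a b" "maps a X X" using e(1) unfolding D by blast
    obtain a' b' where ab': "e' = pr a' b'" "maps a' X X" using e(2) unfolding D by blast
    have "b = b'" using qq[OF om_emp] unfolding q_def ab(1) ab'(1) by simp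
    moreover have "a = a'"
    proof (rule set_ext)
      fix z
      have eqv: "z \<epsilon> a \<and> z \<epsilon> Vs (app r n) \<longleftrightarrow> z \<epsilon> a' \<and> z \<epsilon> Vs (app r n)" if n: "n \<epsilon> om" for n
      proof -
        have "Sep a (\<lambda>z. z \<epsilon> Vs (app r n)) = Sep a' (\<lambda>z. z \<epsilon> Vs (app r n))"
          using qq[OF n] unfolding q_def ab(1) ab'(1) by simp
        then show ?thesis using mem_Sep[OF dz, of z] by metis
      qed
      have sub: "z \<epsilon> X" if gm: "maps g X X" and zg: "z \<epsilon> g" for g
      proof -
        have g: "function_on g X" "\<And>x. x \<epsilon> X \<Longrightarrow> app g x \<epsilon> X" using gm unfolding maps_iff by auto
        obtain x where "x \<epsilon> X" "z = pr x (app g x)" using zg function_on_mem[OF g(1), of z] by blast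
        moreover have "app g x \<epsilon> X" using g(2) calculation(1) .
        ultimately have "z = pr x (app g x)" "x \<epsilon> X" "app g x \<epsilon> X" by simp_all
        then show ?thesis unfolding X_def using Vs_lim_pr[OF l] by simp
      qed
      \<comment> \<open>Cofinality of \<open>r\<close> enters here: a map is the union of its
        approximations, so the code determines it.\<close>
      have "\<exists>n. n \<epsilon> om \<and> z \<epsilon> Vs (app r n)" if z: "z \<epsilon> X"
      proof -
        have "rk z \<epsilon> \<delta>" using z unfolding X_def mem_Vs_Ord[OF lim_Ord[OF l]] .
        then obtain n where n: "n \<epsilon> om" "rk z \<epsilon> app r n" using r(2) by blast
        have "Ord (app r n)" using Ord_mem[OF lim_Ord[OF l] r(1)[OF n(1)]] .
        then show ?thesis using n mem_Vs_Ord by blast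
      qed
      then show "z \<epsilon> a \<longleftrightarrow> z \<epsilon> a'" using sub[OF ab(2)] sub[OF ab'(2)] eqv by blast
    qed
    ultimately show ?thesis using ab(1) ab'(1) by simp
  qed
  have "\<exists>g. deft (\<lambda>s. g (s 0)) \<and> (\<forall>d. d \<epsilon> D \<longrightarrow> g d \<epsilon> B d) \<and>
      (\<forall>d e. d \<epsilon> D \<longrightarrow> e \<epsilon> D \<longrightarrow> g d = g e \<longrightarrow> d = e)"
    by (rule injective_choice[OF dB dQ]) (fact QB, fact Qinj)
  then obtain g where g: "deft (\<lambda>s. g (s 0))" "\<And>d. d \<epsilon> D \<Longrightarrow> g d \<epsilon> B d"
    "\<And>d e. d \<epsilon> D \<Longrightarrow> e \<epsilon> D \<Longrightarrow> g d = g e \<Longrightarrow> d = e"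
    by blast
  have dg: "deft (\<lambda>s. pr (g (s 0)) (p2 (s 0)))" by (intro defs_intro deft_app1[OF g(1)])
  define F where "F = Repl D (\<lambda>d. pr (g d) (p2 d))"
  have F: "pr w y \<epsilon> F \<longleftrightarrow> (\<exists>d. d \<epsilon> D \<and> w = g d \<and> y = p2 d)" for w y
    unfolding F_def mem_Repl[OF dg] by simp
  have "\<exists>w. pr w y \<epsilon> F \<and> function_on w om \<and> (\<forall>n v. pr n v \<epsilon> w \<longrightarrow> (\<exists>x. pr x v \<epsilon> i))"
    if i: "maps i X X" and inj: "\<And>x z v. pr x v \<epsilon> i \<Longrightarrow> pr z v \<epsilon> i \<Longrightarrow> x = z" and y: "y \<epsilon> X" for i y
  proof -
    have fi: "function_on i X" using i unfolding maps_iff by blast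
    have "x = z" if "x \<epsilon> X" "z \<epsilon> X" "app i x = app i z" for x z
      using inj[of x "app i x" z] pr_app[OF fi that(1)] pr_app[OF fi that(2)] that(3) by simp
    then have d: "pr i y \<epsilon> D" unfolding D using i y by blast
    have gB: "maps (g (pr i y)) om X" "\<And>n. n \<epsilon> om \<Longrightarrow> \<exists>x. x \<epsilon> X \<and> app i x = app (g (pr i y)) n"
      using g(2)[OF d] unfolding B by simp_all
    have fg: "function_on (g (pr i y)) om" using gB(1) unfolding maps_iff by blast
    have "\<exists>x. pr x v \<epsilon> i" if "pr n v \<epsilon> g (pr i y)" for n v
      using that gB(2)[of n] unfolding function_on_pr[OF fg] function_on_pr[OF fi] by auto
    moreover have "pr (g (pr i y)) y \<epsilon> F" unfolding F using d by (intro exI[of _ "pr i y"]) simp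
    ultimately show ?thesis using fg by blast
  qed
  moreover have "y = z" if "pr w y \<epsilon> F" "pr w z \<epsilon> F" for w y z
    using that g(3) unfolding F by blast
  ultimately show ?thesis unfolding X_def by (intro exI[of _ F]) blast
qed

lemma el_Ord_ge:
  assumes el: "elementary_embedding j M" and trM: "transitive_class M" and a: "Ord a"
  shows "\<not> j a \<epsilon> a"
proof
  assume ja: "j a \<epsilon> a"
  have "defp (\<lambda>s. j (s 0) \<epsilon> s 0)" by (intro defs_intro el_deft[OF el trM])
  from Ord_least[OF this a ja] obtain b where b: "Ord b" "j b \<epsilon> b" "\<And>c. c \<epsilon> b \<Longrightarrow> \<not> j c \<epsilon> c" by blast
  have "j (j b) \<epsilon> j b" using b(2) el_mem[OF el trM] by blast
  then show False using b(3)[OF b(2)] by blast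
qed

text \<open>By elementarity no limit lies strictly between \<open>r = j r\<close> and
  \<open>j d\<close>. As \<open>d\<close> is a limit above \<open>r\<close>, it is not below
  \<open>j d\<close>; and \<open>j\<close> does not decrease ordinals.\<close>

lemma el_least_lim:
  assumes el: "elementary_embedding j M" and trM: "transitive_class M"
    and d: "lim d" "j r = r" "r \<epsilon> d" "\<And>m. m \<epsilon> d \<Longrightarrow> r \<epsilon> m \<Longrightarrow> \<not> lim m"
  shows "j d = d"
proof -
  note e = el trM
  have o: "Ord d" using d(1) by (rule lim_Ord)
  have "\<not> d \<epsilon> j d"
  proof
    assume dj: "d \<epsilon> j d"
    have "def0 (\<lambda>s. \<forall>m. m \<epsilon> s 1 \<longrightarrow> s 0 \<epsilon> m \<longrightarrow> \<not> lim m)" by (intro def0_intro)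
    note r = el_rel2[OF e, where R = "\<lambda>r d. \<forall>m. m \<epsilon> d \<longrightarrow> r \<epsilon> m \<longrightarrow> \<not> lim m", OF this, of d r]
    have "\<forall>m. m \<epsilon> j d \<longrightarrow> j r \<epsilon> m \<longrightarrow> \<not> lim m" using r d(4) by simp
    then show False using dj d(1-3) by simp
  qed
  then show ?thesis using el_Ord_ge[OF e o] Ord_linear[OF o, of "j d"] el_Ord[OF e, of d] o by auto
qed

lemma el_om_eq:
  assumes el: "elementary_embedding j M" and trM: "transitive_class M"
  shows "j om = om"
proof (rule el_least_lim[OF el trM, where r = emp])
  show "lim om" unfolding lim_def using Ord_om om_emp mem_emp om_sc by metis
  show "j emp = emp" by (rule el_emp[OF el trM])
  show "\<not> lim m" if m: "m \<epsilon> om" "emp \<epsilon> m" for m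
  proof
    assume l: "lim m"
    obtain k where k: "m = sc k" using om_cases[OF m(1)] m(2) by auto
    then have "sc k \<epsilon> m" using l unfolding lim_def by simp
    then show False using k mem_irrefl by simp
  qed
qed simp

text \<open>The restriction \<open>i\<close> of \<open>j\<close> to \<open>V_\<delta>\<close>
  belongs to \<open>M\<close>, where \<open>j F\<close> is a Jonsson function. So \<kappa> is the
  value of \<open>j F\<close> at a sequence \<open>w\<close> in the range of \<open>i\<close>. As
  \<open>j\<close> fixes \<omega> and its elements, \<open>w\<close> is the image of a sequence
  \<open>t\<close>, and \<kappa> is the image of the value of \<open>F\<close> at \<open>t\<close>.
  But a critical point is not in the range of \<open>j\<close>.\<close>

lemma kunen:
  assumes el: "elementary_embedding j M" and trM: "transitive_class M" and crit: "critical_point j \<kappa>"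
    and \<rho>: "Ord \<rho>" "j \<rho> = \<rho>" "\<kappa> \<epsilon> \<rho>"
    and \<delta>: "lim \<delta>" "\<rho> \<epsilon> \<delta>" "\<And>m. m \<epsilon> \<delta> \<Longrightarrow> \<rho> \<epsilon> m \<Longrightarrow> \<not> lim m"
    and V: "\<And>x. subset_of x (Vs \<delta>) \<Longrightarrow> x \<in> M"
  shows False
proof -
  note e = el trM
  have od: "Ord \<delta>" using \<delta>(1) by (rule lim_Ord)
  have ok: "Ord \<kappa>" "j \<kappa> \<noteq> \<kappa>" "\<And>a. a \<epsilon> \<kappa> \<Longrightarrow> j a = a" using crit unfolding critical_point_def by auto
  have jd: "j \<delta> = \<delta>" by (rule el_least_lim[OF e \<delta>(1) \<rho>(2) \<delta>(2,3)])
  have d: "deft (\<lambda>s. sc (s 0))" by (intro defs_intro)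
  obtain r where r: "app r emp = \<rho>" "\<And>n. n \<epsilon> om \<Longrightarrow> app r (sc n) = sc (app r n)"
    using omega_iteration[OF d, of \<rho>] by blast
  have dr: "defp (\<lambda>s. app r (s 0) \<epsilon> \<delta>)" "deft (\<lambda>s. app r (s 0))" by (intro defs_intro)+
  have r1: "app r n \<epsilon> \<delta>" if n: "n \<epsilon> om" for n
    by (rule om_induct[OF dr(1) n]) (use r \<delta>(1,2) in \<open>auto simp: lim_def\<close>)
  \<comment> \<open>The supremum of the ordinals \<open>\<rho> + n\<close> is a limit above \<rho>,
    hence equals \<delta>; so \<open>r\<close> witnesses that \<delta> has cofinality
    \<omega>.\<close>
  define l where "l = Uni (Repl om (app r))"
  have l: "x \<epsilon> l \<longleftrightarrow> (\<exists>n. n \<epsilon> om \<and> x \<epsilon> app r n)" for x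
    unfolding l_def by (auto simp: mem_Repl[OF dr(2)])
  have ol: "Ord l" unfolding l_def
    by (rule Ord_Uni) (use r1 Ord_mem[OF od] in \<open>auto simp: mem_Repl[OF dr(2)]\<close>)
  have rl: "\<rho> \<epsilon> l" unfolding l by (rule exI[of _ "sc emp"]) (simp add: r)
  have "sc x \<epsilon> l" if x: "x \<epsilon> l" for x
  proof -
    obtain n where n: "n \<epsilon> om" "x \<epsilon> app r n" using x unfolding l by blast
    have "sc x \<epsilon> sc (app r n)"
      using Ord_mem_sc[OF Ord_mem[OF od r1[OF n(1)]] n(2)] by auto
    then have "sc x \<epsilon> app r (sc n)" using r(2)[OF n(1)] by simp
    then show ?thesis unfolding l using n(1) om_sc by blast
  qed
  then have "lim l" unfolding lim_def using ol rl by auto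
  then have "\<not> l \<epsilon> \<delta>" using \<delta>(3) rl by blast
  moreover have "subset_of l \<delta>" unfolding subset_of_def l using r1 Ord_trans[OF od] by blast
  ultimately have "l = \<delta>" using Ord_subset[OF ol od] by blast
  then have r2: "\<exists>n. n \<epsilon> om \<and> x \<epsilon> app r n" if "x \<epsilon> \<delta>" for x using that l by blast
  obtain F where F1: "\<And>w y z. pr w y \<epsilon> F \<Longrightarrow> pr w z \<epsilon> F \<Longrightarrow> y = z"
    and F2: "\<And>i y. maps i (Vs \<delta>) (Vs \<delta>) \<Longrightarrow> (\<forall>x z v. pr x v \<epsilon> i \<longrightarrow> pr z v \<epsilon> i \<longrightarrow> x = z) \<Longrightarrow> y \<epsilon> Vs \<delta> \<Longrightarrow>
      \<exists>w. pr w y \<epsilon> F \<and> function_on w om \<and> (\<forall>n v. pr n v \<epsilon> w \<longrightarrow> (\<exists>x. pr x v \<epsilon> i))"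
    using jonsson_function[OF \<delta>(1) r1 r2] by blast
  define X where "X = Vs \<delta>"
  have XM: "x \<in> M" if "x \<epsilon> X" for x
    by (rule V) (use that Vs_tr in \<open>auto simp: X_def subset_of_def\<close>)
  have jX: "j X = X"
  proof (rule set_ext)
    fix x show "x \<epsilon> j X \<longleftrightarrow> x \<epsilon> X" using el_Vs[OF e od, of x] XM[of x] unfolding X_def jd by blast
  qed
  \<comment> \<open>The Jonsson property for the single map \<open>i\<close>, with bounded
    quantifiers; \<omega> is passed as the argument \<open>W\<close>, and \<open>j\<close> fixes it
    by \<open>el_om_eq\<close>.\<close>
  define R where "R i X F W \<longleftrightarrow> (maps i X X \<longrightarrow>
      (\<forall>x v. pr x v \<epsilon> i \<longrightarrow> (\<forall>z u. pr z u \<epsilon> i \<longrightarrow> u = v \<longrightarrow> x = z)) \<longrightarrow>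
      (\<forall>y. y \<epsilon> X \<longrightarrow> (\<exists>w z. pr w z \<epsilon> F \<and> (z = y \<and> function_on w W \<and>
        (\<forall>n v. pr n v \<epsilon> w \<longrightarrow> (\<exists>x u. pr x u \<epsilon> i \<and> u = v))))))" for i X F W
  have dR: "def0 (\<lambda>s. R (s 0) (s 1) (s 2) (s 3))" unfolding R_def by (intro def0_intro)
  have "\<forall>i. R i X F om" unfolding R_def X_def using F2 by (simp; blast)
  then have RM: "\<And>i. i \<in> M \<Longrightarrow> R i X (j F) om"
    using el_all3[OF e dR, of X F om] unfolding jX el_om_eq[OF e] by blast
  have dj: "deft (\<lambda>s. j (s 0))" by (intro defs_intro el_deft[OF e])
  define i where "i = lam X j"
  have i: "pr x v \<epsilon> i \<longleftrightarrow> x \<epsilon> X \<and> v = j x" for x v unfolding i_def mem_lam[OF dj] by auto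
  have jXX: "j x \<epsilon> X" if "x \<epsilon> X" for x using that el_mem[OF e, of x X] jX by simp
  have "subset_of i (Vs \<delta>)"
    unfolding subset_of_def i_def mem_lam[OF dj] using Vs_lim_pr[OF \<delta>(1)] jXX unfolding X_def by auto
  then have iM: "i \<in> M" by (rule V)
  have mi: "maps i X X" unfolding i_def by (rule maps_lam[OF dj jXX])
  have kX: "\<kappa> \<epsilon> X" unfolding X_def using Ord_in_Vs[OF od ok(1)] Ord_trans[OF od \<rho>(3) \<delta>(2)] by blast
  have ii: "\<forall>x v. pr x v \<epsilon> i \<longrightarrow> (\<forall>z u. pr z u \<epsilon> i \<longrightarrow> u = v \<longrightarrow> x = z)"
    unfolding i using el_eq[OF e] by simp
  obtain w where w: "pr w \<kappa> \<epsilon> j F" "function_on w om"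
    and "\<forall>n v. pr n v \<epsilon> w \<longrightarrow> (\<exists>x u. pr x u \<epsilon> i \<and> u = v)"
    using RM[OF iM, unfolded R_def, THEN mp, OF mi, THEN mp, OF ii, THEN spec, THEN mp, OF kX] by auto
  then have wi: "\<exists>x. x \<epsilon> X \<and> v = j x" if "pr n v \<epsilon> w" for n v using that unfolding i by auto
  have dP: "defp (\<lambda>s. s 1 \<epsilon> X \<and> app w (s 0) = j (s 1))" by (intro defs_intro el_deft[OF e])
  obtain t where t: "function_on t om" "\<And>n. n \<epsilon> om \<Longrightarrow> app t n \<epsilon> X \<and> app w n = j (app t n)"
    using choice_predicate[where P = "\<lambda>n x. x \<epsilon> X \<and> app w n = j x" and a = om, OF dP] wi pr_app[OF w(2)] by blast
  have jt: "j t = w"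
  proof (rule function_ext)
    show "function_on (j t) om" using el_function_on[OF e, of t om] t(1) el_om_eq[OF e] by simp
    show "app (j t) n = app w n" if n: "n \<epsilon> om" for n
      using el_app[OF e t(1) n] el_om[OF e n] t(2)[OF n] by simp
  qed (fact w(2))
  have "def0 (\<lambda>s. \<exists>a b. pr a b \<epsilon> s 0 \<and> a = s 1)" by (intro def0_intro)
  note r = el_rel2[OF e, where R = "\<lambda>F t. \<exists>a b. pr a b \<epsilon> F \<and> a = t", OF this, of F t]
  then obtain y where y: "pr t y \<epsilon> F" using w(1) jt by blast
  have "pr w (j y) \<epsilon> j F" using y el_mem[OF e] el_pr[OF e, of t y] jt by metis
  moreover have "def0 (\<lambda>s. \<forall>w y. pr w y \<epsilon> s 0 \<longrightarrow> (\<forall>w' z. pr w' z \<epsilon> s 0 \<longrightarrow> w' = w \<longrightarrow> y = z))" by (intro def0_intro)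
  note r = el_rel1[OF e, where R = "\<lambda>F. \<forall>w y. pr w y \<epsilon> F \<longrightarrow> (\<forall>w' z. pr w' z \<epsilon> F \<longrightarrow> w' = w \<longrightarrow> y = z)", OF this, of F]
  have "\<forall>w y. pr w y \<epsilon> F \<longrightarrow> (\<forall>w' z. pr w' z \<epsilon> F \<longrightarrow> w' = w \<longrightarrow> y = z)" using F1 by blast
  then have "\<forall>w y. pr w y \<epsilon> j F \<longrightarrow> (\<forall>w' z. pr w' z \<epsilon> j F \<longrightarrow> w' = w \<longrightarrow> y = z)" using r by blast
  ultimately have jy: "j y = \<kappa>" using w(1) by blast
  have oy: "Ord y" using el_Ord[OF e, of y] jy ok(1) by simp
  have "\<not> y \<epsilon> \<kappa>" using ok(3)[of y] jy mem_irrefl by metis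
  moreover have "\<not> \<kappa> \<epsilon> y" using el_mem[OF e, of \<kappa> y] jy el_Ord_ge[OF e ok(1)] by simp
  ultimately show False using Ord_linear[OF oy ok(1)] jy ok(2) by blast
qed

section \<open>Strong cardinals and product reflection\<close>

lemma strong_imp_PRP:
  assumes "strong_cardinal \<kappa>"
  shows "PRP (levy_Sigma 2)"
  unfolding PRP_def
proof (intro allI impI, elim conjE)
  fix C assume dC: "definable_by (levy_Sigma 2) C" and gr: "\<forall>G\<in>C. graph G"
  obtain \<phi> where \<phi>: "levy_Sigma 2 \<phi>" "fv \<phi> \<subseteq> {0}" "C = {x. sat (\<epsilon>) UNIV \<phi> (\<lambda>_. x)}"
    using dC unfolding definable_by_def by blast
  have ok: "Ord \<kappa>" using assms unfolding strong_cardinal_def cardinal_def by simp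
  have dcl: "definable_class C" using dC by (rule definable_by_imp_definable_class)
  have dC': "defp (\<lambda>s. t s \<in> C)" if "deft t" for t by (rule defp_class[OF dcl that])
  have dC0: "defp (\<lambda>s. s 0 \<in> C)" by (intro dC' defs_intro)
  define K where "K a = Sep (Vs a) (\<lambda>x. x \<in> C)" for a
  have K: "x \<epsilon> K a \<longleftrightarrow> x \<epsilon> Vs a \<and> x \<in> C" for x a unfolding K_def by (rule mem_Sep[OF dC0])
  obtain P where P: "product (K \<kappa>) P" using product_exists by blast
  obtain U T where PU: "P = pr U T" using P unfolding product_iff by blast
  define Good where "Good a \<longleftrightarrow> (\<forall>G. rk G = a \<longrightarrow> G \<in> C \<longrightarrow> (\<exists>h. homomorphism h P G))" for a
  have dG: "defp (\<lambda>s. Good (s 0))" unfolding Good_def by (intro defs_intro dC')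
  have step: "Good \<rho>" if \<rho>: "Ord \<rho>" and IH: "\<forall>a. a \<epsilon> \<rho> \<longrightarrow> Good a" for \<rho>
    unfolding Good_def
  proof (intro allI impI)
    fix G assume G: "rk G = \<rho>" "G \<in> C"
    have gG: "graph G" using gr G(2) by blast
    show "\<exists>h. homomorphism h P G"
    proof (cases "\<rho> \<epsilon> \<kappa>")
      case True
      then have "G \<epsilon> K \<kappa>" unfolding K mem_Vs_Ord[OF ok] using G by simp
      then show ?thesis using projection_hom[OF P _ gG] by blast
    next
      case False
      have "sat (\<epsilon>) UNIV \<phi> (\<lambda>_. G)" using G(2) \<phi>(3) by simp
      from Sigma2_witnesses[OF \<phi>(1) this] obtain w where
        w: "\<And>M. transitive_class M \<Longrightarrow> (\<And>x. x \<epsilon> w \<Longrightarrow> x \<in> M) \<Longrightarrow> G \<in> M \<Longrightarrow> sat (\<epsilon>) M \<phi> (\<lambda>_. G)" by blast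
      have dl: "defp (\<lambda>s. lim (s 0) \<and> \<rho> \<epsilon> s 0)" by (intro defs_intro)
      obtain l where l: "lim l" "\<rho> \<epsilon> Vs l" using lim_above by blast
      then have "\<rho> \<epsilon> l" by (simp add: mem_Vs_Ord lim_Ord rk_Ord \<rho>)
      then obtain \<delta> where \<delta>: "lim \<delta>" "\<rho> \<epsilon> \<delta>" "\<And>m. m \<epsilon> \<delta> \<Longrightarrow> \<rho> \<epsilon> m \<Longrightarrow> \<not> lim m"
        using Ord_least[OF dl lim_Ord[OF l(1)]] l(1) by blast
      \<comment> \<open>\<open>V_b\<close> has to contain the witnesses \<open>w\<close>, so that
        \<open>G\<close> satisfies the definition in \<open>M\<close>, as well as
        \<open>V_\<delta>\<close>, whose subsets \<open>kunen\<close> requires in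
        \<open>M\<close>.\<close>
      obtain b where b: "lim b" "un (un (sg w) (sg G)) (un (sg \<kappa>) (sg (Vs \<delta>))) \<epsilon> Vs b" using lim_above by blast
      have bV: "w \<epsilon> Vs b" "G \<epsilon> Vs b" "\<kappa> \<epsilon> Vs b" "Vs \<delta> \<epsilon> Vs b" using Vs_tr[OF _ b(2)] by auto
      obtain \<mu> where \<mu>: "cardinal \<mu>" "b \<epsilon> \<mu>" using cardinal_above[OF lim_Ord[OF b(1)]] by blast
      have om: "Ord \<mu>" using \<mu>(1) unfolding cardinal_def by simp
      have "\<kappa> \<epsilon> b" using bV(3) by (simp add: mem_Vs_Ord lim_Ord[OF b(1)] rk_Ord ok)
      then have "\<kappa> \<epsilon> \<mu>" using Ord_trans[OF om _ \<mu>(2)] by blast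
      then have "strong_upto \<kappa> \<mu>" using assms \<mu>(1) by (simp add: strong_cardinal_def)
      then obtain j M where el: "elementary_embedding j M" and trM: "transitive_class M"
        and crit: "critical_point j \<kappa>" and V: "\<And>x. x \<epsilon> Vs \<mu> \<Longrightarrow> x \<in> M"
        unfolding strong_upto_def V_level_iff[OF om] by auto
      note e = el trM
      have VM: "x \<in> M" if "x \<epsilon> Vs b" for x using that Vs_mono[OF om \<mu>(2)] V by blast
      have GM: "G \<in> M" and wM: "\<And>x. x \<epsilon> w \<Longrightarrow> x \<in> M" using VM bV Vs_tr by blast+
      have sG: "sat (\<epsilon>) M \<phi> (\<lambda>_. G)" by (rule w[OF trM wM GM])
      show ?thesis
      \<comment> \<open>That \<open>a\<close> is at most \<rho> keeps the ranks of the graphs in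
        \<open>K a\<close> below \<rho>, where the induction hypothesis applies; that \<rho> is
        below \<open>j a\<close> puts \<open>G\<close> into \<open>j (K a)\<close>.\<close>
      proof (cases "\<exists>a. (a \<epsilon> \<rho> \<or> a = \<rho>) \<and> \<rho> \<epsilon> j a")
        case True
        then obtain a where a: "a \<epsilon> \<rho> \<or> a = \<rho>" "\<rho> \<epsilon> j a" by blast
        have oa: "Ord a" using a(1) \<rho> Ord_mem by blast
        have oj: "Ord (j a)" using oa el_Ord[OF e] by blast
        have "G \<epsilon> j (Vs a)" unfolding el_Vs[OF e oa] mem_Vs_Ord[OF oj] using GM a(2) G(1) by simp
        \<comment> \<open>Variable 1 is \<open>K a\<close> and variable 2 is \<open>V_a\<close>:
          every element of \<open>V_a\<close> that satisfies \<open>\<phi>\<close> is in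
          \<open>K a\<close>. As \<open>\<phi>\<close> need not be bounded, this transfer uses the
          full elementarity schema and the truth of \<open>\<phi>\<close> in
          \<open>M\<close>.\<close>
        moreover have "sat (\<epsilon>) UNIV (Neg (Exists 0 (And (And (Member 0 2) \<phi>) (Neg (Member 0 1)))))
            (\<lambda>i. if i = 1 then K a else Vs a)"
        proof -
          have "sat (\<epsilon>) UNIV \<phi> ((\<lambda>i. if i = 1 then K a else Vs a)(0 := x)) \<longleftrightarrow> x \<in> C" for x
            unfolding \<phi>(3) mem_Collect_eq by (rule sat_cong) (use \<phi>(2) in auto)
          then show ?thesis by (simp add: K)
        qed
        then have "sat (\<epsilon>) M (Neg (Exists 0 (And (And (Member 0 2) \<phi>) (Neg (Member 0 1)))))
            (\<lambda>i. j (if i = 1 then K a else Vs a))" by (rule el_sat[OF e, THEN iffD1])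
        moreover have "sat (\<epsilon>) M \<phi> ((\<lambda>i. j (if i = 1 then K a else Vs a))(0 := G))"
          using sG by (rule back_subst[of "\<lambda>x. x"], intro sat_cong) (use \<phi>(2) in auto)
        ultimately have "G \<epsilon> j (K a)" using GM by auto
        moreover obtain Q where Q: "product (K a) Q" using product_exists by blast
        ultimately obtain h where h: "homomorphism h Q G" using product_hom_target[OF e Q _ gG] by blast
        have "\<exists>h. homomorphism h P A" if A: "A \<epsilon> K a" for A
        proof -
          have "rk A \<epsilon> a" "A \<in> C" using A unfolding K mem_Vs_Ord[OF oa] by auto
          moreover have "rk A \<epsilon> \<rho>" using a(1) calculation(1) Ord_trans[OF \<rho>] by blast
          ultimately show ?thesis using IH unfolding Good_def by blast
        qed
        then obtain k where "homomorphism k P Q" using hom_to_product[OF Q] unfolding PU by blast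
        then show ?thesis using hom_comp h by blast
      next
        case no: False
        have oj: "Ord (j \<rho>)" using \<rho> el_Ord[OF e] by blast
        have "\<not> \<rho> \<epsilon> j \<rho>" using no by metis
        then have jr: "j \<rho> = \<rho>" using Ord_linear[OF \<rho> oj] el_Ord_ge[OF e \<rho>] by auto
        have "j \<kappa> \<noteq> \<kappa>" using crit unfolding critical_point_def by blast
        then have kr: "\<kappa> \<epsilon> \<rho>" using False Ord_linear[OF ok \<rho>] jr by auto
        have "x \<in> M" if "subset_of x (Vs \<delta>)" for x
          using VM[OF Vs_sub[OF that bV(4)]] .
        then have False using kunen[OF e crit \<rho> jr kr \<delta>] by blast
        then show ?thesis ..
      qed
    qed
  qed
  have "\<exists>h. homomorphism h P G" if "G \<in> C" for G
    using Ord_induct[OF dG Ord_rk step, of G] that unfolding Good_def by blast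
  then show "\<exists>S. (\<forall>A. A \<epsilon> S \<longrightarrow> A \<in> C) \<and> (\<forall>G\<in>C. \<exists>P h. product S P \<and> homomorphism h P G)"
    using P K by (intro exI[of _ "K \<kappa>"]) blast
qed

section \<open>The equivalences\<close>

lemma definable_by_mono: "definable_by (levy_Pi 1) C \<Longrightarrow> definable_by (levy_Sigma 2) C"
  unfolding definable_by_def using levy_Pi_mono by blast

lemma PRP_mono: "PRP (levy_Sigma 2) \<Longrightarrow> PRP (levy_Pi 1)"
  unfolding PRP_def using definable_by_mono by blast

lemma SWVP_mono: "SWVP (levy_Sigma 2) \<Longrightarrow> SWVP (levy_Pi 1)"
  unfolding SWVP_def using definable_by_mono by blast

lemma WVP_mono: "WVP (levy_Sigma 2) \<Longrightarrow> WVP (levy_Pi 1)"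
  unfolding WVP_def using definable_by_mono by blast

lemma SWVP_imp_WVP: "SWVP \<Gamma> \<Longrightarrow> WVP \<Gamma>"
proof (rule ccontr)
  assume S: "SWVP \<Gamma>" and "\<not> WVP \<Gamma>"
  then obtain F where F: "definable_by \<Gamma> F" "graph_sequence F" and
    h: "\<And>a b A B. ordinal a \<and> ordinal b \<and> value_at F a A \<and> value_at F b B \<Longrightarrow>
      (a \<epsilon> b \<or> a = b \<longrightarrow> (\<exists>!h. homomorphism h B A)) \<and> (a \<epsilon> b \<longrightarrow> \<not> (\<exists>h. homomorphism h A B))"
    unfolding WVP_def by blast
  have "(a \<epsilon> b \<or> a = b \<longrightarrow> (\<exists>h. homomorphism h B A)) \<and> (a \<epsilon> b \<longrightarrow> \<not> (\<exists>h. homomorphism h A B))"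
    if "ordinal a \<and> ordinal b \<and> value_at F a A \<and> value_at F b B" for a b A B
    using h[OF that] by blast
  then show False using S F unfolding SWVP_def by blast
qed

text \<open>A strong cardinal yields the strongest principle, \<open>\<Sigma>\<^sub>2\<close>-PRP.
  It implies \<open>\<Pi>\<^sub>1\<close>-PRP and, by way of \<open>\<Sigma>\<^sub>2\<close>-SWVP,
  all the other principles, in particular \<open>\<Pi>\<^sub>1\<close>-WVP. Each of
  \<open>\<Pi>\<^sub>1\<close>-PRP and \<open>\<Pi>\<^sub>1\<close>-WVP leads back.\<close>

lemma equivalences:
  defines "S \<equiv> \<exists>\<kappa>. strong_cardinal \<kappa>"
  shows "(S \<longleftrightarrow> PRP (levy_Sigma 2)) \<and> (S \<longleftrightarrow> PRP (levy_Pi 1)) \<and> (S \<longleftrightarrow> SWVP (levy_Sigma 2)) \<and>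
    (S \<longleftrightarrow> SWVP (levy_Pi 1)) \<and> (S \<longleftrightarrow> WVP (levy_Sigma 2)) \<and> (S \<longleftrightarrow> WVP (levy_Pi 1))"
proof -
  have "S \<Longrightarrow> PRP (levy_Sigma 2)" unfolding S_def using strong_imp_PRP by blast
  moreover have "PRP (levy_Pi 1) \<Longrightarrow> S" unfolding S_def using no_strong_not_PRP by blast
  moreover have "WVP (levy_Pi 1) \<Longrightarrow> S" unfolding S_def using no_strong_not_WVP by blast
  ultimately show ?thesis
    using PRP_mono PRP_imp_SWVP SWVP_mono WVP_mono SWVP_imp_WVP by blast
qed

end

theorem theorem5p1:
  fixes E :: "'v \<Rightarrow> 'v \<Rightarrow> bool"
  assumes "ZFC E"
  shows "((\<exists>\<kappa>. membership.strong_cardinal E \<kappa>) \<longleftrightarrow> membership.PRP E (levy_Sigma 2)) \<and>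
         ((\<exists>\<kappa>. membership.strong_cardinal E \<kappa>) \<longleftrightarrow> membership.PRP E (levy_Pi 1)) \<and>
         ((\<exists>\<kappa>. membership.strong_cardinal E \<kappa>) \<longleftrightarrow> membership.SWVP E (levy_Sigma 2)) \<and>
         ((\<exists>\<kappa>. membership.strong_cardinal E \<kappa>) \<longleftrightarrow> membership.SWVP E (levy_Pi 1)) \<and>
         ((\<exists>\<kappa>. membership.strong_cardinal E \<kappa>) \<longleftrightarrow> membership.WVP E (levy_Sigma 2)) \<and>
         ((\<exists>\<kappa>. membership.strong_cardinal E \<kappa>) \<longleftrightarrow> membership.WVP E (levy_Pi 1))"
  by (rule ZFC.equivalences[OF assms])

end
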